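(* Let $\Omega\subset\mathbb{R}^2$ be a bounded polygonal domain, $X=H^2_0(\Omega)$, $Re>0$, $Ro>0$, $F\in H^{-2}(\Omega)$, and let $X^h\subset X$ be the Argyris finite element space on a triangulation $\mathcal T^h$ of $\Omega$ of meshsize $h$. With $a_0,a_1,a_2,\ell$ as in the context, let $\psi\in X$ satisfy $a_0(\psi,\chi)+a_1(\psi,\psi,\chi)+a_2(\psi,\chi)=\ell(\chi)$ for all $\chi\in X$, and let $\psi^h\in X^h$ satisfy $a_0(\psi^h,\chi^h)+a_1(\psi^h,\psi^h,\chi^h)+a_2(\psi^h,\chi^h)=\ell(\chi^h)$ for all $\chi^h\in X^h$. Assume the small data condition $Re^{-2}\,Ro\ge\Gamma_1\|F\|_{-2}$, assume $\psi\in H^6(\Omega)\cap H^2_0(\Omega)$, and assume the dual problem is elliptically regular: for every $g$, the solution $\psi^*\in X$ of $(\mathcal L^*\psi^*,\chi)=(g,\chi)$ for all $\chi\in X$, where $$\mathcal L^*\psi^*=Re^{-1}\Delta^2\psi^*-J(\psi,\Delta\psi^* )+J(\Delta\psi,\psi^* )+Ro^{-1}\frac{\partial\psi^*}{\partial x},$$ satisfies $\psi^*\in H^4(\Omega)\cap H^2_0(\Omega)$, $\|\psi^*\|_4\le C\|g\|_0$ and $\|\psi^*\|_3\le C\|g\|_{-1}$ with $C$ independent of $h$. Then there exist constants $C_0,C_1,C_2>0$, which may depend on $Re,Ro,\Gamma_1,\Gamma_2,F$ but not on $h$, such that $$|\psi-\psi^h|_2\le C_2h^4,\qquad|\psi-\psi^h|_1\le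 C_1h^5,\qquad\|\psi-\psi^h\|_0\le C_0h^6.$$
   Context: $H^2_0(\Omega)=\{\psi\in H^2(\Omega):\psi=\partial\psi/\partial\mathbf{n}=0\text{ on }\partial\Omega\}$. The forms are $a_0(\psi,\chi)=Re^{-1}\int_\Omega\Delta\psi\,\Delta\chi$, $a_1(\zeta,\psi,\chi)=\int_\Omega\Delta\zeta\,(\psi_y\chi_x-\psi_x\chi_y)$, $a_2(\psi,\chi)=-Ro^{-1}\int_\Omega\psi_x\chi$, $\ell(\chi)=Ro^{-1}\int_\Omega F\chi$. $J(a,b)=a_xb_y-a_yb_x$ is the Jacobian. $|\cdot|_k$ is the $H^k$-seminorm, $\|\cdot\|_k$ the $H^k$-norm ($\|\cdot\|_0$ the $L^2$ norm), $\|g\|_{-1}$ the $H^{-1}$ norm, and $\|F\|_{-2}=\sup_{0\ne\chi\in H^2_0}|\int_\Omega F\chi|/|\chi|_2$. $\Gamma_1,\Gamma_2>0$ are constants with $|a_1(\zeta,\psi,\chi)|\le\Gamma_1|\zeta|_2|\psi|_2|\chi|_2$ and $|a_2(\psi,\chi)|\le Ro^{-1}\Gamma_2|\psi|_2|\chi|_2$ for all $\zeta,\psi,\chi\in X$. The Argyris element is the $C^1$ triangular element of piecewise quintic polynomials with 21 degrees of freedom (values, first and second derivatives at the vertices, normal derivatives at edge midpoints); the triangulations are assumed to form a family for which the standard interpolation estimates hold: for $\chi\in H^m(\Omega)\cap H^2_0(\Omega)$, $m=3,4,6$, there is $\chi^h\in X^h$ with $\|\chi-\chi^h\|_2\le Ch^{m-2}|\chi|_m$.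 *)

theory Defs
  imports "HOL-Analysis.Analysis"
begin

type_synonym pt = "real \<times> real"

definition pdx :: "(pt \<Rightarrow> real) \<Rightarrow> pt \<Rightarrow> real" where
  "pdx f p = deriv (\<lambda>t. f (t, snd p)) (fst p)"

definition pdy :: "(pt \<Rightarrow> real) \<Rightarrow> pt \<Rightarrow> real" where
  "pdy f p = deriv (\<lambda>t. f (fst p, t)) (snd p)"

definition cpd :: "nat \<Rightarrow> nat \<Rightarrow> (pt \<Rightarrow> real) \<Rightarrow> pt \<Rightarrow> real" where
  "cpd i j f = (pdx ^^ i) ((pdy ^^ j) f)"

definition smooth2 :: "(pt \<Rightarrow> real) \<Rightarrow> bool" where
  "smooth2 f \<longleftrightarrow> (\<forall>i j. continuous_on UNIV (cpd i j f)
      \<and> (\<forall>p. (\<lambda>t. cpd i j f (t, snd p)) differentiable (at (fst p)))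
      \<and> (\<forall>p. (\<lambda>t. cpd i j f (fst p, t)) differentiable (at (snd p))))"

definition test_fun :: "pt set \<Rightarrow> (pt \<Rightarrow> real) \<Rightarrow> bool" where
  "test_fun \<Omega> \<phi> \<longleftrightarrow> smooth2 \<phi> \<and> compact (closure {p. \<phi> p \<noteq> 0})
      \<and> closure {p. \<phi> p \<noteq> 0} \<subseteq> \<Omega>"

definition L2 :: "pt set \<Rightarrow> (pt \<Rightarrow> real) \<Rightarrow> bool" where
  "L2 \<Omega> f \<longleftrightarrow> set_borel_measurable lborel \<Omega> f \<and> set_integrable lborel \<Omega> (\<lambda>p. (f p)\<^sup>2)"

definition weak_deriv :: "pt set \<Rightarrow> nat \<Rightarrow> nat \<Rightarrow> (pt \<Rightarrow> real) \<Rightarrow> (pt \<Rightarrow> real) \<Rightarrow> bool" where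
  "weak_deriv \<Omega> i j f g \<longleftrightarrow> (\<forall>\<phi>. test_fun \<Omega> \<phi> \<longrightarrow>
      (LINT p:\<Omega>|lborel. f p * cpd i j \<phi> p) = (-1) ^ (i + j) * (LINT p:\<Omega>|lborel. g p * \<phi> p))"

definition Hk :: "pt set \<Rightarrow> nat \<Rightarrow> (pt \<Rightarrow> real) \<Rightarrow> bool" where
  "Hk \<Omega> k f \<longleftrightarrow> L2 \<Omega> f \<and> (\<forall>i j. i + j \<le> k \<longrightarrow> (\<exists>g. L2 \<Omega> g \<and> weak_deriv \<Omega> i j f g))"

definition wd :: "pt set \<Rightarrow> nat \<Rightarrow> nat \<Rightarrow> (pt \<Rightarrow> real) \<Rightarrow> pt \<Rightarrow> real" where
  "wd \<Omega> i j f = (if i = 0 \<and> j = 0 then f else (SOME g. L2 \<Omega> g \<and> weak_deriv \<Omega> i j f g))"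

definition norm0 :: "pt set \<Rightarrow> (pt \<Rightarrow> real) \<Rightarrow> real" where
  "norm0 \<Omega> f = sqrt (LINT p:\<Omega>|lborel. (f p)\<^sup>2)"

definition semi :: "pt set \<Rightarrow> nat \<Rightarrow> (pt \<Rightarrow> real) \<Rightarrow> real" where
  "semi \<Omega> k f = sqrt (\<Sum>i\<le>k. (norm0 \<Omega> (wd \<Omega> i (k - i) f))\<^sup>2)"

definition normH :: "pt set \<Rightarrow> nat \<Rightarrow> (pt \<Rightarrow> real) \<Rightarrow> real" where
  "normH \<Omega> k f = sqrt (\<Sum>m\<le>k. (semi \<Omega> m f)\<^sup>2)"

definition Hk0 :: "pt set \<Rightarrow> nat \<Rightarrow> (pt \<Rightarrow> real) \<Rightarrow> bool" where
  "Hk0 \<Omega> k f \<longleftrightarrow> Hk \<Omega> k f \<and> (\<exists>\<phi>s. (\<forall>n. test_fun \<Omega> (\<phi>s n))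
      \<and> (\<lambda>n. normH \<Omega> k (\<lambda>p. f p - \<phi>s n p)) \<longlonglongrightarrow> 0)"

abbreviation H20 :: "pt set \<Rightarrow> (pt \<Rightarrow> real) \<Rightarrow> bool" where
  "H20 \<Omega> \<equiv> Hk0 \<Omega> 2"

definition normm1 :: "pt set \<Rightarrow> (pt \<Rightarrow> real) \<Rightarrow> real" where
  "normm1 \<Omega> g = Sup {\<bar>LINT p:\<Omega>|lborel. g p * v p\<bar> / normH \<Omega> 1 v | v. Hk0 \<Omega> 1 v \<and> normH \<Omega> 1 v \<noteq> 0}"

definition Hm2 :: "pt set \<Rightarrow> ((pt \<Rightarrow> real) \<Rightarrow> real) \<Rightarrow> bool" where
  "Hm2 \<Omega> F \<longleftrightarrow> (\<forall>a b v v'. H20 \<Omega> v \<longrightarrow> H20 \<Omega> v' \<longrightarrow>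
        F (\<lambda>p. a * v p + b * v' p) = a * F v + b * F v')
     \<and> (\<exists>M. \<forall>v. H20 \<Omega> v \<longrightarrow> \<bar>F v\<bar> \<le> M * semi \<Omega> 2 v)"

definition normm2 :: "pt set \<Rightarrow> ((pt \<Rightarrow> real) \<Rightarrow> real) \<Rightarrow> real" where
  "normm2 \<Omega> F = Sup {\<bar>F v\<bar> / semi \<Omega> 2 v | v. H20 \<Omega> v \<and> semi \<Omega> 2 v \<noteq> 0}"

definition lap :: "pt set \<Rightarrow> (pt \<Rightarrow> real) \<Rightarrow> pt \<Rightarrow> real" where
  "lap \<Omega> f p = wd \<Omega> 2 0 f p + wd \<Omega> 0 2 f p"

definition jac :: "pt set \<Rightarrow> (pt \<Rightarrow> real) \<Rightarrow> (pt \<Rightarrow> real) \<Rightarrow> pt \<Rightarrow> real" where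
  "jac \<Omega> a b p = wd \<Omega> 1 0 a p * wd \<Omega> 0 1 b p - wd \<Omega> 0 1 a p * wd \<Omega> 1 0 b p"

definition a0 :: "pt set \<Rightarrow> real \<Rightarrow> (pt \<Rightarrow> real) \<Rightarrow> (pt \<Rightarrow> real) \<Rightarrow> real" where
  "a0 \<Omega> Rey \<psi> v = (1 / Rey) * (LINT p:\<Omega>|lborel. lap \<Omega> \<psi> p * lap \<Omega> v p)"

definition a1 :: "pt set \<Rightarrow> (pt \<Rightarrow> real) \<Rightarrow> (pt \<Rightarrow> real) \<Rightarrow> (pt \<Rightarrow> real) \<Rightarrow> real" where
  "a1 \<Omega> \<zeta> \<psi> v = (LINT p:\<Omega>|lborel. lap \<Omega> \<zeta> p *
       (wd \<Omega> 0 1 \<psi> p * wd \<Omega> 1 0 v p - wd \<Omega> 1 0 \<psi> p * wd \<Omega> 0 1 v p))"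

definition a2 :: "pt set \<Rightarrow> real \<Rightarrow> (pt \<Rightarrow> real) \<Rightarrow> (pt \<Rightarrow> real) \<Rightarrow> real" where
  "a2 \<Omega> Ro \<psi> v = - (1 / Ro) * (LINT p:\<Omega>|lborel. wd \<Omega> 1 0 \<psi> p * v p)"

definition ell :: "real \<Rightarrow> ((pt \<Rightarrow> real) \<Rightarrow> real) \<Rightarrow> (pt \<Rightarrow> real) \<Rightarrow> real" where
  "ell Ro F v = (1 / Ro) * F v"

text \<open>Weak form of (L* psi_star, chi) = (g, chi), with
  L* psi_star = Rey^-1 Lap^2 psi_star - J(psi, Lap psi_star) + J(Lap psi, psi_star) + Ro^-1 (psi_star)_x;
  the fourth-order term and the term -J(psi, Lap psi_star) are integrated by parts
  (boundary terms vanish for chi in H^2_0):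
  -(J(psi, Lap psi_star), chi) = (Lap psi_star, J(psi, chi)).\<close>
definition dual_eq :: "pt set \<Rightarrow> real \<Rightarrow> real \<Rightarrow> (pt \<Rightarrow> real) \<Rightarrow> (pt \<Rightarrow> real) \<Rightarrow> (pt \<Rightarrow> real) \<Rightarrow> bool" where
  "dual_eq \<Omega> Rey Ro \<psi> g \<psi>s \<longleftrightarrow> (\<forall>v. H20 \<Omega> v \<longrightarrow>
      (1 / Rey) * (LINT p:\<Omega>|lborel. lap \<Omega> \<psi>s p * lap \<Omega> v p)
    + (LINT p:\<Omega>|lborel. lap \<Omega> \<psi>s p * jac \<Omega> \<psi> v p)
    + (LINT p:\<Omega>|lborel. ((wd \<Omega> 3 0 \<psi> p + wd \<Omega> 1 2 \<psi> p) * wd \<Omega> 0 1 \<psi>s p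
                         - (wd \<Omega> 2 1 \<psi> p + wd \<Omega> 0 3 \<psi> p) * wd \<Omega> 1 0 \<psi>s p) * v p)
    + (1 / Ro) * (LINT p:\<Omega>|lborel. wd \<Omega> 1 0 \<psi>s p * v p)
    = (LINT p:\<Omega>|lborel. g p * v p))"

definition polygonal_domain :: "pt set \<Rightarrow> bool" where
  "polygonal_domain \<Omega> \<longleftrightarrow> open \<Omega> \<and> connected \<Omega> \<and> bounded \<Omega> \<and> \<Omega> \<noteq> {}
     \<and> (\<exists>S. finite S \<and> frontier \<Omega> = (\<Union>(a, b)\<in>S. closed_segment a b))"

text \<open>A conforming triangulation: triangles are given by their (3, non-collinear)
  vertex sets; two distinct triangles meet in a common face (empty, vertex or edge).\<close>
definition triangulation :: "pt set \<Rightarrow> pt set set \<Rightarrow> bool" where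
  "triangulation \<Omega> T \<longleftrightarrow> finite T \<and> T \<noteq> {}
     \<and> (\<forall>K\<in>T. card K = 3 \<and> \<not> collinear K)
     \<and> \<Omega> = interior (\<Union>K\<in>T. convex hull K)
     \<and> (\<forall>K\<in>T. \<forall>K'\<in>T. K \<noteq> K' \<longrightarrow> convex hull K \<inter> convex hull K' = convex hull (K \<inter> K'))"

definition meshsize :: "pt set set \<Rightarrow> real" where
  "meshsize T = Max ((\<lambda>K. diameter (convex hull K)) ` T)"

definition poly2 :: "(nat \<Rightarrow> nat \<Rightarrow> real) \<Rightarrow> pt \<Rightarrow> real" where
  "poly2 c p = (\<Sum>i\<le>5. \<Sum>j\<le>5. c i j * fst p ^ i * snd p ^ j)"

definition cdx :: "(nat \<Rightarrow> nat \<Rightarrow> real) \<Rightarrow> nat \<Rightarrow> nat \<Rightarrow> real" where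
  "cdx c i j = real (i + 1) * c (i + 1) j"

definition cdy :: "(nat \<Rightarrow> nat \<Rightarrow> real) \<Rightarrow> nat \<Rightarrow> nat \<Rightarrow> real" where
  "cdy c i j = real (j + 1) * c i (j + 1)"

definition argyris :: "pt set \<Rightarrow> pt set set \<Rightarrow> (pt \<Rightarrow> real) set" where
  "argyris \<Omega> T = {f. H20 \<Omega> f \<and> (\<exists>c :: pt set \<Rightarrow> nat \<Rightarrow> nat \<Rightarrow> real.
      (\<forall>K\<in>T. (\<forall>i j. i + j > 5 \<longrightarrow> c K i j = 0) \<and> (\<forall>p\<in>convex hull K. f p = poly2 (c K) p))
    \<and> (\<forall>K\<in>T. \<forall>K'\<in>T. \<forall>p\<in>convex hull K \<inter> convex hull K'.
         poly2 (cdx (c K)) p = poly2 (cdx (c K')) p \<and> poly2 (cdy (c K)) p = poly2 (cdy (c K')) p)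
    \<and> (\<forall>K\<in>T. \<forall>K'\<in>T. \<forall>v\<in>K \<inter> K'.
         poly2 (cdx (cdx (c K))) v = poly2 (cdx (cdx (c K'))) v
       \<and> poly2 (cdx (cdy (c K))) v = poly2 (cdx (cdy (c K'))) v
       \<and> poly2 (cdy (cdy (c K))) v = poly2 (cdy (cdy (c K'))) v))}"

end

theory Submission
  imports Defs
begin

text \<open>The linearisation \<open>B\<close> of the problem at \<open>\<psi>\<close> is coercive: either \<open>\<psi> = 0\<close>, or \<open>\<psi>\<^sub>x\<^sub>y \<noteq> 0\<close> and the small
  data condition holds with room to spare. Galerkin orthogonality \<open>B(e, v) = a1(e, e, v)\<close> on the finite element
  space then gives the \<open>H\<^sup>2\<close> estimate, and duality with the true adjoint problem \<open>B(v, z) = (g, v)\<close>,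
  for \<open>g = e\<close> and \<open>g = - \<Delta>e\<close>, gives the \<open>L\<^sup>2\<close> and \<open>H\<^sup>1\<close> estimates.

  The operator \<open>L\<^sup>*\<close> of the regularity hypothesis is not the adjoint of \<open>B\<close>, because
  \<open>\<integral> \<Delta>e J(\<psi>, z) = \<integral> e \<Delta>J(\<psi>, z)\<close> and not \<open>\<integral> e J(\<psi>, \<Delta>z)\<close>. However, \<open>\<Delta>J(\<psi>, z) - J(\<psi>, \<Delta>z)\<close> contains
  only derivatives of \<open>z\<close> up to order two, with coefficients that are derivatives of \<open>\<psi>\<close> up to order three. These are
  bounded by Sobolev's inequality on each triangle, since \<open>\<psi> \<in> H\<^sup>6\<close>. So the adjoint solution \<open>z\<close>, which
  exists by the Lax-Milgram lemma, solves the \<open>L\<^sup>*\<close> problem with a right-hand side in \<open>L\<^sup>2\<close>, and the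
  regularity hypothesis applies to it.\<close>

section \<open>Smooth functions of two variables\<close>

text \<open>\<open>Hk0\<close> is a closure of test functions, so traces never enter: integral
  identities are proved for test functions and carried over by L2 limits. When a third factor is
  present it has to be bounded, and this is what the Sobolev bounds on the derivatives of
  \<open>\<psi>\<close> are for. \<open>wd\<close> is chosen by \<open>SOME\<close>, hence
  determined only almost everywhere, and even its linearity rests on uniqueness of weak derivatives.
  For three general functions of \<open>H20\<close> the bound on \<open>a1\<close> gives no
  integrability of the integrand, because a divergent integral counts as 0; linearity of
  \<open>a1\<close> is therefore used only when \<open>\<psi>\<close> or a piecewise polynomial
  supplies a bounded factor. The quadratic remainder \<open>a1(e, e, v)\<close> forces no smallness
  of \<open>h\<close>. In the H2 estimate its part along \<open>e\<close> vanishes, since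
  \<open>a1(e, e, e) = 0\<close>, and the rest is multiplied by the interpolation error. In the
  duality estimates it is of order \<open>h^8\<close>, more than the \<open>h^5\<close> and
  \<open>h^6\<close> required, and the surplus powers are absorbed by the diameter of the
  domain.\<close>

lemma power_over_fact_le_exp:
  fixes x :: real
  assumes "x \<ge> 0"
  shows "x ^ n / fact n \<le> exp x"
proof -
  have s: "summable (\<lambda>n. inverse (fact n) * x ^ n)" by (rule summable_exp)
  have "(\<Sum>k\<in>{n}. inverse (fact k) * x ^ k) \<le> (\<Sum>k. inverse (fact k) * x ^ k)"
    by (rule sum_le_suminf[OF s]) (use assms in auto)
  moreover have "(\<Sum>k. inverse (fact k) * x ^ k) = exp x"
    by (simp add: exp_def)
  ultimately show ?thesis by (simp add: divide_inverse mult.commute)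
qed

text \<open>Differentiating \<open>exp (-1/x)\<close> produces further powers of \<open>1/x\<close>.
  The index \<open>k\<close> keeps track of them and makes the family closed under differentiation
  up to linear combinations; \<open>expdec 0\<close> is the usual smooth function that is flat at
  0.\<close>

definition expdec :: "nat \<Rightarrow> real \<Rightarrow> real" where
  "expdec k x = (if x \<le> 0 then 0 else exp (- (1 / x)) / x ^ k)"

text \<open>The exponential series gives \<open>(1/x)^(k+2) \<le> (k+2)! exp (1/x)\<close>. Two
  powers more than \<open>k\<close> are spent so that the difference quotient at 0 is of order
  \<open>|h|\<close> and the derivative there is 0 for every \<open>k\<close>.\<close>

lemma expdec_bound: "\<bar>expdec k x\<bar> \<le> fact (k + 2) * x\<^sup>2"
proof (cases "x \<le> 0")
  case False
  then have x: "x > 0" by simp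
  define C :: real where "C = fact (k + 2)"
  have C: "C > 0" by (simp add: C_def)
  have "(1 / x) ^ (k + 2) / C \<le> exp (1 / x)"
    unfolding C_def by (rule power_over_fact_le_exp) (use x in simp)
  then have "1 / x ^ (k + 2) / C \<le> exp (1 / x)"
    by (simp only: power_divide power_one)
  then have "1 \<le> exp (1 / x) * (C * x ^ (k + 2))"
    using C zero_less_power[OF x, of "k + 2"] by (simp add: field_simps del: power_Suc power_add)
  then have "exp (- (1 / x)) * 1 \<le> exp (- (1 / x)) * (exp (1 / x) * (C * x ^ (k + 2)))"
    by (intro mult_left_mono) auto
  also have "\<dots> = (exp (- (1 / x)) * exp (1 / x)) * (C * x ^ (k + 2))"
    by (simp only: mult.assoc)
  also have "\<dots> = C * x ^ (k + 2)"
    by (simp add: exp_minus)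
  finally show ?thesis using x
    unfolding C_def[symmetric]
    by (simp add: expdec_def divide_le_eq power_add mult_ac power2_eq_square)
qed (simp add: expdec_def)

lemma has_real_derivative_expdec:
  "(expdec k has_real_derivative (expdec (k + 2) x - real k * expdec (k + 1) x)) (at x)"
proof (cases x "0::real" rule: linorder_cases)
  case less
  have "((\<lambda>_. 0) has_real_derivative 0) (at x)" by simp
  then have "(expdec k has_real_derivative 0) (at x)"
    by (rule has_field_derivative_transform_within_open[where S = "{..<0}"])
       (use less in \<open>auto simp: expdec_def\<close>)
  then show ?thesis using less by (simp add: expdec_def)
next
  case greater
  have p: "((\<lambda>x. x ^ k) has_real_derivative (real k * x ^ k / x)) (at x)"
    using DERIV_pow[of k x] greater by (cases k) auto
  have e: "((\<lambda>x. exp (- (1 / x))) has_real_derivative (exp (- (1 / x)) / x\<^sup>2)) (at x)"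
    using greater by (auto intro!: derivative_eq_intros simp: power2_eq_square)
  have "((\<lambda>x. exp (- (1 / x)) / x ^ k) has_real_derivative
      (exp (- (1 / x)) / x ^ (k + 2) - real k * (exp (- (1 / x)) / x ^ (k + 1)))) (at x)"
    by (rule DERIV_cong[OF DERIV_divide[OF e p]])
       (use greater in \<open>auto simp: field_simps power2_eq_square\<close>)
  then have "(expdec k has_real_derivative
      (exp (- (1 / x)) / x ^ (k + 2) - real k * (exp (- (1 / x)) / x ^ (k + 1)))) (at x)"
    by (rule has_field_derivative_transform_within_open[where S = "{0<..}"])
       (use greater in \<open>auto simp: expdec_def\<close>)
  then show ?thesis using greater by (simp add: expdec_def)
next
  case equal
  have "((\<lambda>h. (expdec k (0 + h) - expdec k 0) / h) \<longlongrightarrow> 0) (at 0)"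
  proof (rule Lim_null_comparison)
    show "\<forall>\<^sub>F h in at 0. norm ((expdec k (0 + h) - expdec k 0) / h) \<le> fact (k + 2) * \<bar>h\<bar>"
    proof (rule eventually_at_filter[THEN iffD2], rule eventuallyI, intro impI)
      fix h :: real assume "h \<noteq> 0"
      then show "norm ((expdec k (0 + h) - expdec k 0) / h) \<le> fact (k + 2) * \<bar>h\<bar>"
        using expdec_bound[of k h]
        by (simp add: expdec_def divide_le_eq power2_eq_square abs_mult_self_eq mult.assoc
            flip: abs_mult)
    qed
    show "((\<lambda>h. fact (k + 2) * \<bar>h\<bar>) \<longlongrightarrow> (0::real)) (at 0)"
      by (auto intro!: tendsto_eq_intros)
  qed
  then show ?thesis using equal by (simp add: DERIV_def expdec_def)
qed

text \<open>\<open>pdx\<close> and \<open>pdy\<close> are built on \<open>deriv\<close>, which is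
  total and unspecified where no derivative exists. This predicate also records existence, and it
  determines the partials uniquely.\<close>

definition has_partials :: "(pt \<Rightarrow> real) \<Rightarrow> (pt \<Rightarrow> real) \<Rightarrow> (pt \<Rightarrow> real) \<Rightarrow> bool" where
  "has_partials f fx fy \<longleftrightarrow>
     (\<forall>x y. ((\<lambda>t. f (t, y)) has_real_derivative fx (x, y)) (at x)) \<and>
     (\<forall>x y. ((\<lambda>t. f (x, t)) has_real_derivative fy (x, y)) (at y))"

lemma has_partials_imp: assumes "has_partials f fx fy" shows "pdx f = fx" "pdy f = fy"
  using assms by (auto simp: has_partials_def pdx_def pdy_def fun_eq_iff intro!: DERIV_imp_deriv)

text \<open>Schwarz's theorem with continuity of only one mixed derivative, and only at the point.
  The mean value theorem, first in \<open>y\<close> and then in \<open>x\<close>, writes the second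
  difference as \<open>h k g(s, z)\<close>; letting first \<open>h\<close> and then \<open>k\<close>
  tend to 0 from the right gives the claim.\<close>

lemma mixed_partials_eq:
  assumes f: "has_partials f fx fy"
    and g: "\<And>x y. ((\<lambda>t. fy (t, y)) has_real_derivative g (x, y)) (at x)"
    and gc: "isCont g (a, b)"
    and d: "((\<lambda>t. fx (a, t)) has_real_derivative d) (at b)"
  shows "d = g (a, b)"
proof -
  have close: "\<bar>d - g (a, b)\<bar> \<le> e" if e: "e > 0" for e
  proof -
    obtain r where r: "r > 0" "\<And>q. dist q (a, b) < r \<Longrightarrow> dist (g q) (g (a, b)) < e"
      using gc e unfolding continuous_at_eps_delta by metis
    have box: "\<bar>g (x, y) - g (a, b)\<bar> \<le> e" if "\<bar>x - a\<bar> < r / 2" "\<bar>y - b\<bar> < r / 2" for x y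
    proof -
      have "dist (x, y) (a, b) \<le> \<bar>x - a\<bar> + \<bar>y - b\<bar>"
        by (simp add: dist_prod_def dist_real_def sqrt_sum_squares_le_sum_abs)
      then show ?thesis using r(2)[of "(x, y)"] that by (simp add: dist_real_def)
    qed
    have quot: "\<bar>(fx (a, b + k) - fx (a, b)) / k - g (a, b)\<bar> \<le> e" if k: "0 < k" "k < r / 2" for k
    proof -
      let ?Q = "\<lambda>h. ((f (a + h, b + k) - f (a + h, b)) - (f (a, b + k) - f (a, b))) / h"
      have "((\<lambda>s. f (s, b + k) - f (s, b)) has_real_derivative (fx (a, b + k) - fx (a, b))) (at a)"
        using f by (auto simp: has_partials_def intro!: derivative_intros)
      then have "?Q \<midarrow>0\<rightarrow> fx (a, b + k) - fx (a, b)" by (simp add: DERIV_def)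
      then have lim: "(?Q \<longlongrightarrow> fx (a, b + k) - fx (a, b)) (at_right 0)"
        by (rule filterlim_mono) (auto simp: at_within_le_at)
      have ev: "\<forall>\<^sub>F h in at_right 0. \<bar>?Q h - k * g (a, b)\<bar> \<le> k * e"
        unfolding eventually_at_right_field
      proof (intro exI[of _ "r / 2"] conjI allI impI)
        show "0 < r / 2" using r(1) by simp
        fix h :: real assume h: "0 < h" "h < r / 2"
        have "\<exists>z. b < z \<and> z < b + k \<and> (f (a + h, b + k) - f (a, b + k)) - (f (a + h, b) - f (a, b))
            = (b + k - b) * (fy (a + h, z) - fy (a, z))"
          by (rule MVT2) (use k f in \<open>auto simp: has_partials_def intro!: derivative_intros\<close>)
        then obtain z where z: "b < z" "z < b + k"
          "(f (a + h, b + k) - f (a, b + k)) - (f (a + h, b) - f (a, b)) = k * (fy (a + h, z) - fy (a, z))"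
          by auto
        have "\<exists>s. a < s \<and> s < a + h \<and> fy (a + h, z) - fy (a, z) = (a + h - a) * g (s, z)"
          by (rule MVT2) (use h g in auto)
        then obtain s where s: "a < s" "s < a + h" "fy (a + h, z) - fy (a, z) = h * g (s, z)" by auto
        have "?Q h = (k * (h * g (s, z))) / h" using z(3) s(3) by (simp add: algebra_simps)
        also have "\<dots> = k * g (s, z)" using h by simp
        finally have "\<bar>?Q h - k * g (a, b)\<bar> = k * \<bar>g (s, z) - g (a, b)\<bar>"
          using k by (simp add: abs_mult flip: right_diff_distrib)
        also have "\<dots> \<le> k * e" using box[of s z] s z h k by (intro mult_left_mono) auto
        finally show "\<bar>?Q h - k * g (a, b)\<bar> \<le> k * e" .
      qed
      have "\<bar>fx (a, b + k) - fx (a, b) - k * g (a, b)\<bar> \<le> k * e"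
        by (rule tendsto_upperbound[OF tendsto_rabs[OF tendsto_diff[OF lim tendsto_const]] ev]) simp
      moreover have "(fx (a, b + k) - fx (a, b)) / k - g (a, b) = (fx (a, b + k) - fx (a, b) - k * g (a, b)) / k"
        using k by (simp add: field_simps)
      ultimately show ?thesis using k by (simp add: abs_divide divide_le_eq mult.commute)
    qed
    have "((\<lambda>k. (fx (a, b + k) - fx (a, b)) / k) \<longlongrightarrow> d) (at_right 0)"
      using d unfolding DERIV_def by (rule filterlim_mono) (auto simp: at_within_le_at)
    then show ?thesis
      by (rule tendsto_upperbound[OF tendsto_rabs[OF tendsto_diff[OF _ tendsto_const]]])
         (auto simp: eventually_at_right_field intro!: exI[of _ "r / 2"] quot r(1))
  qed
  have "\<bar>d - g (a, b)\<bar> \<le> 0" by (rule field_le_epsilon) (use close in auto)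
  then show ?thesis by simp
qed

section \<open>Iterated derivatives and their order\<close>

lemma cpd_00 [simp]: "cpd 0 0 f = f" by (simp add: cpd_def)
lemma cpd_pdy: "cpd i j (pdy f) = cpd i (Suc j) f" by (simp add: cpd_def funpow_swap1)
lemma pdx_cpd: "pdx (cpd i j f) = cpd (Suc i) j f" by (simp add: cpd_def)
lemma cpd_10: "cpd (Suc 0) 0 f = pdx f" by (simp add: cpd_def)
lemma cpd_01: "cpd 0 (Suc 0) f = pdy f" by (simp add: cpd_def)

lemma smooth2_has_partials_cpd:
  assumes "smooth2 f"
  shows "has_partials (cpd i j f) (pdx (cpd i j f)) (pdy (cpd i j f))"
proof -
  have "(\<lambda>t. cpd i j f (t, y)) differentiable (at x)" "(\<lambda>t. cpd i j f (x, t)) differentiable (at y)" for x y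
    using assms unfolding smooth2_def by (metis fst_conv snd_conv)+
  then show ?thesis
    unfolding has_partials_def pdx_def pdy_def
    by (auto simp: DERIV_deriv_iff_real_differentiable)
qed

lemma smooth2_cont_cpd: "smooth2 f \<Longrightarrow> continuous_on UNIV (cpd i j f)"
  by (auto simp: smooth2_def)

lemma smooth2_has_partials: "smooth2 f \<Longrightarrow> has_partials f (pdx f) (pdy f)"
  using smooth2_has_partials_cpd[of f 0 0] by simp

lemma smooth2_cont: "smooth2 f \<Longrightarrow> continuous_on UNIV f"
  using smooth2_cont_cpd[of f 0 0] by simp

lemma smooth2_pdy: "smooth2 f \<Longrightarrow> smooth2 (pdy f)"
  by (simp add: smooth2_def cpd_pdy)

text \<open>\<open>smooth2\<close> speaks only of derivatives with all \<open>pdy\<close> applied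
  before all \<open>pdx\<close>. Moving one \<open>pdy\<close> through \<open>pdx ^^ i\<close> is an
  induction on \<open>i\<close>: the induction hypothesis identifies \<open>pdy (cpd i 0 h)\<close>
  with the controlled derivative \<open>cpd i 1 h\<close>, to which Schwarz's theorem then
  applies.\<close>

lemma pdy_pdx_cpd:
  assumes "smooth2 f" shows "pdy (pdx (cpd i j f)) = pdx (pdy (cpd i j f))"
proof -
  have commute: "pdy (pdx h) = pdx (pdy h)"
    if h: "has_partials h (pdx h) (pdy h)" "has_partials (pdx h) (pdx (pdx h)) (pdy (pdx h))"
      "has_partials (pdy h) (pdx (pdy h)) (pdy (pdy h))" "continuous_on UNIV (pdx (pdy h))" for h
  proof
    fix p :: pt
    obtain x y where p: "p = (x, y)" by (cases p)
    show "pdy (pdx h) p = pdx (pdy h) p" unfolding p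
    proof (rule mixed_partials_eq[OF h(1)])
      show "isCont (pdx (pdy h)) (x, y)" using h(4) by (simp add: continuous_on_eq_continuous_at)
    qed (use h in \<open>auto simp: has_partials_def\<close>)
  qed
  have comm0: "pdy ((pdx ^^ i) h) = (pdx ^^ i) (pdy h)"
    if h: "\<And>i j. has_partials (cpd i j h) (pdx (cpd i j h)) (pdy (cpd i j h))"
      "\<And>i j. continuous_on UNIV (cpd i j h)" for i h
  proof (induction i)
    case (Suc i)
    have e: "pdy (cpd i 0 h) = cpd i 1 h" using Suc by (simp add: cpd_def)
    have "pdy (pdx (cpd i 0 h)) = pdx (pdy (cpd i 0 h))"
    proof (rule commute)
      show "has_partials (pdx (cpd i 0 h)) (pdx (pdx (cpd i 0 h))) (pdy (pdx (cpd i 0 h)))"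
        using h(1)[of "Suc i" 0] by (simp add: pdx_cpd)
      show "has_partials (pdy (cpd i 0 h)) (pdx (pdy (cpd i 0 h))) (pdy (pdy (cpd i 0 h)))"
        unfolding e by (rule h)
      show "continuous_on UNIV (pdx (pdy (cpd i 0 h)))"
        unfolding e pdx_cpd by (rule h)
    qed (rule h)
    then show ?case using Suc by (simp add: cpd_def)
  qed simp
  have c: "cpd a b ((pdy ^^ j) f) = cpd a (b + j) f" for a b by (simp add: cpd_def funpow_add)
  have "pdy ((pdx ^^ k) ((pdy ^^ j) f)) = (pdx ^^ k) (pdy ((pdy ^^ j) f))" for k
    by (rule comm0) (use assms in \<open>auto simp: c smooth2_cont_cpd smooth2_has_partials_cpd\<close>)
  from this[of "Suc i"] this[of i] show ?thesis by (simp add: cpd_def)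
qed

lemma pdy_cpd: assumes "smooth2 f" shows "pdy (cpd i j f) = cpd i (Suc j) f"
proof (induction i)
  case 0 show ?case by (simp add: cpd_def)
next
  case (Suc i)
  then show ?case using pdy_pdx_cpd[OF assms, of i j] by (simp add: pdx_cpd)
qed

lemma cpd_pdx: assumes "smooth2 f" shows "cpd i j (pdx f) = cpd (Suc i) j f"
proof -
  have "(pdy ^^ j) (pdx f) = cpd (Suc 0) j f"
  proof (induction j)
    case (Suc j)
    then show ?case using pdy_cpd[OF assms, of "Suc 0" j] by simp
  qed (simp add: cpd_10)
  then show ?thesis by (simp add: cpd_def funpow_swap1)
qed

lemma smooth2_pdx: "smooth2 f \<Longrightarrow> smooth2 (pdx f)"
  by (simp add: smooth2_def cpd_pdx[unfolded smooth2_def])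

lemma smooth2_cpd: "smooth2 f \<Longrightarrow> smooth2 (cpd i j f)"
proof -
  assume f: "smooth2 f"
  have "smooth2 ((pdy ^^ j) f)" by (induction j) (auto simp: f smooth2_pdy)
  then have "smooth2 ((pdx ^^ i) ((pdy ^^ j) f))" by (induction i) (auto simp: smooth2_pdx)
  then show ?thesis by (simp add: cpd_def)
qed

text \<open>Closure properties of \<^const>\<open>smooth2\<close> are obtained by coinduction: the class below contains all
  the functions that are needed and is closed under both partial derivatives.\<close>

inductive smooth_closure :: "(pt \<Rightarrow> real) \<Rightarrow> bool" where
  base: "smooth2 f \<Longrightarrow> smooth_closure f"
| const: "smooth_closure (\<lambda>_. c)"
| proj_fst: "smooth_closure fst"
| proj_snd: "smooth_closure snd"
| expdec_fst: "smooth_closure (\<lambda>p. expdec k (fst p))"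
| expdec_snd: "smooth_closure (\<lambda>p. expdec k (snd p))"
| add: "smooth_closure f \<Longrightarrow> smooth_closure g \<Longrightarrow> smooth_closure (\<lambda>p. f p + g p)"
| mult: "smooth_closure f \<Longrightarrow> smooth_closure g \<Longrightarrow> smooth_closure (\<lambda>p. f p * g p)"
| affine: "smooth_closure f \<Longrightarrow> smooth_closure (\<lambda>p. f (a + c *\<^sub>R p))"

lemma has_partials_add: "has_partials f fx fy \<Longrightarrow> has_partials g gx gy \<Longrightarrow>
    has_partials (\<lambda>p. f p + g p) (\<lambda>p. fx p + gx p) (\<lambda>p. fy p + gy p)"
  by (auto simp: has_partials_def intro!: derivative_intros)

lemma has_partials_mult: "has_partials f fx fy \<Longrightarrow> has_partials g gx gy \<Longrightarrow>
    has_partials (\<lambda>p. f p * g p) (\<lambda>p. fx p * g p + f p * gx p) (\<lambda>p. fy p * g p + f p * gy p)"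
  by (auto simp: has_partials_def intro!: derivative_eq_intros)

lemma has_partials_affine: assumes "has_partials f fx fy"
  shows "has_partials (\<lambda>p. f (a + c *\<^sub>R p)) (\<lambda>p. c * fx (a + c *\<^sub>R p)) (\<lambda>p. c * fy (a + c *\<^sub>R p))"
proof -
  obtain a1 a2 where a: "a = (a1, a2)" by (cases a)
  have "((\<lambda>t. f (a1 + c * t, y)) has_real_derivative fx (a1 + c * x, y) * c) (at x)" for x y
    by (rule DERIV_chain2[where f = "\<lambda>t. f (t, y)"])
       (use assms in \<open>auto simp: has_partials_def intro!: derivative_eq_intros\<close>)
  moreover have "((\<lambda>t. f (x, a2 + c * t)) has_real_derivative fy (x, a2 + c * y) * c) (at y)" for x y
    by (rule DERIV_chain2[where f = "\<lambda>t. f (x, t)"])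
       (use assms in \<open>auto simp: has_partials_def intro!: derivative_eq_intros\<close>)
  ultimately show ?thesis by (simp add: has_partials_def a mult.commute)
qed

lemma smooth_closure_partialsI:
  assumes "has_partials f fx fy" "continuous_on UNIV f" "smooth_closure fx" "smooth_closure fy"
  shows "continuous_on UNIV f \<and> (\<exists>fx fy. smooth_closure fx \<and> smooth_closure fy \<and> has_partials f fx fy)"
  using assms by blast

text \<open>The invariant of the coinduction. Constants, sums and products belong to the class
  precisely so that the Leibniz and chain rules do not leave it.\<close>

lemma smooth_closure_partials:
  assumes "smooth_closure f"
  shows "continuous_on UNIV f \<and> (\<exists>fx fy. smooth_closure fx \<and> smooth_closure fy \<and> has_partials f fx fy)"
  using assms
proof induction
  case (base f)
  then show ?case
    by (intro smooth_closure_partialsI[OF smooth2_has_partials] smooth2_cont smooth_closure.base smooth2_pdx smooth2_pdy)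
next
  case (const c)
  have "has_partials (\<lambda>_. c) (\<lambda>_. 0) (\<lambda>_. 0)" by (simp add: has_partials_def)
  then show ?case by (rule smooth_closure_partialsI) (intro smooth_closure.const continuous_on_const)+
next
  case proj_fst
  have "has_partials fst (\<lambda>_. 1) (\<lambda>_. 0)" by (simp add: has_partials_def)
  then show ?case by (rule smooth_closure_partialsI) (intro smooth_closure.const continuous_on_fst continuous_on_id)+
next
  case proj_snd
  have "has_partials snd (\<lambda>_. 0) (\<lambda>_. 1)" by (simp add: has_partials_def)
  then show ?case by (rule smooth_closure_partialsI) (intro smooth_closure.const continuous_on_snd continuous_on_id)+
next
  case (expdec_fst k)
  have "continuous_on UNIV (expdec k)"
    by (meson DERIV_isCont continuous_at_imp_continuous_on has_real_derivative_expdec)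
  then have c: "continuous_on UNIV (\<lambda>p::pt. expdec k (fst p))"
    by (rule continuous_on_compose2) (auto intro!: continuous_intros)
  have "has_partials (\<lambda>p. expdec k (fst p))
      (\<lambda>p. expdec (k + 2) (fst p) + (- real k) * expdec (k + 1) (fst p)) (\<lambda>_. 0)"
    using has_real_derivative_expdec by (simp add: has_partials_def)
  then show ?case
    by (rule smooth_closure_partialsI) (rule c smooth_closure.add smooth_closure.mult smooth_closure.const smooth_closure.expdec_fst)+
next
  case (expdec_snd k)
  have "continuous_on UNIV (expdec k)"
    by (meson DERIV_isCont continuous_at_imp_continuous_on has_real_derivative_expdec)
  then have c: "continuous_on UNIV (\<lambda>p::pt. expdec k (snd p))"
    by (rule continuous_on_compose2) (auto intro!: continuous_intros)
  have "has_partials (\<lambda>p. expdec k (snd p)) (\<lambda>_. 0)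
      (\<lambda>p. expdec (k + 2) (snd p) + (- real k) * expdec (k + 1) (snd p))"
    using has_real_derivative_expdec by (simp add: has_partials_def)
  then show ?case
    by (rule smooth_closure_partialsI) (rule c smooth_closure.add smooth_closure.mult smooth_closure.const smooth_closure.expdec_snd)+
next
  case (add f g)
  then obtain fx fy gx gy where *: "has_partials f fx fy" "has_partials g gx gy"
    "smooth_closure fx" "smooth_closure fy" "smooth_closure gx" "smooth_closure gy" by blast
  have "continuous_on UNIV (\<lambda>p. f p + g p)" using add by (intro continuous_on_add) auto
  moreover have "smooth_closure (\<lambda>p. fx p + gx p)" "smooth_closure (\<lambda>p. fy p + gy p)"
    using * by (auto intro: smooth_closure.add)
  ultimately show ?case by (intro smooth_closure_partialsI[OF has_partials_add[OF *(1,2)]])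
next
  case (mult f g)
  then obtain fx fy gx gy where *: "has_partials f fx fy" "has_partials g gx gy"
    "smooth_closure fx" "smooth_closure fy" "smooth_closure gx" "smooth_closure gy" by blast
  have "continuous_on UNIV (\<lambda>p. f p * g p)" using mult by (intro continuous_on_mult) auto
  moreover have "smooth_closure (\<lambda>p. fx p * g p + f p * gx p)" "smooth_closure (\<lambda>p. fy p * g p + f p * gy p)"
    by (rule smooth_closure.add smooth_closure.mult * mult.hyps)+
  ultimately show ?case by (intro smooth_closure_partialsI[OF has_partials_mult[OF *(1,2)]])
next
  case (affine f a c)
  then obtain fx fy where *: "has_partials f fx fy" "smooth_closure fx" "smooth_closure fy" by blast
  have "continuous_on UNIV (\<lambda>p. f (a + c *\<^sub>R p))"
    using affine by (auto intro!: continuous_on_compose2[of UNIV f] continuous_intros)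
  moreover have "smooth_closure (\<lambda>p. c * fx (a + c *\<^sub>R p))" "smooth_closure (\<lambda>p. c * fy (a + c *\<^sub>R p))"
    by (rule smooth_closure.mult smooth_closure.const smooth_closure.affine *)+
  ultimately show ?case by (intro smooth_closure_partialsI[OF has_partials_affine[OF *(1)]])
qed

text \<open>Iterating the invariant reaches every \<open>cpd i j\<close>. The equivalence then turns
  the introduction rules of the class into closure properties of \<open>smooth2\<close>.\<close>

lemma smooth2_iff_smooth_closure: "smooth2 f \<longleftrightarrow> smooth_closure f"
proof
  assume f: "smooth_closure f"
  have x: "smooth_closure (pdx g)" "smooth_closure (pdy g)" "has_partials g (pdx g) (pdy g)"
    "continuous_on UNIV g" if g: "smooth_closure g" for g
  proof -
    from smooth_closure_partials[OF g] obtain fx fy where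
      "continuous_on UNIV g" "smooth_closure fx" "smooth_closure fy" "has_partials g fx fy" by blast
    then show "smooth_closure (pdx g)" "smooth_closure (pdy g)" "has_partials g (pdx g) (pdy g)"
      "continuous_on UNIV g" using has_partials_imp[of g fx fy] by simp_all
  qed
  have "smooth_closure ((pdy ^^ j) f)" for j by (induction j) (auto simp: f x)
  then have c: "smooth_closure (cpd i j f)" for i j
    unfolding cpd_def by (induction i) (auto simp: x)
  have d: "(\<lambda>t. cpd i j f (t, y)) differentiable (at u)" "(\<lambda>t. cpd i j f (u, t)) differentiable (at y)" for i j u y
    using x(3)[OF c] unfolding has_partials_def by (meson real_differentiable_def)+
  show "smooth2 f" unfolding smooth2_def using x(4)[OF c] d by auto
qed (rule smooth_closure.base)

lemma smooth2_const: "smooth2 (\<lambda>_. c)"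
  and smooth2_fst: "smooth2 fst"
  and smooth2_snd: "smooth2 snd"
  and smooth2_expdec_fst: "smooth2 (\<lambda>p. expdec k (fst p))"
  and smooth2_expdec_snd: "smooth2 (\<lambda>p. expdec k (snd p))"
  and smooth2_add: "smooth2 f \<Longrightarrow> smooth2 g \<Longrightarrow> smooth2 (\<lambda>p. f p + g p)"
  and smooth2_mult: "smooth2 f \<Longrightarrow> smooth2 g \<Longrightarrow> smooth2 (\<lambda>p. f p * g p)"
  and smooth2_affine: "smooth2 f \<Longrightarrow> smooth2 (\<lambda>p. f (a + c *\<^sub>R p))"
  unfolding smooth2_iff_smooth_closure by (fact smooth_closure.intros)+

lemma smooth2_cmult: "smooth2 f \<Longrightarrow> smooth2 (\<lambda>p. c * f p)"
  by (intro smooth2_mult smooth2_const)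

lemma smooth2_uminus: "smooth2 f \<Longrightarrow> smooth2 (\<lambda>p. - f p)"
  using smooth2_cmult[of f "-1"] by simp

lemma smooth2_diff: "smooth2 f \<Longrightarrow> smooth2 g \<Longrightarrow> smooth2 (\<lambda>p. f p - g p)"
  using smooth2_add[of f "\<lambda>p. - g p"] smooth2_uminus[of g] by simp

lemma smooth2_sum: "(\<And>i. i \<in> I \<Longrightarrow> smooth2 (f i)) \<Longrightarrow> smooth2 (\<lambda>p. \<Sum>i\<in>I. f i p)"
  by (induction I rule: infinite_finite_induct) (auto intro!: smooth2_const smooth2_add)

lemma smooth2_power: "smooth2 f \<Longrightarrow> smooth2 (\<lambda>p. f p ^ n)"
  by (induction n) (auto intro!: smooth2_const smooth2_mult)

lemmas smooth2_intros = smooth2_const smooth2_fst smooth2_snd smooth2_add smooth2_mult smooth2_cmult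
  smooth2_uminus smooth2_diff smooth2_sum smooth2_power smooth2_pdx smooth2_pdy smooth2_cpd

lemma pd_mult:
  assumes "smooth2 f" "smooth2 g"
  shows "pdx (\<lambda>p. f p * g p) = (\<lambda>p. pdx f p * g p + f p * pdx g p)"
    "pdy (\<lambda>p. f p * g p) = (\<lambda>p. pdy f p * g p + f p * pdy g p)"
  using has_partials_imp[OF has_partials_mult[OF assms[THEN smooth2_has_partials]]] by auto

lemma pd_add:
  assumes "smooth2 f" "smooth2 g"
  shows "pdx (\<lambda>p. f p + g p) = (\<lambda>p. pdx f p + pdx g p)" "pdy (\<lambda>p. f p + g p) = (\<lambda>p. pdy f p + pdy g p)"
  using has_partials_imp[OF has_partials_add[OF assms[THEN smooth2_has_partials]]] by auto

lemma pd_const: "pdx (\<lambda>_. c) = (\<lambda>_. 0)" "pdy (\<lambda>_. c) = (\<lambda>_. 0)"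
  by (auto simp: pdx_def pdy_def)

lemma pd_cmult:
  assumes "smooth2 f"
  shows "pdx (\<lambda>p. c * f p) = (\<lambda>p. c * pdx f p)" "pdy (\<lambda>p. c * f p) = (\<lambda>p. c * pdy f p)"
  using pd_mult[OF smooth2_const assms] by (auto simp: pd_const)

lemma pd_uminus:
  assumes "smooth2 f"
  shows "pdx (\<lambda>p. - f p) = (\<lambda>p. - pdx f p)" "pdy (\<lambda>p. - f p) = (\<lambda>p. - pdy f p)"
  using pd_cmult[OF assms, of "-1"] by auto

lemma pd_diff:
  assumes "smooth2 f" "smooth2 g"
  shows "pdx (\<lambda>p. f p - g p) = (\<lambda>p. pdx f p - pdx g p)" "pdy (\<lambda>p. f p - g p) = (\<lambda>p. pdy f p - pdy g p)"
  using pd_add[OF assms(1) smooth2_uminus[OF assms(2)]] pd_uminus[OF assms(2)] by auto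

lemma pd_fst: "pdx fst = (\<lambda>_. 1)" "pdy fst = (\<lambda>_. 0)"
  and pd_snd: "pdx snd = (\<lambda>_. 0)" "pdy snd = (\<lambda>_. 1)"
  by (auto simp: pdx_def pdy_def)

lemmas pd_simps = pd_mult pd_add pd_const pd_cmult pd_uminus pd_diff pd_fst pd_snd

lemma cpd_lincomb:
  assumes "smooth2 f" "smooth2 g"
  shows "cpd i j (\<lambda>p. a * f p + b * g p) = (\<lambda>p. a * cpd i j f p + b * cpd i j g p)"
proof -
  have s: "smooth2 (cpd k l f)" "smooth2 (cpd k l g)" for k l using assms by (auto intro: smooth2_cpd)
  have "(pdy ^^ j) (\<lambda>p. a * f p + b * g p) = (\<lambda>p. a * cpd 0 j f p + b * cpd 0 j g p)"
    by (induction j) (auto simp: pd_simps smooth2_intros s pdy_cpd assms)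
  moreover have "(pdx ^^ i) (\<lambda>p. a * cpd 0 j f p + b * cpd 0 j g p) = (\<lambda>p. a * cpd i j f p + b * cpd i j g p)"
    by (induction i) (auto simp: pd_simps smooth2_intros s pdx_cpd)
  ultimately show ?thesis by (simp add: cpd_def)
qed

section \<open>Square integrable functions\<close>

text \<open>L2 over an arbitrary measure, because it serves for the whole domain and again for each
  triangle.\<close>

definition sqi :: "'a measure \<Rightarrow> ('a \<Rightarrow> real) \<Rightarrow> bool" where
  "sqi M f \<longleftrightarrow> f \<in> borel_measurable M \<and> integrable M (\<lambda>x. (f x)\<^sup>2)"

definition nrm :: "'a measure \<Rightarrow> ('a \<Rightarrow> real) \<Rightarrow> real" where
  "nrm M f = sqrt (\<integral>x. (f x)\<^sup>2 \<partial>M)"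

lemma sqi_measurable [measurable_dest]: "sqi M f \<Longrightarrow> f \<in> borel_measurable M"
  by (simp add: sqi_def)

lemma nrm_nonneg [simp]: "0 \<le> nrm M f" by (simp add: nrm_def)

lemma nrm_power2: "(nrm M f)\<^sup>2 = (\<integral>x. (f x)\<^sup>2 \<partial>M)" by (simp add: nrm_def)

lemma sqi_integrable_mult:
  assumes "sqi M f" "sqi M g" shows "integrable M (\<lambda>x. f x * g x)"
proof (rule Bochner_Integration.integrable_bound)
  show "integrable M (\<lambda>x. (f x)\<^sup>2 + (g x)\<^sup>2)" using assms by (simp add: sqi_def)
  show "(\<lambda>x. f x * g x) \<in> borel_measurable M" using assms by (auto simp: sqi_def)
  have "\<bar>a * b\<bar> \<le> a\<^sup>2 + b\<^sup>2" for a b :: real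
    using sum_squares_bound[of a b] sum_squares_bound[of a "-b"] by (simp add: abs_le_iff) 
  then show "AE x in M. norm (f x * g x) \<le> norm ((f x)\<^sup>2 + (g x)\<^sup>2)" by simp
qed

lemma sqi_lincomb:
  assumes "sqi M f" "sqi M g" shows "sqi M (\<lambda>x. a * f x + b * g x)"
proof -
  have "integrable M (\<lambda>x. a\<^sup>2 * (f x)\<^sup>2 + b\<^sup>2 * (g x)\<^sup>2 + 2 * a * b * (f x * g x))"
    using assms sqi_integrable_mult[OF assms] by (auto simp: sqi_def)
  then have "integrable M (\<lambda>x. (a * f x + b * g x)\<^sup>2)"
    by (simp add: power2_eq_square algebra_simps)
  then show ?thesis using assms by (auto simp: sqi_def)
qed

lemma sqi_add: "sqi M f \<Longrightarrow> sqi M g \<Longrightarrow> sqi M (\<lambda>x. f x + g x)"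
  and sqi_diff: "sqi M f \<Longrightarrow> sqi M g \<Longrightarrow> sqi M (\<lambda>x. f x - g x)"
  and sqi_cmult: "sqi M f \<Longrightarrow> sqi M (\<lambda>x. c * f x)"
  and sqi_uminus: "sqi M f \<Longrightarrow> sqi M (\<lambda>x. - f x)"
  using sqi_lincomb[of M f g 1 1] sqi_lincomb[of M f g 1 "-1"] sqi_lincomb[of M f f c 0]
    sqi_lincomb[of M f f "-1" 0] by simp_all

lemma sqi_bounded_mult:
  assumes f: "sqi M f" and w: "w \<in> borel_measurable M" "AE x in M. \<bar>w x\<bar> \<le> C"
  shows "sqi M (\<lambda>x. w x * f x)" "nrm M (\<lambda>x. w x * f x) \<le> C * nrm M f"
proof -
  have i: "integrable M (\<lambda>x. C\<^sup>2 * (f x)\<^sup>2)" using f by (simp add: sqi_def)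
  have b: "AE x in M. (w x * f x)\<^sup>2 \<le> C\<^sup>2 * (f x)\<^sup>2"
    using w(2)
  proof eventually_elim
    case (elim x)
    then have "(w x)\<^sup>2 \<le> C\<^sup>2" using abs_le_square_iff[of "w x" C] by simp
    then show ?case by (simp add: power_mult_distrib mult_right_mono)
  qed
  have j: "integrable M (\<lambda>x. (w x * f x)\<^sup>2)"
    by (rule Bochner_Integration.integrable_bound[OF i]) (use f w b in \<open>auto simp: sqi_def\<close>)
  then show "sqi M (\<lambda>x. w x * f x)" using f w by (auto simp: sqi_def)
  show "nrm M (\<lambda>x. w x * f x) \<le> C * nrm M f"
  proof (cases "C \<ge> 0")
    case True
    have "(\<integral>x. (w x * f x)\<^sup>2 \<partial>M) \<le> (\<integral>x. C\<^sup>2 * (f x)\<^sup>2 \<partial>M)"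
      by (rule integral_mono_AE[OF j i b])
    then have "nrm M (\<lambda>x. w x * f x) \<le> sqrt (C\<^sup>2 * (\<integral>x. (f x)\<^sup>2 \<partial>M))"
      unfolding nrm_def by (intro real_sqrt_le_mono) simp
    then show ?thesis using True by (simp add: nrm_def real_sqrt_mult)
  next
    \<comment> \<open>A negative bound can hold almost everywhere only if the whole space is null,
      and then both norms are 0.\<close>
    case False
    have "AE x in M. False" using w(2) by (rule eventually_mono) (use False in auto)
    then have "AE x in M. (w x * f x)\<^sup>2 = 0" "AE x in M. (f x)\<^sup>2 = 0" by auto
    then have "(\<integral>x. (w x * f x)\<^sup>2 \<partial>M) = 0" "(\<integral>x. (f x)\<^sup>2 \<partial>M) = 0"
      by (auto intro: integral_eq_zero_AE)
    then show ?thesis by (simp add: nrm_def)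
  qed
qed

lemma sqi_bounded:
  assumes "finite_measure M" "w \<in> borel_measurable M" "AE x in M. \<bar>w x\<bar> \<le> C"
  shows "sqi M w"
proof -
  have "sqi M (\<lambda>x. 1)" using assms(1) by (simp add: sqi_def finite_measure.integrable_const)
  from sqi_bounded_mult(1)[OF this assms(2,3)] show ?thesis by simp
qed

text \<open>The discriminant argument behind both Cauchy-Schwarz inequalities, for L2 and for the
  abstract inner product. If \<open>c > 0\<close>, take \<open>s = c\<close> and
  \<open>t = b\<close>. If \<open>c = 0\<close> but \<open>b\<close> is not 0, then
  \<open>s = 1\<close> and \<open>t = (a + 1) / b\<close> would give the negative value
  \<open>- a - 2\<close>.\<close>

lemma nonneg_quadratic_form:
  fixes a b c :: real
  assumes q: "\<And>s t. 0 \<le> a * s\<^sup>2 - 2 * b * s * t + c * t\<^sup>2" and nn: "a \<ge> 0" "c \<ge> 0"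
  shows "b\<^sup>2 \<le> a * c"
proof (cases "c = 0")
  case True
  show ?thesis
  proof (cases "b = 0")
    case False
    have "0 \<le> a * 1\<^sup>2 - 2 * b * 1 * ((a + 1) / b) + c * ((a + 1) / b)\<^sup>2" by (rule q)
    also have "\<dots> = a - 2 * (a + 1)" unfolding True using False by (simp add: field_simps)
    finally show ?thesis using nn by simp
  qed (use nn in simp)
next
  case False
  then have c: "c > 0" using nn(2) by linarith
  have "0 \<le> a * c\<^sup>2 - 2 * b * c * b + c * b\<^sup>2" by (rule q)
  also have "\<dots> = c * (a * c - b\<^sup>2)" by (simp add: power2_eq_square algebra_simps)
  finally show ?thesis using c by (simp add: zero_le_mult_iff)
qed

lemma Cauchy_Schwarz_integral:
  assumes f: "sqi M f" and g: "sqi M g"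
  shows "\<bar>\<integral>x. f x * g x \<partial>M\<bar> \<le> nrm M f * nrm M g"
proof -
  let ?a = "\<integral>x. (f x)\<^sup>2 \<partial>M" and ?b = "\<integral>x. f x * g x \<partial>M" and ?c = "\<integral>x. (g x)\<^sup>2 \<partial>M"
  have i: "integrable M (\<lambda>x. (f x)\<^sup>2)" "integrable M (\<lambda>x. (g x)\<^sup>2)" "integrable M (\<lambda>x. f x * g x)"
    using f g sqi_integrable_mult[OF f g] by (auto simp: sqi_def)
  have q: "0 \<le> ?a * s\<^sup>2 - 2 * ?b * s * t + ?c * t\<^sup>2" for s t
  proof -
    have "0 \<le> (\<integral>x. (s * f x - t * g x)\<^sup>2 \<partial>M)" by simp
    also have "\<dots> = (\<integral>x. s\<^sup>2 * (f x)\<^sup>2 + (-2 * s * t) * (f x * g x) + t\<^sup>2 * (g x)\<^sup>2 \<partial>M)"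
      by (intro Bochner_Integration.integral_cong) (auto simp: power2_eq_square algebra_simps)
    also have "\<dots> = s\<^sup>2 * ?a + (-2 * s * t) * ?b + t\<^sup>2 * ?c" using i by simp
    finally show ?thesis by (simp add: algebra_simps)
  qed
  have nn: "?a \<ge> 0" "?c \<ge> 0" by simp_all
  have "?b\<^sup>2 \<le> ?a * ?c" by (rule nonneg_quadratic_form[OF q nn])
  then have "sqrt (?b\<^sup>2) \<le> sqrt (?a * ?c)" by (rule real_sqrt_le_mono)
  then show ?thesis by (simp add: nrm_def real_sqrt_mult)
qed

lemma nrm_triangle:
  assumes f: "sqi M f" and g: "sqi M g"
  shows "nrm M (\<lambda>x. f x + g x) \<le> nrm M f + nrm M g"
proof (rule power2_le_imp_le)
  have i: "integrable M (\<lambda>x. (f x)\<^sup>2)" "integrable M (\<lambda>x. (g x)\<^sup>2)" "integrable M (\<lambda>x. f x * g x)"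
    using f g sqi_integrable_mult[OF f g] by (auto simp: sqi_def)
  have "(nrm M (\<lambda>x. f x + g x))\<^sup>2 = (\<integral>x. (f x)\<^sup>2 + 2 * (f x * g x) + (g x)\<^sup>2 \<partial>M)"
    unfolding nrm_power2 by (intro Bochner_Integration.integral_cong) (auto simp: power2_eq_square algebra_simps)
  also have "\<dots> = (nrm M f)\<^sup>2 + 2 * (\<integral>x. f x * g x \<partial>M) + (nrm M g)\<^sup>2" using i by (simp add: nrm_power2)
  also have "\<dots> \<le> (nrm M f + nrm M g)\<^sup>2"
    using Cauchy_Schwarz_integral[OF f g] by (simp add: power2_sum)
  finally show "(nrm M (\<lambda>x. f x + g x))\<^sup>2 \<le> (nrm M f + nrm M g)\<^sup>2" .
qed simp

lemma nrm_cmult: "nrm M (\<lambda>x. c * f x) = \<bar>c\<bar> * nrm M f"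
  by (simp add: nrm_def power_mult_distrib real_sqrt_mult)

lemma nrm_uminus: "nrm M (\<lambda>x. - f x) = nrm M f"
  by (simp add: nrm_def)

lemma nrm_minus_commute: "nrm M (\<lambda>x. f x - g x) = nrm M (\<lambda>x. g x - f x)"
  by (simp add: nrm_def power2_commute)

lemma nrm_triangle_diff:
  assumes "sqi M f" "sqi M g"
  shows "nrm M (\<lambda>x. f x - g x) \<le> nrm M f + nrm M g"
  using nrm_triangle[OF assms(1) sqi_uminus[OF assms(2)]] by (simp add: nrm_uminus)

lemma nrm_dist_triangle:
  assumes "sqi M f" "sqi M g" "sqi M h"
  shows "nrm M (\<lambda>x. f x - h x) \<le> nrm M (\<lambda>x. f x - g x) + nrm M (\<lambda>x. g x - h x)"
  using nrm_triangle[OF sqi_diff[OF assms(1,2)] sqi_diff[OF assms(2,3)]] by simp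

lemma nrm_cong_AE:
  assumes "f \<in> borel_measurable M" "g \<in> borel_measurable M" "AE x in M. f x = g x"
  shows "nrm M f = nrm M g"
  unfolding nrm_def using assms by (intro arg_cong[of _ _ sqrt] integral_cong_AE) auto

lemma nrm_eq_0: assumes "sqi M f" "nrm M f = 0" shows "AE x in M. f x = 0"
proof -
  have "(\<integral>x. (f x)\<^sup>2 \<partial>M) = 0" using assms(2) by (simp add: nrm_def)
  then have "AE x in M. (f x)\<^sup>2 = 0"
    using assms(1) by (subst (asm) integral_nonneg_eq_0_iff_AE) (auto simp: sqi_def)
  then show ?thesis by simp
qed

text \<open>Membership in L2 is part of the notion: since a divergent integral is 0,
  \<open>nrm\<close> tending to 0 would not by itself mean convergence.\<close>

definition conv2 :: "'a measure \<Rightarrow> (nat \<Rightarrow> 'a \<Rightarrow> real) \<Rightarrow> ('a \<Rightarrow> real) \<Rightarrow> bool" where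
  "conv2 M F f \<longleftrightarrow> (\<forall>n. sqi M (F n)) \<and> sqi M f \<and> (\<lambda>n. nrm M (\<lambda>x. F n x - f x)) \<longlonglongrightarrow> 0"

lemma conv2_sqi: assumes "conv2 M F f" shows "sqi M (F n)" "sqi M f"
  using assms by (auto simp: conv2_def)

lemma conv2_lincomb:
  assumes "conv2 M F f" "conv2 M G g"
  shows "conv2 M (\<lambda>n x. a * F n x + b * G n x) (\<lambda>x. a * f x + b * g x)"
proof -
  have s: "sqi M (F n)" "sqi M (G n)" "sqi M f" "sqi M g" for n using assms by (auto simp: conv2_def)
  have "(\<lambda>n. nrm M (\<lambda>x. (a * F n x + b * G n x) - (a * f x + b * g x))) \<longlonglongrightarrow> 0"
  proof (rule Lim_null_comparison[OF eventuallyI])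
    fix n
    have "nrm M (\<lambda>x. a * (F n x - f x) + b * (G n x - g x))
        \<le> nrm M (\<lambda>x. a * (F n x - f x)) + nrm M (\<lambda>x. b * (G n x - g x))"
      by (intro nrm_triangle sqi_cmult sqi_diff s)
    then show "norm (nrm M (\<lambda>x. (a * F n x + b * G n x) - (a * f x + b * g x)))
        \<le> \<bar>a\<bar> * nrm M (\<lambda>x. F n x - f x) + \<bar>b\<bar> * nrm M (\<lambda>x. G n x - g x)"
      unfolding nrm_cmult by (simp add: algebra_simps)
    show "(\<lambda>n. \<bar>a\<bar> * nrm M (\<lambda>x. F n x - f x) + \<bar>b\<bar> * nrm M (\<lambda>x. G n x - g x)) \<longlonglongrightarrow> 0"
      using assms by (auto simp: conv2_def intro!: tendsto_eq_intros)
  qed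
  then show ?thesis using s by (auto simp: conv2_def intro!: sqi_lincomb)
qed

lemma conv2_add: "conv2 M F f \<Longrightarrow> conv2 M G g \<Longrightarrow> conv2 M (\<lambda>n x. F n x + G n x) (\<lambda>x. f x + g x)"
  and conv2_diff: "conv2 M F f \<Longrightarrow> conv2 M G g \<Longrightarrow> conv2 M (\<lambda>n x. F n x - G n x) (\<lambda>x. f x - g x)"
  using conv2_lincomb[of M F f G g 1 1] conv2_lincomb[of M F f G g 1 "-1"] by simp_all

lemma conv2_const: "sqi M f \<Longrightarrow> conv2 M (\<lambda>_. f) f"
  by (simp add: conv2_def nrm_def)

lemma conv2_bounded_mult:
  assumes "conv2 M F f" and w: "w \<in> borel_measurable M" "AE x in M. \<bar>w x\<bar> \<le> C"
  shows "conv2 M (\<lambda>n x. w x * F n x) (\<lambda>x. w x * f x)"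
proof -
  have s: "sqi M (F n)" "sqi M f" for n using assms by (auto simp: conv2_def)
  have "(\<lambda>n. nrm M (\<lambda>x. w x * F n x - w x * f x)) \<longlonglongrightarrow> 0"
  proof (rule Lim_null_comparison[OF eventuallyI])
    show "(\<lambda>n. C * nrm M (\<lambda>x. F n x - f x)) \<longlonglongrightarrow> 0"
      using assms by (auto simp: conv2_def intro!: tendsto_eq_intros)
    show "norm (nrm M (\<lambda>x. w x * F n x - w x * f x)) \<le> C * nrm M (\<lambda>x. F n x - f x)" for n
      using sqi_bounded_mult(2)[OF sqi_diff[OF s] w, of n] by (simp add: right_diff_distrib)
  qed
  then show ?thesis using s w by (auto simp: conv2_def intro!: sqi_bounded_mult)
qed

lemma conv2_nrm:
  assumes "conv2 M F f" shows "(\<lambda>n. nrm M (F n)) \<longlonglongrightarrow> nrm M f"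
proof -
  have s: "sqi M (F n)" "sqi M f" for n using assms by (auto simp: conv2_def)
  have "(\<lambda>n. nrm M (F n) - nrm M f) \<longlonglongrightarrow> 0"
  proof (rule Lim_null_comparison[OF eventuallyI])
    show "(\<lambda>n. nrm M (\<lambda>x. F n x - f x)) \<longlonglongrightarrow> 0" using assms by (simp add: conv2_def)
    fix n
    have "nrm M (F n) \<le> nrm M (\<lambda>x. F n x - f x) + nrm M f"
      using nrm_triangle[OF sqi_diff[OF s] s(2), of n] by simp
    moreover have "nrm M f \<le> nrm M (\<lambda>x. F n x - f x) + nrm M (F n)"
      using nrm_triangle[OF sqi_diff[OF s(2) s(1)] s(1), of n n] by (simp add: nrm_minus_commute)
    ultimately show "norm (nrm M (F n) - nrm M f) \<le> nrm M (\<lambda>x. F n x - f x)" by simp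
  qed
  then show ?thesis by (simp add: LIM_zero_iff)
qed

text \<open>The device that carries identities from test functions to \<open>Hk0\<close>. The
  difference of the pairings is split as \<open>(F n - f) G n + f (G n - g)\<close>, and the norms
  of \<open>G n\<close> converge, hence stay bounded.\<close>

lemma conv2_integral_mult:
  assumes F: "conv2 M F f" and G: "conv2 M G g"
  shows "(\<lambda>n. \<integral>x. F n x * G n x \<partial>M) \<longlonglongrightarrow> (\<integral>x. f x * g x \<partial>M)"
proof -
  have s: "sqi M (F n)" "sqi M (G n)" "sqi M f" "sqi M g" for n using F G by (auto simp: conv2_def)
  have "(\<lambda>n. (\<integral>x. F n x * G n x \<partial>M) - (\<integral>x. f x * g x \<partial>M)) \<longlonglongrightarrow> 0"
  proof (rule Lim_null_comparison[OF eventuallyI])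
    have "(\<lambda>n. nrm M (\<lambda>x. F n x - f x)) \<longlonglongrightarrow> 0" "(\<lambda>n. nrm M (\<lambda>x. G n x - g x)) \<longlonglongrightarrow> 0"
      using F G by (auto simp: conv2_def)
    then show "(\<lambda>n. nrm M (\<lambda>x. F n x - f x) * nrm M (G n) + nrm M f * nrm M (\<lambda>x. G n x - g x)) \<longlonglongrightarrow> 0"
      using conv2_nrm[OF G] by (auto intro!: tendsto_eq_intros)
    fix n
    have "(\<integral>x. F n x * G n x \<partial>M) - (\<integral>x. f x * g x \<partial>M)
        = (\<integral>x. F n x * G n x - f x * g x \<partial>M)"
      by (intro Bochner_Integration.integral_diff[symmetric] sqi_integrable_mult s)
    also have "\<dots> = (\<integral>x. (F n x - f x) * G n x + f x * (G n x - g x) \<partial>M)"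
      by (intro Bochner_Integration.integral_cong) (auto simp: algebra_simps)
    also have "\<dots> = (\<integral>x. (F n x - f x) * G n x \<partial>M) + (\<integral>x. f x * (G n x - g x) \<partial>M)"
      by (intro Bochner_Integration.integral_add sqi_integrable_mult sqi_diff s)
    finally show "norm ((\<integral>x. F n x * G n x \<partial>M) - (\<integral>x. f x * g x \<partial>M))
        \<le> nrm M (\<lambda>x. F n x - f x) * nrm M (G n) + nrm M f * nrm M (\<lambda>x. G n x - g x)"
      using Cauchy_Schwarz_integral[OF sqi_diff[OF s(1,3)] s(2), of n n]
        Cauchy_Schwarz_integral[OF s(3) sqi_diff[OF s(2,4)], of n] by simp
  qed
  then show ?thesis by (simp add: LIM_zero_iff)
qed

lemma conv2_AE_cong:
  assumes "conv2 M F f" "\<And>n. sqi M (G n)" "sqi M g" "\<And>n. AE x in M. F n x = G n x" "AE x in M. f x = g x"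
  shows "conv2 M G g"
proof -
  have "nrm M (\<lambda>x. F n x - f x) = nrm M (\<lambda>x. G n x - g x)" for n
  proof (rule nrm_cong_AE)
    have "F n \<in> borel_measurable M" "f \<in> borel_measurable M" "G n \<in> borel_measurable M" "g \<in> borel_measurable M"
      using assms(1-3) by (auto simp: conv2_def sqi_def)
    then show "(\<lambda>x. F n x - f x) \<in> borel_measurable M" "(\<lambda>x. G n x - g x) \<in> borel_measurable M" by auto
    show "AE x in M. F n x - f x = G n x - g x" using assms(4)[of n] assms(5) by eventually_elim simp
  qed
  then show ?thesis using assms by (simp add: conv2_def)
qed

text \<open>The core of the Riesz-Fischer theorem. On a finite measure space the L1 norms of the
  increments are bounded by a geometric series, so the telescoping series converges absolutely
  almost everywhere. Fatou's lemma then transfers the L2 bounds to the pointwise limit.\<close>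

lemma fast_Cauchy_conv2:
  assumes M: "finite_measure M" and G: "\<And>n. sqi M (G n)"
    and C: "\<And>k m. k \<le> m \<Longrightarrow> nrm M (\<lambda>x. G m x - G k x) \<le> (1 / 2) ^ k"
  shows "\<exists>f. sqi M f \<and> (\<forall>k. nrm M (\<lambda>x. f x - G k x) \<le> (1 / 2) ^ k)"
proof -
  interpret finite_measure M by fact
  have [measurable]: "G n \<in> borel_measurable M" for n using G by (simp add: sqi_def)
  have one: "sqi M (\<lambda>x. 1)" by (simp add: sqi_def)
  let ?D = "\<lambda>k x. \<bar>G (Suc k) x - G k x\<bar>"
  let ?K = "nrm M (\<lambda>x. 1)"
  have iD: "integrable M (?D k)" for k
    using sqi_integrable_mult[OF one sqi_diff[OF G[of "Suc k"] G[of k]]] by (intro integrable_abs) simp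
  have bD: "(\<integral>x. ?D k x \<partial>M) \<le> ?K * (1 / 2) ^ k" for k
  proof -
    have s: "sqi M (?D k)" using sqi_diff[OF G[of "Suc k"] G[of k]] by (auto simp: sqi_def)
    have "(\<integral>x. ?D k x \<partial>M) \<le> \<bar>\<integral>x. 1 * ?D k x \<partial>M\<bar>" by simp
    also have "\<dots> \<le> ?K * nrm M (?D k)" by (rule Cauchy_Schwarz_integral[OF one s])
    also have "nrm M (?D k) = nrm M (\<lambda>x. G (Suc k) x - G k x)" by (simp add: nrm_def)
    also have "?K * \<dots> \<le> ?K * (1 / 2) ^ k" by (intro mult_left_mono C) auto
    finally show ?thesis .
  qed
  have "(\<integral>\<^sup>+x. (\<Sum>k. ennreal (?D k x)) \<partial>M) = (\<Sum>k. \<integral>\<^sup>+x. ennreal (?D k x) \<partial>M)"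
    by (rule nn_integral_suminf) simp
  also have "\<dots> = (\<Sum>k. ennreal (\<integral>x. ?D k x \<partial>M))"
    by (intro suminf_cong nn_integral_eq_integral iD) auto
  also have "\<dots> \<le> (\<Sum>k. ennreal (?K * (1 / 2) ^ k))"
    by (intro suminf_le ennreal_leI bD) auto
  also have "\<dots> = ennreal (\<Sum>k. ?K * (1 / 2) ^ k)"
    by (intro suminf_ennreal2 summable_mult summable_geometric) auto
  also have "\<dots> < \<infinity>" by simp
  finally have "AE x in M. (\<Sum>k. ennreal (?D k x)) \<noteq> \<infinity>"
    by (intro nn_integral_noteq_infinite) auto
  then have conv: "AE x in M. convergent (\<lambda>k. G k x)"
  proof eventually_elim
    case (elim x)
    then have "summable (\<lambda>k. ?D k x)" by (intro summable_suminf_not_top) auto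
    then have "summable (\<lambda>k. G (Suc k) x - G k x)" by (rule summable_rabs_cancel)
    then have "convergent (\<lambda>n. \<Sum>k<n. G (Suc k) x - G k x)" by (simp add: summable_iff_convergent)
    then have "convergent (\<lambda>n. G n x - G 0 x)" using sum_lessThan_telescope[of "\<lambda>k. G k x"] by simp
    then have "convergent (\<lambda>n. (G n x - G 0 x) + G 0 x)" by (intro convergent_add convergent_const)
    then show ?case by simp
  qed
  define f where "f x = lim (\<lambda>k. G k x)" for x
  have [measurable]: "f \<in> borel_measurable M" unfolding f_def by (rule borel_measurable_lim_metric) simp
  have lim: "AE x in M. (\<lambda>k. G k x) \<longlonglongrightarrow> f x"
    using conv by eventually_elim (simp add: f_def convergent_LIMSEQ_iff)
  have fin: "(\<integral>\<^sup>+x. ennreal ((f x - G k x)\<^sup>2) \<partial>M) \<le> ennreal (((1 / 2) ^ k)\<^sup>2)" for k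
  proof -
    have "(\<integral>\<^sup>+x. ennreal ((f x - G k x)\<^sup>2) \<partial>M) = (\<integral>\<^sup>+x. liminf (\<lambda>m. ennreal ((G m x - G k x)\<^sup>2)) \<partial>M)"
    proof (rule nn_integral_cong_AE)
      show "AE x in M. ennreal ((f x - G k x)\<^sup>2) = liminf (\<lambda>m. ennreal ((G m x - G k x)\<^sup>2))"
        using lim
      proof eventually_elim
        case (elim x)
        have "(\<lambda>m. ennreal ((G m x - G k x)\<^sup>2)) \<longlonglongrightarrow> ennreal ((f x - G k x)\<^sup>2)"
          by (intro tendsto_intros elim)
        from lim_imp_Liminf[OF sequentially_bot this] show ?case by (rule sym)
      qed
    qed
    also have "\<dots> \<le> liminf (\<lambda>m. \<integral>\<^sup>+x. ennreal ((G m x - G k x)\<^sup>2) \<partial>M)"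
      by (rule nn_integral_liminf) simp
    also have "\<dots> \<le> ennreal (((1 / 2) ^ k)\<^sup>2)"
    proof (rule Liminf_le)
      show "\<forall>\<^sub>F m in sequentially. (\<integral>\<^sup>+x. ennreal ((G m x - G k x)\<^sup>2) \<partial>M) \<le> ennreal (((1 / 2) ^ k)\<^sup>2)"
        using eventually_ge_at_top[of k]
      proof eventually_elim
        case (elim m)
        have "(\<integral>\<^sup>+x. ennreal ((G m x - G k x)\<^sup>2) \<partial>M) = ennreal (\<integral>x. (G m x - G k x)\<^sup>2 \<partial>M)"
          using sqi_diff[OF G[of m] G[of k]] by (intro nn_integral_eq_integral) (auto simp: sqi_def)
        also have "\<dots> = ennreal ((nrm M (\<lambda>x. G m x - G k x))\<^sup>2)" by (simp add: nrm_power2)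
        also have "\<dots> \<le> ennreal (((1 / 2) ^ k)\<^sup>2)" by (intro ennreal_leI power_mono C elim) auto
        finally show ?case .
      qed
    qed simp
    finally show ?thesis .
  qed
  have s: "sqi M (\<lambda>x. f x - G k x)" for k
    unfolding sqi_def
  proof
    show "integrable M (\<lambda>x. (f x - G k x)\<^sup>2)"
    proof (rule integrableI_bounded)
      have "(\<integral>\<^sup>+x. ennreal (norm ((f x - G k x)\<^sup>2)) \<partial>M) \<le> ennreal (((1 / 2) ^ k)\<^sup>2)" using fin[of k] by simp
      also have "\<dots> < \<infinity>" by simp
      finally show "(\<integral>\<^sup>+x. ennreal (norm ((f x - G k x)\<^sup>2)) \<partial>M) < \<infinity>" .
    qed simp
  qed simp
  have "sqi M f" using sqi_add[OF s[of 0] G[of 0]] by simp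
  moreover have "nrm M (\<lambda>x. f x - G k x) \<le> (1 / 2) ^ k" for k
  proof (rule power2_le_imp_le)
    have "ennreal ((nrm M (\<lambda>x. f x - G k x))\<^sup>2) = (\<integral>\<^sup>+x. ennreal ((f x - G k x)\<^sup>2) \<partial>M)"
      unfolding nrm_power2 using s[of k] by (intro nn_integral_eq_integral[symmetric]) (auto simp: sqi_def)
    then have "ennreal ((nrm M (\<lambda>x. f x - G k x))\<^sup>2) \<le> ennreal (((1 / 2) ^ k)\<^sup>2)"
      using fin[of k] by (simp only:)
    then show "(nrm M (\<lambda>x. f x - G k x))\<^sup>2 \<le> ((1 / 2) ^ k)\<^sup>2"
      by (rule ennreal_le_iff[THEN iffD1, rotated]) simp
  qed simp
  ultimately show ?thesis by blast
qed

lemma Cauchy_conv2: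
  assumes M: "finite_measure M" and F: "\<And>n. sqi M (F n)"
    and C: "\<And>e. e > 0 \<Longrightarrow> \<exists>N. \<forall>m\<ge>N. \<forall>n\<ge>N. nrm M (\<lambda>x. F m x - F n x) < e"
  shows "\<exists>f. conv2 M F f"
proof -
  have "\<exists>N. \<forall>m\<ge>N. \<forall>n\<ge>N. nrm M (\<lambda>x. F m x - F n x) < (1 / 2) ^ k" for k by (rule C) simp
  then obtain N where N: "\<And>k m n. m \<ge> N k \<Longrightarrow> n \<ge> N k \<Longrightarrow> nrm M (\<lambda>x. F m x - F n x) < (1 / 2) ^ k"
    by metis
  \<comment> \<open>A nondecreasing majorant of \<open>N\<close>, so that the terms with index
    \<open>r k\<close> form a sequence with geometrically small distances.\<close>
  define r where "r k = (\<Sum>i\<le>k. N i)" for k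
  have r: "r k \<le> r m" if "k \<le> m" for k m unfolding r_def using that by (intro sum_mono2) auto
  have rN: "N k \<le> r k" for k unfolding r_def by (rule member_le_sum) auto
  have "\<exists>f. sqi M f \<and> (\<forall>k. nrm M (\<lambda>x. f x - F (r k) x) \<le> (1 / 2) ^ k)"
    by (rule fast_Cauchy_conv2[OF M F])
       (use N rN r in \<open>meson le_trans less_imp_le\<close>)
  then obtain f where f: "sqi M f" "\<And>k. nrm M (\<lambda>x. f x - F (r k) x) \<le> (1 / 2) ^ k" by blast
  have "(\<lambda>n. nrm M (\<lambda>x. F n x - f x)) \<longlonglongrightarrow> 0"
  proof (rule LIMSEQ_I)
    fix e :: real assume e: "e > 0"
    obtain k where k: "(1 / 2) ^ k < e / 2" using real_arch_pow_inv[of "e / 2" "1 / 2"] e by auto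
    show "\<exists>n0. \<forall>n\<ge>n0. norm (nrm M (\<lambda>x. F n x - f x) - 0) < e"
    proof (intro exI[of _ "r k"] allI impI)
      fix n assume n: "n \<ge> r k"
      have "nrm M (\<lambda>x. F n x - f x) \<le> nrm M (\<lambda>x. F n x - F (r k) x) + nrm M (\<lambda>x. F (r k) x - f x)"
        by (rule nrm_dist_triangle[OF F F f(1)])
      also have "nrm M (\<lambda>x. F n x - F (r k) x) < e / 2"
        using N[of k n "r k"] rN[of k] n k by linarith
      also have "nrm M (\<lambda>x. F (r k) x - f x) < e / 2"
        using f(2)[of k] k by (simp add: nrm_minus_commute)
      finally show "norm (nrm M (\<lambda>x. F n x - f x) - 0) < e" by simp
    qed
  qed
  then show ?thesis using F f(1) by (auto simp: conv2_def)
qed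

section \<open>Test functions and integration by parts\<close>

lemma test_fun_smooth2: "test_fun \<Omega> \<phi> \<Longrightarrow> smooth2 \<phi>"
  by (simp add: test_fun_def)

lemma test_fun_support_mono:
  assumes \<phi>: "test_fun \<Omega> \<phi>" and \<eta>: "smooth2 \<eta>" "\<And>p. p \<notin> closure {p. \<phi> p \<noteq> 0} \<Longrightarrow> \<eta> p = 0"
  shows "test_fun \<Omega> \<eta>"
proof -
  have sub: "closure {p. \<eta> p \<noteq> 0} \<subseteq> closure {p. \<phi> p \<noteq> 0}"
    by (rule closure_minimal) (use \<eta>(2) in auto)
  have "compact (closure {p. \<phi> p \<noteq> 0} \<inter> closure {p. \<eta> p \<noteq> 0})"
    using \<phi> by (intro compact_Int_closed) (auto simp: test_fun_def)
  then have "compact (closure {p. \<eta> p \<noteq> 0})" using sub by (simp add: Int_absorb1)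
  moreover have "closure {p. \<eta> p \<noteq> 0} \<subseteq> \<Omega>" using sub \<phi> unfolding test_fun_def by blast
  ultimately show ?thesis using \<eta>(1) by (simp add: test_fun_def)
qed

lemma not_in_closure_nonzero: "p \<notin> closure {p. \<phi> p \<noteq> 0} \<Longrightarrow> \<phi> p = (0::real)"
  using subsetD[OF closure_subset, of p "{p. \<phi> p \<noteq> 0}"] by blast

lemma test_fun_mult:
  assumes "test_fun \<Omega> \<phi>" "smooth2 \<eta>"
  shows "test_fun \<Omega> (\<lambda>p. \<phi> p * \<eta> p)" "test_fun \<Omega> (\<lambda>p. \<eta> p * \<phi> p)"
proof -
  have s: "smooth2 \<phi>" using assms(1) by (rule test_fun_smooth2)
  show "test_fun \<Omega> (\<lambda>p. \<phi> p * \<eta> p)"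
    by (rule test_fun_support_mono[OF assms(1) smooth2_mult[OF s assms(2)]])
       (drule not_in_closure_nonzero, simp)
  show "test_fun \<Omega> (\<lambda>p. \<eta> p * \<phi> p)"
    by (rule test_fun_support_mono[OF assms(1) smooth2_mult[OF assms(2) s]])
       (drule not_in_closure_nonzero, simp)
qed

lemma test_fun_pd:
  assumes "test_fun \<Omega> \<phi>" shows "test_fun \<Omega> (pdx \<phi>)" "test_fun \<Omega> (pdy \<phi>)"
proof -
  have *: "pdx \<phi> p = 0 \<and> pdy \<phi> p = 0" if p: "p \<notin> closure {p. \<phi> p \<noteq> 0}" for p
  proof -
    obtain x y where xy: "p = (x, y)" by (cases p)
    let ?U = "- closure {p. \<phi> p \<noteq> 0}"
    have U: "open ?U" "p \<in> ?U" using p by auto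
    obtain A B where AB: "open A" "open B" "x \<in> A" "y \<in> B" "A \<times> B \<subseteq> ?U"
      using open_prod_elim[OF U] unfolding xy by (metis mem_Sigma_iff)
    have z: "\<phi> q = 0" if "q \<in> A \<times> B" for q using subsetD[OF AB(5) that] by (intro not_in_closure_nonzero[of q \<phi>]) blast
    have "((\<lambda>t. \<phi> (t, y)) has_real_derivative 0) (at x)"
      by (rule has_field_derivative_transform_within_open[where f = "\<lambda>_. 0" and S = A]) (use AB z in auto)
    moreover have "((\<lambda>t. \<phi> (x, t)) has_real_derivative 0) (at y)"
      by (rule has_field_derivative_transform_within_open[where f = "\<lambda>_. 0" and S = B]) (use AB z in auto)
    ultimately show ?thesis unfolding pdx_def pdy_def xy fst_conv snd_conv
      by (intro conjI DERIV_imp_deriv)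
  qed
  show "test_fun \<Omega> (pdx \<phi>)" "test_fun \<Omega> (pdy \<phi>)"
    by (rule test_fun_support_mono[OF assms] smooth2_pdx smooth2_pdy test_fun_smooth2[OF assms]
        *[THEN conjunct1] *[THEN conjunct2] | assumption)+
qed

lemma test_fun_cpd: assumes "test_fun \<Omega> \<phi>" shows "test_fun \<Omega> (cpd i j \<phi>)"
proof -
  have "test_fun \<Omega> ((pdy ^^ j) \<phi>)" by (induction j) (auto simp: assms test_fun_pd)
  then show ?thesis unfolding cpd_def by (induction i) (auto simp: test_fun_pd)
qed

lemma test_fun_lincomb:
  assumes "test_fun \<Omega> \<phi>" "test_fun \<Omega> \<eta>" shows "test_fun \<Omega> (\<lambda>p. a * \<phi> p + b * \<eta> p)"
proof -
  let ?S = "closure {p. \<phi> p \<noteq> 0} \<union> closure {p. \<eta> p \<noteq> 0}"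
  have sub: "closure {p. a * \<phi> p + b * \<eta> p \<noteq> 0} \<subseteq> ?S"
  proof (rule closure_minimal)
    show "{p. a * \<phi> p + b * \<eta> p \<noteq> 0} \<subseteq> ?S"
    proof
      fix p assume p: "p \<in> {p. a * \<phi> p + b * \<eta> p \<noteq> 0}"
      show "p \<in> ?S"
      proof (rule ccontr)
        assume "p \<notin> ?S"
        then have "p \<notin> closure {p. \<phi> p \<noteq> 0}" "p \<notin> closure {p. \<eta> p \<noteq> 0}" by blast+
        then have "\<phi> p = 0" "\<eta> p = 0" by (blast dest: not_in_closure_nonzero)+
        then show False using p by simp
      qed
    qed
  qed (intro closed_Un closed_closure)
  have "compact (?S \<inter> closure {p. a * \<phi> p + b * \<eta> p \<noteq> 0})"
    using assms by (intro compact_Int_closed) (auto simp: test_fun_def)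
  then have "compact (closure {p. a * \<phi> p + b * \<eta> p \<noteq> 0})" using sub by (simp add: Int_absorb1)
  moreover have "closure {p. a * \<phi> p + b * \<eta> p \<noteq> 0} \<subseteq> \<Omega>"
    using sub assms unfolding test_fun_def by blast
  moreover have "smooth2 (\<lambda>p. a * \<phi> p + b * \<eta> p)"
    using assms by (intro smooth2_add smooth2_cmult test_fun_smooth2)
  ultimately show ?thesis by (simp add: test_fun_def)
qed

lemma test_fun_add: "test_fun \<Omega> \<phi> \<Longrightarrow> test_fun \<Omega> \<eta> \<Longrightarrow> test_fun \<Omega> (\<lambda>p. \<phi> p + \<eta> p)"
  using test_fun_lincomb[of \<Omega> \<phi> \<eta> 1 1] by simp

lemma test_fun_zero: "test_fun \<Omega> (\<lambda>p. 0)"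
  by (simp add: test_fun_def smooth2_const)

lemma test_fun_mono: "test_fun \<Omega> \<phi> \<Longrightarrow> \<Omega> \<subseteq> \<Omega>' \<Longrightarrow> test_fun \<Omega>' \<phi>"
  by (auto simp: test_fun_def)

lemma test_fun_zero_outside: "test_fun \<Omega> \<phi> \<Longrightarrow> p \<notin> \<Omega> \<Longrightarrow> \<phi> p = 0"
  using not_in_closure_nonzero[of p \<phi>] unfolding test_fun_def by blast

lemma test_fun_integrable:
  assumes "test_fun \<Omega> \<phi>" shows "integrable lborel \<phi>"
proof -
  let ?S = "closure {p. \<phi> p \<noteq> 0}"
  have "integrable lborel (\<lambda>p. indicator ?S p *\<^sub>R \<phi> p)"
    using assms smooth2_cont[of \<phi>]
    by (intro borel_integrable_compact) (auto simp: test_fun_def intro: continuous_on_subset)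
  moreover have "(\<lambda>p. indicator ?S p *\<^sub>R \<phi> p) = \<phi>"
  proof
    fix p show "indicator ?S p *\<^sub>R \<phi> p = \<phi> p"
      by (cases "p \<in> ?S") (simp, drule not_in_closure_nonzero, simp)
  qed
  ultimately show ?thesis by simp
qed

section \<open>Derivatives of test functions integrate to zero\<close>

lemma integral_deriv_compact_support:
  fixes f :: "real \<Rightarrow> real"
  assumes d: "\<And>t. (f has_real_derivative f' t) (at t)" and c: "continuous_on UNIV f'"
    and z: "\<And>t. \<bar>t\<bar> \<ge> R \<Longrightarrow> f t = 0" "\<And>t. \<bar>t\<bar> \<ge> R \<Longrightarrow> f' t = 0" and R: "R > 0"
  shows "(\<integral>t. f' t \<partial>lborel) = 0"
proof -
  have "(\<integral>t. f' t * indicator {-R..R} t \<partial>lborel) = f R - f (-R)"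
  proof (rule integral_FTC_Icc_real)
    show "isCont f' x" for x using c by (simp add: continuous_on_eq_continuous_at)
  qed (use d R in auto)
  moreover have "f' t * indicator {-R..R} t = f' t" for t
    using z(2)[of t] by (cases "R \<le> \<bar>t\<bar>") (auto simp: indicator_def)
  ultimately show ?thesis using z(1)[of R] z(1)[of "-R"] R by simp
qed

text \<open>Fubini's theorem with the variable of differentiation integrated first. The radius
  \<open>R\<close> exceeds the bound \<open>R0\<close> of the support strictly, so that
  \<open>\<phi>\<close> and its partials already vanish where a coordinate has modulus exactly
  \<open>R\<close>.\<close>

lemma integral_pd_test_fun:
  assumes "test_fun \<Omega> \<phi>"
  shows "(\<integral>p. pdx \<phi> p \<partial>lborel) = 0" "(\<integral>p. pdy \<phi> p \<partial>lborel) = 0"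
proof -
  have "bounded (closure {p. \<phi> p \<noteq> 0})" using assms by (simp add: test_fun_def compact_imp_bounded)
  then obtain R0 where R0: "\<And>p. p \<in> closure {p. \<phi> p \<noteq> 0} \<Longrightarrow> norm p \<le> R0" by (auto simp: bounded_iff)
  define R where "R = \<bar>R0\<bar> + 1"
  have R: "R > 0" by (simp add: R_def)
  have t: "test_fun {p. norm p \<le> R0} \<phi>" using assms R0 by (auto simp: test_fun_def)
  have big: "norm (x, y) > R0" if "\<bar>x\<bar> \<ge> R \<or> \<bar>y\<bar> \<ge> R" for x y :: real
    using that norm_fst_le[of x y] norm_snd_le[of y x] by (auto simp: R_def)
  have z: "\<phi> (x, y) = 0" "pdx \<phi> (x, y) = 0" "pdy \<phi> (x, y) = 0" if "\<bar>x\<bar> \<ge> R \<or> \<bar>y\<bar> \<ge> R" for x y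
    using test_fun_zero_outside[OF t, of "(x, y)"] test_fun_zero_outside[OF test_fun_pd(1)[OF t], of "(x, y)"]
      test_fun_zero_outside[OF test_fun_pd(2)[OF t], of "(x, y)"] big[OF that] by auto
  have p: "has_partials \<phi> (pdx \<phi>) (pdy \<phi>)" using assms by (intro smooth2_has_partials test_fun_smooth2)
  have c: "continuous_on UNIV (pdx \<phi>)" "continuous_on UNIV (pdy \<phi>)"
    using assms by (intro smooth2_cont smooth2_pdx smooth2_pdy test_fun_smooth2; simp)+
  have i: "integrable (lborel \<Otimes>\<^sub>M lborel) (\<lambda>(x, y). pdx \<phi> (x, y))" "integrable (lborel \<Otimes>\<^sub>M lborel) (\<lambda>(x, y). pdy \<phi> (x, y))"
    using test_fun_integrable[OF test_fun_pd(1)[OF assms]] test_fun_integrable[OF test_fun_pd(2)[OF assms]]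
    by (simp_all add: lborel_prod)
  have "(\<integral>x. pdx \<phi> (x, y) \<partial>lborel) = 0" for y
  proof (rule integral_deriv_compact_support[where f = "\<lambda>x. \<phi> (x, y)" and R = R])
    show "((\<lambda>x. \<phi> (x, y)) has_real_derivative pdx \<phi> (t, y)) (at t)" for t
      using p by (simp add: has_partials_def)
    show "continuous_on UNIV (\<lambda>x. pdx \<phi> (x, y))"
      by (rule continuous_on_compose2[OF c(1)]) (auto intro!: continuous_intros)
  qed (simp_all add: z R)
  then show "(\<integral>p. pdx \<phi> p \<partial>lborel) = 0"
    using lborel_pair.integral_snd[OF i(1)] by (simp add: lborel_prod)
  have "(\<integral>y. pdy \<phi> (x, y) \<partial>lborel) = 0" for x
  proof (rule integral_deriv_compact_support[where f = "\<lambda>y. \<phi> (x, y)" and R = R])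
    show "((\<lambda>y. \<phi> (x, y)) has_real_derivative pdy \<phi> (x, t)) (at t)" for t
      using p by (simp add: has_partials_def)
    show "continuous_on UNIV (\<lambda>y. pdy \<phi> (x, y))"
      by (rule continuous_on_compose2[OF c(2)]) (auto intro!: continuous_intros)
  qed (simp_all add: z R)
  then show "(\<integral>p. pdy \<phi> p \<partial>lborel) = 0"
    using lborel_pair.integral_fst[OF i(2)] by (simp add: lborel_prod)
qed

text \<open>Each factor is a flat function of the signed distance to one side of the box. The index
  \<open>n\<close> only sharpens the edge: \<open>exp (-1 / (n d))\<close> tends to 1 for
  \<open>d > 0\<close>, so the bumps tend to the indicator of the open box while their supports stay
  in the closed box.\<close>

definition bump :: "pt \<Rightarrow> pt \<Rightarrow> nat \<Rightarrow> pt \<Rightarrow> real" where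
  "bump a b n p = expdec 0 (real n * (fst p - fst a)) * expdec 0 (real n * (fst b - fst p))
     * (expdec 0 (real n * (snd p - snd a)) * expdec 0 (real n * (snd b - snd p)))"

lemma mem_box_pt: "p \<in> box a b \<longleftrightarrow> fst a < fst p \<and> fst p < fst b \<and> snd a < snd p \<and> snd p < snd b"
  and mem_cbox_pt: "p \<in> cbox a b \<longleftrightarrow> fst a \<le> fst p \<and> fst p \<le> fst b \<and> snd a \<le> snd p \<and> snd p \<le> snd b"
  for a b p :: pt
  by (auto simp: mem_box Basis_prod_def ball_Un inner_prod_def)

lemma expdec_range: "0 \<le> expdec 0 x" "expdec 0 x \<le> 1"
  by (auto simp: expdec_def)

lemma bump_range: "0 \<le> bump a b n p" "bump a b n p \<le> 1"
  unfolding bump_def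
  by (intro mult_nonneg_nonneg expdec_range mult_le_one)+

lemma bump_outside: "p \<notin> box a b \<Longrightarrow> bump a b n p = 0"
  by (auto simp: mem_box_pt bump_def expdec_def not_less mult_nonneg_nonpos)

lemma bump_le_indicator: "\<bar>bump a b n p\<bar> \<le> indicator (box a b) p"
  using bump_range[of a b n p] bump_outside[of p a b n] by (auto simp: indicator_def)

lemma smooth2_bump: "smooth2 (bump a b n)"
proof -
  have "smooth2 (\<lambda>p::pt. expdec 0 (real n * (fst p - c)))" "smooth2 (\<lambda>p::pt. expdec 0 (real n * (c - fst p)))"
    "smooth2 (\<lambda>p::pt. expdec 0 (real n * (snd p - c)))" "smooth2 (\<lambda>p::pt. expdec 0 (real n * (c - snd p)))" for c
    using smooth2_affine[OF smooth2_expdec_fst[of 0], of "(- real n * c, 0)" "real n"]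
      smooth2_affine[OF smooth2_expdec_fst[of 0], of "(real n * c, 0)" "- real n"]
      smooth2_affine[OF smooth2_expdec_snd[of 0], of "(0, - real n * c)" "real n"]
      smooth2_affine[OF smooth2_expdec_snd[of 0], of "(0, real n * c)" "- real n"]
    by (simp_all add: algebra_simps)
  then show ?thesis unfolding bump_def by (intro smooth2_mult)
qed

lemma test_fun_bump: assumes "cbox a b \<subseteq> \<Omega>" shows "test_fun \<Omega> (bump a b n)"
proof -
  have sub: "closure {p. bump a b n p \<noteq> 0} \<subseteq> cbox a b"
    by (rule closure_minimal) (use bump_outside[of _ a b n] box_subset_cbox[of a b] in auto)
  have "compact (cbox a b \<inter> closure {p. bump a b n p \<noteq> 0})" by (intro compact_Int_closed) auto
  then have "compact (closure {p. bump a b n p \<noteq> 0})" using sub by (simp add: Int_absorb1)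
  then show ?thesis using sub assms smooth2_bump by (auto simp: test_fun_def)
qed

lemma bump_tendsto: "(\<lambda>n. bump a b n p) \<longlonglongrightarrow> indicator (box a b) p"
proof (cases "p \<in> box a b")
  case True
  have *: "(\<lambda>n. expdec 0 (real n * s)) \<longlonglongrightarrow> 1" if s: "s > 0" for s
  proof -
    have "(\<lambda>n. exp (- (1 / s) * (1 / real n))) \<longlonglongrightarrow> exp (- (1 / s) * 0)"
      by (intro tendsto_intros lim_1_over_n)
    then have l: "(\<lambda>n. exp (- (1 / s) * (1 / real n))) \<longlonglongrightarrow> 1" by simp
    show ?thesis
    proof (rule Lim_transform_eventually[OF l])
      show "\<forall>\<^sub>F n in sequentially. exp (- (1 / s) * (1 / real n)) = expdec 0 (real n * s)"
        using eventually_gt_at_top[of 0]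
        by eventually_elim (use s in \<open>auto simp: expdec_def mult_le_0_iff field_simps\<close>)
    qed
  qed
  have "(\<lambda>n. bump a b n p) \<longlonglongrightarrow> 1 * 1 * (1 * 1)"
    unfolding bump_def by (intro tendsto_mult *) (use True in \<open>auto simp: mem_box_pt\<close>)
  then show ?thesis using True by simp
qed (simp add: bump_outside)

text \<open>Turns the set integrals of the statement into plain integrals over a finite measure, to
  which the theory of \<open>sqi\<close> applies directly.\<close>

definition msr :: "pt set \<Rightarrow> pt measure" where "msr \<Omega> = restrict_space lborel \<Omega>"

locale bounded_open =
  fixes \<Omega> :: "pt set"
  assumes open_dom: "open \<Omega>" and bounded_dom: "bounded \<Omega>"
begin

abbreviation "M \<equiv> msr \<Omega>"

lemma dom_sets [measurable]: "\<Omega> \<in> sets borel" using open_dom by simp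

lemma emeasure_dom_finite: "emeasure lborel \<Omega> < \<infinity>"
proof -
  obtain a b where "\<Omega> \<subseteq> cbox a b" using bounded_dom bounded_subset_cbox_symmetric by blast
  then have "emeasure lborel \<Omega> \<le> emeasure lborel (cbox a b)" by (intro emeasure_mono) auto
  also have "\<dots> < \<infinity>" by (simp add: emeasure_lborel_cbox_eq)
  finally show ?thesis .
qed

lemma finite_msr: "finite_measure M"
  by (rule finite_measureI)
     (use emeasure_dom_finite in \<open>simp add: msr_def space_restrict_space emeasure_restrict_space\<close>)

lemma space_msr: "space M = \<Omega>" by (simp add: msr_def space_restrict_space)

lemma set_integral_msr: "(LINT p:\<Omega>|lborel. f p) = (\<integral>p. f p \<partial>M)" for f :: "pt \<Rightarrow> real"
  by (simp add: set_lebesgue_integral_def msr_def integral_restrict_space)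

lemma measurable_msr_iff: "f \<in> borel_measurable M \<longleftrightarrow> set_borel_measurable lborel \<Omega> f" for f :: "pt \<Rightarrow> real"
  by (simp add: set_borel_measurable_def msr_def borel_measurable_restrict_space_iff)

lemma integrable_msr_iff: "integrable M f \<longleftrightarrow> integrable lborel (\<lambda>p. indicator \<Omega> p *\<^sub>R f p)" for f :: "pt \<Rightarrow> real"
  by (simp add: msr_def integrable_restrict_space)

lemma L2_iff_sqi: "L2 \<Omega> f \<longleftrightarrow> sqi M f"
  by (simp add: L2_def sqi_def measurable_msr_iff integrable_msr_iff set_integrable_def)

lemma norm0_eq_nrm: "norm0 \<Omega> f = nrm M f"
  by (simp add: norm0_def nrm_def set_integral_msr)

lemma weak_deriv_iff: "weak_deriv \<Omega> i j f g \<longleftrightarrow> (\<forall>\<phi>. test_fun \<Omega> \<phi> \<longrightarrow>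
      (\<integral>p. f p * cpd i j \<phi> p \<partial>M) = (-1) ^ (i + j) * (\<integral>p. g p * \<phi> p \<partial>M))"
  by (simp add: weak_deriv_def set_integral_msr)

lemma AE_msr_iff: "(AE p in M. P p) \<longleftrightarrow> (AE p in lborel. p \<in> \<Omega> \<longrightarrow> P p)"
  unfolding msr_def by (rule AE_restrict_space_iff) simp

lemma cont_measurable_msr: "continuous_on UNIV f \<Longrightarrow> f \<in> borel_measurable M" for f :: "pt \<Rightarrow> real"
  unfolding msr_def by (intro measurable_restrict_space1) (simp add: borel_measurable_continuous_onI)

lemma cont_bounded_msr:
  fixes f :: "pt \<Rightarrow> real"
  assumes "continuous_on UNIV f" shows "\<exists>C. \<forall>p\<in>\<Omega>. \<bar>f p\<bar> \<le> C"
proof -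
  have "compact (closure \<Omega>)" using bounded_dom by simp
  then have "compact (f ` closure \<Omega>)"
    by (rule compact_continuous_image[OF continuous_on_subset[OF assms subset_UNIV]])
  then obtain C where "\<forall>y\<in>f ` closure \<Omega>. norm y \<le> C" using compact_imp_bounded bounded_iff by blast
  then show ?thesis using closure_subset by (intro exI[of _ C]) auto
qed

lemma AE_msrI: "(\<And>p. p \<in> \<Omega> \<Longrightarrow> P p) \<Longrightarrow> AE p in M. P p"
  using space_msr by (intro AE_I2) simp

lemma smooth2_measurable: "smooth2 f \<Longrightarrow> f \<in> borel_measurable M"
  by (intro cont_measurable_msr smooth2_cont)

lemma smooth2_bounded: "smooth2 f \<Longrightarrow> \<exists>C. AE p in M. \<bar>f p\<bar> \<le> C"
  using cont_bounded_msr[OF smooth2_cont] AE_msrI by metis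

lemma smooth2_sqi: "smooth2 f \<Longrightarrow> sqi M f"
  using sqi_bounded[OF finite_msr smooth2_measurable] smooth2_bounded by blast

lemma test_fun_sqi: "test_fun \<Omega> \<phi> \<Longrightarrow> sqi M \<phi>"
  by (intro smooth2_sqi test_fun_smooth2)

lemma test_fun_integral_msr:
  assumes "test_fun \<Omega> \<phi>" shows "(\<integral>p. \<phi> p \<partial>M) = (\<integral>p. \<phi> p \<partial>lborel)"
proof -
  have "indicator \<Omega> p *\<^sub>R \<phi> p = \<phi> p" for p
    using test_fun_zero_outside[OF assms, of p] by (cases "p \<in> \<Omega>") auto
  then have e: "(\<lambda>p. indicator \<Omega> p *\<^sub>R \<phi> p) = \<phi>" by (rule ext)
  show ?thesis unfolding msr_def by (subst integral_restrict_space) (simp_all only: e, simp)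
qed

lemma integral_pd_test_fun_msr:
  assumes "test_fun \<Omega> \<phi>"
  shows "(\<integral>p. pdx \<phi> p \<partial>M) = 0" "(\<integral>p. pdy \<phi> p \<partial>M) = 0"
  using assms by (simp_all add: test_fun_integral_msr[OF test_fun_pd(1)] test_fun_integral_msr[OF test_fun_pd(2)]
      integral_pd_test_fun)

lemma integral_by_parts:
  assumes f: "smooth2 f" and \<phi>: "test_fun \<Omega> \<phi>"
  shows "(\<integral>p. f p * pdx \<phi> p \<partial>M) = - (\<integral>p. pdx f p * \<phi> p \<partial>M)"
    "(\<integral>p. f p * pdy \<phi> p \<partial>M) = - (\<integral>p. pdy f p * \<phi> p \<partial>M)"
proof -
  have s: "smooth2 \<phi>" using \<phi> by (rule test_fun_smooth2)
  have t: "test_fun \<Omega> (\<lambda>p. f p * \<phi> p)" using \<phi> f by (rule test_fun_mult)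
  have i: "integrable M (\<lambda>p. pdx f p * \<phi> p)" "integrable M (\<lambda>p. f p * pdx \<phi> p)"
    "integrable M (\<lambda>p. pdy f p * \<phi> p)" "integrable M (\<lambda>p. f p * pdy \<phi> p)"
    using f s by (auto intro!: sqi_integrable_mult smooth2_sqi smooth2_pdx smooth2_pdy)
  show "(\<integral>p. f p * pdx \<phi> p \<partial>M) = - (\<integral>p. pdx f p * \<phi> p \<partial>M)"
    using integral_pd_test_fun_msr(1)[OF t] i by (simp add: pd_mult f s)
  show "(\<integral>p. f p * pdy \<phi> p \<partial>M) = - (\<integral>p. pdy f p * \<phi> p \<partial>M)"
    using integral_pd_test_fun_msr(2)[OF t] i by (simp add: pd_mult f s)
qed

lemma weak_deriv_smooth2:
  assumes "smooth2 f" shows "weak_deriv \<Omega> i j f (cpd i j f)"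
proof -
  have y: "(\<integral>p. f p * cpd 0 j \<phi> p \<partial>M) = (-1) ^ j * (\<integral>p. cpd 0 j f p * \<phi> p \<partial>M)"
    if "smooth2 f" "test_fun \<Omega> \<phi>" for f \<phi>
    using that(1)
  proof (induction j arbitrary: f)
    case (Suc j)
    have "(\<integral>p. f p * cpd 0 (Suc j) \<phi> p \<partial>M) = (\<integral>p. f p * pdy (cpd 0 j \<phi>) p \<partial>M)"
      by (simp add: cpd_def)
    also have "\<dots> = - (\<integral>p. pdy f p * cpd 0 j \<phi> p \<partial>M)"
      using Suc that by (intro integral_by_parts test_fun_cpd)
    also have "\<dots> = - ((-1) ^ j * (\<integral>p. cpd 0 j (pdy f) p * \<phi> p \<partial>M))"
      using Suc by (simp add: smooth2_pdy)
    finally show ?case by (simp add: cpd_pdy)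
  qed simp
  have "(\<integral>p. f p * cpd i j \<phi> p \<partial>M) = (-1) ^ (i + j) * (\<integral>p. cpd i j f p * \<phi> p \<partial>M)"
    if \<phi>: "test_fun \<Omega> \<phi>" for \<phi>
    using assms
  proof (induction i arbitrary: f)
    case 0 then show ?case using y[OF _ \<phi>] by simp
  next
    case (Suc i)
    have "(\<integral>p. f p * cpd (Suc i) j \<phi> p \<partial>M) = (\<integral>p. f p * pdx (cpd i j \<phi>) p \<partial>M)"
      by (simp add: pdx_cpd)
    also have "\<dots> = - (\<integral>p. pdx f p * cpd i j \<phi> p \<partial>M)"
      using Suc \<phi> by (intro integral_by_parts test_fun_cpd)
    also have "\<dots> = - ((-1) ^ (i + j) * (\<integral>p. cpd i j (pdx f) p * \<phi> p \<partial>M))"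
      using Suc by (simp add: smooth2_pdx)
    finally show ?case using Suc.prems by (simp add: cpd_pdx)
  qed
  then show ?thesis by (simp add: weak_deriv_iff)
qed

section \<open>From integrals over small cubes to almost everywhere statements\<close>

lemma bump_integral_tendsto:
  assumes g: "integrable M g"
  shows "(\<lambda>n. \<integral>p. g p * bump a b n p \<partial>M) \<longlonglongrightarrow> (\<integral>p. g p * indicator (box a b) p \<partial>M)"
proof (rule integral_dominated_convergence[where w = "\<lambda>p. \<bar>g p\<bar>"])
  show "integrable M (\<lambda>p. \<bar>g p\<bar>)" using g by simp
  have m [measurable]: "g \<in> borel_measurable M" using g by simp
  show "(\<lambda>p. g p * bump a b n p) \<in> borel_measurable M" for n
    using smooth2_measurable[OF smooth2_bump, of a b n] by measurable
  have "box a b \<inter> \<Omega> \<in> sets borel" by simp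
  then have "indicator (box a b) \<in> borel_measurable M"
    unfolding msr_def by (intro measurable_restrict_space1) simp
  then show "(\<lambda>p. g p * indicator (box a b) p) \<in> borel_measurable M" by measurable
  show "AE p in M. norm (g p * bump a b n p) \<le> \<bar>g p\<bar>" for n
    using bump_range[of a b n] by (auto simp: abs_mult intro!: AE_I2 mult_left_le)
  show "AE p in M. (\<lambda>n. g p * bump a b n p) \<longlonglongrightarrow> g p * indicator (box a b) p"
    by (intro AE_I2 tendsto_intros bump_tendsto)
qed

text \<open>Lebesgue's differentiation theorem for cubes that have \<open>x\<close> as their lower
  corner. The range of admissible \<open>h\<close> may depend on \<open>x\<close>, only the constant
  \<open>C\<close> has to be uniform. It is used with \<open>C = 0\<close> for the fundamental lemma
  and with a positive \<open>C\<close> for Sobolev's inequality.\<close>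

lemma cube_averages_bound:
  assumes g: "integrable M g"
    and b: "\<And>x. x \<in> \<Omega> \<Longrightarrow> \<exists>d>0. \<forall>h. 0 < h \<and> h < d \<longrightarrow>
              \<bar>\<integral>p. g p * indicator (box x (x + h *\<^sub>R One)) p \<partial>M\<bar> \<le> C * h\<^sup>2"
  shows "AE p in M. \<bar>g p\<bar> \<le> C"
proof -
  let ?f = "\<lambda>p. indicator \<Omega> p *\<^sub>R g p"
  have f: "integrable lborel ?f" using g by (simp add: integrable_msr_iff)
  have "?f integrable_on cbox a b" for a b
    using integrable_on_lborel[OF f] by (rule integrable_on_subcbox) simp
  then obtain N where N: "negligible N" "\<And>x e. x \<notin> N \<Longrightarrow> 0 < e \<Longrightarrow>
      \<exists>d>0. \<forall>h. 0 < h \<and> h < d \<longrightarrow> norm (integral (cbox x (x + h *\<^sub>R One)) ?f /\<^sub>R h ^ DIM(pt) - ?f x) < e"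
    using integrable_ccontinuous_explicit[of ?f] by blast
  have box_eq: "integral (cbox x y) ?f = (\<integral>p. g p * indicator (box x y) p \<partial>M)" for x y
  proof -
    have s: "set_integrable lborel (box x y) ?f"
      unfolding set_integrable_def by (rule integrable_mult_indicator[OF _ f]) simp
    have "integral (cbox x y) ?f = integral (box x y) ?f" by (simp add: integral_open_interval)
    also have "\<dots> = (LINT p:box x y|lborel. ?f p)" using set_borel_integral_eq_integral(2)[OF s] by simp
    also have "\<dots> = (\<integral>p. g p * indicator (box x y) p \<partial>M)"
      by (simp add: set_lebesgue_integral_def msr_def integral_restrict_space mult_ac)
    finally show ?thesis .
  qed
  have "\<bar>g x\<bar> \<le> C" if x: "x \<in> \<Omega>" "x \<notin> N" for x
  proof (rule field_le_epsilon)
    fix e :: real assume e: "e > 0"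
    obtain d1 where d1: "d1 > 0" "\<And>h. 0 < h \<Longrightarrow> h < d1 \<Longrightarrow>
       norm (integral (cbox x (x + h *\<^sub>R One)) ?f /\<^sub>R h ^ DIM(pt) - ?f x) < e" using N(2)[OF x(2) e] by blast
    obtain d2 where d2: "d2 > 0" "\<And>h. 0 < h \<Longrightarrow> h < d2 \<Longrightarrow>
       \<bar>\<integral>p. g p * indicator (box x (x + h *\<^sub>R One)) p \<partial>M\<bar> \<le> C * h\<^sup>2" using b[OF x(1)] by blast
    define h where "h = min d1 d2 / 2"
    have h: "0 < h" "h < d1" "h < d2" using d1 d2 by (auto simp: h_def)
    let ?I = "\<integral>p. g p * indicator (box x (x + h *\<^sub>R One)) p \<partial>M"
    have "\<bar>?I / h\<^sup>2 - g x\<bar> < e" using d1(2)[OF h(1,2)] x(1) unfolding box_eq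
      by (simp add: divide_inverse mult.commute power2_eq_square)
    moreover have "\<bar>?I / h\<^sup>2\<bar> \<le> C" using d2(2)[OF h(1,3)] h(1) by (simp add: abs_divide divide_le_eq)
    ultimately show "\<bar>g x\<bar> \<le> C + e" by linarith
  qed
  moreover have "AE x in lborel. x \<notin> N"
  proof -
    have "N \<in> null_sets lebesgue" using N(1) by (simp add: negligible_iff_null_sets)
    then have "AE x in lebesgue. x \<notin> N" by (rule AE_not_in)
    then show ?thesis by (simp add: AE_completion_iff)
  qed
  ultimately show ?thesis unfolding AE_msr_iff by (elim eventually_mono) simp
qed

lemma small_cubes_in_dom:
  assumes "x \<in> \<Omega>" shows "\<exists>d>0. \<forall>h. 0 < h \<and> h < d \<longrightarrow> cbox x (x + h *\<^sub>R One) \<subseteq> \<Omega>"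
proof -
  obtain e where e: "e > 0" "ball x e \<subseteq> \<Omega>" using open_dom assms open_contains_ball by blast
  have "cbox x (x + h *\<^sub>R One) \<subseteq> ball x e" if h: "0 < h" "h < e / 2" for h
  proof
    fix p assume p: "p \<in> cbox x (x + h *\<^sub>R One)"
    have One: "fst (One :: pt) = 1" "snd (One :: pt) = 1"
      by (simp_all add: Basis_prod_def sum.union_disjoint image_iff sum.reindex inj_on_def disjoint_iff)
    have "\<bar>fst x - fst p\<bar> \<le> h" "\<bar>snd x - snd p\<bar> \<le> h" using p by (auto simp: mem_cbox_pt One)
    then have "dist x p \<le> h + h"
      unfolding dist_prod_def dist_real_def
      using sqrt_sum_squares_le_sum_abs[of "fst x - fst p" "snd x - snd p"] by simp
    then show "p \<in> ball x e" using h by simp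
  qed
  then show ?thesis using e by (intro exI[of _ "e / 2"]) auto
qed

text \<open>The fundamental lemma of the calculus of variations: bumps turn orthogonality to test
  functions into vanishing integrals over all small boxes, and \<open>cube_averages_bound\<close>
  applies with \<open>C = 0\<close>.\<close>

lemma vanishing_weakly_imp_AE_zero:
  assumes g: "sqi M g" and z: "\<And>\<phi>. test_fun \<Omega> \<phi> \<Longrightarrow> (\<integral>p. g p * \<phi> p \<partial>M) = 0"
  shows "AE p in M. g p = 0"
proof -
  have "sqi M (\<lambda>x. 1)" by (intro smooth2_sqi smooth2_const)
  from sqi_integrable_mult[OF g this] have i: "integrable M g" by simp
  have "AE p in M. \<bar>g p\<bar> \<le> 0"
  proof (rule cube_averages_bound[OF i])
    fix x assume x: "x \<in> \<Omega>"
    obtain d where d: "d > 0" "\<And>h. 0 < h \<Longrightarrow> h < d \<Longrightarrow> cbox x (x + h *\<^sub>R One) \<subseteq> \<Omega>"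
      using small_cubes_in_dom[OF x] by blast
    have "(\<integral>p. g p * indicator (box x (x + h *\<^sub>R One)) p \<partial>M) = 0" if "0 < h" "h < d" for h
    proof (rule LIMSEQ_unique[OF bump_integral_tendsto[OF i]])
      show "(\<lambda>n. \<integral>p. g p * bump x (x + h *\<^sub>R One) n p \<partial>M) \<longlonglongrightarrow> 0"
        using z[OF test_fun_bump[OF d(2)[OF that]]] by simp
    qed
    then show "\<exists>d>0. \<forall>h. 0 < h \<and> h < d \<longrightarrow>
        \<bar>\<integral>p. g p * indicator (box x (x + h *\<^sub>R One)) p \<partial>M\<bar> \<le> 0 * h\<^sup>2"
      using d(1) by auto
  qed
  then show ?thesis by simp
qed

end

section \<open>Weak derivatives\<close>

lemma semi_eq_L2_set: "semi \<Omega> k f = L2_set (\<lambda>i. norm0 \<Omega> (wd \<Omega> i (k - i) f)) {..k}"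
  by (simp add: semi_def L2_set_def)

lemma normH_eq_L2_set: "normH \<Omega> k f = L2_set (\<lambda>m. semi \<Omega> m f) {..k}"
  by (simp add: normH_def L2_set_def)

lemma semi_nonneg [simp]: "0 \<le> semi \<Omega> k f" by (simp add: semi_eq_L2_set)
lemma normH_nonneg [simp]: "0 \<le> normH \<Omega> k f" by (simp add: normH_eq_L2_set)

lemma semi_le_normH: "m \<le> k \<Longrightarrow> semi \<Omega> m f \<le> normH \<Omega> k f"
  unfolding normH_eq_L2_set by (rule member_le_L2_set) auto

lemma norm0_wd_le_semi: "norm0 \<Omega> (wd \<Omega> i j f) \<le> semi \<Omega> (i + j) f"
  unfolding semi_eq_L2_set
  using member_le_L2_set[of "{..i + j}" i "\<lambda>i'. norm0 \<Omega> (wd \<Omega> i' (i + j - i') f)"] by simp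

lemma norm0_wd_le_normH: "i + j \<le> k \<Longrightarrow> norm0 \<Omega> (wd \<Omega> i j f) \<le> normH \<Omega> k f"
  using norm0_wd_le_semi semi_le_normH order_trans by blast

lemma semi_le_sum: "semi \<Omega> k f \<le> (\<Sum>i\<le>k. norm0 \<Omega> (wd \<Omega> i (k - i) f))"
  unfolding semi_eq_L2_set by (rule L2_set_le_sum) (simp add: norm0_def set_lebesgue_integral_def)

lemma normH_le_sum: "normH \<Omega> k f \<le> (\<Sum>m\<le>k. \<Sum>i\<le>m. norm0 \<Omega> (wd \<Omega> i (m - i) f))"
proof -
  have "normH \<Omega> k f \<le> (\<Sum>m\<le>k. semi \<Omega> m f)"
    unfolding normH_eq_L2_set by (rule L2_set_le_sum) simp
  also have "\<dots> \<le> (\<Sum>m\<le>k. \<Sum>i\<le>m. norm0 \<Omega> (wd \<Omega> i (m - i) f))"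
    by (intro sum_mono semi_le_sum)
  finally show ?thesis .
qed

lemma Hk_mono: "Hk \<Omega> k f \<Longrightarrow> l \<le> k \<Longrightarrow> Hk \<Omega> l f"
  by (auto simp: Hk_def)

context bounded_open
begin

text \<open>This gives the choice in \<open>wd\<close> a meaning: any square integrable candidate
  agrees with the chosen one almost everywhere.\<close>

lemma weak_deriv_unique:
  assumes g: "sqi M g" "weak_deriv \<Omega> i j f g" and h: "sqi M h" "weak_deriv \<Omega> i j f h"
  shows "AE p in M. g p = h p"
proof -
  have "AE p in M. g p - h p = 0"
  proof (rule vanishing_weakly_imp_AE_zero[OF sqi_diff[OF g(1) h(1)]])
    fix \<phi> assume \<phi>: "test_fun \<Omega> \<phi>"
    have "(-1) ^ (i + j) * (\<integral>p. g p * \<phi> p \<partial>M) = (-1) ^ (i + j) * (\<integral>p. h p * \<phi> p \<partial>M)"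
      using g(2) h(2) \<phi> unfolding weak_deriv_iff by metis
    then have "(\<integral>p. g p * \<phi> p \<partial>M) = (\<integral>p. h p * \<phi> p \<partial>M)" by simp
    then show "(\<integral>p. (g p - h p) * \<phi> p \<partial>M) = 0"
      using sqi_integrable_mult[OF g(1) test_fun_sqi[OF \<phi>]] sqi_integrable_mult[OF h(1) test_fun_sqi[OF \<phi>]]
      by (simp add: left_diff_distrib)
  qed
  then show ?thesis by simp
qed

lemma weak_deriv_00: "weak_deriv \<Omega> 0 0 f f" by (simp add: weak_deriv_def)

lemma HkI:
  assumes "sqi M f" "\<And>i j. i + j \<le> k \<Longrightarrow> \<exists>g. sqi M g \<and> weak_deriv \<Omega> i j f g"
  shows "Hk \<Omega> k f"
  using assms by (auto simp: Hk_def L2_iff_sqi)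

lemma Hk_sqi: "Hk \<Omega> k f \<Longrightarrow> sqi M f" by (simp add: Hk_def L2_iff_sqi)

lemma wd_00 [simp]: "wd \<Omega> 0 0 f = f" by (simp add: wd_def)

lemma wd_spec:
  assumes "Hk \<Omega> k f" "i + j \<le> k"
  shows "sqi M (wd \<Omega> i j f)" "weak_deriv \<Omega> i j f (wd \<Omega> i j f)"
proof -
  have "\<exists>g. L2 \<Omega> g \<and> weak_deriv \<Omega> i j f g" using assms by (auto simp: Hk_def)
  from someI_ex[OF this] have "L2 \<Omega> (wd \<Omega> i j f) \<and> weak_deriv \<Omega> i j f (wd \<Omega> i j f)"
    using assms(1) by (auto simp: wd_def weak_deriv_00 Hk_def)
  then show "sqi M (wd \<Omega> i j f)" "weak_deriv \<Omega> i j f (wd \<Omega> i j f)" by (simp_all add: L2_iff_sqi)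
qed

lemma wd_AE_eqI:
  assumes "Hk \<Omega> k f" "i + j \<le> k" "sqi M g" "weak_deriv \<Omega> i j f g"
  shows "AE p in M. wd \<Omega> i j f p = g p"
  using weak_deriv_unique wd_spec assms by blast

lemma weak_deriv_lincomb:
  assumes f: "sqi M f" "sqi M f'" "weak_deriv \<Omega> i j f f'"
    and g: "sqi M g" "sqi M g'" "weak_deriv \<Omega> i j g g'"
  shows "weak_deriv \<Omega> i j (\<lambda>p. a * f p + b * g p) (\<lambda>p. a * f' p + b * g' p)"
  unfolding weak_deriv_iff
proof (intro allI impI)
  fix \<phi> assume \<phi>: "test_fun \<Omega> \<phi>"
  have s: "sqi M \<phi>" "sqi M (cpd i j \<phi>)" using \<phi> by (auto intro: test_fun_sqi test_fun_cpd)
  note i = sqi_integrable_mult[OF f(1) s(2)] sqi_integrable_mult[OF g(1) s(2)]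
    sqi_integrable_mult[OF f(2) s(1)] sqi_integrable_mult[OF g(2) s(1)]
  show "(\<integral>p. (a * f p + b * g p) * cpd i j \<phi> p \<partial>M) = (-1) ^ (i + j) * (\<integral>p. (a * f' p + b * g' p) * \<phi> p \<partial>M)"
    using f(3) g(3) \<phi> i by (simp add: weak_deriv_iff distrib_right mult.assoc) (simp add: algebra_simps)
qed

lemma Hk_lincomb:
  assumes f: "Hk \<Omega> k f" and g: "Hk \<Omega> k g"
  shows "Hk \<Omega> k (\<lambda>p. a * f p + b * g p)"
    "i + j \<le> k \<Longrightarrow> AE p in M. wd \<Omega> i j (\<lambda>p. a * f p + b * g p) p = a * wd \<Omega> i j f p + b * wd \<Omega> i j g p"
proof -
  have w: "weak_deriv \<Omega> i j (\<lambda>p. a * f p + b * g p) (\<lambda>p. a * wd \<Omega> i j f p + b * wd \<Omega> i j g p)"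
    "sqi M (\<lambda>p. a * wd \<Omega> i j f p + b * wd \<Omega> i j g p)" if "i + j \<le> k" for i j
    by (rule weak_deriv_lincomb sqi_lincomb wd_spec[OF f that] wd_spec[OF g that] Hk_sqi[OF f] Hk_sqi[OF g])+
  show h: "Hk \<Omega> k (\<lambda>p. a * f p + b * g p)"
  proof (rule HkI)
    show "\<exists>g'. sqi M g' \<and> weak_deriv \<Omega> i j (\<lambda>p. a * f p + b * g p) g'" if "i + j \<le> k" for i j
      using w[OF that] by blast
  qed (intro sqi_lincomb Hk_sqi[OF f] Hk_sqi[OF g])
  show "AE p in M. wd \<Omega> i j (\<lambda>p. a * f p + b * g p) p = a * wd \<Omega> i j f p + b * wd \<Omega> i j g p"
    if "i + j \<le> k" using that h w by (intro wd_AE_eqI) auto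
qed

lemma Hk_diff:
  assumes "Hk \<Omega> k f" "Hk \<Omega> k g"
  shows "Hk \<Omega> k (\<lambda>p. f p - g p)"
    "i + j \<le> k \<Longrightarrow> AE p in M. wd \<Omega> i j (\<lambda>p. f p - g p) p = wd \<Omega> i j f p - wd \<Omega> i j g p"
  using Hk_lincomb[OF assms, where a = 1 and b = "-1"] by simp_all

lemma Hk_smooth2:
  assumes "smooth2 f"
  shows "Hk \<Omega> k f" "AE p in M. wd \<Omega> i j f p = cpd i j f p"
proof -
  have s: "sqi M (cpd i j f)" "weak_deriv \<Omega> i j f (cpd i j f)" for i j
    using assms by (auto intro: smooth2_sqi smooth2_cpd weak_deriv_smooth2)
  show h: "Hk \<Omega> k f" for k 
  proof (rule HkI)
    show "\<exists>g. sqi M g \<and> weak_deriv \<Omega> i j f g" for i j using s by blast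
  qed (use assms in \<open>rule smooth2_sqi\<close>)
  show "AE p in M. wd \<Omega> i j f p = cpd i j f p"
    using s h[of "i + j"] by (intro wd_AE_eqI) auto
qed

lemma Hk0_Hk: "Hk0 \<Omega> k f \<Longrightarrow> Hk \<Omega> k f" by (simp add: Hk0_def)

text \<open>Replaces convergence in the single norm \<open>normH\<close> by L2 convergence of each
  derivative, the form in which products can be passed to the limit.\<close>

lemma Hk0_approx:
  assumes "Hk0 \<Omega> k f"
  obtains \<phi> where "\<And>n. test_fun \<Omega> (\<phi> n)"
    "\<And>i j. i + j \<le> k \<Longrightarrow> conv2 M (\<lambda>n. cpd i j (\<phi> n)) (wd \<Omega> i j f)"
proof -
  obtain \<phi> where \<phi>: "\<And>n. test_fun \<Omega> (\<phi> n)" "(\<lambda>n. normH \<Omega> k (\<lambda>p. f p - \<phi> n p)) \<longlonglongrightarrow> 0"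
    using assms by (auto simp: Hk0_def)
  have f: "Hk \<Omega> k f" using assms by (rule Hk0_Hk)
  have s: "smooth2 (\<phi> n)" for n using \<phi>(1) by (rule test_fun_smooth2)
  have "conv2 M (\<lambda>n. cpd i j (\<phi> n)) (wd \<Omega> i j f)" if ij: "i + j \<le> k" for i j
  proof -
    have "(\<lambda>n. nrm M (\<lambda>p. cpd i j (\<phi> n) p - wd \<Omega> i j f p)) \<longlonglongrightarrow> 0"
    proof (rule Lim_null_comparison[OF eventuallyI \<phi>(2)])
      fix n
      have "AE p in M. wd \<Omega> i j (\<lambda>p. f p - \<phi> n p) p = wd \<Omega> i j f p - cpd i j (\<phi> n) p"
        using Hk_diff(2)[OF f Hk_smooth2(1)[OF s] ij, of n] Hk_smooth2(2)[OF s, of i j n] by eventually_elim simp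
      then have "nrm M (wd \<Omega> i j (\<lambda>p. f p - \<phi> n p)) = nrm M (\<lambda>p. wd \<Omega> i j f p - cpd i j (\<phi> n) p)"
        using wd_spec(1)[OF Hk_diff(1)[OF f Hk_smooth2(1)[OF s]] ij, of n]
          sqi_diff[OF wd_spec(1)[OF f ij] smooth2_sqi[OF smooth2_cpd[OF s]], of i j n]
        by (intro nrm_cong_AE) (auto simp: sqi_def)
      then show "norm (nrm M (\<lambda>p. cpd i j (\<phi> n) p - wd \<Omega> i j f p)) \<le> normH \<Omega> k (\<lambda>p. f p - \<phi> n p)"
        using norm0_wd_le_normH[OF ij, of \<Omega> "\<lambda>p. f p - \<phi> n p"]
        by (simp add: norm0_eq_nrm nrm_minus_commute[of M "cpd i j (\<phi> n)"])
    qed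
    then show ?thesis using s wd_spec(1)[OF f ij] by (auto simp: conv2_def intro!: smooth2_sqi smooth2_cpd)
  qed
  then show thesis using \<phi>(1) that by blast
qed

text \<open>Converse of \<open>Hk0_approx\<close>. The weak identities survive the L2 limit, so the
  joint limits \<open>G i j\<close> are forced to be the derivatives of
  \<open>G 0 0\<close>.\<close>

lemma Hk0_limitI:
  assumes \<phi>: "\<And>n. test_fun \<Omega> (\<phi> n)"
    and G: "\<And>i j. i + j \<le> k \<Longrightarrow> conv2 M (\<lambda>n. cpd i j (\<phi> n)) (G i j)"
  shows "Hk0 \<Omega> k (G 0 0)" "i + j \<le> k \<Longrightarrow> AE p in M. wd \<Omega> i j (G 0 0) p = G i j p"
proof -
  have s: "smooth2 (\<phi> n)" for n using \<phi> by (rule test_fun_smooth2)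
  have G0: "conv2 M \<phi> (G 0 0)" using G[of 0 0] by simp
  have w: "weak_deriv \<Omega> i j (G 0 0) (G i j)" if ij: "i + j \<le> k" for i j
    unfolding weak_deriv_iff
  proof (intro allI impI)
    fix \<eta> assume \<eta>: "test_fun \<Omega> \<eta>"
    have A: "(\<lambda>n. \<integral>p. \<phi> n p * cpd i j \<eta> p \<partial>M) \<longlonglongrightarrow> (\<integral>p. G 0 0 p * cpd i j \<eta> p \<partial>M)"
      by (intro conv2_integral_mult G0 conv2_const test_fun_sqi test_fun_cpd \<eta>)
    have B: "(\<lambda>n. (-1) ^ (i + j) * (\<integral>p. cpd i j (\<phi> n) p * \<eta> p \<partial>M))
        \<longlonglongrightarrow> (-1) ^ (i + j) * (\<integral>p. G i j p * \<eta> p \<partial>M)"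
      by (intro tendsto_mult tendsto_const conv2_integral_mult G ij conv2_const test_fun_sqi \<eta>)
    have E: "(\<integral>p. \<phi> n p * cpd i j \<eta> p \<partial>M) = (-1) ^ (i + j) * (\<integral>p. cpd i j (\<phi> n) p * \<eta> p \<partial>M)" for n
      using weak_deriv_smooth2[OF s] \<eta> by (simp add: weak_deriv_iff)
    show "(\<integral>p. G 0 0 p * cpd i j \<eta> p \<partial>M) = (-1) ^ (i + j) * (\<integral>p. G i j p * \<eta> p \<partial>M)"
      by (rule LIMSEQ_unique[OF A B[folded E]])
  qed
  have h: "Hk \<Omega> k (G 0 0)"
  proof (rule HkI)
    show "\<exists>g. sqi M g \<and> weak_deriv \<Omega> i j (G 0 0) g" if "i + j \<le> k" for i j
      using w[OF that] conv2_sqi(2)[OF G[OF that]] by blast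
  qed (rule conv2_sqi(2)[OF G0])
  show wd_eq: "AE p in M. wd \<Omega> i j (G 0 0) p = G i j p" if "i + j \<le> k" for i j
    by (rule wd_AE_eqI[OF h that conv2_sqi(2)[OF G[OF that]] w[OF that]])
  have conv: "(\<lambda>n. norm0 \<Omega> (wd \<Omega> i j (\<lambda>p. G 0 0 p - \<phi> n p))) \<longlonglongrightarrow> 0" if ij: "i + j \<le> k" for i j
  proof -
    have "norm0 \<Omega> (wd \<Omega> i j (\<lambda>p. G 0 0 p - \<phi> n p)) = nrm M (\<lambda>p. cpd i j (\<phi> n) p - G i j p)" for n
    proof -
      have "AE p in M. wd \<Omega> i j (\<lambda>p. G 0 0 p - \<phi> n p) p = G i j p - cpd i j (\<phi> n) p"
        using Hk_diff(2)[OF h Hk_smooth2(1)[OF s] ij, of n] Hk_smooth2(2)[OF s, of i j n] wd_eq[OF ij]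
        by eventually_elim simp
      then show ?thesis unfolding norm0_eq_nrm nrm_minus_commute[of M "cpd i j (\<phi> n)"]
        using wd_spec(1)[OF Hk_diff(1)[OF h Hk_smooth2(1)[OF s]] ij, of n] G[OF ij]
          sqi_diff[of M "G i j" "cpd i j (\<phi> n)"]
        by (intro nrm_cong_AE) (auto simp: sqi_def conv2_def)
    qed
    then show ?thesis using G[OF ij] by (simp add: conv2_def)
  qed
  have "(\<lambda>n. normH \<Omega> k (\<lambda>p. G 0 0 p - \<phi> n p)) \<longlonglongrightarrow> 0"
  proof (rule Lim_null_comparison[OF eventuallyI])
    show "norm (normH \<Omega> k (\<lambda>p. G 0 0 p - \<phi> n p))
        \<le> (\<Sum>m\<le>k. \<Sum>i\<le>m. norm0 \<Omega> (wd \<Omega> i (m - i) (\<lambda>p. G 0 0 p - \<phi> n p)))" for n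
      using normH_le_sum by simp
    show "(\<lambda>n. \<Sum>m\<le>k. \<Sum>i\<le>m. norm0 \<Omega> (wd \<Omega> i (m - i) (\<lambda>p. G 0 0 p - \<phi> n p))) \<longlonglongrightarrow> 0"
      by (intro tendsto_null_sum conv) auto
  qed
  then show "Hk0 \<Omega> k (G 0 0)" using h \<phi> by (auto simp: Hk0_def)
qed

lemma Hk0_lincomb:
  assumes f: "Hk0 \<Omega> k f" and g: "Hk0 \<Omega> k g" shows "Hk0 \<Omega> k (\<lambda>p. a * f p + b * g p)"
proof -
  obtain \<phi> where \<phi>: "\<And>n. test_fun \<Omega> (\<phi> n)"
    "\<And>i j. i + j \<le> k \<Longrightarrow> conv2 M (\<lambda>n. cpd i j (\<phi> n)) (wd \<Omega> i j f)" using Hk0_approx[OF f] by blast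
  obtain \<eta> where \<eta>: "\<And>n. test_fun \<Omega> (\<eta> n)"
    "\<And>i j. i + j \<le> k \<Longrightarrow> conv2 M (\<lambda>n. cpd i j (\<eta> n)) (wd \<Omega> i j g)" using Hk0_approx[OF g] by blast
  have "Hk0 \<Omega> k ((\<lambda>i j p. a * wd \<Omega> i j f p + b * wd \<Omega> i j g p) 0 0)"
  proof (rule Hk0_limitI(1)[where \<phi> = "\<lambda>n p. a * \<phi> n p + b * \<eta> n p" and
        G = "\<lambda>i j p. a * wd \<Omega> i j f p + b * wd \<Omega> i j g p"])
    show "test_fun \<Omega> (\<lambda>p. a * \<phi> n p + b * \<eta> n p)" for n by (intro test_fun_lincomb \<phi> \<eta>)
    show "conv2 M (\<lambda>n. cpd i j (\<lambda>p. a * \<phi> n p + b * \<eta> n p)) (\<lambda>p. a * wd \<Omega> i j f p + b * wd \<Omega> i j g p)"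
      if "i + j \<le> k" for i j
      using conv2_lincomb[OF \<phi>(2)[OF that] \<eta>(2)[OF that], of a b]
      by (simp add: cpd_lincomb[OF test_fun_smooth2[OF \<phi>(1)] test_fun_smooth2[OF \<eta>(1)]])
  qed
  then show ?thesis by simp
qed

lemma Hk0_diff: "Hk0 \<Omega> k f \<Longrightarrow> Hk0 \<Omega> k g \<Longrightarrow> Hk0 \<Omega> k (\<lambda>p. f p - g p)"
  using Hk0_lincomb[where a = 1 and b = "-1"] by simp

lemma Hk0_mono: assumes "Hk0 \<Omega> k f" "l \<le> k" shows "Hk0 \<Omega> l f"
proof -
  obtain \<phi> where \<phi>: "\<And>n. test_fun \<Omega> (\<phi> n)"
    "\<And>i j. i + j \<le> k \<Longrightarrow> conv2 M (\<lambda>n. cpd i j (\<phi> n)) (wd \<Omega> i j f)" using Hk0_approx[OF assms(1)] by blast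
  have "Hk0 \<Omega> l ((\<lambda>i j. wd \<Omega> i j f) 0 0)"
    by (rule Hk0_limitI(1)[where \<phi> = \<phi> and G = "\<lambda>i j. wd \<Omega> i j f"]) (use \<phi> assms(2) in auto)
  then show ?thesis by simp
qed

lemma Hk0_test_fun: assumes "test_fun \<Omega> \<phi>" shows "Hk0 \<Omega> k \<phi>"
proof -
  have "Hk0 \<Omega> k ((\<lambda>i j. cpd i j \<phi>) 0 0)"
    by (rule Hk0_limitI(1)[where \<phi> = "\<lambda>_. \<phi>" and G = "\<lambda>i j. cpd i j \<phi>"]) (use assms in \<open>auto intro: conv2_const test_fun_sqi test_fun_cpd\<close>)
  then show ?thesis by simp
qed

text \<open>Completeness of L2 gives limits of all derivatives separately. To see that they belong
  together, each \<open>u n\<close> is replaced by a test function that is within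
  \<open>1 / (n + 1)\<close> of it in every derivative; the limits are unchanged and
  \<open>Hk0_limitI\<close> applies.\<close>

lemma Hk0_complete:
  assumes u: "\<And>n. Hk0 \<Omega> k (u n)"
    and C: "\<And>i j e. i + j \<le> k \<Longrightarrow> e > 0 \<Longrightarrow>
      \<exists>N. \<forall>m\<ge>N. \<forall>n\<ge>N. nrm M (\<lambda>p. wd \<Omega> i j (u m) p - wd \<Omega> i j (u n) p) < e"
  shows "\<exists>w. Hk0 \<Omega> k w \<and> (\<forall>i j. i + j \<le> k \<longrightarrow> conv2 M (\<lambda>n. wd \<Omega> i j (u n)) (wd \<Omega> i j w))"
proof -
  have s: "sqi M (wd \<Omega> i j (u n))" if "i + j \<le> k" for i j n
    using wd_spec(1)[OF Hk0_Hk[OF u] that] .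
  have "\<exists>g. i + j \<le> k \<longrightarrow> conv2 M (\<lambda>n. wd \<Omega> i j (u n)) g" for i j
    using Cauchy_conv2[OF finite_msr, of "\<lambda>n. wd \<Omega> i j (u n)"] s C by blast
  then obtain G where G: "\<And>i j. i + j \<le> k \<Longrightarrow> conv2 M (\<lambda>n. wd \<Omega> i j (u n)) (G i j)" by metis
  have "\<exists>\<phi>. test_fun \<Omega> \<phi> \<and> (\<forall>i j. i + j \<le> k \<longrightarrow> nrm M (\<lambda>p. cpd i j \<phi> p - wd \<Omega> i j (u n) p) < 1 / real (Suc n))" for n
  proof -
    obtain \<phi> where \<phi>: "\<And>m. test_fun \<Omega> (\<phi> m)"
      "\<And>i j. i + j \<le> k \<Longrightarrow> conv2 M (\<lambda>m. cpd i j (\<phi> m)) (wd \<Omega> i j (u n))" using Hk0_approx[OF u] by blast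
    have "\<forall>\<^sub>F m in sequentially. \<forall>(i, j)\<in>{(i, j). i + j \<le> k}. nrm M (\<lambda>p. cpd i j (\<phi> m) p - wd \<Omega> i j (u n) p) < 1 / real (Suc n)"
    proof (rule eventually_ball_finite)
      have "{(i, j). i + j \<le> k} \<subseteq> {..k} \<times> {..k}" by auto
      then show "finite {(i, j). i + j \<le> k}" by (rule finite_subset) simp
      show "\<forall>y\<in>{(i, j). i + j \<le> k}. \<forall>\<^sub>F m in sequentially. case y of (i, j) \<Rightarrow>
          nrm M (\<lambda>p. cpd i j (\<phi> m) p - wd \<Omega> i j (u n) p) < 1 / real (Suc n)"
        using \<phi>(2) unfolding conv2_def by (auto intro!: order_tendstoD(2))
    qed
    then obtain m where "\<forall>(i, j)\<in>{(i, j). i + j \<le> k}. nrm M (\<lambda>p. cpd i j (\<phi> m) p - wd \<Omega> i j (u n) p) < 1 / real (Suc n)"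
      by (metis (no_types, lifting) eventually_sequentially order_refl)
    then show ?thesis using \<phi>(1) by blast
  qed
  then obtain \<phi> where \<phi>: "\<And>n. test_fun \<Omega> (\<phi> n)"
    "\<And>n i j. i + j \<le> k \<Longrightarrow> nrm M (\<lambda>p. cpd i j (\<phi> n) p - wd \<Omega> i j (u n) p) < 1 / real (Suc n)" by metis
  have c: "conv2 M (\<lambda>n. cpd i j (\<phi> n)) (G i j)" if ij: "i + j \<le> k" for i j
  proof -
    have sp: "sqi M (cpd i j (\<phi> n))" for n using \<phi>(1) by (intro test_fun_sqi test_fun_cpd)
    have sG: "sqi M (G i j)" using G[OF ij] by (simp add: conv2_def)
    have "(\<lambda>n. nrm M (\<lambda>p. cpd i j (\<phi> n) p - G i j p)) \<longlonglongrightarrow> 0"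
    proof (rule Lim_null_comparison[OF eventuallyI])
      show "norm (nrm M (\<lambda>p. cpd i j (\<phi> n) p - G i j p))
          \<le> 1 / real (Suc n) + nrm M (\<lambda>p. wd \<Omega> i j (u n) p - G i j p)" for n
        using nrm_dist_triangle[OF sp s[OF ij] sG, of n n] \<phi>(2)[OF ij, of n] by simp
      have "(\<lambda>n. nrm M (\<lambda>p. wd \<Omega> i j (u n) p - G i j p)) \<longlonglongrightarrow> 0" using G[OF ij] by (simp add: conv2_def)
      from tendsto_add[OF lim_inverse_n' [THEN LIMSEQ_Suc] this]
      show "(\<lambda>n. 1 / real (Suc n) + nrm M (\<lambda>p. wd \<Omega> i j (u n) p - G i j p)) \<longlonglongrightarrow> 0" by simp
    qed
    then show ?thesis using sp sG by (simp add: conv2_def)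
  qed
  have w: "Hk0 \<Omega> k (G 0 0)" "\<And>i j. i + j \<le> k \<Longrightarrow> AE p in M. wd \<Omega> i j (G 0 0) p = G i j p"
    using Hk0_limitI[OF \<phi>(1) c] by blast+
  have "conv2 M (\<lambda>n. wd \<Omega> i j (u n)) (wd \<Omega> i j (G 0 0))" if ij: "i + j \<le> k" for i j
  proof (rule conv2_AE_cong[OF G[OF ij]])
    show "AE p in M. G i j p = wd \<Omega> i j (G 0 0) p" using w(2)[OF ij] by eventually_elim simp
  qed (use s[OF ij] wd_spec(1)[OF Hk0_Hk[OF w(1)] ij] in auto)
  then show ?thesis using w(1) by blast
qed

text \<open>All weak derivatives are defined from \<open>f\<close> itself. Comparing the definition
  of order \<open>(i + 1, j)\<close> tested with \<open>\<phi>\<close> and that of order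
  \<open>(i, j)\<close> tested with \<open>pdx \<phi>\<close> shows that they are related by one
  derivative; the signs differ by exactly one factor \<open>-1\<close>.\<close>

lemma wd_step_test:
  assumes f: "Hk \<Omega> k f" "i + j < k" and \<phi>: "test_fun \<Omega> \<phi>"
  shows "(\<integral>p. wd \<Omega> (Suc i) j f p * \<phi> p \<partial>M) = - (\<integral>p. wd \<Omega> i j f p * pdx \<phi> p \<partial>M)"
    "(\<integral>p. wd \<Omega> i (Suc j) f p * \<phi> p \<partial>M) = - (\<integral>p. wd \<Omega> i j f p * pdy \<phi> p \<partial>M)"
proof -
  have w: "weak_deriv \<Omega> (Suc i) j f (wd \<Omega> (Suc i) j f)" "weak_deriv \<Omega> i (Suc j) f (wd \<Omega> i (Suc j) f)"
    "weak_deriv \<Omega> i j f (wd \<Omega> i j f)" using f by (auto intro: wd_spec)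
  have s: "smooth2 \<phi>" using \<phi> by (rule test_fun_smooth2)
  have e: "(-1 :: real) ^ (i + j) * (-1) ^ (i + j) = 1" by (simp flip: power_add)
  define c where "c = (-1 :: real) ^ (i + j)"
  have c: "c * c = 1" using e by (simp add: c_def)
  have cc: "x = - y" if "z = - c * x" "z = c * y" for x y z
  proof -
    have "c * (- c * x) = c * (c * y)" using that by simp
    then have "- (c * c) * x = (c * c) * y" by (simp only: mult.assoc[symmetric] mult_minus_right)
    then show ?thesis using c by simp
  qed
  show "(\<integral>p. wd \<Omega> (Suc i) j f p * \<phi> p \<partial>M) = - (\<integral>p. wd \<Omega> i j f p * pdx \<phi> p \<partial>M)"
    using w(1,3) \<phi> test_fun_pd(1)[OF \<phi>] s by (intro cc) (auto simp: weak_deriv_iff c_def cpd_pdx)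
  show "(\<integral>p. wd \<Omega> i (Suc j) f p * \<phi> p \<partial>M) = - (\<integral>p. wd \<Omega> i j f p * pdy \<phi> p \<partial>M)"
    using w(2,3) \<phi> test_fun_pd(2)[OF \<phi>] s by (intro cc) (auto simp: weak_deriv_iff c_def cpd_pdy)
qed

text \<open>Integration by parts without boundary term: the right-hand factor is a limit of test
  functions, while \<open>f\<close> may be any function of \<open>Hk\<close>.\<close>

lemma wd_step:
  assumes f: "Hk \<Omega> k f" "i + j < k" and v: "Hk0 \<Omega> 1 v"
  shows "(\<integral>p. wd \<Omega> (Suc i) j f p * v p \<partial>M) = - (\<integral>p. wd \<Omega> i j f p * wd \<Omega> 1 0 v p \<partial>M)"
    "(\<integral>p. wd \<Omega> i (Suc j) f p * v p \<partial>M) = - (\<integral>p. wd \<Omega> i j f p * wd \<Omega> 0 1 v p \<partial>M)"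
proof -
  obtain \<phi> where \<phi>: "\<And>n. test_fun \<Omega> (\<phi> n)"
    "\<And>i j. i + j \<le> 1 \<Longrightarrow> conv2 M (\<lambda>n. cpd i j (\<phi> n)) (wd \<Omega> i j v)" using Hk0_approx[OF v] by blast
  have c: "conv2 M \<phi> v" "conv2 M (\<lambda>n. pdx (\<phi> n)) (wd \<Omega> 1 0 v)" "conv2 M (\<lambda>n. pdy (\<phi> n)) (wd \<Omega> 0 1 v)"
    using \<phi>(2)[of 0 0] \<phi>(2)[of 1 0] \<phi>(2)[of 0 1] by (simp_all add: cpd_10 cpd_01)
  have s: "sqi M (wd \<Omega> i j f)" "sqi M (wd \<Omega> (Suc i) j f)" "sqi M (wd \<Omega> i (Suc j) f)"
    using f by (auto intro: wd_spec)
  note l = conv2_integral_mult[OF conv2_const]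
  show "(\<integral>p. wd \<Omega> (Suc i) j f p * v p \<partial>M) = - (\<integral>p. wd \<Omega> i j f p * wd \<Omega> 1 0 v p \<partial>M)"
    by (rule LIMSEQ_unique[OF l[OF s(2) c(1), unfolded wd_step_test[OF f \<phi>(1)]] tendsto_minus[OF l[OF s(1) c(2)]]])
  show "(\<integral>p. wd \<Omega> i (Suc j) f p * v p \<partial>M) = - (\<integral>p. wd \<Omega> i j f p * wd \<Omega> 0 1 v p \<partial>M)"
    by (rule LIMSEQ_unique[OF l[OF s(3) c(1), unfolded wd_step_test[OF f \<phi>(1)]] tendsto_minus[OF l[OF s(1) c(3)]]])
qed

text \<open>Integrating the derivative of \<open>x \<phi>\<^sup>2\<close> gives \<open>\<integral>\<phi>\<^sup>2 = - 2 \<integral>x \<phi> \<phi>\<^sub>x\<close>, hence the Poincare inequality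
  with an explicit constant.\<close>

lemma poincare_test:
  "\<exists>C>0. \<forall>\<phi>. test_fun \<Omega> \<phi> \<longrightarrow> nrm M \<phi> \<le> C * nrm M (pdx \<phi>) \<and> nrm M \<phi> \<le> C * nrm M (pdy \<phi>)"
proof -
  obtain C1 C2 where C: "\<forall>p\<in>\<Omega>. \<bar>fst p\<bar> \<le> C1" "\<forall>p\<in>\<Omega>. \<bar>snd p\<bar> \<le> C2"
    using cont_bounded_msr[OF continuous_on_fst[OF continuous_on_id]]
      cont_bounded_msr[OF continuous_on_snd[OF continuous_on_id]] by blast
  define R where "R = \<bar>C1\<bar> + \<bar>C2\<bar> + 1"
  have fR: "\<bar>fst p\<bar> \<le> R" "\<bar>snd p\<bar> \<le> R" if "p \<in> \<Omega>" for p
    using bspec[OF C(1) that] bspec[OF C(2) that] by (simp_all add: R_def)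
  have R: "R > 0" "AE p in M. \<bar>fst p\<bar> \<le> R" "AE p in M. \<bar>snd p\<bar> \<le> R"
    by (simp add: R_def) (rule AE_msrI, erule fR)+
  \<comment> \<open>\<open>w\<close> stands for a coordinate and \<open>g\<close> for the partial
    derivative of \<open>\<phi>\<close> in that direction, so one computation serves both
    directions.\<close>
  have key: "nrm M \<phi> \<le> 2 * R * nrm M g"
    if \<phi>: "test_fun \<Omega> \<phi>" and w: "w \<in> borel_measurable M" "AE p in M. \<bar>w p\<bar> \<le> R" and g: "sqi M g"
      and ibp: "(\<integral>p. (w p * \<phi> p) * g p \<partial>M) = - (\<integral>p. (\<phi> p + w p * g p) * \<phi> p \<partial>M)" for \<phi> w g
  proof -
    have s: "sqi M \<phi>" using \<phi> by (rule test_fun_sqi)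
    have wp: "sqi M (\<lambda>p. w p * \<phi> p)" "sqi M (\<lambda>p. w p * g p)"
      using sqi_bounded_mult(1)[OF s w] sqi_bounded_mult(1)[OF g w] .
    have "(\<integral>p. (\<phi> p + w p * g p) * \<phi> p \<partial>M) = (\<integral>p. \<phi> p * \<phi> p + (w p * g p) * \<phi> p \<partial>M)"
      by (simp add: distrib_right)
    also have "\<dots> = (\<integral>p. \<phi> p * \<phi> p \<partial>M) + (\<integral>p. (w p * g p) * \<phi> p \<partial>M)"
      by (intro Bochner_Integration.integral_add sqi_integrable_mult s wp)
    also have "(\<integral>p. (w p * g p) * \<phi> p \<partial>M) = (\<integral>p. (w p * \<phi> p) * g p \<partial>M)" by (simp add: mult_ac)
    finally have "(nrm M \<phi>)\<^sup>2 = - 2 * (\<integral>p. (w p * \<phi> p) * g p \<partial>M)"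
      using ibp unfolding nrm_power2 by (simp add: power2_eq_square)
    also have "\<dots> \<le> 2 * (nrm M (\<lambda>p. w p * \<phi> p) * nrm M g)"
      using abs_le_D2[OF Cauchy_Schwarz_integral[OF wp(1) g]] by linarith
    also have "\<dots> \<le> 2 * (R * nrm M \<phi> * nrm M g)"
      using sqi_bounded_mult(2)[OF s w] by (intro mult_left_mono mult_right_mono) auto
    finally have "nrm M \<phi> * nrm M \<phi> \<le> nrm M \<phi> * (2 * R * nrm M g)"
      by (simp add: power2_eq_square mult_ac)
    then have le: "nrm M \<phi> = 0 \<or> nrm M \<phi> \<le> 2 * R * nrm M g"
      using nrm_nonneg[of M \<phi>] by (simp only: mult_le_cancel_left) linarith
    show ?thesis
    proof (cases "nrm M \<phi> = 0")
      case True
      then show ?thesis using R(1) by simp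
    qed (use le in simp)
  qed
  have "nrm M \<phi> \<le> 2 * R * nrm M (pdx \<phi>) \<and> nrm M \<phi> \<le> 2 * R * nrm M (pdy \<phi>)" if \<phi>: "test_fun \<Omega> \<phi>" for \<phi>
  proof
    have s: "smooth2 \<phi>" using \<phi> by (rule test_fun_smooth2)
    show "nrm M \<phi> \<le> 2 * R * nrm M (pdx \<phi>)"
    proof (rule key[OF \<phi> _ R(2)])
      show "(\<integral>p. (fst p * \<phi> p) * pdx \<phi> p \<partial>M) = - (\<integral>p. (\<phi> p + fst p * pdx \<phi> p) * \<phi> p \<partial>M)"
        using integral_by_parts(1)[OF smooth2_mult[OF smooth2_fst s] \<phi>] by (simp add: pd_mult smooth2_fst s pd_fst)
    qed (rule smooth2_measurable smooth2_fst smooth2_sqi smooth2_pdx s)+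
    show "nrm M \<phi> \<le> 2 * R * nrm M (pdy \<phi>)"
    proof (rule key[OF \<phi> _ R(3)])
      show "(\<integral>p. (snd p * \<phi> p) * pdy \<phi> p \<partial>M) = - (\<integral>p. (\<phi> p + snd p * pdy \<phi> p) * \<phi> p \<partial>M)"
        using integral_by_parts(2)[OF smooth2_mult[OF smooth2_snd s] \<phi>] by (simp add: pd_mult smooth2_snd s pd_snd)
    qed (rule smooth2_measurable smooth2_snd smooth2_sqi smooth2_pdy s)+
  qed
  then show ?thesis using R(1) by (intro exI[of _ "2 * R"]) auto
qed

text \<open>Derivatives of test functions are test functions, so the inequality holds at every order
  below \<open>k\<close> and climbs one order in either direction.\<close>

lemma poincare:
  "\<exists>C>0. \<forall>k v i j. Hk0 \<Omega> k v \<longrightarrow> i + j < k \<longrightarrow>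
      nrm M (wd \<Omega> i j v) \<le> C * nrm M (wd \<Omega> (Suc i) j v) \<and> nrm M (wd \<Omega> i j v) \<le> C * nrm M (wd \<Omega> i (Suc j) v)"
proof -
  obtain C where C: "C > 0" "\<And>\<phi>. test_fun \<Omega> \<phi> \<Longrightarrow> nrm M \<phi> \<le> C * nrm M (pdx \<phi>)"
    "\<And>\<phi>. test_fun \<Omega> \<phi> \<Longrightarrow> nrm M \<phi> \<le> C * nrm M (pdy \<phi>)" using poincare_test by blast
  have "nrm M (wd \<Omega> i j v) \<le> C * nrm M (wd \<Omega> (Suc i) j v) \<and> nrm M (wd \<Omega> i j v) \<le> C * nrm M (wd \<Omega> i (Suc j) v)"
    if v: "Hk0 \<Omega> k v" and ij: "i + j < k" for k v i j
  proof -
    obtain \<phi> where \<phi>: "\<And>n. test_fun \<Omega> (\<phi> n)"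
      "\<And>i j. i + j \<le> k \<Longrightarrow> conv2 M (\<lambda>n. cpd i j (\<phi> n)) (wd \<Omega> i j v)" using Hk0_approx[OF v] by blast
    have l: "(\<lambda>n. nrm M (cpd i j (\<phi> n))) \<longlonglongrightarrow> nrm M (wd \<Omega> i j v)"
      "(\<lambda>n. nrm M (cpd (Suc i) j (\<phi> n))) \<longlonglongrightarrow> nrm M (wd \<Omega> (Suc i) j v)"
      "(\<lambda>n. nrm M (cpd i (Suc j) (\<phi> n))) \<longlonglongrightarrow> nrm M (wd \<Omega> i (Suc j) v)"
      using ij by (auto intro!: conv2_nrm \<phi>(2))
    have b: "nrm M (cpd i j (\<phi> n)) \<le> C * nrm M (cpd (Suc i) j (\<phi> n))"
      "nrm M (cpd i j (\<phi> n)) \<le> C * nrm M (cpd i (Suc j) (\<phi> n))" for n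
      using C(2,3)[OF test_fun_cpd[OF \<phi>(1)], of i j n] by (simp_all add: pdx_cpd pdy_cpd test_fun_smooth2[OF \<phi>(1)])
    show ?thesis
      using LIMSEQ_le[OF l(1) tendsto_mult_left[OF l(2)]] LIMSEQ_le[OF l(1) tendsto_mult_left[OF l(3)]] b by blast
  qed
  then show ?thesis using C(1) by blast
qed

lemma normH2_le_semi2: "\<exists>C>0. \<forall>v. H20 \<Omega> v \<longrightarrow> normH \<Omega> 2 v \<le> C * semi \<Omega> 2 v"
proof -
  obtain C where C: "C > 0" "\<And>k v i j. Hk0 \<Omega> k v \<Longrightarrow> i + j < k \<Longrightarrow>
      nrm M (wd \<Omega> i j v) \<le> C * nrm M (wd \<Omega> (Suc i) j v)" "\<And>k v i j. Hk0 \<Omega> k v \<Longrightarrow> i + j < k \<Longrightarrow>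
      nrm M (wd \<Omega> i j v) \<le> C * nrm M (wd \<Omega> i (Suc j) v)"
    using poincare by blast
  \<comment> \<open>The summands count derivatives of order 0, 1 and 2. Order 0 costs two
    applications of the Poincare inequality, order 1 has two derivatives with one application each,
    and order 2 has three terms.\<close>
  have "normH \<Omega> 2 v \<le> (C * C + 2 * C + 3) * semi \<Omega> 2 v" if v: "H20 \<Omega> v" for v
  proof -
    let ?s = "semi \<Omega> 2 v"
    have b2: "nrm M (wd \<Omega> i j v) \<le> ?s" if "i + j = 2" for i j
      using norm0_wd_le_semi[of \<Omega> i j v] that by (simp add: norm0_eq_nrm)
    have b1: "nrm M (wd \<Omega> (Suc 0) 0 v) \<le> C * ?s" "nrm M (wd \<Omega> 0 (Suc 0) v) \<le> C * ?s"
    proof -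
      have "nrm M (wd \<Omega> (Suc 0) 0 v) \<le> C * nrm M (wd \<Omega> 2 0 v)" "nrm M (wd \<Omega> 0 (Suc 0) v) \<le> C * nrm M (wd \<Omega> 0 2 v)"
        using C(2)[OF v, of 1 0] C(3)[OF v, of 0 1] by (simp_all add: numeral_2_eq_2)
      then show "nrm M (wd \<Omega> (Suc 0) 0 v) \<le> C * ?s" "nrm M (wd \<Omega> 0 (Suc 0) v) \<le> C * ?s"
        using mult_left_mono[OF b2[of 2 0], of C] mult_left_mono[OF b2[of 0 2], of C] C(1) by linarith+
    qed
    have b0: "nrm M v \<le> C * C * ?s"
    proof -
      have "nrm M v \<le> C * nrm M (wd \<Omega> (Suc 0) 0 v)" using C(2)[OF v, of 0 0] by simp
      also have "\<dots> \<le> C * (C * ?s)" using b1(1) C(1) by (intro mult_left_mono) auto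
      finally show ?thesis by (simp only: mult.assoc)
    qed
    have "normH \<Omega> 2 v \<le> (\<Sum>m\<le>2. \<Sum>i\<le>m. nrm M (wd \<Omega> i (m - i) v))"
      using normH_le_sum[of \<Omega> 2 v] by (simp add: norm0_eq_nrm)
    also have "\<dots> = nrm M v + (nrm M (wd \<Omega> 0 (Suc 0) v) + nrm M (wd \<Omega> (Suc 0) 0 v))
        + (nrm M (wd \<Omega> 0 2 v) + nrm M (wd \<Omega> (Suc 0) (Suc 0) v) + nrm M (wd \<Omega> 2 0 v))"
      by (simp add: numeral_2_eq_2)
    also have "\<dots> \<le> C * C * ?s + (C * ?s + C * ?s) + (?s + ?s + ?s)"
      by (intro add_mono b0 b1 b2) auto
    finally show ?thesis by (simp add: algebra_simps)
  qed
  moreover have "C * C + 2 * C + 3 > 0" using C(1) by (simp add: add_pos_pos)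
  ultimately show ?thesis by blast
qed

text \<open>Two integrations by parts, in \<open>y\<close> and then back in \<open>x\<close>. Third
  derivatives occur in between, which is why this is done for test functions before the
  limit.\<close>

lemma wd20_wd02:
  assumes u: "H20 \<Omega> u" and v: "H20 \<Omega> v"
  shows "(\<integral>p. wd \<Omega> 2 0 u p * wd \<Omega> 0 2 v p \<partial>M) = (\<integral>p. wd \<Omega> 1 1 u p * wd \<Omega> 1 1 v p \<partial>M)"
proof -
  obtain \<phi> where \<phi>: "\<And>n. test_fun \<Omega> (\<phi> n)"
    "\<And>i j. i + j \<le> 2 \<Longrightarrow> conv2 M (\<lambda>n. cpd i j (\<phi> n)) (wd \<Omega> i j u)" using Hk0_approx[OF u] by blast
  obtain \<eta> where \<eta>: "\<And>n. test_fun \<Omega> (\<eta> n)"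
    "\<And>i j. i + j \<le> 2 \<Longrightarrow> conv2 M (\<lambda>n. cpd i j (\<eta> n)) (wd \<Omega> i j v)" using Hk0_approx[OF v] by blast
  have e: "(\<integral>p. cpd 2 0 (\<phi> n) p * cpd 0 2 (\<eta> n) p \<partial>M) = (\<integral>p. cpd 1 1 (\<phi> n) p * cpd 1 1 (\<eta> n) p \<partial>M)" for n
  proof -
    have s: "smooth2 (\<phi> n)" "smooth2 (\<eta> n)" using \<phi>(1) \<eta>(1) by (auto intro: test_fun_smooth2)
    have t: "test_fun \<Omega> (cpd 0 1 (\<eta> n))" using \<eta>(1) by (rule test_fun_cpd)
    have "(\<integral>p. cpd 2 0 (\<phi> n) p * cpd 0 2 (\<eta> n) p \<partial>M) = (\<integral>p. cpd 2 0 (\<phi> n) p * pdy (cpd 0 1 (\<eta> n)) p \<partial>M)"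
      by (simp add: pdy_cpd s numeral_2_eq_2)
    also have "\<dots> = - (\<integral>p. pdy (cpd 2 0 (\<phi> n)) p * cpd 0 1 (\<eta> n) p \<partial>M)"
      by (intro integral_by_parts t smooth2_cpd s)
    also have "pdy (cpd 2 0 (\<phi> n)) = pdx (cpd 1 1 (\<phi> n))"
      by (simp add: pdy_cpd pdx_cpd s numeral_2_eq_2)
    also have "- (\<integral>p. pdx (cpd 1 1 (\<phi> n)) p * cpd 0 1 (\<eta> n) p \<partial>M) = (\<integral>p. cpd 1 1 (\<phi> n) p * pdx (cpd 0 1 (\<eta> n)) p \<partial>M)"
      using integral_by_parts(1)[OF smooth2_cpd[OF s(1)] t] by simp
    finally show ?thesis by (simp add: pdx_cpd)
  qed
  have "(\<lambda>n. \<integral>p. cpd 2 0 (\<phi> n) p * cpd 0 2 (\<eta> n) p \<partial>M) \<longlonglongrightarrow> (\<integral>p. wd \<Omega> 2 0 u p * wd \<Omega> 0 2 v p \<partial>M)"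
    "(\<lambda>n. \<integral>p. cpd 1 1 (\<phi> n) p * cpd 1 1 (\<eta> n) p \<partial>M) \<longlonglongrightarrow> (\<integral>p. wd \<Omega> 1 1 u p * wd \<Omega> 1 1 v p \<partial>M)"
    by (intro conv2_integral_mult \<phi>(2) \<eta>(2); simp)+
  then show ?thesis unfolding e by (rule LIMSEQ_unique)
qed

lemma lap_sqi: "Hk \<Omega> k v \<Longrightarrow> 2 \<le> k \<Longrightarrow> sqi M (lap \<Omega> v)"
  unfolding lap_def by (intro sqi_add wd_spec) auto

text \<open>Expanding the square leaves the cross term \<open>2 v_xx v_yy\<close>, which integrates
  to twice the square of the mixed derivative. \<open>semi\<close> counts that derivative only once,
  so one copy is left over; this surplus is what makes coercivity strict in the borderline case of
  the small data condition.\<close>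

lemma nrm_lap:
  assumes "H20 \<Omega> v"
  shows "(nrm M (lap \<Omega> v))\<^sup>2 = (semi \<Omega> 2 v)\<^sup>2 + (nrm M (wd \<Omega> 1 1 v))\<^sup>2"
proof -
  have s: "sqi M (wd \<Omega> 2 0 v)" "sqi M (wd \<Omega> 0 2 v)" using Hk0_Hk[OF assms] by (auto intro: wd_spec)
  have i: "integrable M (\<lambda>p. (wd \<Omega> 2 0 v p)\<^sup>2)" "integrable M (\<lambda>p. (wd \<Omega> 0 2 v p)\<^sup>2)"
    "integrable M (\<lambda>p. wd \<Omega> 2 0 v p * wd \<Omega> 0 2 v p)"
    using s sqi_integrable_mult[OF s] by (auto simp: sqi_def)
  have "(nrm M (lap \<Omega> v))\<^sup>2 = (\<integral>p. (wd \<Omega> 2 0 v p)\<^sup>2 + 2 * (wd \<Omega> 2 0 v p * wd \<Omega> 0 2 v p) + (wd \<Omega> 0 2 v p)\<^sup>2 \<partial>M)"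
    unfolding nrm_power2 lap_def
    by (intro Bochner_Integration.integral_cong) (auto simp: power2_eq_square algebra_simps)
  also have "\<dots> = (nrm M (wd \<Omega> 2 0 v))\<^sup>2 + 2 * (nrm M (wd \<Omega> 1 1 v))\<^sup>2 + (nrm M (wd \<Omega> 0 2 v))\<^sup>2"
    using i wd20_wd02[OF assms assms] unfolding nrm_power2 by (simp flip: power2_eq_square)
  also have "(semi \<Omega> 2 v)\<^sup>2 = (nrm M (wd \<Omega> 0 2 v))\<^sup>2 + (nrm M (wd \<Omega> 1 1 v))\<^sup>2 + (nrm M (wd \<Omega> 2 0 v))\<^sup>2"
    by (simp add: semi_def norm0_eq_nrm numeral_2_eq_2 sum_nonneg)
  ultimately show ?thesis by simp
qed

lemma semi_le_nrm_lap: "H20 \<Omega> v \<Longrightarrow> semi \<Omega> 2 v \<le> nrm M (lap \<Omega> v)"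
  by (rule power2_le_imp_le) (simp_all add: nrm_lap)

lemma nrm_lap_le: assumes "H20 \<Omega> v" shows "nrm M (lap \<Omega> v) \<le> 2 * semi \<Omega> 2 v"
proof (rule power2_le_imp_le)
  have "nrm M (wd \<Omega> 1 1 v) \<le> semi \<Omega> 2 v"
    using norm0_wd_le_semi[of \<Omega> 1 1 v] by (simp add: norm0_eq_nrm numeral_2_eq_2)
  then have "(nrm M (wd \<Omega> 1 1 v))\<^sup>2 \<le> (semi \<Omega> 2 v)\<^sup>2" by (intro power_mono) auto
  moreover have "(2 * semi \<Omega> 2 v)\<^sup>2 = 4 * (semi \<Omega> 2 v)\<^sup>2" by (simp add: power_mult_distrib)
  ultimately show "(nrm M (lap \<Omega> v))\<^sup>2 \<le> (2 * semi \<Omega> 2 v)\<^sup>2"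
    using nrm_lap[OF assms] zero_le_power2[of "semi \<Omega> 2 v"] by linarith
qed simp

text \<open>The Poincare inequality in \<open>y\<close> shows that \<open>v_x\<close> vanishes, and
  then the one in \<open>x\<close> shows that \<open>v\<close> vanishes almost everywhere; hence all
  its weak derivatives do.\<close>

lemma mixed_derivative_zero:
  assumes v: "H20 \<Omega> v" and z: "nrm M (wd \<Omega> 1 1 v) = 0" shows "semi \<Omega> 2 v = 0"
proof -
  obtain C where C: "C > 0" "\<And>k v i j. Hk0 \<Omega> k v \<Longrightarrow> i + j < k \<Longrightarrow>
      nrm M (wd \<Omega> i j v) \<le> C * nrm M (wd \<Omega> (Suc i) j v)" "\<And>k v i j. Hk0 \<Omega> k v \<Longrightarrow> i + j < k \<Longrightarrow>
      nrm M (wd \<Omega> i j v) \<le> C * nrm M (wd \<Omega> i (Suc j) v)"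
    using poincare by blast
  have "nrm M (wd \<Omega> (Suc 0) 0 v) = 0"
    using C(3)[OF v, of "Suc 0" 0] z by (intro antisym) simp_all
  then have "nrm M v = 0" using C(2)[OF v, of 0 0] by (intro antisym) simp_all
  then have v0: "AE p in M. v p = 0" using nrm_eq_0 Hk_sqi[OF Hk0_Hk[OF v]] by blast
  have "nrm M (wd \<Omega> i j v) = 0" if ij: "i + j \<le> 2" for i j
  proof -
    have w: "sqi M (wd \<Omega> i j v)" "weak_deriv \<Omega> i j v (wd \<Omega> i j v)" using wd_spec[OF Hk0_Hk[OF v] ij] .
    have "AE p in M. wd \<Omega> i j v p = 0"
    proof (rule vanishing_weakly_imp_AE_zero[OF w(1)])
      fix \<phi> assume \<phi>: "test_fun \<Omega> \<phi>"
      have "(\<integral>p. v p * cpd i j \<phi> p \<partial>M) = 0"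
        using v0 by (intro integral_eq_zero_AE) (auto elim: AE_mp)
      then show "(\<integral>p. wd \<Omega> i j v p * \<phi> p \<partial>M) = 0" using w(2) \<phi> by (simp add: weak_deriv_iff)
    qed
    then have "(\<integral>p. (wd \<Omega> i j v p)\<^sup>2 \<partial>M) = 0" by (intro integral_eq_zero_AE) (auto elim: AE_mp)
    then show ?thesis by (simp add: nrm_def)
  qed
  then show ?thesis by (simp add: semi_def norm0_eq_nrm)
qed

end

section \<open>Sobolev's inequality on convex sets\<close>

text \<open>Total differentiability from continuous partials. It is needed for the chain rule along
  rays, where both coordinates move with the parameter.\<close>

lemma smooth2_has_derivative:
  assumes "smooth2 f"
  shows "(f has_derivative (\<lambda>v. pdx f p * fst v + pdy f p * snd v)) (at p)"
proof -
  obtain x y where p: "p = (x, y)" by (cases p)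
  have hp: "has_partials f (pdx f) (pdy f)" using assms by (rule smooth2_has_partials)
  have c: "continuous_on UNIV (pdy f)" using assms by (intro smooth2_cont smooth2_pdy)
  have "((\<lambda>(x, y). f (x, y)) has_derivative
      (\<lambda>(tx, ty). pdx f (x, y) * tx + blinfun_apply (blinfun_mult_right (pdy f (x, y))) ty)) (at (x, y) within UNIV \<times> UNIV)"
  proof (rule has_derivative_partialsI[where fy = "\<lambda>x y. blinfun_mult_right (pdy f (x, y))"])
    show "((\<lambda>x. f (x, y)) has_derivative (\<lambda>tx. pdx f (x, y) * tx)) (at x within UNIV)"
      using hp by (simp add: has_partials_def has_field_derivative_def)
    show "((\<lambda>y. f (x, y)) has_derivative blinfun_apply (blinfun_mult_right (pdy f (x, y)))) (at y within UNIV)" for x y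
      using hp by (simp add: has_partials_def has_field_derivative_def)
    have "continuous_on UNIV (\<lambda>q. blinfun_mult_right (pdy f q))"
      by (rule bounded_linear.continuous_on[OF bounded_linear_blinfun_mult_right c])
    then show "continuous (at (x, y) within UNIV \<times> UNIV) (\<lambda>(x, y). blinfun_mult_right (pdy f (x, y)))"
      by (simp add: continuous_on_eq_continuous_at case_prod_beta')
  qed auto
  then show ?thesis by (simp add: p case_prod_beta')
qed

lemma scaled_smooth_has_derivative:
  assumes f: "smooth2 f" and t: "t > 0"
  shows "((\<lambda>t. inverse (t\<^sup>2) * f (p + (1 / t) *\<^sub>R (y - p))) has_real_derivative
    - (inverse (t ^ 3) * (2 * f (p + (1 / t) *\<^sub>R (y - p))
        + fst ((1 / t) *\<^sub>R (y - p)) * pdx f (p + (1 / t) *\<^sub>R (y - p))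
        + snd ((1 / t) *\<^sub>R (y - p)) * pdy f (p + (1 / t) *\<^sub>R (y - p))))) (at t)"
proof -
  let ?q = "p + (1 / t) *\<^sub>R (y - p)"
  have "((\<lambda>t. p + (1 / t) *\<^sub>R (y - p)) has_derivative (\<lambda>h. (- h / t\<^sup>2) *\<^sub>R (y - p))) (at t)"
    using t by (auto intro!: derivative_eq_intros simp: field_simps power2_eq_square)
  from has_derivative_compose[OF this smooth2_has_derivative[OF f]]
  have "((\<lambda>t. f (p + (1 / t) *\<^sub>R (y - p))) has_derivative
      (\<lambda>h. pdx f ?q * fst ((- h / t\<^sup>2) *\<^sub>R (y - p)) + pdy f ?q * snd ((- h / t\<^sup>2) *\<^sub>R (y - p)))) (at t)"
    by simp
  then have d: "((\<lambda>t. f (p + (1 / t) *\<^sub>R (y - p))) has_real_derivative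
      - (pdx f ?q * fst (y - p) + pdy f ?q * snd (y - p)) / t\<^sup>2) (at t)"
  proof -
    have "A * ((- h / t\<^sup>2) * a) + B * ((- h / t\<^sup>2) * b) = (- (A * a + B * b) / t\<^sup>2) * h" for A B a b h :: real
      by (simp add: algebra_simps add_divide_distrib diff_divide_distrib)
    then show ?thesis
      unfolding has_field_derivative_def
      using \<open>((\<lambda>t. f (p + (1 / t) *\<^sub>R (y - p))) has_derivative _) (at t)\<close>
      by (simp only: fst_scaleR snd_scaleR real_scaleR_def)
  qed
  have i: "((\<lambda>t. inverse (t\<^sup>2)) has_real_derivative (- 2 / t ^ 3)) (at t)"
    using t by (auto intro!: derivative_eq_intros simp: field_simps power2_eq_square power3_eq_cube)
  show ?thesis
    by (rule DERIV_cong[OF DERIV_mult[OF i d]])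
       (use t in \<open>simp add: field_simps power2_eq_square power3_eq_cube\<close>)
qed

text \<open>A second derivative of size \<open>1 / s\<close> makes the first one logarithmic, and a
  logarithm is integrable at 0, so \<open>G\<close> stays bounded down to \<open>t = 0\<close>. The
  two integrations are done by monotonicity of \<open>G'\<close> and \<open>G\<close> plus or minus
  a comparison function.\<close>

lemma second_derivative_bound:
  fixes G G' G'' :: "real \<Rightarrow> real"
  assumes d: "\<And>s. 0 < s \<Longrightarrow> s \<le> 1 \<Longrightarrow> (G has_real_derivative G' s) (at s)"
    "\<And>s. 0 < s \<Longrightarrow> s \<le> 1 \<Longrightarrow> (G' has_real_derivative G'' s) (at s)"
    and b: "\<And>s. 0 < s \<Longrightarrow> s \<le> 1 \<Longrightarrow> \<bar>G'' s\<bar> \<le> m / s" "\<bar>G' 1\<bar> \<le> c" "\<bar>G 1\<bar> \<le> a" and m: "m \<ge> 0" "c \<ge> 0"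
    and t: "0 < t" "t \<le> 1"
  shows "\<bar>G t\<bar> \<le> a + c + m"
proof -
  have G': "\<bar>G' s\<bar> \<le> c - m * ln s" if s: "0 < s" "s \<le> 1" for s
  proof -
    have "(\<lambda>r. G' r + m * ln r) s \<le> (\<lambda>r. G' r + m * ln r) 1"
    proof (rule DERIV_nonneg_imp_nondecreasing[OF s(2)])
      fix r assume r: "s \<le> r" "r \<le> 1"
      then have "((\<lambda>r. G' r + m * ln r) has_real_derivative G'' r + m * (1 / r)) (at r)"
        using s d(2)[of r] by (auto intro!: derivative_eq_intros)
      moreover have "G'' r + m * (1 / r) \<ge> 0" using b(1)[of r] r s by (simp add: abs_le_iff)
      ultimately show "\<exists>y. ((\<lambda>r. G' r + m * ln r) has_real_derivative y) (at r) \<and> 0 \<le> y" by blast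
    qed
    moreover have "(\<lambda>r. - G' r + m * ln r) s \<le> (\<lambda>r. - G' r + m * ln r) 1"
    proof (rule DERIV_nonneg_imp_nondecreasing[OF s(2)])
      fix r assume r: "s \<le> r" "r \<le> 1"
      then have "((\<lambda>r. - G' r + m * ln r) has_real_derivative - G'' r + m * (1 / r)) (at r)"
        using s d(2)[of r] by (auto intro!: derivative_eq_intros)
      moreover have "- G'' r + m * (1 / r) \<ge> 0" using b(1)[of r] r s by (simp add: abs_le_iff)
      ultimately show "\<exists>y. ((\<lambda>r. - G' r + m * ln r) has_real_derivative y) (at r) \<and> 0 \<le> y" by blast
    qed
    ultimately show ?thesis using b(2) by (simp add: abs_le_iff)
  qed
  \<comment> \<open>An antiderivative of \<open>c - m ln s\<close>. Its values are nonnegative on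
    the interval in question, and \<open>P 1 = c + m\<close> is exactly what is added to
    \<open>a\<close> in the claim.\<close>
  define P where "P s = c * s - m * (s * ln s - s)" for s
  have P: "(P has_real_derivative c - m * ln s) (at s)" if "s > 0" for s
    unfolding P_def using that by (auto intro!: derivative_eq_intros)
  have "ln t \<le> 0" using t by simp
  then have "t * ln t \<le> 0" using t by (simp add: mult_nonneg_nonpos)
  then have "0 \<le> t - t * ln t" using t by linarith
  then have "0 \<le> m * (t - t * ln t)" using m by (intro mult_nonneg_nonneg)
  moreover have "0 \<le> c * t" using t m by simp
  ultimately have Pt: "P t \<ge> 0" by (simp add: P_def algebra_simps)
  have "(\<lambda>s. G s + P s) t \<le> (\<lambda>s. G s + P s) 1"
  proof (rule DERIV_nonneg_imp_nondecreasing[OF t(2)])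
    fix r assume r: "t \<le> r" "r \<le> 1"
    then have "((\<lambda>s. G s + P s) has_real_derivative G' r + (c - m * ln r)) (at r)"
      using t by (intro DERIV_add d P) auto
    moreover have "G' r + (c - m * ln r) \<ge> 0" using G'[of r] r t by (simp add: abs_le_iff)
    ultimately show "\<exists>y. ((\<lambda>s. G s + P s) has_real_derivative y) (at r) \<and> 0 \<le> y" by blast
  qed
  moreover have "(\<lambda>s. - G s + P s) t \<le> (\<lambda>s. - G s + P s) 1"
  proof (rule DERIV_nonneg_imp_nondecreasing[OF t(2)])
    fix r assume r: "t \<le> r" "r \<le> 1"
    then have "((\<lambda>s. - G s + P s) has_real_derivative - G' r + (c - m * ln r)) (at r)"
      using t by (intro DERIV_add DERIV_minus d P) auto
    moreover have "- G' r + (c - m * ln r) \<ge> 0" using G'[of r] r t by (simp add: abs_le_iff)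
    ultimately show "\<exists>y. ((\<lambda>s. - G s + P s) has_real_derivative y) (at r) \<and> 0 \<le> y" by blast
  qed
  ultimately show ?thesis using Pt b(3) by (simp add: P_def abs_le_iff)
qed

section \<open>Averages over sets shrunk towards a point\<close>

lemma One_pt: "fst (One :: pt) = 1" "snd (One :: pt) = 1"
  by (simp_all add: Basis_prod_def sum.union_disjoint image_iff sum.reindex inj_on_def disjoint_iff)

text \<open>A bare first-order relation between two given functions. On a triangle one works with
  restrictions of the derivatives chosen on the whole domain, so the pairs must be arguments and not
  be chosen anew.\<close>

definition weak_x :: "pt set \<Rightarrow> (pt \<Rightarrow> real) \<Rightarrow> (pt \<Rightarrow> real) \<Rightarrow> bool" where
  "weak_x \<Omega> u v \<longleftrightarrow> (\<forall>\<phi>. test_fun \<Omega> \<phi> \<longrightarrow> (\<integral>p. v p * \<phi> p \<partial>msr \<Omega>) = - (\<integral>p. u p * pdx \<phi> p \<partial>msr \<Omega>))"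

definition weak_y :: "pt set \<Rightarrow> (pt \<Rightarrow> real) \<Rightarrow> (pt \<Rightarrow> real) \<Rightarrow> bool" where
  "weak_y \<Omega> u v \<longleftrightarrow> (\<forall>\<phi>. test_fun \<Omega> \<phi> \<longrightarrow> (\<integral>p. v p * \<phi> p \<partial>msr \<Omega>) = - (\<integral>p. u p * pdy \<phi> p \<partial>msr \<Omega>))"

text \<open>With \<open>y = p + t (q - p)\<close> this becomes the integral of
  \<open>u(p + t (q - p)) \<sigma>(q)\<close>: an average of \<open>u\<close> over the shape of
  \<open>\<sigma>\<close> shrunk towards \<open>p\<close>. In the form chosen here the parameter
  \<open>t\<close> sits only in the smooth kernel, so differentiation in \<open>t\<close> never
  touches \<open>u\<close>.\<close>

definition scaled_avg :: "pt set \<Rightarrow> pt \<Rightarrow> (pt \<Rightarrow> real) \<Rightarrow> (pt \<Rightarrow> real) \<Rightarrow> real \<Rightarrow> real" where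
  "scaled_avg \<Omega> p \<sigma> u t = (\<integral>y. u y * (inverse (t\<^sup>2) * \<sigma> (p + (1 / t) *\<^sub>R (y - p))) \<partial>msr \<Omega>)"

locale bounded_open_convex = bounded_open +
  assumes convex_dom: "convex \<Omega>"
begin

lemma test_fun_bounded: assumes "test_fun \<Omega> \<phi>" shows "\<exists>C\<ge>0. \<forall>p. \<bar>\<phi> p\<bar> \<le> C"
proof -
  obtain C where C: "\<forall>p\<in>\<Omega>. \<bar>\<phi> p\<bar> \<le> C"
    using cont_bounded_msr smooth2_cont test_fun_smooth2 assms by blast
  have "\<bar>\<phi> p\<bar> \<le> \<bar>C\<bar>" for p
    using bspec[OF C, of p] test_fun_zero_outside[OF assms, of p] by (cases "p \<in> \<Omega>") auto
  then show ?thesis by (intro exI[of _ "\<bar>C\<bar>"]) auto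
qed

lemma smooth2_scaled: assumes "smooth2 f" shows "smooth2 (\<lambda>y. f (p + (1 / t) *\<^sub>R (y - p)))"
  using smooth2_affine[OF assms, of "p - (1 / t) *\<^sub>R p" "1 / t"] by (simp add: algebra_simps)

lemma pd_scaled:
  assumes "smooth2 f"
  shows "pdx (\<lambda>y. f (p + (1 / t) *\<^sub>R (y - p))) = (\<lambda>y. 1 / t * pdx f (p + (1 / t) *\<^sub>R (y - p)))"
    "pdy (\<lambda>y. f (p + (1 / t) *\<^sub>R (y - p))) = (\<lambda>y. 1 / t * pdy f (p + (1 / t) *\<^sub>R (y - p)))"
  using has_partials_imp[OF has_partials_affine[OF smooth2_has_partials[OF assms], of "p - (1 / t) *\<^sub>R p" "1 / t"]]
  by (simp_all add: algebra_simps)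

text \<open>Convexity enters here: contracting the support of \<open>\<sigma>\<close> towards
  \<open>p\<close> with ratio \<open>t\<close> keeps it inside the domain, so the rescaled kernel
  may be used as a test function.\<close>

lemma test_fun_scaled:
  assumes \<sigma>: "test_fun \<Omega> \<sigma>" and p: "p \<in> \<Omega>" and t: "0 < t" "t \<le> 1"
  shows "test_fun \<Omega> (\<lambda>y. \<sigma> (p + (1 / t) *\<^sub>R (y - p)))"
proof -
  let ?S = "closure {q. \<sigma> q \<noteq> 0}"
  let ?f = "\<lambda>q. (1 - t) *\<^sub>R p + t *\<^sub>R q"
  have S: "compact ?S" "?S \<subseteq> \<Omega>" using \<sigma> by (auto simp: test_fun_def)
  have cI: "compact (?f ` ?S)" by (intro compact_continuous_image S continuous_intros)
  have IO: "?f ` ?S \<subseteq> \<Omega>"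
  proof (rule image_subsetI)
    fix q assume "q \<in> ?S"
    then show "?f q \<in> \<Omega>" using S(2) p t convexD[OF convex_dom p, of q "1 - t" t] by auto
  qed
  have "{y. \<sigma> (p + (1 / t) *\<^sub>R (y - p)) \<noteq> 0} \<subseteq> ?f ` ?S"
  proof
    fix y assume "y \<in> {y. \<sigma> (p + (1 / t) *\<^sub>R (y - p)) \<noteq> 0}"
    then have "p + (1 / t) *\<^sub>R (y - p) \<in> ?S" by (intro subsetD[OF closure_subset]) simp
    moreover have "y = ?f (p + (1 / t) *\<^sub>R (y - p))" using t by (simp add: algebra_simps)
    ultimately show "y \<in> ?f ` ?S" by (rule rev_image_eqI)
  qed
  then have sub: "closure {y. \<sigma> (p + (1 / t) *\<^sub>R (y - p)) \<noteq> 0} \<subseteq> ?f ` ?S"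
    by (intro closure_minimal compact_imp_closed cI)
  have "compact (?f ` ?S \<inter> closure {y. \<sigma> (p + (1 / t) *\<^sub>R (y - p)) \<noteq> 0})"
    by (intro compact_Int_closed cI closed_closure)
  then have "compact (closure {y. \<sigma> (p + (1 / t) *\<^sub>R (y - p)) \<noteq> 0})" using sub by (simp add: Int_absorb1)
  moreover have "smooth2 (\<lambda>y. \<sigma> (p + (1 / t) *\<^sub>R (y - p)))" using \<sigma> by (intro smooth2_scaled test_fun_smooth2)
  moreover have "closure {y. \<sigma> (p + (1 / t) *\<^sub>R (y - p)) \<noteq> 0} \<subseteq> \<Omega>" using sub IO by (rule subset_trans)
  ultimately show ?thesis by (simp add: test_fun_def)
qed

lemma test_fun_moment:
  assumes "test_fun \<Omega> \<sigma>"
  shows "test_fun \<Omega> (\<lambda>q. (fst q - c) * \<sigma> q)" "test_fun \<Omega> (\<lambda>q. (snd q - c) * \<sigma> q)"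
  by (intro test_fun_mult(2)[OF assms] smooth2_diff smooth2_fst smooth2_snd smooth2_const)+

text \<open>Differentiation under the integral. For \<open>|h| < t / 2\<close> the mean value
  theorem bounds the difference quotients of the kernel uniformly, and \<open>u\<close> is
  integrable, so dominated convergence applies along every sequence tending to 0.\<close>

lemma scaled_avg_derivative_integral:
  assumes u: "sqi M u" and \<sigma>: "test_fun \<Omega> \<sigma>" and t: "0 < t"
  shows "(scaled_avg \<Omega> p \<sigma> u has_real_derivative
     (\<integral>y. u y * - (inverse (t ^ 3) * (2 * \<sigma> (p + (1 / t) *\<^sub>R (y - p))
        + fst ((1 / t) *\<^sub>R (y - p)) * pdx \<sigma> (p + (1 / t) *\<^sub>R (y - p))
        + snd ((1 / t) *\<^sub>R (y - p)) * pdy \<sigma> (p + (1 / t) *\<^sub>R (y - p)))) \<partial>M)) (at t)"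
proof -
  have s: "smooth2 \<sigma>" using \<sigma> by (rule test_fun_smooth2)
  define \<kappa> where "\<kappa> q = 2 * \<sigma> q + (fst q - fst p) * pdx \<sigma> q + (snd q - snd p) * pdy \<sigma> q" for q
  have "test_fun \<Omega> \<kappa>" unfolding \<kappa>_def
    by (intro test_fun_add test_fun_moment test_fun_pd \<sigma> test_fun_mult(2)[OF \<sigma> smooth2_const])
  then obtain C where C: "C \<ge> 0" "\<And>q. \<bar>\<kappa> q\<bar> \<le> C" using test_fun_bounded by blast
  have sk: "smooth2 \<kappa>" unfolding \<kappa>_def by (intro smooth2_intros s)
  let ?r = "\<lambda>t y. inverse (t\<^sup>2) * \<sigma> (p + (1 / t) *\<^sub>R (y - p))"
  let ?r' = "\<lambda>t y. - (inverse (t ^ 3) * \<kappa> (p + (1 / t) *\<^sub>R (y - p)))"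
  have dr: "((\<lambda>t. ?r t y) has_real_derivative ?r' t y) (at t)" if "t > 0" for t y
    using scaled_smooth_has_derivative[OF s that, of p y] by (simp add: \<kappa>_def)
  \<comment> \<open>The intermediate points of the mean value theorem exceed \<open>t / 2\<close>,
    where the factor \<open>s^-3\<close> is at most \<open>(t / 2)^-3\<close>.\<close>
  define B where "B = inverse ((t / 2) ^ 3) * C"
  have r'B: "\<bar>?r' s y\<bar> \<le> B" if "s \<ge> t / 2" for s y
  proof -
    have "inverse (s ^ 3) \<le> inverse ((t / 2) ^ 3)" using that t by (intro le_imp_inverse_le power_mono) auto
    then have "inverse (s ^ 3) * \<bar>\<kappa> (p + (1 / s) *\<^sub>R (y - p))\<bar> \<le> B"
      unfolding B_def using C t by (intro mult_mono) auto
    then show ?thesis using that t by (simp add: abs_mult)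
  qed
  have lip: "\<bar>(?r (t + h) y - ?r t y) / h\<bar> \<le> B" if h: "h \<noteq> 0" "\<bar>h\<bar> < t / 2" for h y
  proof -
    have "\<exists>z. z > min t (t + h) \<and> z < max t (t + h) \<and>
       ?r (max t (t + h)) y - ?r (min t (t + h)) y = (max t (t + h) - min t (t + h)) * ?r' z y"
      by (rule MVT2) (use h t dr in auto)
    then obtain z where z: "z > min t (t + h)"
      "?r (max t (t + h)) y - ?r (min t (t + h)) y = (max t (t + h) - min t (t + h)) * ?r' z y" by blast
    have "?r (t + h) y - ?r t y = h * ?r' z y"
    proof (cases "h > 0")
      case True
      then have mm: "max t (t + h) = t + h" "min t (t + h) = t" by auto
      have c: "(t + h - t) * X = h * X" for X by simp
      show ?thesis using z(2) unfolding mm c .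
    next
      case False
      then have mm: "max t (t + h) = t" "min t (t + h) = t + h" by auto
      have c: "(t - (t + h)) * X = - (h * X)" for X by (simp add: algebra_simps)
      show ?thesis using z(2) unfolding mm c by linarith
    qed
    then have "(?r (t + h) y - ?r t y) / h = ?r' z y" using h by simp
    then show ?thesis using r'B[of z y] z(1) h by (simp add: min_def split: if_splits)
  qed
  have sr: "sqi M (?r s)" "sqi M (?r' s)" for s
    by (intro smooth2_sqi smooth2_uminus smooth2_cmult smooth2_scaled s sk)+
  have iu: "integrable M u" using sqi_integrable_mult[OF u smooth2_sqi[OF smooth2_const[of 1]]] by simp
  have "((\<lambda>h. (scaled_avg \<Omega> p \<sigma> u (t + h) - scaled_avg \<Omega> p \<sigma> u t) / h) \<longlongrightarrow> (\<integral>y. u y * ?r' t y \<partial>M)) (at 0)"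
    unfolding tendsto_at_iff_sequentially
  proof (intro allI impI)
    fix X :: "nat \<Rightarrow> real" assume X: "\<forall>i. X i \<in> UNIV - {0}" "X \<longlonglongrightarrow> 0"
    have "\<forall>\<^sub>F n in sequentially. \<bar>X n\<bar> < t / 2"
      using X(2) t by (intro order_tendstoD(2)[OF tendsto_rabs_zero]) auto
    then obtain N where N: "\<And>n. n \<ge> N \<Longrightarrow> \<bar>X n\<bar> < t / 2" by (auto simp: eventually_sequentially)
    have X0: "X n \<noteq> 0" for n using X(1) by auto
    have q: "(scaled_avg \<Omega> p \<sigma> u (t + h) - scaled_avg \<Omega> p \<sigma> u t) / h
        = (\<integral>y. u y * ((?r (t + h) y - ?r t y) / h) \<partial>M)" for h
    proof -
      have "scaled_avg \<Omega> p \<sigma> u (t + h) - scaled_avg \<Omega> p \<sigma> u t = (\<integral>y. u y * ?r (t + h) y - u y * ?r t y \<partial>M)"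
        unfolding scaled_avg_def
        by (intro Bochner_Integration.integral_diff[symmetric] sqi_integrable_mult u sr)
      then show ?thesis by (simp add: right_diff_distrib flip: integral_divide_zero)
    qed
    have "(\<lambda>n. \<integral>y. u y * ((?r (t + X (n + N)) y - ?r t y) / X (n + N)) \<partial>M) \<longlonglongrightarrow> (\<integral>y. u y * ?r' t y \<partial>M)"
    proof (rule integral_dominated_convergence[where w = "\<lambda>y. B * \<bar>u y\<bar>"])
      show "integrable M (\<lambda>y. B * \<bar>u y\<bar>)" using iu by simp
      show "(\<lambda>y. u y * ?r' t y) \<in> borel_measurable M"
        by (intro borel_measurable_times sqi_measurable u sr)
      show "(\<lambda>y. u y * ((?r (t + X (n + N)) y - ?r t y) / X (n + N))) \<in> borel_measurable M" for n
        by (intro borel_measurable_times borel_measurable_divide borel_measurable_diff borel_measurable_const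
            sqi_measurable[OF u] sqi_measurable[OF sr(1)])
      show "AE y in M. norm (u y * ((?r (t + X (n + N)) y - ?r t y) / X (n + N))) \<le> B * \<bar>u y\<bar>" for n
      proof (rule AE_I2)
        fix y
        have "\<bar>u y\<bar> * \<bar>(?r (t + X (n + N)) y - ?r t y) / X (n + N)\<bar> \<le> \<bar>u y\<bar> * B"
          by (intro mult_left_mono lip X0 N) auto
        then show "norm (u y * ((?r (t + X (n + N)) y - ?r t y) / X (n + N))) \<le> B * \<bar>u y\<bar>"
          by (simp only: real_norm_def abs_mult mult.commute)
      qed
      show "AE y in M. (\<lambda>n. u y * ((?r (t + X (n + N)) y - ?r t y) / X (n + N))) \<longlonglongrightarrow> u y * ?r' t y"
      proof (rule AE_I2, rule tendsto_mult[OF tendsto_const])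
        fix y
        have "((\<lambda>h. (?r (t + h) y - ?r t y) / h) \<longlongrightarrow> ?r' t y) (at 0)"
          using dr[OF t, of y] by (simp add: DERIV_def)
        then have "((\<lambda>h. (?r (t + h) y - ?r t y) / h) \<circ> X) \<longlonglongrightarrow> ?r' t y"
          unfolding tendsto_at_iff_sequentially using X by blast
        from LIMSEQ_ignore_initial_segment[OF this, of N]
        show "(\<lambda>n. (?r (t + X (n + N)) y - ?r t y) / X (n + N)) \<longlonglongrightarrow> ?r' t y" by (simp only: o_def)
      qed
    qed
    then have "(\<lambda>n. (scaled_avg \<Omega> p \<sigma> u (t + X (n + N)) - scaled_avg \<Omega> p \<sigma> u t) / X (n + N))
       \<longlonglongrightarrow> (\<integral>y. u y * ?r' t y \<partial>M)" unfolding q .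
    from LIMSEQ_offset[OF this]
    show "((\<lambda>h. (scaled_avg \<Omega> p \<sigma> u (t + h) - scaled_avg \<Omega> p \<sigma> u t) / h) \<circ> X) \<longlonglongrightarrow> (\<integral>y. u y * ?r' t y \<partial>M)"
      by (simp only: o_def)
  qed
  then show ?thesis unfolding DERIV_def by (simp add: \<kappa>_def)
qed

text \<open>The kernel \<open>k\<^sub>t(y) = t\<^sup>-\<^sup>2 \<sigma>(p + (y - p) / t)\<close> satisfies
  \<open>\<partial>\<^sub>t k\<^sub>t = - div ((y - p) / t k\<^sub>t)\<close>, so that differentiating the average in \<open>t\<close> produces averages
  of the weak derivatives.\<close>

lemma scaled_avg_derivative:
  assumes u: "sqi M u" "sqi M ux" "sqi M uy" "weak_x \<Omega> u ux" "weak_y \<Omega> u uy"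
    and \<sigma>: "test_fun \<Omega> \<sigma>" and p: "p \<in> \<Omega>" and t: "0 < t" "t \<le> 1"
  shows "(scaled_avg \<Omega> p \<sigma> u has_real_derivative
     scaled_avg \<Omega> p (\<lambda>q. (fst q - fst p) * \<sigma> q) ux t + scaled_avg \<Omega> p (\<lambda>q. (snd q - snd p) * \<sigma> q) uy t) (at t)"
proof -
  have s: "smooth2 \<sigma>" using \<sigma> by (rule test_fun_smooth2)
  let ?q = "\<lambda>y. p + (1 / t) *\<^sub>R (y - p)"
  let ?\<sigma>x = "\<lambda>q. (fst q - fst p) * \<sigma> q" and ?\<sigma>y = "\<lambda>q. (snd q - snd p) * \<sigma> q"
  let ?\<phi>x = "\<lambda>y. inverse (t\<^sup>2) * ?\<sigma>x (?q y)" and ?\<phi>y = "\<lambda>y. inverse (t\<^sup>2) * ?\<sigma>y (?q y)"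
  have sx: "smooth2 ?\<sigma>x" "smooth2 ?\<sigma>y" by (intro smooth2_intros s)+
  have t\<phi>: "test_fun \<Omega> ?\<phi>x" "test_fun \<Omega> ?\<phi>y"
    by (rule test_fun_mult(2)[OF test_fun_scaled[OF test_fun_moment(1)[OF \<sigma>] p t] smooth2_const])
       (rule test_fun_mult(2)[OF test_fun_scaled[OF test_fun_moment(2)[OF \<sigma>] p t] smooth2_const])
  have "pdx ?\<sigma>x = (\<lambda>q. \<sigma> q + (fst q - fst p) * pdx \<sigma> q)" "pdy ?\<sigma>y = (\<lambda>q. \<sigma> q + (snd q - snd p) * pdy \<sigma> q)"
    by (simp_all add: pd_mult pd_diff pd_fst pd_snd pd_const smooth2_diff smooth2_fst smooth2_snd smooth2_const s)
  then have pd: "pdx ?\<phi>x = (\<lambda>y. inverse (t\<^sup>2) * (1 / t * (\<sigma> (?q y) + (fst (?q y) - fst p) * pdx \<sigma> (?q y))))"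
    "pdy ?\<phi>y = (\<lambda>y. inverse (t\<^sup>2) * (1 / t * (\<sigma> (?q y) + (snd (?q y) - snd p) * pdy \<sigma> (?q y))))"
    using pd_cmult(1)[OF smooth2_scaled[OF sx(1)], of "inverse (t\<^sup>2)" p t]
      pd_cmult(2)[OF smooth2_scaled[OF sx(2)], of "inverse (t\<^sup>2)" p t]
      pd_scaled(1)[OF sx(1), of p t] pd_scaled(2)[OF sx(2), of p t] by simp_all
  have si: "sqi M (pdx ?\<phi>x)" "sqi M (pdy ?\<phi>y)"
    by (rule test_fun_sqi[OF test_fun_pd(1)[OF t\<phi>(1)]], rule test_fun_sqi[OF test_fun_pd(2)[OF t\<phi>(2)]])
  have "(\<integral>y. u y * - (inverse (t ^ 3) * (2 * \<sigma> (?q y) + fst ((1 / t) *\<^sub>R (y - p)) * pdx \<sigma> (?q y)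
        + snd ((1 / t) *\<^sub>R (y - p)) * pdy \<sigma> (?q y))) \<partial>M)
      = (\<integral>y. - (u y * pdx ?\<phi>x y) + - (u y * pdy ?\<phi>y y) \<partial>M)"
  proof (rule Bochner_Integration.integral_cong[OF refl])
    fix y
    have i3: "inverse (t ^ 3) = inverse (t\<^sup>2) * (1 / t)"
      using t by (simp add: field_simps power2_eq_square power3_eq_cube)
    have g: "U * - (inverse (t ^ 3) * (2 * S + \<alpha> * A + \<beta> * B))
       = - (U * (inverse (t\<^sup>2) * (1 / t * (S + \<alpha> * A)))) + - (U * (inverse (t\<^sup>2) * (1 / t * (S + \<beta> * B))))"
      for U S A B \<alpha> \<beta> :: real
    proof -
      have k: "inverse (t\<^sup>2) * (1 / t * Z) = inverse (t ^ 3) * Z" for Z by (simp only: i3 mult.assoc)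
      show ?thesis unfolding k by (simp add: algebra_simps)
    qed
    have e: "fst (?q y) - fst p = fst ((1 / t) *\<^sub>R (y - p))" "snd (?q y) - snd p = snd ((1 / t) *\<^sub>R (y - p))"
      by simp_all
    show "u y * - (inverse (t ^ 3) * (2 * \<sigma> (?q y) + fst ((1 / t) *\<^sub>R (y - p)) * pdx \<sigma> (?q y)
        + snd ((1 / t) *\<^sub>R (y - p)) * pdy \<sigma> (?q y))) = - (u y * pdx ?\<phi>x y) + - (u y * pdy ?\<phi>y y)"
      unfolding pd e by (rule g)
  qed
  also have "\<dots> = - (\<integral>y. u y * pdx ?\<phi>x y \<partial>M) + - (\<integral>y. u y * pdy ?\<phi>y y \<partial>M)"
    using sqi_integrable_mult[OF u(1) si(1)] sqi_integrable_mult[OF u(1) si(2)] by simp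
  also have "\<dots> = (\<integral>y. ux y * ?\<phi>x y \<partial>M) + (\<integral>y. uy y * ?\<phi>y y \<partial>M)"
    using u(4,5) t\<phi> by (simp only: weak_x_def weak_y_def)
  also have "\<dots> = scaled_avg \<Omega> p ?\<sigma>x ux t + scaled_avg \<Omega> p ?\<sigma>y uy t"
    by (simp only: scaled_avg_def)
  finally show ?thesis using scaled_avg_derivative_integral[OF u(1) \<sigma> t(1), of p] by (simp only:)
qed

lemma mem_scaled_box:
  fixes p y a :: pt
  assumes t: "t > 0"
  shows "p + (1 / t) *\<^sub>R (y - p) \<in> box a (a + s *\<^sub>R One) \<longleftrightarrow>
    y \<in> box (p + t *\<^sub>R (a - p)) (p + t *\<^sub>R (a - p) + (t * s) *\<^sub>R One)"
proof -
  have l: "c < x + 1 / t * (z - x) \<longleftrightarrow> x + t * (c - x) < z" for c x z :: real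
  proof -
    have e: "x + 1 / t * (z - x) - c = (z - (x + t * (c - x))) / t" using t by (simp add: field_simps)
    have "c < x + 1 / t * (z - x) \<longleftrightarrow> 0 < x + 1 / t * (z - x) - c" by linarith
    also have "\<dots> \<longleftrightarrow> 0 < z - (x + t * (c - x))" unfolding e using t by (simp only: zero_less_divide_iff) auto
    finally show ?thesis by linarith
  qed
  have r: "x + 1 / t * (z - x) < c + s \<longleftrightarrow> z < x + t * (c - x) + t * s" for c x z :: real
  proof -
    have e: "c + s - (x + 1 / t * (z - x)) = (x + t * (c - x) + t * s - z) / t" using t by (simp add: field_simps)
    have "x + 1 / t * (z - x) < c + s \<longleftrightarrow> 0 < c + s - (x + 1 / t * (z - x))" by linarith
    also have "\<dots> \<longleftrightarrow> 0 < x + t * (c - x) + t * s - z" unfolding e using t by (simp only: zero_less_divide_iff) auto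
    finally show ?thesis by linarith
  qed
  show ?thesis
    unfolding mem_box_pt fst_add snd_add fst_scaleR snd_scaleR fst_diff snd_diff One_pt real_scaleR_def mult_1_right
    by (simp only: l r)
qed

text \<open>The rescaled kernel lives on a box of side \<open>t s\<close>, so its L2 norm is at most
  \<open>t^-2 c (t s) = c s / t\<close>. In the plane the loss is thus only one power of
  \<open>t\<close>, just what \<open>second_derivative_bound\<close> can afford.\<close>

lemma scaled_avg_bound:
  assumes u: "sqi M u" and \<sigma>: "\<And>q. \<bar>\<sigma> q\<bar> \<le> c * indicator (box a (a + s *\<^sub>R One)) q" "\<sigma> \<in> borel_measurable borel"
    and s: "s > 0" and c: "c \<ge> 0" and t: "t > 0"
  shows "\<bar>scaled_avg \<Omega> p \<sigma> u t\<bar> \<le> c * s * nrm M u / t"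
proof -
  let ?q = "\<lambda>y. p + (1 / t) *\<^sub>R (y - p)"
  let ?b = "p + t *\<^sub>R (a - p)"
  let ?B = "box ?b (?b + (t * s) *\<^sub>R One)"
  have in_box: "?q y \<in> box a (a + s *\<^sub>R One) \<longleftrightarrow> y \<in> ?B" for y
    using t by (rule mem_scaled_box)
  have qm: "?q \<in> borel_measurable borel" by (intro borel_measurable_continuous_onI continuous_intros)
  have meas: "(\<lambda>y. \<sigma> (?q y)) \<in> borel_measurable M"
    unfolding msr_def by (rule measurable_restrict_space1) (use measurable_compose[OF qm \<sigma>(2)] in simp)
  have \<sigma>b: "\<bar>\<sigma> (?q y)\<bar> \<le> c * indicator ?B y" for y
    using \<sigma>(1)[of "?q y"] in_box[of y] by (simp add: indicator_def)
  have sB: "sqi M (indicator ?B)"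
  proof (rule sqi_bounded[OF finite_msr])
    show "indicator ?B \<in> borel_measurable M" unfolding msr_def by (rule measurable_restrict_space1) simp
    show "AE y in M. \<bar>indicator ?B y :: real\<bar> \<le> 1" by (auto simp: indicator_def)
  qed
  have sq: "sqi M (\<lambda>y. \<sigma> (?q y))"
  proof (rule sqi_bounded[OF finite_msr meas])
    show "AE y in M. \<bar>\<sigma> (?q y)\<bar> \<le> c"
    proof (rule AE_I2)
      fix y show "\<bar>\<sigma> (?q y)\<bar> \<le> c" using \<sigma>b[of y] c by (cases "y \<in> ?B") auto
    qed
  qed
  have "(nrm M (\<lambda>y. \<sigma> (?q y)))\<^sup>2 \<le> (\<integral>y. c\<^sup>2 * indicator ?B y \<partial>M)"
    unfolding nrm_power2
  proof (rule integral_mono)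
    show "integrable M (\<lambda>y. (\<sigma> (?q y))\<^sup>2)" using sq by (simp add: sqi_def)
    show "integrable M (\<lambda>y. c\<^sup>2 * indicator ?B y)"
      using sqi_integrable_mult[OF smooth2_sqi[OF smooth2_const[of "c\<^sup>2"]] sB] by simp
    fix y
    have "\<bar>\<sigma> (?q y)\<bar>\<^sup>2 \<le> (c * indicator ?B y)\<^sup>2" by (intro power_mono \<sigma>b) simp
    then show "(\<sigma> (?q y))\<^sup>2 \<le> c\<^sup>2 * indicator ?B y" by (cases "y \<in> ?B") auto
  qed
  also have "\<dots> = c\<^sup>2 * (\<integral>y. indicator ?B y \<partial>M)" by simp
  also have "\<dots> \<le> c\<^sup>2 * (t * s)\<^sup>2"
  proof (rule mult_left_mono[OF _ zero_le_power2])
    have "(\<integral>y. (indicator ?B y :: real) \<partial>M) = (\<integral>y. indicator (\<Omega> \<inter> ?B) y \<partial>lborel)"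
    proof -
      have "(indicator (\<Omega> \<inter> ?B) :: pt \<Rightarrow> real) = (\<lambda>y. indicator \<Omega> y *\<^sub>R indicator ?B y)"
        by (rule ext) (simp add: indicator_inter_arith)
      then show ?thesis unfolding msr_def by (subst integral_restrict_space) simp_all
    qed
    also have "\<dots> = measure lborel (\<Omega> \<inter> ?B)" by simp
    also have "\<dots> \<le> measure lborel ?B"
      by (intro measure_mono_fmeasurable) (auto simp: fmeasurable_def emeasure_lborel_box_finite[unfolded infinity_ennreal_def])
    also have "\<dots> = (t * s)\<^sup>2"
    proof -
      have o: "(One :: pt) \<bullet> b = 1" if "b \<in> Basis" for b
        using inner_sum_left_Basis[OF that, of "\<lambda>_. 1"] by simp
      have le: "?b \<bullet> b \<le> (?b + (t * s) *\<^sub>R One) \<bullet> b" if "b \<in> Basis" for b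
        unfolding inner_add_left inner_scaleR_left o[OF that] using t s by simp
      have "measure lborel ?B = (\<Prod>b\<in>Basis. (?b + (t * s) *\<^sub>R One - ?b) \<bullet> b)"
        by (rule measure_lborel_box[OF le])
      also have "\<dots> = (\<Prod>b\<in>(Basis :: pt set). t * s)"
        by (rule prod.cong[OF refl]) (simp only: add_diff_cancel_left' inner_scaleR_left o mult_1_right)
      also have "\<dots> = (t * s)\<^sup>2" by (simp only: prod_constant DIM_prod DIM_real one_add_one)
      finally show ?thesis .
    qed
    finally show "(\<integral>y. indicator ?B y \<partial>M) \<le> (t * s)\<^sup>2" .
  qed
  finally have "(nrm M (\<lambda>y. \<sigma> (?q y)))\<^sup>2 \<le> (c * (t * s))\<^sup>2"
    unfolding power_mult_distrib[of c] .
  then have n: "nrm M (\<lambda>y. \<sigma> (?q y)) \<le> c * (t * s)"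
    by (rule power2_le_imp_le) (use c t s in simp)
  have "scaled_avg \<Omega> p \<sigma> u t = inverse (t\<^sup>2) * (\<integral>y. u y * \<sigma> (?q y) \<partial>M)"
    unfolding scaled_avg_def
    by (simp only: mult.left_commute[of _ "inverse (t\<^sup>2)"] integral_mult_right_zero)
  then have "\<bar>scaled_avg \<Omega> p \<sigma> u t\<bar> = inverse (t\<^sup>2) * \<bar>\<integral>y. u y * \<sigma> (?q y) \<partial>M\<bar>"
    by (simp only: abs_mult abs_inverse abs_power2)
  also have "\<dots> \<le> inverse (t\<^sup>2) * (nrm M u * (c * (t * s)))"
    using order_trans[OF Cauchy_Schwarz_integral[OF u sq] mult_left_mono[OF n nrm_nonneg]]
    by (intro mult_left_mono) auto
  also have "\<dots> = inverse (t\<^sup>2) * t * (c * s * nrm M u)" by (simp only: mult_ac)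
  also have "inverse (t\<^sup>2) * t = 1 / t"
    using t by (simp only: power2_eq_square inverse_mult_distrib mult.assoc) (simp add: inverse_eq_divide)
  also have "1 / t * (c * s * nrm M u) = c * s * nrm M u / t" by simp
  finally show ?thesis .
qed

text \<open>Fix a small cube \<open>Q\<close> in the domain and average \<open>u\<close> over its
  copies shrunk towards \<open>p\<close>. As a function of \<open>t\<close> the average has a second
  derivative made of averages of the second derivatives of \<open>u\<close>, of size
  \<open>1 / t\<close>; so it is bounded uniformly in \<open>t\<close> and \<open>p\<close>. Every
  small cube is such a copy, and \<open>cube_averages_bound\<close> concludes.\<close>

lemma sobolev_bound:
  assumes u: "sqi M u" "sqi M ux" "sqi M uy" "sqi M uxx" "sqi M uxy" "sqi M uyy"
    and w: "weak_x \<Omega> u ux" "weak_y \<Omega> u uy" "weak_x \<Omega> ux uxx" "weak_y \<Omega> ux uxy" "weak_x \<Omega> uy uxy" "weak_y \<Omega> uy uyy"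
  shows "\<exists>C. AE p in M. \<bar>u p\<bar> \<le> C"
proof (cases "\<Omega> = {}")
  case True
  then have "AE p in M. \<bar>u p\<bar> \<le> 0" by (intro AE_msrI) auto
  then show ?thesis by blast
next
  case False
  then obtain a where a: "a \<in> \<Omega>" by blast
  obtain d where d: "d > 0" "\<And>h. 0 < h \<Longrightarrow> h < d \<Longrightarrow> cbox a (a + h *\<^sub>R One) \<subseteq> \<Omega>"
    using small_cubes_in_dom[OF a] by blast
  define s where "s = d / 2"
  have s: "s > 0" "cbox a (a + s *\<^sub>R One) \<subseteq> \<Omega>" using d by (auto simp: s_def)
  let ?Q = "box a (a + s *\<^sub>R One)"
  have Q: "?Q \<subseteq> \<Omega>" using s(2) box_subset_cbox by blast
  obtain C1 C2 where C12: "\<forall>p\<in>\<Omega>. \<bar>fst p\<bar> \<le> C1" "\<forall>p\<in>\<Omega>. \<bar>snd p\<bar> \<le> C2"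
    using cont_bounded_msr[OF continuous_on_fst[OF continuous_on_id]]
      cont_bounded_msr[OF continuous_on_snd[OF continuous_on_id]] by blast
  define D where "D = 2 * (\<bar>C1\<bar> + \<bar>C2\<bar>)"
  have D: "D \<ge> 0" by (simp add: D_def)
  have Dq: "\<bar>fst q - fst p\<bar> \<le> D" "\<bar>snd q - snd p\<bar> \<le> D" if "p \<in> \<Omega>" "q \<in> \<Omega>" for p q
  proof -
    have "\<bar>fst q - fst p\<bar> \<le> 2 * C1" using bspec[OF C12(1) that(1)] bspec[OF C12(1) that(2)] by linarith
    also have "\<dots> \<le> D" by (simp add: D_def)
    finally show "\<bar>fst q - fst p\<bar> \<le> D" .
    have "\<bar>snd q - snd p\<bar> \<le> 2 * C2" using bspec[OF C12(2) that(1)] bspec[OF C12(2) that(2)] by linarith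
    also have "\<dots> \<le> D" by (simp add: D_def)
    finally show "\<bar>snd q - snd p\<bar> \<le> D" .
  qed
  \<comment> \<open>Each differentiation in \<open>t\<close> multiplies the kernel by a coordinate
    difference, at most \<open>D\<close> on the domain. The mixed derivative arises twice, once from
    \<open>ux\<close> and once from \<open>uy\<close>.\<close>
  define m where "m = D * D * s * (nrm M uxx + 2 * nrm M uxy + nrm M uyy)"
  define c where "c = D * s * (nrm M ux + nrm M uy)"
  define K where "K = s * nrm M u + c + m"
  have mc: "m \<ge> 0" "c \<ge> 0" using D s by (auto simp: m_def c_def)
  have bump_avg: "\<bar>scaled_avg \<Omega> p (bump a (a + s *\<^sub>R One) n) u t\<bar> \<le> K"
    if p: "p \<in> \<Omega>" and t: "0 < t" "t \<le> 1" for p t n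
  proof -
    let ?\<sigma> = "bump a (a + s *\<^sub>R One) n"
    let ?X = "\<lambda>\<sigma> q. (fst q - fst p) * \<sigma> q" and ?Y = "\<lambda>\<sigma> q. (snd q - snd p) * \<sigma> q"
    have T: "test_fun \<Omega> ?\<sigma>" by (rule test_fun_bump[OF s(2)])
    have TX: "test_fun \<Omega> (?X \<sigma>)" "test_fun \<Omega> (?Y \<sigma>)" if "test_fun \<Omega> \<sigma>" for \<sigma>
      using that by (rule test_fun_moment)+
    have B0: "\<bar>?\<sigma> q\<bar> \<le> 1 * indicator ?Q q" for q using bump_le_indicator[of a "a + s *\<^sub>R One" n q] by simp
    have BX: "\<bar>?X \<sigma> q\<bar> \<le> (D * k) * indicator ?Q q" "\<bar>?Y \<sigma> q\<bar> \<le> (D * k) * indicator ?Q q"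
      if "\<And>q. \<bar>\<sigma> q\<bar> \<le> k * indicator ?Q q" for \<sigma> k q
    proof -
      show "\<bar>?X \<sigma> q\<bar> \<le> (D * k) * indicator ?Q q" "\<bar>?Y \<sigma> q\<bar> \<le> (D * k) * indicator ?Q q"
        using that[of q] Q Dq[OF p, of q] D mult_mono[of "\<bar>fst q - fst p\<bar>" D "\<bar>\<sigma> q\<bar>" k]
          mult_mono[of "\<bar>snd q - snd p\<bar>" D "\<bar>\<sigma> q\<bar>" k]
        by (cases "q \<in> ?Q"; auto simp: abs_mult)+
    qed
    have bound: "\<bar>scaled_avg \<Omega> p \<sigma> v r\<bar> \<le> k * s * nrm M v / r"
      if "test_fun \<Omega> \<sigma>" "\<And>q. \<bar>\<sigma> q\<bar> \<le> k * indicator ?Q q" "k \<ge> 0" "sqi M v" "r > 0" for \<sigma> k v r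
      using that s smooth2_cont[OF test_fun_smooth2[OF that(1)]]
      by (intro scaled_avg_bound[where a = a]) (auto intro: borel_measurable_continuous_onI)
    let ?G = "scaled_avg \<Omega> p ?\<sigma> u"
    let ?G' = "\<lambda>r. scaled_avg \<Omega> p (?X ?\<sigma>) ux r + scaled_avg \<Omega> p (?Y ?\<sigma>) uy r"
    let ?G'' = "\<lambda>r. (scaled_avg \<Omega> p (?X (?X ?\<sigma>)) uxx r + scaled_avg \<Omega> p (?Y (?X ?\<sigma>)) uxy r)
        + (scaled_avg \<Omega> p (?X (?Y ?\<sigma>)) uxy r + scaled_avg \<Omega> p (?Y (?Y ?\<sigma>)) uyy r)"
    have "\<bar>?G t\<bar> \<le> s * nrm M u + c + m"
    proof (rule second_derivative_bound[where G = ?G and G' = ?G' and G'' = ?G'', OF _ _ _ _ _ mc t])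
      fix r :: real assume r: "0 < r" "r \<le> 1"
      show "(?G has_real_derivative ?G' r) (at r)"
        by (rule scaled_avg_derivative[OF u(1-3) w(1,2) T p r])
      show "(?G' has_real_derivative ?G'' r) (at r)"
        by (intro DERIV_add scaled_avg_derivative[OF u(2,4,5) w(3,4) TX(1)[OF T] p r]
            scaled_avg_derivative[OF u(3,5,6) w(5,6) TX(2)[OF T] p r])
      have "\<bar>?G'' r\<bar> \<le> (D * (D * 1) * s * nrm M uxx / r + D * (D * 1) * s * nrm M uxy / r)
          + (D * (D * 1) * s * nrm M uxy / r + D * (D * 1) * s * nrm M uyy / r)"
        by (intro order_trans[OF abs_triangle_ineq] add_mono bound TX T BX B0 mult_nonneg_nonneg D u r) auto
      also have "\<dots> = m / r" by (simp add: m_def add_divide_distrib algebra_simps)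
      finally show "\<bar>?G'' r\<bar> \<le> m / r" .
    next
      have "\<bar>?G' 1\<bar> \<le> D * 1 * s * nrm M ux / 1 + D * 1 * s * nrm M uy / 1"
        by (intro order_trans[OF abs_triangle_ineq] add_mono bound TX T BX B0 mult_nonneg_nonneg D u) auto
      then show "\<bar>?G' 1\<bar> \<le> c" by (simp add: c_def algebra_simps)
      show "\<bar>?G 1\<bar> \<le> s * nrm M u" using bound[OF T B0 _ u(1), of 1] by simp
    qed
    then show ?thesis by (simp only: K_def)
  qed
  have iu: "integrable M u" using sqi_integrable_mult[OF u(1) smooth2_sqi[OF smooth2_const[of 1]]] by simp
  \<comment> \<open>\<open>K\<close> does not depend on \<open>n\<close>, so the smooth kernels may
    be replaced by the indicator of \<open>Q\<close> in the limit. The factor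
    \<open>t\<^sup>2\<close> undoes the normalisation in \<open>scaled_avg\<close>.\<close>
  have box_avg: "\<bar>\<integral>y. u y * indicator (box (p + t *\<^sub>R (a - p)) (p + t *\<^sub>R (a - p) + (t * s) *\<^sub>R One)) y \<partial>M\<bar> \<le> t\<^sup>2 * K"
    if p: "p \<in> \<Omega>" and t: "0 < t" "t \<le> 1" for p t
  proof -
    let ?q = "\<lambda>y. p + (1 / t) *\<^sub>R (y - p)"
    let ?B = "box (p + t *\<^sub>R (a - p)) (p + t *\<^sub>R (a - p) + (t * s) *\<^sub>R One)"
    let ?\<sigma> = "bump a (a + s *\<^sub>R One)"
    have in_box: "?q y \<in> ?Q \<longleftrightarrow> y \<in> ?B" for y
      using t(1) by (rule mem_scaled_box)
    have "(\<lambda>n. \<integral>y. u y * (?\<sigma> n (?q y)) \<partial>M) \<longlonglongrightarrow> (\<integral>y. u y * indicator ?B y \<partial>M)"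
    proof (rule integral_dominated_convergence[where w = "\<lambda>y. \<bar>u y\<bar>"])
      show "integrable M (\<lambda>y. \<bar>u y\<bar>)" using iu by simp
      have "indicator ?B \<in> borel_measurable M" unfolding msr_def by (rule measurable_restrict_space1) simp
      then show "(\<lambda>y. u y * indicator ?B y) \<in> borel_measurable M"
        by (intro borel_measurable_times sqi_measurable[OF u(1)])
      show "(\<lambda>y. u y * ?\<sigma> n (?q y)) \<in> borel_measurable M" for n
        by (intro borel_measurable_times sqi_measurable[OF u(1)] smooth2_measurable smooth2_scaled smooth2_bump)
      show "AE y in M. norm (u y * ?\<sigma> n (?q y)) \<le> \<bar>u y\<bar>" for n
      proof (rule AE_I2)
        fix y show "norm (u y * ?\<sigma> n (?q y)) \<le> \<bar>u y\<bar>"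
          using bump_range[of a "a + s *\<^sub>R One" n "?q y"] by (simp add: abs_mult mult_left_le)
      qed
      show "AE y in M. (\<lambda>n. u y * ?\<sigma> n (?q y)) \<longlonglongrightarrow> u y * indicator ?B y"
      proof (rule AE_I2, rule tendsto_mult[OF tendsto_const])
        fix y
        have "(indicator ?B y :: real) = indicator ?Q (?q y)" using in_box[of y] by (simp add: indicator_def)
        then show "(\<lambda>n. ?\<sigma> n (?q y)) \<longlonglongrightarrow> indicator ?B y" using bump_tendsto by simp
      qed
    qed
    then have l: "(\<lambda>n. \<bar>\<integral>y. u y * (?\<sigma> n (?q y)) \<partial>M\<bar>) \<longlonglongrightarrow> \<bar>\<integral>y. u y * indicator ?B y \<partial>M\<bar>"
      by (rule tendsto_rabs)
    have "\<bar>\<integral>y. u y * (?\<sigma> n (?q y)) \<partial>M\<bar> \<le> t\<^sup>2 * K" for n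
    proof -
      have "(\<integral>y. u y * (?\<sigma> n (?q y)) \<partial>M) = t\<^sup>2 * scaled_avg \<Omega> p (?\<sigma> n) u t"
      proof -
        have "scaled_avg \<Omega> p (?\<sigma> n) u t = inverse (t\<^sup>2) * (\<integral>y. u y * (?\<sigma> n (?q y)) \<partial>M)"
          unfolding scaled_avg_def
          by (simp only: mult.left_commute[of _ "inverse (t\<^sup>2)"] integral_mult_right_zero)
        then show ?thesis using t by simp
      qed
      then show ?thesis using bump_avg[OF p t, of n] by (simp add: abs_mult mult_left_mono)
    qed
    then show ?thesis by (intro tendsto_upperbound[OF l]) auto
  qed
  have "AE p in M. \<bar>u p\<bar> \<le> K / s\<^sup>2"
  proof (rule cube_averages_bound[OF iu])
    fix x assume x: "x \<in> \<Omega>"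
    \<comment> \<open>A cube with corner \<open>x\<close> and side \<open>t s\<close> is the copy of
      \<open>Q\<close> shrunk towards the point \<open>p\<close> with
      \<open>p + t (a - p) = x\<close>. Solving for \<open>p\<close> gives
      \<open>(x - t a) / (1 - t)\<close>, which tends to \<open>x\<close> and so lies in the domain
      for small \<open>t\<close>.\<close>
    have cont: "((\<lambda>t. (1 / (1 - t)) *\<^sub>R (x - t *\<^sub>R a)) \<longlongrightarrow> (1 / (1 - 0)) *\<^sub>R (x - 0 *\<^sub>R a)) (at_right 0)"
      by (intro tendsto_intros) auto
    have "\<forall>\<^sub>F t in at_right 0. (1 / (1 - t)) *\<^sub>R (x - t *\<^sub>R a) \<in> \<Omega>"
      by (rule topological_tendstoD[OF cont open_dom]) (use x in simp)
    then obtain e where e: "e > 0" "\<And>t. 0 < t \<Longrightarrow> t < e \<Longrightarrow> (1 / (1 - t)) *\<^sub>R (x - t *\<^sub>R a) \<in> \<Omega>"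
      unfolding eventually_at_right_field by blast
    show "\<exists>d>0. \<forall>h. 0 < h \<and> h < d \<longrightarrow>
        \<bar>\<integral>p. u p * indicator (box x (x + h *\<^sub>R One)) p \<partial>M\<bar> \<le> K / s\<^sup>2 * h\<^sup>2"
    \<comment> \<open>Side length \<open>h\<close> corresponds to \<open>t = h / s\<close>; the
      bound \<open>e\<close> keeps the centre in the domain, and \<open>1 / 2\<close> keeps
      \<open>1 - t\<close> away from 0.\<close>
    proof (intro exI[of _ "s * min e (1 / 2)"] conjI allI impI)
      show "0 < s * min e (1 / 2)" using s e by simp
      fix h assume h: "0 < h \<and> h < s * min e (1 / 2)"
      define t where "t = h / s"
      have "t < min e (1 / 2)" using h s unfolding t_def by (simp only: pos_divide_less_eq mult.commute)
      then have t: "0 < t" "t < e" "t < 1 / 2" "t * s = h" using h s by (auto simp: t_def)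
      let ?p = "(1 / (1 - t)) *\<^sub>R (x - t *\<^sub>R a)"
      have gen: "P + t *\<^sub>R (a - P) = (1 - t) *\<^sub>R P + t *\<^sub>R a" for P by (simp add: algebra_simps)
      have "?p + t *\<^sub>R (a - ?p) = (1 - t) *\<^sub>R ?p + t *\<^sub>R a" by (rule gen)
      also have "(1 - t) *\<^sub>R ?p = x - t *\<^sub>R a" using t(3) by (simp only: scaleR_scaleR) simp
      also have "x - t *\<^sub>R a + t *\<^sub>R a = x" by simp
      finally have px: "?p + t *\<^sub>R (a - ?p) = x" .
      have "\<bar>\<integral>p. u p * indicator (box x (x + h *\<^sub>R One)) p \<partial>M\<bar> \<le> t\<^sup>2 * K"
        using box_avg[OF e(2)[OF t(1,2)] t(1)] t(3) unfolding px t(4) by simp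
      also have "\<dots> = K / s\<^sup>2 * h\<^sup>2" using s by (simp add: t_def power_divide)
      finally show "\<bar>\<integral>p. u p * indicator (box x (x + h *\<^sub>R One)) p \<partial>M\<bar> \<le> K / s\<^sup>2 * h\<^sup>2" .
    qed
  qed
  then show ?thesis by blast
qed

end

section \<open>Restriction to open subsets of the domain\<close>

context bounded_open
begin

lemma subdomain:
  assumes "open K" "K \<subseteq> \<Omega>"
  shows "bounded_open K" "sqi M f \<Longrightarrow> sqi (msr K) f"
    "test_fun K \<phi> \<Longrightarrow> (\<integral>p. f p * \<phi> p \<partial>msr K) = (\<integral>p. f p * \<phi> p \<partial>M)"
proof -
  show K: "bounded_open K" using assms bounded_dom by unfold_locales (auto intro: bounded_subset)
  have m: "msr K = restrict_space M K"
    unfolding msr_def by (subst restrict_restrict_space) (use assms in \<open>auto simp: Int_absorb1\<close>)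
  have Ks: "K \<inter> space M \<in> sets M" using assms
    by (simp add: msr_def space_restrict_space sets_restrict_space_iff Int_absorb2)
  show "sqi (msr K) f" if f: "sqi M f"
    unfolding sqi_def m
  proof
    show "f \<in> borel_measurable (restrict_space M K)" using sqi_measurable[OF f] by (rule measurable_restrict_space1)
    show "integrable (restrict_space M K) (\<lambda>p. (f p)\<^sup>2)"
      using f integrable_mult_indicator[of K M "\<lambda>p. (f p)\<^sup>2"] Ks assms(2)
      by (subst integrable_restrict_space) (auto simp: sqi_def Int_absorb2 space_msr Int_commute)
  qed
  show "(\<integral>p. f p * \<phi> p \<partial>msr K) = (\<integral>p. f p * \<phi> p \<partial>M)" if \<phi>: "test_fun K \<phi>"
  proof -
    have "indicator K p *\<^sub>R (f p * \<phi> p) = f p * \<phi> p" for p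
      using test_fun_zero_outside[OF \<phi>, of p] by (cases "p \<in> K") auto
    then have e: "(\<lambda>p. indicator K p *\<^sub>R (f p * \<phi> p)) = (\<lambda>p. f p * \<phi> p)" by (rule ext)
    show ?thesis unfolding m by (subst integral_restrict_space[OF Ks]) (simp only: e)
  qed
qed

text \<open>Test functions of \<open>K\<close> are test functions of the domain, so the restriction
  of the global weak derivative is a weak derivative on \<open>K\<close>, where it must agree with
  the classical derivative of \<open>g\<close>.\<close>

lemma wd_eq_on_subdomain:
  assumes K: "open K" "K \<subseteq> \<Omega>" and f: "Hk \<Omega> k f" "i + j \<le> k" and g: "smooth2 g" "\<And>p. p \<in> K \<Longrightarrow> f p = g p"
  shows "AE p in M. p \<in> K \<longrightarrow> wd \<Omega> i j f p = cpd i j g p"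
proof -
  interpret K: bounded_open K using K by (rule subdomain)
  have "AE p in msr K. wd \<Omega> i j f p = cpd i j g p"
  proof (rule K.weak_deriv_unique[where f = g])
    show "sqi (msr K) (wd \<Omega> i j f)" by (intro subdomain(2)[OF K] wd_spec[OF f])
    show "sqi (msr K) (cpd i j g)" by (intro K.smooth2_sqi smooth2_cpd g)
    show "weak_deriv K i j g (cpd i j g)" by (intro K.weak_deriv_smooth2 g)
    show "weak_deriv K i j g (wd \<Omega> i j f)"
      unfolding K.weak_deriv_iff
    proof (intro allI impI)
      fix \<phi> assume \<phi>: "test_fun K \<phi>"
      have "(\<integral>p. g p * cpd i j \<phi> p \<partial>msr K) = (\<integral>p. f p * cpd i j \<phi> p \<partial>msr K)"
        by (intro Bochner_Integration.integral_cong) (use g(2) K.space_msr in auto)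
      also have "\<dots> = (\<integral>p. f p * cpd i j \<phi> p \<partial>M)" by (intro subdomain(3)[OF K] test_fun_cpd \<phi>)
      also have "\<dots> = (-1) ^ (i + j) * (\<integral>p. wd \<Omega> i j f p * \<phi> p \<partial>M)"
        using wd_spec(2)[OF f] test_fun_mono[OF \<phi> K(2)] by (simp add: weak_deriv_iff)
      also have "(\<integral>p. wd \<Omega> i j f p * \<phi> p \<partial>M) = (\<integral>p. wd \<Omega> i j f p * \<phi> p \<partial>msr K)"
        by (intro subdomain(3)[OF K, symmetric] \<phi>)
      finally show "(\<integral>p. g p * cpd i j \<phi> p \<partial>msr K) = (-1) ^ (i + j) * (\<integral>p. wd \<Omega> i j f p * \<phi> p \<partial>msr K)" .
    qed
  qed
  then show ?thesis unfolding K.AE_msr_iff AE_msr_iff by (rule eventually_mono) simp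
qed

lemma AE_bounded_cover:
  fixes u :: "pt \<Rightarrow> real"
  assumes fin: "finite \<K>" and cov: "AE p in M. p \<in> \<Union>\<K>"
    and b: "\<And>K. K \<in> \<K> \<Longrightarrow> \<exists>C. AE p in M. p \<in> K \<longrightarrow> \<bar>u p\<bar> \<le> C"
  shows "\<exists>C. AE p in M. \<bar>u p\<bar> \<le> C"
proof -
  obtain C where C: "\<And>K. K \<in> \<K> \<Longrightarrow> AE p in M. p \<in> K \<longrightarrow> \<bar>u p\<bar> \<le> C K" using b by metis
  have "AE p in M. \<forall>K\<in>\<K>. p \<in> K \<longrightarrow> \<bar>u p\<bar> \<le> C K" using C fin by (intro AE_finite_allI) auto
  then have "AE p in M. \<bar>u p\<bar> \<le> (\<Sum>K\<in>\<K>. \<bar>C K\<bar>)"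
    using cov
  proof eventually_elim
    case (elim p)
    then obtain K where K: "K \<in> \<K>" "p \<in> K" by blast
    then have "\<bar>u p\<bar> \<le> \<bar>C K\<bar>" using elim(1) by fastforce
    also have "\<dots> \<le> (\<Sum>K\<in>\<K>. \<bar>C K\<bar>)" using K fin by (intro member_le_sum) auto
    finally show ?case .
  qed
  then show ?thesis by blast
qed

text \<open>Convexity is available only piecewise, but boundedness on finitely many convex pieces
  that cover almost everything suffices. The gap of 2 in the order provides the two further
  derivatives consumed by \<open>sobolev_bound\<close>.\<close>

lemma sobolev_bound_cover:
  assumes fin: "finite \<K>" and cov: "AE p in M. p \<in> \<Union>\<K>"
    and K: "\<And>K. K \<in> \<K> \<Longrightarrow> open K \<and> convex K \<and> K \<subseteq> \<Omega>"
    and f: "Hk \<Omega> k f" "i + j + 2 \<le> k"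
  shows "\<exists>C. AE p in M. \<bar>wd \<Omega> i j f p\<bar> \<le> C"
proof (rule AE_bounded_cover[OF fin cov])
  fix K assume "K \<in> \<K>"
  then have Ko: "open K" "K \<subseteq> \<Omega>" and Kc: "convex K" using K by auto
  interpret K: bounded_open K using Ko by (rule subdomain)
  interpret K: bounded_open_convex K by unfold_locales (rule Kc)
  have s: "sqi (msr K) (wd \<Omega> l n f)" if "l + n \<le> k" for l n
    by (intro subdomain(2)[OF Ko] wd_spec(1)[OF f(1) that])
  have x: "weak_x K (wd \<Omega> l n f) (wd \<Omega> (Suc l) n f)" "weak_y K (wd \<Omega> l n f) (wd \<Omega> l (Suc n) f)" if ln: "l + n < k" for l n
    unfolding weak_x_def weak_y_def
    using wd_step_test[OF f(1) ln test_fun_mono[OF _ Ko(2)]]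
    by (simp_all add: subdomain(3)[OF Ko] test_fun_pd)
  have "\<exists>C. AE p in msr K. \<bar>wd \<Omega> i j f p\<bar> \<le> C"
    by (rule K.sobolev_bound[of _ "wd \<Omega> (Suc i) j f" "wd \<Omega> i (Suc j) f" "wd \<Omega> (Suc (Suc i)) j f"
        "wd \<Omega> (Suc i) (Suc j) f" "wd \<Omega> i (Suc (Suc j)) f"]; (rule s | rule x); use f(2) in simp)
  then obtain C where "AE p in lborel. p \<in> K \<longrightarrow> \<bar>wd \<Omega> i j f p\<bar> \<le> C" unfolding K.AE_msr_iff by blast
  then have "AE p in M. p \<in> K \<longrightarrow> \<bar>wd \<Omega> i j f p\<bar> \<le> C" unfolding AE_msr_iff by (rule eventually_mono) simp
  then show "\<exists>C. AE p in M. p \<in> K \<longrightarrow> \<bar>wd \<Omega> i j f p\<bar> \<le> C" by blast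
qed

end

section \<open>The Lax-Milgram lemma\<close>

text \<open>A predicate on functions with a positive semidefinite form, not a Hilbert space type:
  functions equal almost everywhere are not identified, and definiteness is not assumed.
  Completeness is stated for the squared distance.\<close>

locale hilbert_fun =
  fixes V :: "('b \<Rightarrow> real) \<Rightarrow> bool" and ip :: "('b \<Rightarrow> real) \<Rightarrow> ('b \<Rightarrow> real) \<Rightarrow> real"
  assumes V_lincomb: "V u \<Longrightarrow> V v \<Longrightarrow> V (\<lambda>p. a * u p + b * v p)"
    and V_zero: "V (\<lambda>_. 0)"
    and ip_commute: "V u \<Longrightarrow> V v \<Longrightarrow> ip u v = ip v u"
    and ip_lincomb: "V u \<Longrightarrow> V v \<Longrightarrow> V w \<Longrightarrow> ip (\<lambda>p. a * u p + b * v p) w = a * ip u w + b * ip v w"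
    and ip_nonneg: "V u \<Longrightarrow> 0 \<le> ip u u"
    and V_complete: "(\<And>n. V (U n)) \<Longrightarrow>
      (\<And>e. e > 0 \<Longrightarrow> \<exists>N. \<forall>m\<ge>N. \<forall>n\<ge>N. ip (\<lambda>p. U m p - U n p) (\<lambda>p. U m p - U n p) < e) \<Longrightarrow>
      \<exists>w. V w \<and> (\<lambda>n. ip (\<lambda>p. U n p - w p) (\<lambda>p. U n p - w p)) \<longlonglongrightarrow> 0"
begin

lemma V_diff: "V u \<Longrightarrow> V v \<Longrightarrow> V (\<lambda>p. u p - v p)"
  using V_lincomb[of u v 1 "-1"] by simp

lemma ip_lincomb_right:
  "V u \<Longrightarrow> V v \<Longrightarrow> V w \<Longrightarrow> ip w (\<lambda>p. a * u p + b * v p) = a * ip w u + b * ip w v"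
  using ip_lincomb[of u v w a b] ip_commute V_lincomb by metis

lemma ip_diff: "V u \<Longrightarrow> V v \<Longrightarrow> V w \<Longrightarrow> ip (\<lambda>p. u p - v p) w = ip u w - ip v w"
  using ip_lincomb[of u v w 1 "-1"] by simp

lemma ip_square:
  assumes "V u" "V v"
  shows "ip (\<lambda>p. a * u p + b * v p) (\<lambda>p. a * u p + b * v p) = a\<^sup>2 * ip u u + 2 * a * b * ip u v + b\<^sup>2 * ip v v"
proof -
  have w: "V (\<lambda>p. a * u p + b * v p)" using assms by (rule V_lincomb)
  show ?thesis
    unfolding ip_lincomb[OF assms w] ip_lincomb_right[OF assms assms(1)] ip_lincomb_right[OF assms assms(2)]
      ip_commute[OF assms(2,1)]
    by (simp add: power2_eq_square algebra_simps)
qed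

lemma ip_diff_square:
  assumes "V u" "V v"
  shows "ip (\<lambda>p. u p - v p) (\<lambda>p. u p - v p) = ip u u - 2 * ip u v + ip v v"
  using ip_square[OF assms, of 1 "-1"] by simp

definition len :: "('b \<Rightarrow> real) \<Rightarrow> real" where "len u = sqrt (ip u u)"

lemma len_power2: "V u \<Longrightarrow> (len u)\<^sup>2 = ip u u" by (simp add: len_def ip_nonneg)
lemma len_nonneg: "V u \<Longrightarrow> 0 \<le> len u" by (simp add: len_def ip_nonneg)

lemma ip_Cauchy_Schwarz:
  assumes "V u" "V v" shows "\<bar>ip u v\<bar> \<le> len u * len v"
proof -
  have "(ip u v)\<^sup>2 \<le> ip u u * ip v v"
  proof (rule nonneg_quadratic_form)
    fix s t
    have "0 \<le> ip (\<lambda>p. s * u p + (- t) * v p) (\<lambda>p. s * u p + (- t) * v p)"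
      by (intro ip_nonneg V_lincomb assms)
    then show "0 \<le> ip u u * s\<^sup>2 - 2 * ip u v * s * t + ip v v * t\<^sup>2"
      unfolding ip_square[OF assms] by (simp add: mult_ac)
  qed (intro ip_nonneg assms)+
  then have "sqrt ((ip u v)\<^sup>2) \<le> sqrt (ip u u * ip v v)" by (rule real_sqrt_le_mono)
  then show ?thesis by (simp add: len_def real_sqrt_mult)
qed

lemma len_diff_le:
  assumes "V u" "V v" shows "len (\<lambda>p. u p - v p) \<le> len u + len v"
proof (rule power2_le_imp_le)
  have "- ip u v \<le> len u * len v" using abs_le_D2[OF ip_Cauchy_Schwarz[OF assms]] .
  then show "(len (\<lambda>p. u p - v p))\<^sup>2 \<le> (len u + len v)\<^sup>2"
    unfolding len_power2[OF V_diff[OF assms]] ip_diff_square[OF assms] power2_sum len_power2[OF assms(1)] len_power2[OF assms(2)]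
    by linarith
  show "0 \<le> len u + len v" using assms by (intro add_nonneg_nonneg len_nonneg)
qed

text \<open>The representative minimises \<open>ip v v - 2 l v\<close>; by the parallelogram law a minimising
  sequence is Cauchy.\<close>

lemma riesz:
  assumes l_lin: "\<And>u v a b. V u \<Longrightarrow> V v \<Longrightarrow> l (\<lambda>p. a * u p + b * v p) = a * l u + b * l v"
    and l_bd: "\<And>v. V v \<Longrightarrow> \<bar>l v\<bar> \<le> L * len v"
  shows "\<exists>w. V w \<and> (\<forall>v. V v \<longrightarrow> ip w v = l v)"
proof -
  define Q where "Q v = ip v v - 2 * l v" for v
  have Q_lb: "- L\<^sup>2 \<le> Q v" if v: "V v" for v
  proof -
    have "2 * l v \<le> 2 * (L * len v)" using l_bd[OF v] by linarith
    moreover have "0 \<le> (len v - L)\<^sup>2" by simp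
    ultimately show ?thesis using len_power2[OF v] by (simp add: Q_def power2_diff mult_ac)
  qed
  define m where "m = Inf (Q ` Collect V)"
  have bdd: "bdd_below (Q ` Collect V)" using Q_lb by (intro bdd_belowI2) auto
  have mQ: "m \<le> Q v" if "V v" for v unfolding m_def using bdd that by (intro cInf_lower) auto
  have "\<exists>v. V v \<and> Q v < m + 1 / real (Suc n)" for n
  proof -
    have "Inf (Q ` Collect V) < m + 1 / real (Suc n)" unfolding m_def by simp
    then obtain y where "y \<in> Q ` Collect V" "y < m + 1 / real (Suc n)"
      using cInf_lessD[of "Q ` Collect V"] V_zero by blast
    then show ?thesis by blast
  qed
  then obtain U where U: "\<And>n. V (U n)" "\<And>n. Q (U n) < m + 1 / real (Suc n)" by metis
  have par: "ip (\<lambda>p. U i p - U j p) (\<lambda>p. U i p - U j p) \<le> 2 / real (Suc i) + 2 / real (Suc j)" for i j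
  proof -
    have "m \<le> Q (\<lambda>p. 1 / 2 * U i p + 1 / 2 * U j p)" by (intro mQ V_lincomb U)
    also have "\<dots> = (1 / 2)\<^sup>2 * ip (U i) (U i) + 2 * (1 / 2) * (1 / 2) * ip (U i) (U j) + (1 / 2)\<^sup>2 * ip (U j) (U j)
        - 2 * (1 / 2 * l (U i) + 1 / 2 * l (U j))"
      unfolding Q_def ip_square[OF U(1) U(1)] l_lin[OF U(1) U(1)] ..
    finally have "4 * m \<le> ip (U i) (U i) + 2 * ip (U i) (U j) + ip (U j) (U j) - 4 * l (U i) - 4 * l (U j)"
      by (simp add: power2_eq_square)
    then show ?thesis using U(2)[of i] U(2)[of j] unfolding ip_diff_square[OF U(1) U(1)] Q_def by simp
  qed
  have "\<exists>w. V w \<and> (\<lambda>n. ip (\<lambda>p. U n p - w p) (\<lambda>p. U n p - w p)) \<longlonglongrightarrow> 0"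
  proof (rule V_complete[OF U(1)])
    fix e :: real assume e: "e > 0"
    obtain N where N: "1 / real (Suc N) < e / 4" using nat_approx_posE[of "e / 4"] e by auto
    show "\<exists>N. \<forall>m\<ge>N. \<forall>n\<ge>N. ip (\<lambda>p. U m p - U n p) (\<lambda>p. U m p - U n p) < e"
    proof (intro exI[of _ N] allI impI)
      fix i j assume ij: "N \<le> i" "N \<le> j"
      have "2 / real (Suc i) \<le> 2 * (1 / real (Suc N))" "2 / real (Suc j) \<le> 2 * (1 / real (Suc N))"
        using ij by (simp_all add: frac_le)
      then show "ip (\<lambda>p. U i p - U j p) (\<lambda>p. U i p - U j p) < e" using par[of i j] N by linarith
    qed
  qed
  then obtain w where w: "V w" "(\<lambda>n. ip (\<lambda>p. U n p - w p) (\<lambda>p. U n p - w p)) \<longlonglongrightarrow> 0" by blast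
  have len0: "(\<lambda>n. len (\<lambda>p. U n p - w p)) \<longlonglongrightarrow> 0"
    using tendsto_real_sqrt[OF w(2)] by (simp add: len_def)
  have "ip w v = l v" if v: "V v" for v
  proof -
    have "(\<lambda>n. ip (U n) v - ip w v) \<longlonglongrightarrow> 0"
    proof (rule Lim_null_comparison[OF eventuallyI])
      show "norm (ip (U n) v - ip w v) \<le> len (\<lambda>p. U n p - w p) * len v" for n
        using ip_Cauchy_Schwarz[OF V_diff[OF U(1) w(1)] v, of n] unfolding ip_diff[OF U(1) w(1) v] by simp
      show "(\<lambda>n. len (\<lambda>p. U n p - w p) * len v) \<longlonglongrightarrow> 0" using tendsto_mult_left_zero[OF len0] .
    qed
    then have lim: "(\<lambda>n. ip (U n) v) \<longlonglongrightarrow> ip w v" by (simp add: LIM_zero_iff)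
    \<comment> \<open>First variation: \<open>Q (U n + t v)\<close> is at least the infimum, while
      \<open>Q (U n)\<close> exceeds it by less than \<open>1 / (n + 1)\<close>; the excess
      disappears in the limit.\<close>
    have q: "0 \<le> 2 * t * (ip w v - l v) + t\<^sup>2 * ip v v" for t
    proof (rule tendsto_lowerbound)
      show "(\<lambda>n. 2 * t * (ip (U n) v - l v) + t\<^sup>2 * ip v v + 1 / real (Suc n))
          \<longlonglongrightarrow> 2 * t * (ip w v - l v) + t\<^sup>2 * ip v v"
      proof -
        have "(\<lambda>n. 2 * t * (ip (U n) v - l v) + t\<^sup>2 * ip v v + 1 / real (Suc n))
          \<longlonglongrightarrow> 2 * t * (ip w v - l v) + t\<^sup>2 * ip v v + 0"
          by (intro tendsto_intros lim lim_inverse_n'[THEN LIMSEQ_Suc])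
        then show ?thesis by simp
      qed
      show "\<forall>\<^sub>F n in sequentially. 0 \<le> 2 * t * (ip (U n) v - l v) + t\<^sup>2 * ip v v + 1 / real (Suc n)"
      proof (rule eventuallyI)
        fix n
        have "m \<le> Q (\<lambda>p. 1 * U n p + t * v p)" by (intro mQ V_lincomb U v)
        also have "\<dots> = 1\<^sup>2 * ip (U n) (U n) + 2 * 1 * t * ip (U n) v + t\<^sup>2 * ip v v - 2 * (1 * l (U n) + t * l v)"
          unfolding Q_def ip_square[OF U(1) v] l_lin[OF U(1) v] ..
        finally show "0 \<le> 2 * t * (ip (U n) v - l v) + t\<^sup>2 * ip v v + 1 / real (Suc n)"
          using U(2)[of n] by (simp add: Q_def algebra_simps)
      qed
    qed simp
    define d c where "d = ip w v - l v" and "c = ip v v"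
    have c: "c \<ge> 0" unfolding c_def using v by (rule ip_nonneg)
    \<comment> \<open>The quadratic in \<open>t\<close> is tested at
      \<open>t = - d / (c + 1)\<close>, near its minimiser; the \<open>+ 1\<close> avoids division
      by 0 when \<open>v\<close> has length 0. The value there is
      \<open>- d\<^sup>2 (c + 2) / (c + 1)\<^sup>2\<close>, so \<open>d\<close> must be 0.\<close>
    have "0 \<le> (c + 1)\<^sup>2 * (2 * (- d / (c + 1)) * d + (- d / (c + 1))\<^sup>2 * c)"
      using q[of "- d / (c + 1)"] unfolding d_def[symmetric] c_def[symmetric] by (intro mult_nonneg_nonneg) auto
    also have "\<dots> = - (d\<^sup>2 * (c + 2))"
    proof -
      define k where "k = c + 1"
      have k: "k \<noteq> 0" "c = k - 1" using c by (auto simp: k_def)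
      have "k\<^sup>2 * (2 * (- d / k) * d + (- d / k)\<^sup>2 * (k - 1)) = - (2 * d\<^sup>2 * k) + d\<^sup>2 * (k - 1)"
      proof -
        have "k\<^sup>2 * (2 * (- d / k) * d) = - (2 * d\<^sup>2 * k)" using k(1) by (simp add: power2_eq_square)
        moreover have "k\<^sup>2 * ((- d / k)\<^sup>2 * (k - 1)) = d\<^sup>2 * (k - 1)" using k(1) by (simp add: power_divide)
        ultimately show ?thesis by (simp only: distrib_left)
      qed
      then show ?thesis unfolding k_def by (simp add: algebra_simps)
    qed
    finally have "d\<^sup>2 * (c + 2) \<le> 0" by linarith
    then have "d = 0" using c by (simp add: mult_le_0_iff)
    then show ?thesis by (simp add: d_def)
  qed
  then show ?thesis using w(1) by blast
qed

text \<open>Richardson iteration \<open>z\<^sub>n\<^sub>+\<^sub>1 = z\<^sub>n + \<tau> w\<^sub>n\<close>, where \<open>w\<^sub>n\<close> is the Riesz representative of the residual: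
  for \<open>\<tau> = \<alpha> / K\<^sup>2\<close> the residuals decay geometrically, and coercivity turns this into
  convergence of \<open>z\<^sub>n\<close>.\<close>

lemma lax_milgram:
  assumes B_left: "\<And>u v z a b. V u \<Longrightarrow> V v \<Longrightarrow> V z \<Longrightarrow> B (\<lambda>p. a * u p + b * v p) z = a * B u z + b * B v z"
    and B_right: "\<And>u v z a b. V u \<Longrightarrow> V v \<Longrightarrow> V z \<Longrightarrow> B z (\<lambda>p. a * u p + b * v p) = a * B z u + b * B z v"
    and B_bd: "\<And>u v. V u \<Longrightarrow> V v \<Longrightarrow> \<bar>B u v\<bar> \<le> K * len u * len v"
    and coercive: "\<And>v. V v \<Longrightarrow> \<alpha> * (len v)\<^sup>2 \<le> B v v" and \<alpha>: "\<alpha> > 0" "\<alpha> \<le> K"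
    and l_lin: "\<And>u v a b. V u \<Longrightarrow> V v \<Longrightarrow> l (\<lambda>p. a * u p + b * v p) = a * l u + b * l v"
    and l_bd: "\<And>v. V v \<Longrightarrow> \<bar>l v\<bar> \<le> L * len v"
  shows "\<exists>z. V z \<and> (\<forall>v. V v \<longrightarrow> B v z = l v)"
proof -
  have K: "K > 0" using \<alpha> by linarith
  have "\<exists>w. V w \<and> (\<forall>v. V v \<longrightarrow> ip w v = l v - B v z)" if z: "V z" for z
  proof (rule riesz[where L = "L + K * len z"])
    show "l (\<lambda>p. a * u p + b * v p) - B (\<lambda>p. a * u p + b * v p) z = a * (l u - B u z) + b * (l v - B v z)"
      if "V u" "V v" for u v a b
      unfolding l_lin[OF that] B_left[OF that z] by (simp add: algebra_simps)
    show "\<bar>l v - B v z\<bar> \<le> (L + K * len z) * len v" if "V v" for v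
      using l_bd[OF that] B_bd[OF that z] by (simp add: algebra_simps)
  qed
  then obtain R where R: "\<And>z. V z \<Longrightarrow> V (R z)" "\<And>z v. V z \<Longrightarrow> V v \<Longrightarrow> ip (R z) v = l v - B v z" by metis
  define \<tau> where "\<tau> = \<alpha> / K\<^sup>2"
  \<comment> \<open>The value of \<open>1 - 2 \<tau> \<alpha> + (\<tau> K)\<^sup>2\<close> at its
    minimiser in \<open>\<tau>\<close>; the condition \<open>\<alpha> \<le> K\<close> makes it
    nonnegative.\<close>
  define q where "q = 1 - \<alpha>\<^sup>2 / K\<^sup>2"
  have "\<alpha>\<^sup>2 \<le> K\<^sup>2" using \<alpha> by (intro power_mono) auto
  then have q: "0 \<le> q" "q < 1" using K \<alpha> by (simp_all add: q_def divide_le_eq)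
  have \<tau>: "\<tau> > 0" using \<alpha> K by (simp add: \<tau>_def)
  define Z where "Z n = ((\<lambda>z p. 1 * z p + \<tau> * R z p) ^^ n) (\<lambda>_. 0)" for n
  have ZS: "Z (Suc n) = (\<lambda>p. 1 * Z n p + \<tau> * R (Z n) p)" for n by (simp add: Z_def)
  have Z: "V (Z n)" for n
  proof (induction n)
    case 0 show ?case by (simp add: Z_def V_zero)
  next
    case (Suc n) show ?case unfolding ZS by (intro V_lincomb R Suc)
  qed
  let ?w = "\<lambda>n. R (Z n)"
  have w: "V (?w n)" for n by (intro R Z)
  have decay1: "ip (?w (Suc n)) (?w (Suc n)) \<le> q * ip (?w n) (?w n)" for n
  proof -
    let ?a = "\<lambda>p. ?w n p - ?w (Suc n) p"
    have a: "V ?a" by (intro V_diff w)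
    have av: "ip ?a v = \<tau> * B v (?w n)" if v: "V v" for v
    proof -
      have "B v (Z (Suc n)) = 1 * B v (Z n) + \<tau> * B v (?w n)" unfolding ZS by (rule B_right[OF Z w v])
      then show ?thesis unfolding ip_diff[OF w w v] R(2)[OF Z v] by simp
    qed
    have "(len ?a)\<^sup>2 \<le> \<tau> * (K * len ?a * len (?w n))"
      unfolding len_power2[OF a] av[OF a] using abs_le_D1[OF B_bd[OF a w]] \<tau> by (intro mult_left_mono) auto
    then have "len ?a * len ?a \<le> len ?a * (\<tau> * K * len (?w n))" by (simp add: power2_eq_square mult_ac)
    then have "len ?a \<le> \<tau> * K * len (?w n)"
      using len_nonneg[OF a] len_nonneg[OF w, of n] \<tau> K
      by (cases "len ?a = 0") (simp_all add: mult_le_cancel_left)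
    then have "(len ?a)\<^sup>2 \<le> (\<tau> * K * len (?w n))\<^sup>2" using len_nonneg[OF a] by (rule power_mono)
    then have "ip ?a ?a \<le> (\<tau> * K)\<^sup>2 * ip (?w n) (?w n)"
      by (simp only: power_mult_distrib[of "\<tau> * K"] len_power2[OF a] len_power2[OF w])
    moreover have "ip ?a (?w n) \<ge> \<tau> * \<alpha> * ip (?w n) (?w n)"
      unfolding av[OF w] using mult_left_mono[OF coercive[OF w, of n], of \<tau>] \<tau>
      by (simp add: len_power2[OF w] mult.assoc)
    moreover have "ip (?w (Suc n)) (?w (Suc n)) = ip (?w n) (?w n) - 2 * ip ?a (?w n) + ip ?a ?a"
      using ip_diff_square[OF w a, of n] ip_commute[OF a w, of n] by simp
    moreover have "q = 1 - 2 * (\<tau> * \<alpha>) + (\<tau> * K)\<^sup>2"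
      using K by (simp add: q_def \<tau>_def field_simps power2_eq_square)
    moreover have "(1 - 2 * (\<tau> * \<alpha>) + (\<tau> * K)\<^sup>2) * W = W - 2 * (\<tau> * \<alpha> * W) + (\<tau> * K)\<^sup>2 * W" for W
      by (simp add: algebra_simps)
    ultimately show ?thesis by (smt (verit))
  qed
  have decay: "ip (?w n) (?w n) \<le> q ^ n * ip (?w 0) (?w 0)" for n
  proof (induction n)
    case (Suc n)
    then show ?case using order_trans[OF decay1[of n] mult_left_mono[OF Suc q(1)]] by (simp add: mult.assoc)
  qed simp
  have "(\<lambda>n. ip (?w n) (?w n)) \<longlonglongrightarrow> 0"
  proof (rule Lim_null_comparison[OF eventuallyI])
    show "norm (ip (?w n) (?w n)) \<le> q ^ n * ip (?w 0) (?w 0)" for n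
      using decay[of n] ip_nonneg[OF w, of n] by simp
    show "(\<lambda>n. q ^ n * ip (?w 0) (?w 0)) \<longlonglongrightarrow> 0"
      using q by (intro tendsto_mult_left_zero LIMSEQ_realpow_zero)
  qed
  from tendsto_real_sqrt[OF this] have w0: "(\<lambda>n. len (?w n)) \<longlonglongrightarrow> 0" by (simp add: len_def)
  \<comment> \<open>\<open>B\<close> applied to the difference of two iterates equals the difference
    of their residuals, so coercivity bounds distances of iterates by residuals.\<close>
  have dist: "len (\<lambda>p. Z i p - Z j p) \<le> (len (?w i) + len (?w j)) / \<alpha>" for i j
  proof -
    let ?d = "\<lambda>p. Z i p - Z j p"
    have d: "V ?d" by (intro V_diff Z)
    have "\<alpha> * (len ?d)\<^sup>2 \<le> B ?d ?d" by (rule coercive[OF d])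
    also have "B ?d ?d = 1 * B ?d (Z i) + (- 1) * B ?d (Z j)" using B_right[OF Z Z d, of 1 i "-1" j] by simp
    also have "\<dots> = ip (\<lambda>p. ?w j p - ?w i p) ?d"
      unfolding ip_diff[OF w w d] R(2)[OF Z d] by simp
    also have "\<dots> \<le> len (\<lambda>p. ?w j p - ?w i p) * len ?d"
      using abs_le_D1[OF ip_Cauchy_Schwarz[OF V_diff[OF w w] d]] .
    also have "\<dots> \<le> (len (?w i) + len (?w j)) * len ?d"
      using len_diff_le[OF w w, of j i] len_nonneg[OF d] by (intro mult_right_mono) auto
    finally have "len ?d * (\<alpha> * len ?d) \<le> len ?d * (len (?w i) + len (?w j))"
      by (simp add: power2_eq_square mult_ac)
    then have "\<alpha> * len ?d \<le> len (?w i) + len (?w j)"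
      using len_nonneg[OF d] len_nonneg[OF w, of i] len_nonneg[OF w, of j]
      by (cases "len ?d = 0") (simp_all add: mult_le_cancel_left)
    then show ?thesis using \<alpha> by (simp add: le_divide_eq mult.commute)
  qed
  have "\<exists>z. V z \<and> (\<lambda>n. ip (\<lambda>p. Z n p - z p) (\<lambda>p. Z n p - z p)) \<longlonglongrightarrow> 0"
  proof (rule V_complete[OF Z])
    fix e :: real assume e: "e > 0"
    have "\<forall>\<^sub>F n in sequentially. len (?w n) < \<alpha> * sqrt e / 2"
      using w0 e \<alpha> by (intro order_tendstoD(2)) auto
    then obtain N where N: "\<And>n. n \<ge> N \<Longrightarrow> len (?w n) < \<alpha> * sqrt e / 2" by (auto simp: eventually_sequentially)
    show "\<exists>N. \<forall>m\<ge>N. \<forall>n\<ge>N. ip (\<lambda>p. Z m p - Z n p) (\<lambda>p. Z m p - Z n p) < e"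
    proof (intro exI[of _ N] allI impI)
      fix i j assume "N \<le> i" "N \<le> j"
      then have "(len (?w i) + len (?w j)) / \<alpha> < sqrt e"
        using N[of i] N[of j] \<alpha> by (simp add: divide_less_eq mult.commute)
      then have "len (\<lambda>p. Z i p - Z j p) < sqrt e" using dist[of i j] by linarith
      then show "ip (\<lambda>p. Z i p - Z j p) (\<lambda>p. Z i p - Z j p) < e" by (simp add: len_def)
    qed
  qed
  then obtain z where z: "V z" "(\<lambda>n. ip (\<lambda>p. Z n p - z p) (\<lambda>p. Z n p - z p)) \<longlonglongrightarrow> 0" by blast
  from tendsto_real_sqrt[OF z(2)] have zl: "(\<lambda>n. len (\<lambda>p. Z n p - z p)) \<longlonglongrightarrow> 0" by (simp add: len_def)
  have "B v z = l v" if v: "V v" for v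
  proof -
    have "(\<lambda>n. B v z - l v) \<longlonglongrightarrow> 0"
    proof (rule Lim_null_comparison[OF eventuallyI])
      fix n
      have "B v (\<lambda>p. 1 * Z n p + (- 1) * z p) = 1 * B v (Z n) + (- 1) * B v z" by (rule B_right[OF Z z(1) v])
      then have "B v z - l v = - ip (?w n) v - B v (\<lambda>p. Z n p - z p)" unfolding R(2)[OF Z v] by simp
      then show "norm (B v z - l v) \<le> len (?w n) * len v + K * len v * len (\<lambda>p. Z n p - z p)"
        using ip_Cauchy_Schwarz[OF w v, of n] B_bd[OF v V_diff[OF Z z(1)], of n] by simp
      show "(\<lambda>n. len (?w n) * len v + K * len v * len (\<lambda>p. Z n p - z p)) \<longlonglongrightarrow> 0"
        using w0 zl by (auto intro!: tendsto_eq_intros)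
    qed
    then show ?thesis by (simp add: LIMSEQ_const_iff)
  qed
  then show ?thesis using z(1) by blast
qed

end

section \<open>The space \<open>H20\<close> with the inner product of Laplacians\<close>

context bounded_open
begin

lemma lap_lincomb:
  assumes "Hk \<Omega> k u" "Hk \<Omega> k v" "2 \<le> k"
  shows "AE p in M. lap \<Omega> (\<lambda>p. a * u p + b * v p) p = a * lap \<Omega> u p + b * lap \<Omega> v p"
  using Hk_lincomb(2)[OF assms(1,2), of 2 0 a b] Hk_lincomb(2)[OF assms(1,2), of 0 2 a b] assms(3)
  by (auto simp: lap_def algebra_simps)

text \<open>On \<open>H20\<close> the norm of the Laplacian dominates \<open>semi\<close> and, by
  the Poincare inequality, every derivative up to order two. A Cauchy sequence for the form is
  therefore Cauchy in all derivatives, and \<open>Hk0_complete\<close> supplies the limit.\<close>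

lemma hilbert_fun_H20: "hilbert_fun (H20 \<Omega>) (\<lambda>u v. \<integral>p. lap \<Omega> u p * lap \<Omega> v p \<partial>M)"
proof
  have h: "Hk \<Omega> 2 u" if "H20 \<Omega> u" for u using that by (rule Hk0_Hk)
  have s: "sqi M (lap \<Omega> u)" if "H20 \<Omega> u" for u using lap_sqi[OF h[OF that]] by simp
  show "H20 \<Omega> (\<lambda>p. a * u p + b * v p)" if "H20 \<Omega> u" "H20 \<Omega> v" for u v a b using that by (rule Hk0_lincomb)
  show "H20 \<Omega> (\<lambda>_. 0)" by (intro Hk0_test_fun test_fun_zero)
  show "(\<integral>p. lap \<Omega> u p * lap \<Omega> v p \<partial>M) = (\<integral>p. lap \<Omega> v p * lap \<Omega> u p \<partial>M)" for u v by (simp add: mult.commute)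
  show "0 \<le> (\<integral>p. lap \<Omega> u p * lap \<Omega> u p \<partial>M)" for u by simp
  show "(\<integral>p. lap \<Omega> (\<lambda>p. a * u p + b * v p) p * lap \<Omega> w p \<partial>M)
      = a * (\<integral>p. lap \<Omega> u p * lap \<Omega> w p \<partial>M) + b * (\<integral>p. lap \<Omega> v p * lap \<Omega> w p \<partial>M)"
    if u: "H20 \<Omega> u" and v: "H20 \<Omega> v" and w: "H20 \<Omega> w" for u v w a b
  proof -
    have "(\<integral>p. lap \<Omega> (\<lambda>p. a * u p + b * v p) p * lap \<Omega> w p \<partial>M)
        = (\<integral>p. a * (lap \<Omega> u p * lap \<Omega> w p) + b * (lap \<Omega> v p * lap \<Omega> w p) \<partial>M)"
    proof (rule integral_cong_AE)
      show "AE p in M. lap \<Omega> (\<lambda>p. a * u p + b * v p) p * lap \<Omega> w p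
          = a * (lap \<Omega> u p * lap \<Omega> w p) + b * (lap \<Omega> v p * lap \<Omega> w p)"
        using lap_lincomb[OF h[OF u] h[OF v] order_refl, of a b] by eventually_elim (simp add: algebra_simps)
      show "(\<lambda>p. lap \<Omega> (\<lambda>p. a * u p + b * v p) p * lap \<Omega> w p) \<in> borel_measurable M"
        "(\<lambda>p. a * (lap \<Omega> u p * lap \<Omega> w p) + b * (lap \<Omega> v p * lap \<Omega> w p)) \<in> borel_measurable M"
        by (intro borel_measurable_times borel_measurable_add borel_measurable_const
            sqi_measurable[OF s[OF Hk0_lincomb[OF u v]]] sqi_measurable[OF s[OF u]]
            sqi_measurable[OF s[OF v]] sqi_measurable[OF s[OF w]])+
    qed
    also have "\<dots> = a * (\<integral>p. lap \<Omega> u p * lap \<Omega> w p \<partial>M) + b * (\<integral>p. lap \<Omega> v p * lap \<Omega> w p \<partial>M)"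
      using sqi_integrable_mult[OF s[OF u] s[OF w]] sqi_integrable_mult[OF s[OF v] s[OF w]] by simp
    finally show ?thesis .
  qed
  obtain C where C: "C > 0" "\<And>v. H20 \<Omega> v \<Longrightarrow> normH \<Omega> 2 v \<le> C * semi \<Omega> 2 v" using normH2_le_semi2 by blast
  fix U :: "nat \<Rightarrow> pt \<Rightarrow> real"
  assume U: "\<And>n. H20 \<Omega> (U n)"
    and Cau: "\<And>e. e > 0 \<Longrightarrow> \<exists>N. \<forall>m\<ge>N. \<forall>n\<ge>N.
      (\<integral>p. lap \<Omega> (\<lambda>p. U m p - U n p) p * lap \<Omega> (\<lambda>p. U m p - U n p) p \<partial>M) < e"
  have "\<exists>w. H20 \<Omega> w \<and> (\<forall>i j. i + j \<le> 2 \<longrightarrow> conv2 M (\<lambda>n. wd \<Omega> i j (U n)) (wd \<Omega> i j w))"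
  proof (rule Hk0_complete[OF U])
    fix i j :: nat and e :: real assume ij: "i + j \<le> 2" and e: "e > 0"
    obtain N where N: "\<And>m n. m \<ge> N \<Longrightarrow> n \<ge> N \<Longrightarrow>
       (\<integral>p. lap \<Omega> (\<lambda>p. U m p - U n p) p * lap \<Omega> (\<lambda>p. U m p - U n p) p \<partial>M) < (e / C)\<^sup>2"
      using Cau[of "(e / C)\<^sup>2"] e C(1) by auto
    show "\<exists>N. \<forall>m\<ge>N. \<forall>n\<ge>N. nrm M (\<lambda>p. wd \<Omega> i j (U m) p - wd \<Omega> i j (U n) p) < e"
    proof (intro exI[of _ N] allI impI)
      fix m n assume mn: "N \<le> m" "N \<le> n"
      let ?d = "\<lambda>p. U m p - U n p"
      have d: "H20 \<Omega> ?d" by (intro Hk0_diff U)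
      have "(nrm M (lap \<Omega> ?d))\<^sup>2 < (e / C)\<^sup>2" using N[OF mn] unfolding nrm_power2
        by (simp only: power2_eq_square)
      then have lt: "nrm M (lap \<Omega> ?d) < e / C" by (rule power2_less_imp_less) (use e C in simp)
      have "nrm M (\<lambda>p. wd \<Omega> i j (U m) p - wd \<Omega> i j (U n) p) = nrm M (wd \<Omega> i j ?d)"
      proof (rule nrm_cong_AE)
        show "AE p in M. wd \<Omega> i j (U m) p - wd \<Omega> i j (U n) p = wd \<Omega> i j ?d p"
          using Hk_diff(2)[OF h[OF U] h[OF U] ij, of m n] by eventually_elim simp
      qed (intro borel_measurable_diff sqi_measurable wd_spec(1)[OF h[OF U] ij] wd_spec(1)[OF h[OF d] ij])+
      also have "\<dots> \<le> normH \<Omega> 2 ?d" using norm0_wd_le_normH[OF ij, of \<Omega> ?d]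
        by (simp add: norm0_eq_nrm)
      also have "\<dots> \<le> C * nrm M (lap \<Omega> ?d)"
        using C(2)[OF d] mult_left_mono[OF semi_le_nrm_lap[OF d], of C] C(1) by linarith
      also have "\<dots> < e" using lt C(1) by (simp add: less_divide_eq mult.commute)
      finally show "nrm M (\<lambda>p. wd \<Omega> i j (U m) p - wd \<Omega> i j (U n) p) < e" .
    qed
  qed
  then obtain w where w: "H20 \<Omega> w" "\<And>i j. i + j \<le> 2 \<Longrightarrow> conv2 M (\<lambda>n. wd \<Omega> i j (U n)) (wd \<Omega> i j w)" by blast
  have c: "conv2 M (\<lambda>n. lap \<Omega> (U n)) (lap \<Omega> w)"
    using conv2_add[OF w(2)[of 2 0] w(2)[of 0 2]] by (simp add: lap_def[abs_def])
  have "(\<integral>p. lap \<Omega> (\<lambda>p. U n p - w p) p * lap \<Omega> (\<lambda>p. U n p - w p) p \<partial>M)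
      = (nrm M (\<lambda>p. lap \<Omega> (U n) p - lap \<Omega> w p))\<^sup>2" for n
  proof -
    have "nrm M (lap \<Omega> (\<lambda>p. U n p - w p)) = nrm M (\<lambda>p. lap \<Omega> (U n) p - lap \<Omega> w p)"
    proof (rule nrm_cong_AE)
      show "AE p in M. lap \<Omega> (\<lambda>p. U n p - w p) p = lap \<Omega> (U n) p - lap \<Omega> w p"
        using lap_lincomb[OF h[OF U] h[OF w(1)] order_refl, of 1 n "-1"] by simp
    qed (intro borel_measurable_diff sqi_measurable s U w(1) Hk0_diff)+
    from this[symmetric] show ?thesis by (simp only: nrm_power2 power2_eq_square[symmetric])
  qed
  moreover have "(\<lambda>n. (nrm M (\<lambda>p. lap \<Omega> (U n) p - lap \<Omega> w p))\<^sup>2) \<longlonglongrightarrow> 0"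
    using c tendsto_power[of _ 0 sequentially 2] by (fastforce simp: conv2_def)
  ultimately show "\<exists>w. H20 \<Omega> w \<and>
      (\<lambda>n. \<integral>p. lap \<Omega> (\<lambda>p. U n p - w p) p * lap \<Omega> (\<lambda>p. U n p - w p) p \<partial>M) \<longlonglongrightarrow> 0"
    using w(1) by auto
qed

lemma lax_milgram_H20:
  assumes B_left: "\<And>u v z a b. H20 \<Omega> u \<Longrightarrow> H20 \<Omega> v \<Longrightarrow> H20 \<Omega> z \<Longrightarrow> B (\<lambda>p. a * u p + b * v p) z = a * B u z + b * B v z"
    and B_right: "\<And>u v z a b. H20 \<Omega> u \<Longrightarrow> H20 \<Omega> v \<Longrightarrow> H20 \<Omega> z \<Longrightarrow> B z (\<lambda>p. a * u p + b * v p) = a * B z u + b * B z v"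
    and B_bd: "\<And>u v. H20 \<Omega> u \<Longrightarrow> H20 \<Omega> v \<Longrightarrow> \<bar>B u v\<bar> \<le> K * semi \<Omega> 2 u * semi \<Omega> 2 v"
    and coercive: "\<And>v. H20 \<Omega> v \<Longrightarrow> \<alpha> * (semi \<Omega> 2 v)\<^sup>2 \<le> B v v" and \<alpha>: "\<alpha> > 0"
    and l_lin: "\<And>u v a b. H20 \<Omega> u \<Longrightarrow> H20 \<Omega> v \<Longrightarrow> l (\<lambda>p. a * u p + b * v p) = a * l u + b * l v"
    and l_bd: "\<And>v. H20 \<Omega> v \<Longrightarrow> \<bar>l v\<bar> \<le> L * semi \<Omega> 2 v"
  shows "\<exists>z. H20 \<Omega> z \<and> (\<forall>v. H20 \<Omega> v \<longrightarrow> B v z = l v)"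
proof -
  interpret H: hilbert_fun "H20 \<Omega>" "\<lambda>u v. \<integral>p. lap \<Omega> u p * lap \<Omega> v p \<partial>M" by (rule hilbert_fun_H20)
  have len: "H.len v = nrm M (lap \<Omega> v)" for v by (simp add: H.len_def nrm_def power2_eq_square)
  \<comment> \<open>The constants are translated from \<open>semi\<close> to the Laplacian norm. As
    that norm is at most twice \<open>semi\<close>, coercivity becomes \<open>\<alpha> / 4\<close>;
    the maximum secures the relation between the two constants that \<open>lax_milgram\<close>
    demands.\<close>
  let ?K = "max \<bar>K\<bar> (\<alpha> / 4)"
  show ?thesis
  proof (rule H.lax_milgram[OF B_left B_right _ _ _ _ l_lin])
    fix u v assume u: "H20 \<Omega> u" and v: "H20 \<Omega> v"
    have "\<bar>B u v\<bar> \<le> K * (semi \<Omega> 2 u * semi \<Omega> 2 v)" using B_bd[OF u v] by (simp add: mult.assoc)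
    also have "\<dots> \<le> ?K * (nrm M (lap \<Omega> u) * nrm M (lap \<Omega> v))"
      by (intro mult_mono semi_le_nrm_lap u v mult_nonneg_nonneg) auto
    finally show "\<bar>B u v\<bar> \<le> ?K * H.len u * H.len v" by (simp add: len mult.assoc)
  next
    fix v assume v: "H20 \<Omega> v"
    have "(nrm M (lap \<Omega> v))\<^sup>2 \<le> (2 * semi \<Omega> 2 v)\<^sup>2" by (intro power_mono nrm_lap_le v) simp
    then have "\<alpha> / 4 * (nrm M (lap \<Omega> v))\<^sup>2 \<le> \<alpha> / 4 * (2 * semi \<Omega> 2 v)\<^sup>2" using \<alpha> by (intro mult_left_mono) auto
    also have "\<dots> = \<alpha> * (semi \<Omega> 2 v)\<^sup>2" by (simp add: power_mult_distrib)
    finally show "\<alpha> / 4 * (H.len v)\<^sup>2 \<le> B v v" using coercive[OF v] by (simp add: len)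
    have "\<bar>l v\<bar> \<le> \<bar>L\<bar> * semi \<Omega> 2 v" using l_bd[OF v] mult_right_mono[OF abs_ge_self[of L] semi_nonneg[of \<Omega> 2 v]] by linarith
    also have "\<dots> \<le> \<bar>L\<bar> * nrm M (lap \<Omega> v)" by (intro mult_left_mono semi_le_nrm_lap v) simp
    finally show "\<bar>l v\<bar> \<le> \<bar>L\<bar> * H.len v" by (simp add: len)
  qed (use \<alpha> in auto)
qed

end

section \<open>The bilinear and trilinear forms\<close>

context bounded_open
begin

text \<open>Membership in L-infinity: the weights that preserve both L2 and L2 convergence under
  multiplication.\<close>

definition bdd_fun :: "(pt \<Rightarrow> real) \<Rightarrow> bool" where
  "bdd_fun w \<longleftrightarrow> w \<in> borel_measurable M \<and> (\<exists>C. AE p in M. \<bar>w p\<bar> \<le> C)"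

lemma bdd_fun_sqi: "bdd_fun w \<Longrightarrow> sqi M f \<Longrightarrow> sqi M (\<lambda>p. w p * f p)"
  unfolding bdd_fun_def using sqi_bounded_mult(1) by blast

lemma bdd_fun_conv2: "bdd_fun w \<Longrightarrow> conv2 M F f \<Longrightarrow> conv2 M (\<lambda>n p. w p * F n p) (\<lambda>p. w p * f p)"
  unfolding bdd_fun_def using conv2_bounded_mult by blast

lemma bdd_fun_lincomb:
  assumes "bdd_fun v" "bdd_fun w" shows "bdd_fun (\<lambda>p. a * v p + b * w p)"
proof -
  obtain C D where C: "AE p in M. \<bar>v p\<bar> \<le> C" and D: "AE p in M. \<bar>w p\<bar> \<le> D"
    using assms by (auto simp: bdd_fun_def)
  have "AE p in M. \<bar>a * v p + b * w p\<bar> \<le> \<bar>a\<bar> * C + \<bar>b\<bar> * D"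
    using C D
  proof eventually_elim
    case (elim p)
    have "\<bar>a * v p + b * w p\<bar> \<le> \<bar>a\<bar> * \<bar>v p\<bar> + \<bar>b\<bar> * \<bar>w p\<bar>"
      using abs_triangle_ineq[of "a * v p" "b * w p"] by (simp only: abs_mult)
    also have "\<dots> \<le> \<bar>a\<bar> * C + \<bar>b\<bar> * D" using elim by (intro add_mono mult_left_mono) auto
    finally show ?case .
  qed
  moreover have "(\<lambda>p. a * v p + b * w p) \<in> borel_measurable M"
    using assms unfolding bdd_fun_def by (intro borel_measurable_add borel_measurable_times borel_measurable_const) auto
  ultimately show ?thesis unfolding bdd_fun_def by blast
qed

lemma bdd_fun_nrm:
  assumes "bdd_fun w" shows "\<exists>C\<ge>0. \<forall>f. sqi M f \<longrightarrow> nrm M (\<lambda>p. w p * f p) \<le> C * nrm M f"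
proof -
  obtain C where C: "AE p in M. \<bar>w p\<bar> \<le> C" and w: "w \<in> borel_measurable M" using assms by (auto simp: bdd_fun_def)
  have "AE p in M. \<bar>w p\<bar> \<le> \<bar>C\<bar>" using C by eventually_elim auto
  then show ?thesis using sqi_bounded_mult(2)[OF _ w] by (intro exI[of _ "\<bar>C\<bar>"]) auto
qed

lemma integral_lincomb_AE:
  fixes F F1 F2 :: "pt \<Rightarrow> real"
  assumes "AE p in M. F p = a * F1 p + b * F2 p" "F \<in> borel_measurable M" "integrable M F1" "integrable M F2"
  shows "(\<integral>p. F p \<partial>M) = a * (\<integral>p. F1 p \<partial>M) + b * (\<integral>p. F2 p \<partial>M)"
proof -
  have "(\<integral>p. F p \<partial>M) = (\<integral>p. a * F1 p + b * F2 p \<partial>M)"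
    using assms by (intro integral_cong_AE) auto
  then show ?thesis using assms by simp
qed

lemma a0_eq: "a0 \<Omega> Rey u v = 1 / Rey * (\<integral>p. lap \<Omega> u p * lap \<Omega> v p \<partial>M)"
  by (simp add: a0_def set_integral_msr)

lemma a1_eq: "a1 \<Omega> \<zeta> u v = (\<integral>p. lap \<Omega> \<zeta> p * (wd \<Omega> 0 1 u p * wd \<Omega> 1 0 v p - wd \<Omega> 1 0 u p * wd \<Omega> 0 1 v p) \<partial>M)"
  by (simp add: a1_def set_integral_msr)

lemma a2_eq: "a2 \<Omega> Ro u v = - (1 / Ro) * (\<integral>p. wd \<Omega> 1 0 u p * v p \<partial>M)"
  by (simp add: a2_def set_integral_msr)

lemma H20_sqi:
  assumes "H20 \<Omega> u"
  shows "sqi M u" "sqi M (lap \<Omega> u)" "i + j \<le> 2 \<Longrightarrow> sqi M (wd \<Omega> i j u)"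
  using Hk0_Hk[OF assms] Hk_sqi lap_sqi wd_spec(1) by auto

lemma a0_commute: "a0 \<Omega> Rey u v = a0 \<Omega> Rey v u"
  by (simp add: a0_eq mult.commute)

lemma a0_lincomb:
  assumes u: "H20 \<Omega> u" and v: "H20 \<Omega> v" and w: "H20 \<Omega> w"
  shows "a0 \<Omega> Rey (\<lambda>p. a * u p + b * v p) w = a * a0 \<Omega> Rey u w + b * a0 \<Omega> Rey v w"
    "a0 \<Omega> Rey w (\<lambda>p. a * u p + b * v p) = a * a0 \<Omega> Rey w u + b * a0 \<Omega> Rey w v"
proof -
  interpret H: hilbert_fun "H20 \<Omega>" "\<lambda>u v. \<integral>p. lap \<Omega> u p * lap \<Omega> v p \<partial>M" by (rule hilbert_fun_H20)
  show "a0 \<Omega> Rey (\<lambda>p. a * u p + b * v p) w = a * a0 \<Omega> Rey u w + b * a0 \<Omega> Rey v w"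
    unfolding a0_eq H.ip_lincomb[OF u v w] by (simp add: algebra_simps)
  then show "a0 \<Omega> Rey w (\<lambda>p. a * u p + b * v p) = a * a0 \<Omega> Rey w u + b * a0 \<Omega> Rey w v"
    by (simp only: a0_commute[of Rey w])
qed

lemma a2_lincomb:
  assumes u: "H20 \<Omega> u" and v: "H20 \<Omega> v" and w: "H20 \<Omega> w"
  shows "a2 \<Omega> Ro (\<lambda>p. a * u p + b * v p) w = a * a2 \<Omega> Ro u w + b * a2 \<Omega> Ro v w"
    "a2 \<Omega> Ro w (\<lambda>p. a * u p + b * v p) = a * a2 \<Omega> Ro w u + b * a2 \<Omega> Ro w v"
proof -
  have i: "integrable M (\<lambda>p. wd \<Omega> 1 0 f p * g p)" if "H20 \<Omega> f" "H20 \<Omega> g" for f g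
    using that by (intro sqi_integrable_mult H20_sqi) auto
  have m: "(\<lambda>p. wd \<Omega> 1 0 f p * g p) \<in> borel_measurable M" if "H20 \<Omega> f" "H20 \<Omega> g" for f g
    using i[OF that] by (rule borel_measurable_integrable)
  have uv: "H20 \<Omega> (\<lambda>p. a * u p + b * v p)" using u v by (rule Hk0_lincomb)
  have "AE p in M. wd \<Omega> 1 0 (\<lambda>p. a * u p + b * v p) p = a * wd \<Omega> 1 0 u p + b * wd \<Omega> 1 0 v p"
    by (rule Hk_lincomb(2)[OF Hk0_Hk[OF u] Hk0_Hk[OF v]]) simp
  then have "AE p in M. wd \<Omega> 1 0 (\<lambda>p. a * u p + b * v p) p * w p = a * (wd \<Omega> 1 0 u p * w p) + b * (wd \<Omega> 1 0 v p * w p)"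
    by eventually_elim (simp add: algebra_simps)
  from integral_lincomb_AE[OF this m[OF uv w] i[OF u w] i[OF v w]]
  show "a2 \<Omega> Ro (\<lambda>p. a * u p + b * v p) w = a * a2 \<Omega> Ro u w + b * a2 \<Omega> Ro v w"
    unfolding a2_eq by (simp add: algebra_simps)
  have "AE p in M. wd \<Omega> 1 0 w p * (a * u p + b * v p) = a * (wd \<Omega> 1 0 w p * u p) + b * (wd \<Omega> 1 0 w p * v p)"
    by (simp add: algebra_simps)
  from integral_lincomb_AE[OF this m[OF w uv] i[OF w u] i[OF w v]]
  show "a2 \<Omega> Ro w (\<lambda>p. a * u p + b * v p) = a * a2 \<Omega> Ro w u + b * a2 \<Omega> Ro w v"
    unfolding a2_eq by (simp add: algebra_simps)
qed

text \<open>One integration by parts in \<open>x\<close> shows that \<open>a2\<close> is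
  skew-symmetric; hence it vanishes on the diagonal and changes sign in the adjoint problem.\<close>

lemma a2_eq_dual:
  assumes "H20 \<Omega> u" "H20 \<Omega> v" shows "a2 \<Omega> Ro u v = 1 / Ro * (\<integral>p. wd \<Omega> 1 0 v p * u p \<partial>M)"
  using wd_step(1)[OF Hk0_Hk[OF assms(1)], of 0 0 v] Hk0_mono[OF assms(2), of 1]
  by (simp add: a2_eq mult.commute)

lemma a2_self: assumes "H20 \<Omega> u" shows "a2 \<Omega> Ro u u = 0"
  using a2_eq_dual[OF assms assms, of Ro] by (simp add: a2_eq)

lemma a1_self: "a1 \<Omega> \<zeta> u u = 0"
  by (simp add: a1_eq mult.commute)

lemma a0_self_ge:
  assumes "H20 \<Omega> u" "Rey > 0" shows "1 / Rey * (semi \<Omega> 2 u)\<^sup>2 \<le> a0 \<Omega> Rey u u"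
proof -
  have "(semi \<Omega> 2 u)\<^sup>2 \<le> (nrm M (lap \<Omega> u))\<^sup>2" using semi_le_nrm_lap[OF assms(1)] by (intro power_mono) auto
  then have "1 / Rey * (semi \<Omega> 2 u)\<^sup>2 \<le> 1 / Rey * (nrm M (lap \<Omega> u))\<^sup>2" using assms(2) by (intro mult_left_mono) auto
  then show ?thesis by (simp only: a0_eq nrm_power2 power2_eq_square[symmetric])
qed

lemma a0_bound:
  assumes u: "H20 \<Omega> u" and v: "H20 \<Omega> v" and "Rey > 0"
  shows "\<bar>a0 \<Omega> Rey u v\<bar> \<le> 4 / Rey * semi \<Omega> 2 u * semi \<Omega> 2 v"
proof -
  have "\<bar>\<integral>p. lap \<Omega> u p * lap \<Omega> v p \<partial>M\<bar> \<le> nrm M (lap \<Omega> u) * nrm M (lap \<Omega> v)"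
    by (intro Cauchy_Schwarz_integral H20_sqi u v)
  also have "\<dots> \<le> (2 * semi \<Omega> 2 u) * (2 * semi \<Omega> 2 v)" by (intro mult_mono nrm_lap_le u v) auto
  finally have "1 / Rey * \<bar>\<integral>p. lap \<Omega> u p * lap \<Omega> v p \<partial>M\<bar> \<le> 1 / Rey * ((2 * semi \<Omega> 2 u) * (2 * semi \<Omega> 2 v))"
    using assms(3) by (intro mult_left_mono) auto
  then show ?thesis using assms(3) by (simp add: a0_eq abs_mult)
qed

text \<open>\<^term>\<open>a1 \<Omega> \<zeta> u v\<close> is additive only where both products are integrable (a divergent Bochner
  integral is 0).\<close>

definition a1_integrable :: "(pt \<Rightarrow> real) \<Rightarrow> (pt \<Rightarrow> real) \<Rightarrow> (pt \<Rightarrow> real) \<Rightarrow> bool" where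
  "a1_integrable \<zeta> u v \<longleftrightarrow> H20 \<Omega> \<zeta> \<and> H20 \<Omega> u \<and> H20 \<Omega> v \<and>
     integrable M (\<lambda>p. lap \<Omega> \<zeta> p * (wd \<Omega> 0 1 u p * wd \<Omega> 1 0 v p - wd \<Omega> 1 0 u p * wd \<Omega> 0 1 v p))"

text \<open>With such a \<open>u\<close> in the second slot the integrand of \<open>a1\<close> is a
  product of two L2 functions, whatever the other two arguments in \<open>H20\<close>. Both
  \<open>\<psi>\<close> and the finite element functions qualify.\<close>

definition grad_bdd :: "(pt \<Rightarrow> real) \<Rightarrow> bool" where
  "grad_bdd u \<longleftrightarrow> H20 \<Omega> u \<and> bdd_fun (wd \<Omega> 1 0 u) \<and> bdd_fun (wd \<Omega> 0 1 u)"

lemma grad_bdd_sqi: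
  assumes "grad_bdd u" "H20 \<Omega> v"
  shows "sqi M (\<lambda>p. wd \<Omega> 0 1 u p * wd \<Omega> 1 0 v p - wd \<Omega> 1 0 u p * wd \<Omega> 0 1 v p)"
  using assms by (intro sqi_diff bdd_fun_sqi H20_sqi(3)) (auto simp: grad_bdd_def)

lemma a1_integrable_grad:
  assumes "H20 \<Omega> \<zeta>" "grad_bdd u" "H20 \<Omega> v" shows "a1_integrable \<zeta> u v"
  using assms sqi_integrable_mult[OF H20_sqi(2)[OF assms(1)] grad_bdd_sqi[OF assms(2,3)]]
  by (simp add: a1_integrable_def grad_bdd_def)

text \<open>The other source of integrability, a bounded Laplacian in the first slot. It covers the
  term of the linearisation that has \<open>\<psi>\<close> there.\<close>

lemma a1_integrable_lap:
  assumes z: "H20 \<Omega> \<zeta>" "bdd_fun (lap \<Omega> \<zeta>)" and u: "H20 \<Omega> u" and v: "H20 \<Omega> v"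
  shows "a1_integrable \<zeta> u v"
proof -
  have i: "integrable M (\<lambda>p. (lap \<Omega> \<zeta> p * wd \<Omega> 0 1 u p) * wd \<Omega> 1 0 v p)"
    "integrable M (\<lambda>p. (lap \<Omega> \<zeta> p * wd \<Omega> 1 0 u p) * wd \<Omega> 0 1 v p)"
    by (rule sqi_integrable_mult[OF bdd_fun_sqi[OF z(2) H20_sqi(3)[OF u]] H20_sqi(3)[OF v]]; simp)+
  have "integrable M (\<lambda>p. (lap \<Omega> \<zeta> p * wd \<Omega> 0 1 u p) * wd \<Omega> 1 0 v p - (lap \<Omega> \<zeta> p * wd \<Omega> 1 0 u p) * wd \<Omega> 0 1 v p)"
    by (rule Bochner_Integration.integrable_diff[OF i])
  then show ?thesis using z u v by (simp add: a1_integrable_def right_diff_distrib mult.assoc)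
qed

lemma grad_bdd_lincomb:
  assumes u: "grad_bdd u" and v: "grad_bdd v" shows "grad_bdd (\<lambda>p. a * u p + b * v p)"
proof -
  have h: "H20 \<Omega> u" "H20 \<Omega> v" "H20 \<Omega> (\<lambda>p. a * u p + b * v p)"
    using u v by (auto simp: grad_bdd_def intro: Hk0_lincomb)
  have "bdd_fun (wd \<Omega> i j (\<lambda>p. a * u p + b * v p))"
    if b: "bdd_fun (wd \<Omega> i j u)" "bdd_fun (wd \<Omega> i j v)" and ij: "i + j \<le> 2" for i j
  proof -
    obtain C where C: "AE p in M. \<bar>a * wd \<Omega> i j u p + b * wd \<Omega> i j v p\<bar> \<le> C"
      using bdd_fun_lincomb[OF b, of a b] by (auto simp: bdd_fun_def)
    have "AE p in M. \<bar>wd \<Omega> i j (\<lambda>p. a * u p + b * v p) p\<bar> \<le> C"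
      using C Hk_lincomb(2)[OF Hk0_Hk[OF h(1)] Hk0_Hk[OF h(2)] ij, of a b] by eventually_elim simp
    then show ?thesis using sqi_measurable[OF H20_sqi(3)[OF h(3) ij]] unfolding bdd_fun_def by blast
  qed
  then show ?thesis using h(3) u v by (simp add: grad_bdd_def del: One_nat_def)
qed

lemma a1_lincomb_1:
  assumes "a1_integrable \<zeta> u v" "a1_integrable \<xi> u v" "a1_integrable (\<lambda>p. a * \<zeta> p + b * \<xi> p) u v"
  shows "a1 \<Omega> (\<lambda>p. a * \<zeta> p + b * \<xi> p) u v = a * a1 \<Omega> \<zeta> u v + b * a1 \<Omega> \<xi> u v"
  unfolding a1_eq
proof (rule integral_lincomb_AE)
  have "Hk \<Omega> 2 \<zeta>" "Hk \<Omega> 2 \<xi>" using assms by (auto simp: a1_integrable_def intro: Hk0_Hk)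
  from lap_lincomb[OF this order_refl, of a b]
  show "AE p in M. lap \<Omega> (\<lambda>p. a * \<zeta> p + b * \<xi> p) p * (wd \<Omega> 0 1 u p * wd \<Omega> 1 0 v p - wd \<Omega> 1 0 u p * wd \<Omega> 0 1 v p)
     = a * (lap \<Omega> \<zeta> p * (wd \<Omega> 0 1 u p * wd \<Omega> 1 0 v p - wd \<Omega> 1 0 u p * wd \<Omega> 0 1 v p))
     + b * (lap \<Omega> \<xi> p * (wd \<Omega> 0 1 u p * wd \<Omega> 1 0 v p - wd \<Omega> 1 0 u p * wd \<Omega> 0 1 v p))"
    by eventually_elim (simp only: distrib_right mult.assoc)
qed (use assms in \<open>auto simp: a1_integrable_def intro: borel_measurable_integrable\<close>)

lemma a1_lincomb_3:
  assumes "a1_integrable \<zeta> u v" "a1_integrable \<zeta> u w" "a1_integrable \<zeta> u (\<lambda>p. a * v p + b * w p)"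
  shows "a1 \<Omega> \<zeta> u (\<lambda>p. a * v p + b * w p) = a * a1 \<Omega> \<zeta> u v + b * a1 \<Omega> \<zeta> u w"
  unfolding a1_eq
proof (rule integral_lincomb_AE)
  let ?w = "\<lambda>p. a * v p + b * w p"
  have h: "Hk \<Omega> 2 v" "Hk \<Omega> 2 w" using assms by (auto simp: a1_integrable_def intro: Hk0_Hk)
  have "AE p in M. wd \<Omega> 1 0 ?w p = a * wd \<Omega> 1 0 v p + b * wd \<Omega> 1 0 w p"
    "AE p in M. wd \<Omega> 0 1 ?w p = a * wd \<Omega> 0 1 v p + b * wd \<Omega> 0 1 w p" by (rule Hk_lincomb(2)[OF h]; simp)+
  then show "AE p in M. lap \<Omega> \<zeta> p * (wd \<Omega> 0 1 u p * wd \<Omega> 1 0 ?w p - wd \<Omega> 1 0 u p * wd \<Omega> 0 1 ?w p)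
     = a * (lap \<Omega> \<zeta> p * (wd \<Omega> 0 1 u p * wd \<Omega> 1 0 v p - wd \<Omega> 1 0 u p * wd \<Omega> 0 1 v p))
     + b * (lap \<Omega> \<zeta> p * (wd \<Omega> 0 1 u p * wd \<Omega> 1 0 w p - wd \<Omega> 1 0 u p * wd \<Omega> 0 1 w p))"
  proof eventually_elim
    case (elim p) show ?case unfolding elim by (simp only: algebra_simps)
  qed
qed (use assms in \<open>auto simp: a1_integrable_def intro: borel_measurable_integrable\<close>)

lemma a1_antisym: "a1 \<Omega> \<zeta> u v = - a1 \<Omega> \<zeta> v u"
  unfolding a1_eq Bochner_Integration.integral_minus[symmetric]
  by (intro Bochner_Integration.integral_cong refl) (simp only: algebra_simps)

lemma a1_integrable_commute: "a1_integrable \<zeta> u v \<Longrightarrow> a1_integrable \<zeta> v u"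
proof -
  assume a: "a1_integrable \<zeta> u v"
  then have "integrable M (\<lambda>p. - (lap \<Omega> \<zeta> p * (wd \<Omega> 0 1 u p * wd \<Omega> 1 0 v p - wd \<Omega> 1 0 u p * wd \<Omega> 0 1 v p)))"
    unfolding a1_integrable_def by (intro Bochner_Integration.integrable_minus) blast
  also have "(\<lambda>p. - (lap \<Omega> \<zeta> p * (wd \<Omega> 0 1 u p * wd \<Omega> 1 0 v p - wd \<Omega> 1 0 u p * wd \<Omega> 0 1 v p)))
     = (\<lambda>p. lap \<Omega> \<zeta> p * (wd \<Omega> 0 1 v p * wd \<Omega> 1 0 u p - wd \<Omega> 1 0 v p * wd \<Omega> 0 1 u p))"
    by (rule ext) (simp only: algebra_simps)
  finally show ?thesis using a unfolding a1_integrable_def by blast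
qed

lemma a1_lincomb_2:
  assumes "a1_integrable \<zeta> u w" "a1_integrable \<zeta> v w" "a1_integrable \<zeta> (\<lambda>p. a * u p + b * v p) w"
  shows "a1 \<Omega> \<zeta> (\<lambda>p. a * u p + b * v p) w = a * a1 \<Omega> \<zeta> u w + b * a1 \<Omega> \<zeta> v w"
  using a1_lincomb_3[OF assms[THEN a1_integrable_commute]]
  by (simp only: a1_antisym[of \<zeta> _ w] mult_minus_right minus_add_distrib)

end

text \<open>\<open>dual_corr \<Omega> \<psi> z\<close> is \<open>- J(\<Delta>\<psi>, z) - 2 J(\<psi>\<^sub>x, z\<^sub>x) - 2 J(\<psi>\<^sub>y, z\<^sub>y)\<close>, the difference
  \<open>J(\<psi>, \<Delta>z) - \<Delta> J(\<psi>, z)\<close> between the adjoint of the linearised operator and the operator \<open>L\<^sup>*\<close> of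
  \<^const>\<open>dual_eq\<close>.\<close>

definition dual_corr :: "pt set \<Rightarrow> (pt \<Rightarrow> real) \<Rightarrow> (pt \<Rightarrow> real) \<Rightarrow> pt \<Rightarrow> real" where
  "dual_corr \<Omega> \<psi> z p =
     (- 1 * wd \<Omega> 3 0 \<psi> p + - 1 * wd \<Omega> 1 2 \<psi> p) * wd \<Omega> 0 1 z p
   + (1 * wd \<Omega> 2 1 \<psi> p + 1 * wd \<Omega> 0 3 \<psi> p) * wd \<Omega> 1 0 z p
   + (2 * wd \<Omega> 0 2 \<psi> p + - 2 * wd \<Omega> 2 0 \<psi> p) * wd \<Omega> 1 1 z p
   + (2 * wd \<Omega> 1 1 \<psi> p + 0 * wd \<Omega> 1 1 \<psi> p) * wd \<Omega> 2 0 z p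
   + (- 2 * wd \<Omega> 1 1 \<psi> p + 0 * wd \<Omega> 1 1 \<psi> p) * wd \<Omega> 0 2 z p"

text \<open>\<open>\<psi>\<close> has only weak derivatives, so all of them are moved onto products
  of the smooth functions. This is the coefficient of \<open>\<psi>\<close> that results, and by the
  Leibniz rule it cancels identically. Behind it is \<open>\<Delta> J(\<psi>, \<eta>) =
  J(\<Delta>\<psi>, \<eta>) + 2 J(\<psi>_x, \<eta>_x) + 2 J(\<psi>_y, \<eta>_y) + J(\<psi>,
  \<Delta>\<eta>)\<close>.\<close>

lemma dual_identity_pointwise:
  assumes \<phi>: "smooth2 \<phi>" and \<eta>: "smooth2 \<eta>"
  defines "lf \<equiv> \<lambda>p. cpd 2 0 \<phi> p + cpd 0 2 \<phi> p" and "le \<equiv> \<lambda>p. cpd 2 0 \<eta> p + cpd 0 2 \<eta> p"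
  shows "- cpd 0 1 (\<lambda>p. lf p * cpd 1 0 \<eta> p + le p * cpd 1 0 \<phi> p) p
     + cpd 1 0 (\<lambda>p. lf p * cpd 0 1 \<eta> p + le p * cpd 0 1 \<phi> p) p
     - cpd 3 0 (\<lambda>p. cpd 0 1 \<eta> p * cpd 0 0 \<phi> p) p - cpd 1 2 (\<lambda>p. cpd 0 1 \<eta> p * cpd 0 0 \<phi> p) p
     + cpd 2 1 (\<lambda>p. cpd 1 0 \<eta> p * cpd 0 0 \<phi> p) p + cpd 0 3 (\<lambda>p. cpd 1 0 \<eta> p * cpd 0 0 \<phi> p) p
     + 2 * cpd 2 0 (\<lambda>p. cpd 1 1 \<eta> p * cpd 0 0 \<phi> p) p
     - 2 * cpd 1 1 (\<lambda>p. cpd 2 0 \<eta> p * cpd 0 0 \<phi> p) p + 2 * cpd 1 1 (\<lambda>p. cpd 0 2 \<eta> p * cpd 0 0 \<phi> p) p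
     - 2 * cpd 0 2 (\<lambda>p. cpd 1 1 \<eta> p * cpd 0 0 \<phi> p) p = 0"
proof -
  have c: "cpd (Suc 0) 0 f = pdx f" "cpd 0 (Suc 0) f = pdy f" "cpd (Suc 0) (Suc 0) f = pdx (pdy f)"
    "cpd (Suc (Suc 0)) 0 f = pdx (pdx f)" "cpd 0 (Suc (Suc 0)) f = pdy (pdy f)"
    "cpd (Suc (Suc (Suc 0))) 0 f = pdx (pdx (pdx f))" "cpd 0 (Suc (Suc (Suc 0))) f = pdy (pdy (pdy f))"
    "cpd (Suc 0) (Suc (Suc 0)) f = pdx (pdy (pdy f))" "cpd (Suc (Suc 0)) (Suc 0) f = pdx (pdx (pdy f))" for f
    by (simp_all add: cpd_def)
  have s: "smooth2 (cpd i j \<phi>)" "smooth2 (cpd i j \<eta>)" for i j using \<phi> \<eta> by (auto intro: smooth2_cpd)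
  have d: "pdx (cpd i j \<phi>) = cpd (Suc i) j \<phi>" "pdy (cpd i j \<phi>) = cpd i (Suc j) \<phi>"
    "pdx (cpd i j \<eta>) = cpd (Suc i) j \<eta>" "pdy (cpd i j \<eta>) = cpd i (Suc j) \<eta>" for i j
    by (simp_all only: pdx_cpd pdy_cpd[OF \<phi>] pdy_cpd[OF \<eta>])
  show ?thesis
    unfolding lf_def le_def One_nat_def numeral_2_eq_2 numeral_3_eq_3
    \<comment> \<open>The expansion rules are instantiated for the products alone, so that
      derivatives of \<open>\<phi>\<close> and \<open>\<eta>\<close> stay in the form
      \<open>cpd i j\<close>. There mixed derivatives are already commuted and ring rewriting can
      cancel.\<close>
    by (simp only: c[of "\<lambda>p. (cpd (Suc (Suc 0)) 0 \<phi> p + cpd 0 (Suc (Suc 0)) \<phi> p) * cpd (Suc 0) 0 \<eta> p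
        + (cpd (Suc (Suc 0)) 0 \<eta> p + cpd 0 (Suc (Suc 0)) \<eta> p) * cpd (Suc 0) 0 \<phi> p"]
      c[of "\<lambda>p. (cpd (Suc (Suc 0)) 0 \<phi> p + cpd 0 (Suc (Suc 0)) \<phi> p) * cpd 0 (Suc 0) \<eta> p
        + (cpd (Suc (Suc 0)) 0 \<eta> p + cpd 0 (Suc (Suc 0)) \<eta> p) * cpd 0 (Suc 0) \<phi> p"]
      c[of "\<lambda>p. cpd 0 (Suc 0) \<eta> p * cpd 0 0 \<phi> p"] c[of "\<lambda>p. cpd (Suc 0) 0 \<eta> p * cpd 0 0 \<phi> p"]
      c[of "\<lambda>p. cpd (Suc 0) (Suc 0) \<eta> p * cpd 0 0 \<phi> p"] c[of "\<lambda>p. cpd (Suc (Suc 0)) 0 \<eta> p * cpd 0 0 \<phi> p"]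
      c[of "\<lambda>p. cpd 0 (Suc (Suc 0)) \<eta> p * cpd 0 0 \<phi> p"]
      pd_mult pd_add s d smooth2_mult smooth2_add)
       (simp only: algebra_simps)
qed

section \<open>The adjoint of the linearised operator\<close>

context bounded_open
begin

text \<open>Grouped by the derivative of \<open>\<psi>\<close> that occurs, the difference of the
  two sides is a sum of ten integrals against test functions. Moving the derivatives off
  \<open>\<psi>\<close> produces the integral of \<open>\<psi>\<close> times the vanishing
  expression of \<open>dual_identity_pointwise\<close>.\<close>

lemma dual_identity_test:
  assumes \<psi>: "Hk \<Omega> k \<psi>" "3 \<le> k" and bdd_all: "\<forall>i j. i + j \<le> 3 \<longrightarrow> bdd_fun (wd \<Omega> i j \<psi>)"
    and \<phi>: "test_fun \<Omega> \<phi>" and \<eta>: "test_fun \<Omega> \<eta>"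
  defines "lf \<equiv> \<lambda>p. cpd 2 0 \<phi> p + cpd 0 2 \<phi> p" and "le \<equiv> \<lambda>p. cpd 2 0 \<eta> p + cpd 0 2 \<eta> p"
  defines "dc \<equiv> \<lambda>p. (- 1 * wd \<Omega> 3 0 \<psi> p + - 1 * wd \<Omega> 1 2 \<psi> p) * cpd 0 1 \<eta> p
   + (1 * wd \<Omega> 2 1 \<psi> p + 1 * wd \<Omega> 0 3 \<psi> p) * cpd 1 0 \<eta> p
   + (2 * wd \<Omega> 0 2 \<psi> p + - 2 * wd \<Omega> 2 0 \<psi> p) * cpd 1 1 \<eta> p
   + (2 * wd \<Omega> 1 1 \<psi> p + 0 * wd \<Omega> 1 1 \<psi> p) * cpd 2 0 \<eta> p
   + (- 2 * wd \<Omega> 1 1 \<psi> p + 0 * wd \<Omega> 1 1 \<psi> p) * cpd 0 2 \<eta> p"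
  shows "(\<integral>p. lf p * (wd \<Omega> 0 1 \<psi> p * cpd 1 0 \<eta> p - wd \<Omega> 1 0 \<psi> p * cpd 0 1 \<eta> p) \<partial>M)
    = (\<integral>p. le p * (wd \<Omega> 1 0 \<psi> p * cpd 0 1 \<phi> p - wd \<Omega> 0 1 \<psi> p * cpd 1 0 \<phi> p) \<partial>M) + (\<integral>p. dc p * \<phi> p \<partial>M)"
proof -
  have bdd: "bdd_fun (wd \<Omega> i j \<psi>)" if "i + j \<le> 3" for i j using bdd_all that by blast
  let ?W = "\<lambda>i j. wd \<Omega> i j \<psi>"
  have s: "smooth2 \<phi>" "smooth2 \<eta>" using \<phi> \<eta> by (auto intro: test_fun_smooth2)
  have sc: "smooth2 (cpd i j \<phi>)" "smooth2 (cpd i j \<eta>)" for i j using s by (auto intro: smooth2_cpd)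
  have tc: "test_fun \<Omega> (cpd i j \<phi>)" "test_fun \<Omega> (cpd i j \<eta>)" for i j using \<phi> \<eta> by (auto intro: test_fun_cpd)
  let ?c1 = "\<lambda>p. lf p * cpd 1 0 \<eta> p + le p * cpd 1 0 \<phi> p"
  let ?c2 = "\<lambda>p. lf p * cpd 0 1 \<eta> p + le p * cpd 0 1 \<phi> p"
  let ?m = "\<lambda>i j p. cpd i j \<eta> p * cpd 0 0 \<phi> p"
  have slf: "smooth2 lf" "smooth2 le" unfolding lf_def le_def by (intro smooth2_add sc)+
  have t: "test_fun \<Omega> ?c1" "test_fun \<Omega> ?c2" "test_fun \<Omega> (?m i j)" for i j
    by (intro test_fun_add test_fun_mult(2)[OF tc(2) slf(1)] test_fun_mult(2)[OF tc(1) slf(2)] test_fun_mult(2)[OF tc(1) sc(2)])+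
  have w: "(\<integral>p. ?W i j p * \<xi> p \<partial>M) = (-1) ^ (i + j) * (\<integral>p. \<psi> p * cpd i j \<xi> p \<partial>M)"
    if "test_fun \<Omega> \<xi>" "i + j \<le> 3" for i j \<xi>
  proof -
    have "(\<integral>p. \<psi> p * cpd i j \<xi> p \<partial>M) = (-1) ^ (i + j) * (\<integral>p. ?W i j p * \<xi> p \<partial>M)"
      using wd_spec(2)[OF \<psi>(1), of i j] that \<psi>(2) by (simp add: weak_deriv_iff)
    then show ?thesis by (simp add: mult.assoc[symmetric] power_add[symmetric])
  qed
  have sW: "sqi M (?W i j)" if "i + j \<le> 3" for i j using wd_spec(1)[OF \<psi>(1), of i j] that \<psi>(2) by simp
  have iW: "integrable M (\<lambda>p. ?W i j p * \<xi> p)" if "test_fun \<Omega> \<xi>" "i + j \<le> 3" for i j \<xi>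
    using that by (intro sqi_integrable_mult sW test_fun_sqi)
  have iP: "integrable M (\<lambda>p. \<psi> p * cpd i j \<xi> p)" if "test_fun \<Omega> \<xi>" for i j \<xi>
    using that by (intro sqi_integrable_mult Hk_sqi[OF \<psi>(1)] test_fun_sqi test_fun_cpd)
  note i1 = iW[OF t(1), of 0 1] and i2 = iW[OF t(2), of 1 0] and i3 = iW[OF t(3)[of 0 1], of 3 0]
    and i4 = iW[OF t(3)[of 0 1], of 1 2] and i5 = iW[OF t(3)[of 1 0], of 2 1] and i6 = iW[OF t(3)[of 1 0], of 0 3]
    and i7 = iW[OF t(3)[of 1 1], of 2 0] and i8 = iW[OF t(3)[of 2 0], of 1 1] and i9 = iW[OF t(3)[of 0 2], of 1 1]
    and i10 = iW[OF t(3)[of 1 1], of 0 2]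
  have S: "(\<integral>p. ?W 0 1 p * ?c1 p - ?W 1 0 p * ?c2 p + ?W 3 0 p * ?m 0 1 p + ?W 1 2 p * ?m 0 1 p
       - ?W 2 1 p * ?m 1 0 p - ?W 0 3 p * ?m 1 0 p + 2 * (?W 2 0 p * ?m 1 1 p) - 2 * (?W 1 1 p * ?m 2 0 p)
       + 2 * (?W 1 1 p * ?m 0 2 p) - 2 * (?W 0 2 p * ?m 1 1 p) \<partial>M) = 0" (is "integral\<^sup>L M ?S = 0")
  proof -
    have "integral\<^sup>L M ?S = (\<integral>p. ?W 0 1 p * ?c1 p \<partial>M) - (\<integral>p. ?W 1 0 p * ?c2 p \<partial>M)
       + (\<integral>p. ?W 3 0 p * ?m 0 1 p \<partial>M) + (\<integral>p. ?W 1 2 p * ?m 0 1 p \<partial>M)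
       - (\<integral>p. ?W 2 1 p * ?m 1 0 p \<partial>M) - (\<integral>p. ?W 0 3 p * ?m 1 0 p \<partial>M) + 2 * (\<integral>p. ?W 2 0 p * ?m 1 1 p \<partial>M)
       - 2 * (\<integral>p. ?W 1 1 p * ?m 2 0 p \<partial>M) + 2 * (\<integral>p. ?W 1 1 p * ?m 0 2 p \<partial>M) - 2 * (\<integral>p. ?W 0 2 p * ?m 1 1 p \<partial>M)"
      using i1 i2 i3 i4 i5 i6 i7 i8 i9 i10 by (simp del: One_nat_def)
    also have "\<dots> = - (\<integral>p. \<psi> p * cpd 0 1 ?c1 p \<partial>M) + (\<integral>p. \<psi> p * cpd 1 0 ?c2 p \<partial>M)
       - (\<integral>p. \<psi> p * cpd 3 0 (?m 0 1) p \<partial>M) - (\<integral>p. \<psi> p * cpd 1 2 (?m 0 1) p \<partial>M)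
       + (\<integral>p. \<psi> p * cpd 2 1 (?m 1 0) p \<partial>M) + (\<integral>p. \<psi> p * cpd 0 3 (?m 1 0) p \<partial>M) + 2 * (\<integral>p. \<psi> p * cpd 2 0 (?m 1 1) p \<partial>M)
       - 2 * (\<integral>p. \<psi> p * cpd 1 1 (?m 2 0) p \<partial>M) + 2 * (\<integral>p. \<psi> p * cpd 1 1 (?m 0 2) p \<partial>M) - 2 * (\<integral>p. \<psi> p * cpd 0 2 (?m 1 1) p \<partial>M)"
      using w[OF t(1), of 0 1] w[OF t(2), of 1 0] w[OF t(3)[of 0 1], of 3 0] w[OF t(3)[of 0 1], of 1 2]
        w[OF t(3)[of 1 0], of 2 1] w[OF t(3)[of 1 0], of 0 3] w[OF t(3)[of 1 1], of 2 0] w[OF t(3)[of 2 0], of 1 1]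
        w[OF t(3)[of 0 2], of 1 1] w[OF t(3)[of 1 1], of 0 2] by (simp del: One_nat_def cpd_00)
    also have "\<dots> = (\<integral>p. \<psi> p * (- cpd 0 1 ?c1 p + cpd 1 0 ?c2 p - cpd 3 0 (?m 0 1) p - cpd 1 2 (?m 0 1) p
       + cpd 2 1 (?m 1 0) p + cpd 0 3 (?m 1 0) p + 2 * cpd 2 0 (?m 1 1) p - 2 * cpd 1 1 (?m 2 0) p
       + 2 * cpd 1 1 (?m 0 2) p - 2 * cpd 0 2 (?m 1 1) p) \<partial>M)"
      using iP[OF t(1), of 0 1] iP[OF t(2), of 1 0] iP[OF t(3)[of 0 1], of 3 0] iP[OF t(3)[of 0 1], of 1 2]
        iP[OF t(3)[of 1 0], of 2 1] iP[OF t(3)[of 1 0], of 0 3] iP[OF t(3)[of 1 1], of 2 0] iP[OF t(3)[of 2 0], of 1 1]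
        iP[OF t(3)[of 0 2], of 1 1] iP[OF t(3)[of 1 1], of 0 2]
      by (simp add: distrib_left right_diff_distrib mult.left_commute[of _ 2] del: One_nat_def cpd_00)
    also have "\<dots> = 0"
      using dual_identity_pointwise[OF s] unfolding lf_def le_def by simp
    finally show ?thesis .
  qed
  have i: "integrable M (\<lambda>p. lf p * (?W 0 1 p * cpd 1 0 \<eta> p - ?W 1 0 p * cpd 0 1 \<eta> p))"
    "integrable M (\<lambda>p. le p * (?W 1 0 p * cpd 0 1 \<phi> p - ?W 0 1 p * cpd 1 0 \<phi> p))" "integrable M (\<lambda>p. dc p * \<phi> p)"
    unfolding dc_def
    by (intro sqi_integrable_mult sqi_diff sqi_add bdd_fun_sqi bdd_fun_lincomb bdd smooth2_sqi slf s sc; simp)+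
  have "integral\<^sup>L M ?S = (\<integral>p. lf p * (?W 0 1 p * cpd 1 0 \<eta> p - ?W 1 0 p * cpd 0 1 \<eta> p)
      - le p * (?W 1 0 p * cpd 0 1 \<phi> p - ?W 0 1 p * cpd 1 0 \<phi> p) - dc p * \<phi> p \<partial>M)"
    by (intro Bochner_Integration.integral_cong refl) (simp add: dc_def algebra_simps)
  also have "\<dots> = (\<integral>p. lf p * (?W 0 1 p * cpd 1 0 \<eta> p - ?W 1 0 p * cpd 0 1 \<eta> p) \<partial>M)
     - (\<integral>p. le p * (?W 1 0 p * cpd 0 1 \<phi> p - ?W 0 1 p * cpd 1 0 \<phi> p) \<partial>M) - (\<integral>p. dc p * \<phi> p \<partial>M)"
    using i by simp
  finally show ?thesis using S by simp
qed

text \<open>Both arguments are approximated by test functions at once. The trilinear terms converge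
  because the derivatives of \<open>\<psi>\<close> up to order three act as bounded weights.\<close>

lemma dual_identity:
  assumes \<psi>: "Hk \<Omega> k \<psi>" "3 \<le> k" and bdd: "\<And>i j. i + j \<le> 3 \<Longrightarrow> bdd_fun (wd \<Omega> i j \<psi>)"
    and v: "H20 \<Omega> v" and z: "H20 \<Omega> z"
  shows "a1 \<Omega> v \<psi> z = (\<integral>p. lap \<Omega> z p * jac \<Omega> \<psi> v p \<partial>M) + (\<integral>p. dual_corr \<Omega> \<psi> z p * v p \<partial>M)"
proof -
  obtain \<phi> where \<phi>: "\<And>n. test_fun \<Omega> (\<phi> n)"
    "\<And>i j. i + j \<le> 2 \<Longrightarrow> conv2 M (\<lambda>n. cpd i j (\<phi> n)) (wd \<Omega> i j v)" using Hk0_approx[OF v] by blast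
  obtain \<eta> where \<eta>: "\<And>n. test_fun \<Omega> (\<eta> n)"
    "\<And>i j. i + j \<le> 2 \<Longrightarrow> conv2 M (\<lambda>n. cpd i j (\<eta> n)) (wd \<Omega> i j z)" using Hk0_approx[OF z] by blast
  have "conv2 M \<phi> v" using \<phi>(2)[of 0 0] by simp
  then have A: "(\<lambda>n. \<integral>p. (cpd 2 0 (\<phi> n) p + cpd 0 2 (\<phi> n) p) * (wd \<Omega> 0 1 \<psi> p * cpd 1 0 (\<eta> n) p - wd \<Omega> 1 0 \<psi> p * cpd 0 1 (\<eta> n) p) \<partial>M)
      \<longlonglongrightarrow> (\<integral>p. (wd \<Omega> 2 0 v p + wd \<Omega> 0 2 v p) * (wd \<Omega> 0 1 \<psi> p * wd \<Omega> 1 0 z p - wd \<Omega> 1 0 \<psi> p * wd \<Omega> 0 1 z p) \<partial>M)"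
    by (intro conv2_integral_mult conv2_add conv2_diff bdd_fun_conv2 bdd \<phi>(2) \<eta>(2)) simp_all
  have B: "(\<lambda>n. (\<integral>p. (cpd 2 0 (\<eta> n) p + cpd 0 2 (\<eta> n) p) * (wd \<Omega> 1 0 \<psi> p * cpd 0 1 (\<phi> n) p - wd \<Omega> 0 1 \<psi> p * cpd 1 0 (\<phi> n) p) \<partial>M)
     + (\<integral>p. ((- 1 * wd \<Omega> 3 0 \<psi> p + - 1 * wd \<Omega> 1 2 \<psi> p) * cpd 0 1 (\<eta> n) p
   + (1 * wd \<Omega> 2 1 \<psi> p + 1 * wd \<Omega> 0 3 \<psi> p) * cpd 1 0 (\<eta> n) p
   + (2 * wd \<Omega> 0 2 \<psi> p + - 2 * wd \<Omega> 2 0 \<psi> p) * cpd 1 1 (\<eta> n) p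
   + (2 * wd \<Omega> 1 1 \<psi> p + 0 * wd \<Omega> 1 1 \<psi> p) * cpd 2 0 (\<eta> n) p
   + (- 2 * wd \<Omega> 1 1 \<psi> p + 0 * wd \<Omega> 1 1 \<psi> p) * cpd 0 2 (\<eta> n) p) * \<phi> n p \<partial>M))
     \<longlonglongrightarrow> (\<integral>p. (wd \<Omega> 2 0 z p + wd \<Omega> 0 2 z p) * (wd \<Omega> 1 0 \<psi> p * wd \<Omega> 0 1 v p - wd \<Omega> 0 1 \<psi> p * wd \<Omega> 1 0 v p) \<partial>M)
     + (\<integral>p. ((- 1 * wd \<Omega> 3 0 \<psi> p + - 1 * wd \<Omega> 1 2 \<psi> p) * wd \<Omega> 0 1 z p
   + (1 * wd \<Omega> 2 1 \<psi> p + 1 * wd \<Omega> 0 3 \<psi> p) * wd \<Omega> 1 0 z p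
   + (2 * wd \<Omega> 0 2 \<psi> p + - 2 * wd \<Omega> 2 0 \<psi> p) * wd \<Omega> 1 1 z p
   + (2 * wd \<Omega> 1 1 \<psi> p + 0 * wd \<Omega> 1 1 \<psi> p) * wd \<Omega> 2 0 z p
   + (- 2 * wd \<Omega> 1 1 \<psi> p + 0 * wd \<Omega> 1 1 \<psi> p) * wd \<Omega> 0 2 z p) * v p \<partial>M)"
    by (intro tendsto_add conv2_integral_mult conv2_add conv2_diff bdd_fun_conv2 bdd_fun_lincomb bdd \<phi>(2) \<eta>(2)
        \<open>conv2 M \<phi> v\<close>) simp_all
  have bdd_all: "\<forall>i j. i + j \<le> 3 \<longrightarrow> bdd_fun (wd \<Omega> i j \<psi>)" using bdd by blast
  note E = dual_identity_test[OF \<psi> bdd_all \<phi>(1) \<eta>(1)]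
  show ?thesis
    unfolding a1_eq lap_def jac_def dual_corr_def
    by (rule LIMSEQ_unique[OF A B[folded E]])
qed

text \<open>The bracket is a divergence: \<open>\<phi>_y \<eta>_x - \<phi>_x \<eta>_y = (\<phi>
  \<eta>_x)_y - (\<phi> \<eta>_y)_x\<close>, as the mixed derivatives of \<open>\<eta>\<close>
  cancel. One integration by parts then leaves the gradient of the Laplacian of
  \<open>\<psi>\<close>.\<close>

lemma a1_by_parts_test:
  assumes \<psi>: "Hk \<Omega> k \<psi>" "3 \<le> k" and \<phi>: "test_fun \<Omega> \<phi>" and \<eta>: "test_fun \<Omega> \<eta>"
  shows "(\<integral>p. lap \<Omega> \<psi> p * (cpd 0 1 \<phi> p * cpd 1 0 \<eta> p - cpd 1 0 \<phi> p * cpd 0 1 \<eta> p) \<partial>M)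
    = (\<integral>p. ((wd \<Omega> 3 0 \<psi> p + wd \<Omega> 1 2 \<psi> p) * cpd 0 1 \<eta> p - (wd \<Omega> 2 1 \<psi> p + wd \<Omega> 0 3 \<psi> p) * cpd 1 0 \<eta> p) * \<phi> p \<partial>M)"
proof -
  let ?W = "\<lambda>i j. wd \<Omega> i j \<psi>"
  have s: "smooth2 \<phi>" "smooth2 \<eta>" using \<phi> \<eta> by (auto intro: test_fun_smooth2)
  have t: "test_fun \<Omega> (\<lambda>p. cpd i j \<eta> p * \<phi> p)" for i j
    by (intro test_fun_mult(2) \<phi> smooth2_cpd s)
  have sW: "sqi M (?W i j)" if "i + j \<le> 3" for i j using wd_spec(1)[OF \<psi>(1), of i j] that \<psi>(2) by simp
  have iW: "integrable M (\<lambda>p. ?W i j p * \<xi> p)" if "test_fun \<Omega> \<xi>" "i + j \<le> 3" for i j \<xi>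
    using that by (intro sqi_integrable_mult sW test_fun_sqi)
  have st: "(\<integral>p. ?W (Suc i) j p * \<xi> p \<partial>M) = - (\<integral>p. ?W i j p * pdx \<xi> p \<partial>M)"
    "(\<integral>p. ?W i (Suc j) p * \<xi> p \<partial>M) = - (\<integral>p. ?W i j p * pdy \<xi> p \<partial>M)" if "test_fun \<Omega> \<xi>" "i + j \<le> 2" for i j \<xi>
    using wd_step_test[OF \<psi>(1) _ that(1), of i j] that(2) \<psi>(2) by auto
  let ?y = "\<lambda>p. cpd 0 1 \<eta> p * \<phi> p" and ?x = "\<lambda>p. cpd 1 0 \<eta> p * \<phi> p"
  have pd: "pdx ?y = (\<lambda>p. cpd 1 1 \<eta> p * \<phi> p + cpd 0 1 \<eta> p * cpd 1 0 \<phi> p)"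
    "pdy ?x = (\<lambda>p. cpd 1 1 \<eta> p * \<phi> p + cpd 1 0 \<eta> p * cpd 0 1 \<phi> p)"
    by (simp_all add: pd_mult smooth2_cpd s pdx_cpd pdy_cpd cpd_10[of \<phi>] cpd_01[of \<phi>])
  have tp: "test_fun \<Omega> (pdx ?y)" "test_fun \<Omega> (pdy ?x)" by (intro test_fun_pd t)+
  have "(\<integral>p. ((?W 3 0 p + ?W 1 2 p) * cpd 0 1 \<eta> p - (?W 2 1 p + ?W 0 3 p) * cpd 1 0 \<eta> p) * \<phi> p \<partial>M)
    = (\<integral>p. ?W 3 0 p * ?y p + ?W 1 2 p * ?y p - ?W 2 1 p * ?x p - ?W 0 3 p * ?x p \<partial>M)"
    by (intro Bochner_Integration.integral_cong refl) (simp only: algebra_simps)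
  also have "\<dots> = (\<integral>p. ?W 3 0 p * ?y p \<partial>M) + (\<integral>p. ?W 1 2 p * ?y p \<partial>M) - (\<integral>p. ?W 2 1 p * ?x p \<partial>M) - (\<integral>p. ?W 0 3 p * ?x p \<partial>M)"
    using iW[OF t[of 0 1], of 3 0] iW[OF t[of 0 1], of 1 2] iW[OF t[of 1 0], of 2 1] iW[OF t[of 1 0], of 0 3]
    by (simp del: One_nat_def)
  also have "\<dots> = - (\<integral>p. ?W 2 0 p * pdx ?y p \<partial>M) - (\<integral>p. ?W 0 2 p * pdx ?y p \<partial>M)
      + (\<integral>p. ?W 2 0 p * pdy ?x p \<partial>M) + (\<integral>p. ?W 0 2 p * pdy ?x p \<partial>M)"
    using st(1)[OF t[of 0 1], of 2 0] st(1)[OF t[of 0 1], of 0 2] st(2)[OF t[of 1 0], of 2 0] st(2)[OF t[of 1 0], of 0 2]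
    by (simp add: numeral_2_eq_2 numeral_3_eq_3)
  also have "\<dots> = (\<integral>p. - (?W 2 0 p * pdx ?y p) - ?W 0 2 p * pdx ?y p + ?W 2 0 p * pdy ?x p + ?W 0 2 p * pdy ?x p \<partial>M)"
    using iW[OF tp(1), of 2 0] iW[OF tp(1), of 0 2] iW[OF tp(2), of 2 0] iW[OF tp(2), of 0 2] by (simp del: One_nat_def)
  also have "\<dots> = (\<integral>p. lap \<Omega> \<psi> p * (cpd 0 1 \<phi> p * cpd 1 0 \<eta> p - cpd 1 0 \<phi> p * cpd 0 1 \<eta> p) \<partial>M)"
    by (intro Bochner_Integration.integral_cong refl) (simp only: pd lap_def, simp only: algebra_simps)
  finally show ?thesis by (rule sym)
qed

lemma lap_bdd:
  assumes "\<And>i j. i + j \<le> 3 \<Longrightarrow> bdd_fun (wd \<Omega> i j \<psi>)" shows "bdd_fun (lap \<Omega> \<psi>)"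
  using bdd_fun_lincomb[OF assms[of 2 0] assms[of 0 2], of 1 1] by (simp add: lap_def[abs_def])

lemma a1_by_parts:
  assumes \<psi>: "Hk \<Omega> k \<psi>" "3 \<le> k" and bdd: "\<And>i j. i + j \<le> 3 \<Longrightarrow> bdd_fun (wd \<Omega> i j \<psi>)"
    and v: "H20 \<Omega> v" and z: "H20 \<Omega> z"
  shows "a1 \<Omega> \<psi> v z = (\<integral>p. ((wd \<Omega> 3 0 \<psi> p + wd \<Omega> 1 2 \<psi> p) * wd \<Omega> 0 1 z p
      - (wd \<Omega> 2 1 \<psi> p + wd \<Omega> 0 3 \<psi> p) * wd \<Omega> 1 0 z p) * v p \<partial>M)"
proof -
  obtain \<phi> where \<phi>: "\<And>n. test_fun \<Omega> (\<phi> n)"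
    "\<And>i j. i + j \<le> 2 \<Longrightarrow> conv2 M (\<lambda>n. cpd i j (\<phi> n)) (wd \<Omega> i j v)" using Hk0_approx[OF v] by blast
  obtain \<eta> where \<eta>: "\<And>n. test_fun \<Omega> (\<eta> n)"
    "\<And>i j. i + j \<le> 2 \<Longrightarrow> conv2 M (\<lambda>n. cpd i j (\<eta> n)) (wd \<Omega> i j z)" using Hk0_approx[OF z] by blast
  have \<phi>0: "conv2 M \<phi> v" using \<phi>(2)[of 0 0] by simp
  note b = lap_bdd[OF bdd]
  have cv: "conv2 M (\<lambda>n p. lap \<Omega> \<psi> p * cpd i j (\<phi> n) p) (\<lambda>p. lap \<Omega> \<psi> p * wd \<Omega> i j v p)" if "i + j \<le> 2" for i j
    by (rule bdd_fun_conv2[OF b \<phi>(2)[OF that]])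
  have bl: "bdd_fun (\<lambda>p. 1 * wd \<Omega> 3 0 \<psi> p + 1 * wd \<Omega> 1 2 \<psi> p)" "bdd_fun (\<lambda>p. 1 * wd \<Omega> 2 1 \<psi> p + 1 * wd \<Omega> 0 3 \<psi> p)"
    by (intro bdd_fun_lincomb bdd; simp)+
  have i: "integrable M (\<lambda>p. (lap \<Omega> \<psi> p * f p) * g p)" if "sqi M f" "sqi M g" for f g
    using that by (intro sqi_integrable_mult bdd_fun_sqi b)
  have split: "(\<integral>p. lap \<Omega> \<psi> p * (f p * g p - h p * k p) \<partial>M)
      = (\<integral>p. (lap \<Omega> \<psi> p * f p) * g p \<partial>M) - (\<integral>p. (lap \<Omega> \<psi> p * h p) * k p \<partial>M)"
    if "sqi M f" "sqi M g" "sqi M h" "sqi M k" for f g h k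
    using i[OF that(1,2)] i[OF that(3,4)] by (simp add: right_diff_distrib mult.assoc)
  have sc: "sqi M (cpd i j (\<phi> n))" "sqi M (cpd i j (\<eta> n))" for i j n
    using \<phi>(1) \<eta>(1) by (auto intro: test_fun_sqi test_fun_cpd)
  have sw: "sqi M (wd \<Omega> i j v)" "sqi M (wd \<Omega> i j z)" if "i + j \<le> 2" for i j using H20_sqi(3)[OF v that] H20_sqi(3)[OF z that] .
  have "(\<lambda>n. (\<integral>p. (lap \<Omega> \<psi> p * cpd 0 1 (\<phi> n) p) * cpd 1 0 (\<eta> n) p \<partial>M) - (\<integral>p. (lap \<Omega> \<psi> p * cpd 1 0 (\<phi> n) p) * cpd 0 1 (\<eta> n) p \<partial>M))
     \<longlonglongrightarrow> (\<integral>p. (lap \<Omega> \<psi> p * wd \<Omega> 0 1 v p) * wd \<Omega> 1 0 z p \<partial>M) - (\<integral>p. (lap \<Omega> \<psi> p * wd \<Omega> 1 0 v p) * wd \<Omega> 0 1 z p \<partial>M)"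
    by (intro tendsto_diff conv2_integral_mult cv \<eta>(2)) simp_all
  then have L: "(\<lambda>n. \<integral>p. lap \<Omega> \<psi> p * (cpd 0 1 (\<phi> n) p * cpd 1 0 (\<eta> n) p - cpd 1 0 (\<phi> n) p * cpd 0 1 (\<eta> n) p) \<partial>M)
     \<longlonglongrightarrow> a1 \<Omega> \<psi> v z"
    unfolding a1_eq split[OF sc(1) sc(2) sc(1) sc(2)]
    by (subst split) (simp_all add: sw del: One_nat_def)
  have R: "(\<lambda>n. \<integral>p. ((1 * wd \<Omega> 3 0 \<psi> p + 1 * wd \<Omega> 1 2 \<psi> p) * cpd 0 1 (\<eta> n) p - (1 * wd \<Omega> 2 1 \<psi> p + 1 * wd \<Omega> 0 3 \<psi> p) * cpd 1 0 (\<eta> n) p) * \<phi> n p \<partial>M)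
     \<longlonglongrightarrow> (\<integral>p. ((1 * wd \<Omega> 3 0 \<psi> p + 1 * wd \<Omega> 1 2 \<psi> p) * wd \<Omega> 0 1 z p - (1 * wd \<Omega> 2 1 \<psi> p + 1 * wd \<Omega> 0 3 \<psi> p) * wd \<Omega> 1 0 z p) * v p \<partial>M)"
    by (intro conv2_integral_mult conv2_diff bdd_fun_conv2 bl \<eta>(2) \<phi>0) simp_all
  show ?thesis
    using LIMSEQ_unique[OF L[unfolded a1_by_parts_test[OF \<psi> \<phi>(1) \<eta>(1)]] R[unfolded mult_1]] .
qed

text \<open>\<open>a1_by_parts\<close> and skew-symmetry of \<open>a2\<close> match two terms of
  \<open>dual_eq\<close> exactly. The term with \<open>\<psi>\<close> in the second slot matches up
  to \<open>dual_corr\<close>, which is moved to the right-hand side.\<close>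

lemma adjoint_imp_dual_eq:
  assumes \<psi>: "Hk \<Omega> k \<psi>" "3 \<le> k" and bdd: "\<And>i j. i + j \<le> 3 \<Longrightarrow> bdd_fun (wd \<Omega> i j \<psi>)"
    and z: "H20 \<Omega> z" and g: "sqi M g"
    and adj: "\<And>v. H20 \<Omega> v \<Longrightarrow>
      a0 \<Omega> Rey v z + a1 \<Omega> v \<psi> z + a1 \<Omega> \<psi> v z + a2 \<Omega> Ro v z = (\<integral>p. g p * v p \<partial>M)"
    and d: "sqi M (dual_corr \<Omega> \<psi> z)"
  shows "dual_eq \<Omega> Rey Ro \<psi> (\<lambda>p. g p - dual_corr \<Omega> \<psi> z p) z"
  unfolding dual_eq_def set_integral_msr
proof (intro allI impI)
  fix v assume v: "H20 \<Omega> v"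
  have "(\<integral>p. (g p - dual_corr \<Omega> \<psi> z p) * v p \<partial>M) = (\<integral>p. g p * v p \<partial>M) - (\<integral>p. dual_corr \<Omega> \<psi> z p * v p \<partial>M)"
    using sqi_integrable_mult[OF g H20_sqi(1)[OF v]] sqi_integrable_mult[OF d H20_sqi(1)[OF v]]
    by (simp add: left_diff_distrib)
  then show "1 / Rey * (\<integral>p. lap \<Omega> z p * lap \<Omega> v p \<partial>M) + (\<integral>p. lap \<Omega> z p * jac \<Omega> \<psi> v p \<partial>M)
     + (\<integral>p. ((wd \<Omega> 3 0 \<psi> p + wd \<Omega> 1 2 \<psi> p) * wd \<Omega> 0 1 z p - (wd \<Omega> 2 1 \<psi> p + wd \<Omega> 0 3 \<psi> p) * wd \<Omega> 1 0 z p) * v p \<partial>M)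
     + 1 / Ro * (\<integral>p. wd \<Omega> 1 0 z p * v p \<partial>M) = (\<integral>p. (g p - dual_corr \<Omega> \<psi> z p) * v p \<partial>M)"
    using adj[OF v] dual_identity[OF \<psi> bdd v z] a1_by_parts[OF \<psi> bdd v z] a2_eq_dual[OF v z, of Ro]
      a0_eq[of Rey z v] a0_commute[of Rey v z]
    by linarith
qed

text \<open>No derivative of \<open>z\<close> beyond order two occurs, so \<open>semi\<close> of
  order two suffices on the right. The coefficients in \<open>dual_corr\<close> are written as
  two-term combinations, if necessary with a factor 0, so that \<open>bdd_fun_lincomb\<close> fits
  all of them.\<close>

lemma dual_corr_bound:
  assumes bdd: "\<And>i j. i + j \<le> 3 \<Longrightarrow> bdd_fun (wd \<Omega> i j \<psi>)"
  shows "\<exists>C\<ge>0. \<forall>z. H20 \<Omega> z \<longrightarrow> sqi M (dual_corr \<Omega> \<psi> z) \<and> nrm M (dual_corr \<Omega> \<psi> z) \<le> C * semi \<Omega> 2 z"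
proof -
  obtain P where P: "P > 0" "\<And>v. H20 \<Omega> v \<Longrightarrow> normH \<Omega> 2 v \<le> P * semi \<Omega> 2 v" using normH2_le_semi2 by blast
  have key: "\<exists>C\<ge>0. \<forall>z. H20 \<Omega> z \<longrightarrow> sqi M (\<lambda>p. w p * wd \<Omega> i j z p) \<and> nrm M (\<lambda>p. w p * wd \<Omega> i j z p) \<le> C * semi \<Omega> 2 z"
    if w: "bdd_fun w" and ij: "i + j \<le> 2" for w i j
  proof -
    obtain C where C: "C \<ge> 0" "\<And>f. sqi M f \<Longrightarrow> nrm M (\<lambda>p. w p * f p) \<le> C * nrm M f" using bdd_fun_nrm[OF w] by blast
    have "sqi M (\<lambda>p. w p * wd \<Omega> i j z p) \<and> nrm M (\<lambda>p. w p * wd \<Omega> i j z p) \<le> C * P * semi \<Omega> 2 z" if z: "H20 \<Omega> z" for z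
    proof
      show "sqi M (\<lambda>p. w p * wd \<Omega> i j z p)" by (intro bdd_fun_sqi w H20_sqi(3)[OF z ij])
      have "nrm M (wd \<Omega> i j z) \<le> P * semi \<Omega> 2 z"
        using norm0_wd_le_normH[OF ij, of \<Omega> z] P(2)[OF z] by (simp add: norm0_eq_nrm)
      then have "C * nrm M (wd \<Omega> i j z) \<le> C * (P * semi \<Omega> 2 z)" using C(1) by (rule mult_left_mono)
      then show "nrm M (\<lambda>p. w p * wd \<Omega> i j z p) \<le> C * P * semi \<Omega> 2 z"
        using C(2)[OF H20_sqi(3)[OF z ij]] by (simp only: mult.assoc)
    qed
    then show ?thesis using C(1) P(1) by (intro exI[of _ "C * P"]) auto
  qed
  have add: "\<exists>C\<ge>0. \<forall>z. H20 \<Omega> z \<longrightarrow> sqi M (\<lambda>p. F z p + G z p) \<and> nrm M (\<lambda>p. F z p + G z p) \<le> C * semi \<Omega> 2 z"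
    if F: "\<exists>C\<ge>0. \<forall>z. H20 \<Omega> z \<longrightarrow> sqi M (F z) \<and> nrm M (F z) \<le> C * semi \<Omega> 2 z"
      and G: "\<exists>C\<ge>0. \<forall>z. H20 \<Omega> z \<longrightarrow> sqi M (G z) \<and> nrm M (G z) \<le> C * semi \<Omega> 2 z" for F G
  proof -
    obtain C D where C: "C \<ge> 0" "\<And>z. H20 \<Omega> z \<Longrightarrow> sqi M (F z) \<and> nrm M (F z) \<le> C * semi \<Omega> 2 z"
      and D: "D \<ge> 0" "\<And>z. H20 \<Omega> z \<Longrightarrow> sqi M (G z) \<and> nrm M (G z) \<le> D * semi \<Omega> 2 z" using F G by blast
    have "sqi M (\<lambda>p. F z p + G z p) \<and> nrm M (\<lambda>p. F z p + G z p) \<le> (C + D) * semi \<Omega> 2 z" if "H20 \<Omega> z" for z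
      using C(2)[OF that] D(2)[OF that] nrm_triangle[of M "F z" "G z"] sqi_add[of M "F z" "G z"]
      by (auto simp: distrib_right)
    then show ?thesis using C(1) D(1) by (intro exI[of _ "C + D"]) auto
  qed
  show ?thesis unfolding dual_corr_def[abs_def]
    by (intro add key bdd_fun_lincomb bdd) simp_all
qed

end

section \<open>Triangulations and the linearised problem\<close>

context bounded_open
begin

lemma semi_diff_le:
  assumes f: "Hk \<Omega> k f" and g: "Hk \<Omega> k g"
  shows "semi \<Omega> k (\<lambda>p. f p - g p) \<le> semi \<Omega> k f + semi \<Omega> k g"
proof -
  have "semi \<Omega> k (\<lambda>p. f p - g p) \<le> L2_set (\<lambda>i. norm0 \<Omega> (wd \<Omega> i (k - i) f) + norm0 \<Omega> (wd \<Omega> i (k - i) g)) {..k}"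
    unfolding semi_eq_L2_set
  proof (rule L2_set_mono)
    fix i assume "i \<in> {..k}"
    then have ij: "i + (k - i) \<le> k" by simp
    have s: "sqi M (wd \<Omega> i (k - i) f)" "sqi M (wd \<Omega> i (k - i) g)" "sqi M (wd \<Omega> i (k - i) (\<lambda>p. f p - g p))"
      by (rule wd_spec(1)[OF f ij] wd_spec(1)[OF g ij] wd_spec(1)[OF Hk_diff(1)[OF f g] ij])+
    have "nrm M (wd \<Omega> i (k - i) (\<lambda>p. f p - g p)) = nrm M (\<lambda>p. wd \<Omega> i (k - i) f p - wd \<Omega> i (k - i) g p)"
      by (rule nrm_cong_AE[OF sqi_measurable[OF s(3)] sqi_measurable[OF sqi_diff[OF s(1,2)]] Hk_diff(2)[OF f g ij]])
    also have "\<dots> \<le> nrm M (wd \<Omega> i (k - i) f) + nrm M (wd \<Omega> i (k - i) g)" by (rule nrm_triangle_diff[OF s(1,2)])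
    finally show "norm0 \<Omega> (wd \<Omega> i (k - i) (\<lambda>p. f p - g p)) \<le> norm0 \<Omega> (wd \<Omega> i (k - i) f) + norm0 \<Omega> (wd \<Omega> i (k - i) g)"
      by (simp add: norm0_eq_nrm)
  qed (simp add: norm0_eq_nrm)
  also have "\<dots> \<le> semi \<Omega> k f + semi \<Omega> k g" unfolding semi_eq_L2_set by (rule L2_set_triangle_ineq)
  finally show ?thesis .
qed

text \<open>\<open>normm1\<close> is a real \<open>Sup\<close>, which says nothing useful about an
  empty set. Hence a function with zero boundary values and nonzero norm has to be exhibited: a bump
  on a small cube.\<close>

lemma normm1_le:
  assumes ne: "\<Omega> \<noteq> {}" and b: "\<And>v. Hk0 \<Omega> 1 v \<Longrightarrow> \<bar>\<integral>p. g p * v p \<partial>M\<bar> \<le> K * normH \<Omega> 1 v"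
  shows "normm1 \<Omega> g \<le> K"
  unfolding normm1_def set_integral_msr
proof (rule cSup_least)
  obtain x where x: "x \<in> \<Omega>" using ne by blast
  obtain d where d: "d > 0" "\<And>h. 0 < h \<Longrightarrow> h < d \<Longrightarrow> cbox x (x + h *\<^sub>R One) \<subseteq> \<Omega>"
    using small_cubes_in_dom[OF x] by blast
  define y where "y = x + (d / 2) *\<^sub>R One"
  have sub: "cbox x y \<subseteq> \<Omega>" unfolding y_def using d by (intro d(2)) auto
  let ?\<phi> = "bump x y 1"
  have T: "test_fun \<Omega> ?\<phi>" by (rule test_fun_bump[OF sub])
  have pos: "?\<phi> p \<noteq> 0" if "p \<in> box x y" for p
    using that by (simp add: bump_def mem_box_pt expdec_def)
  have "nrm M ?\<phi> \<noteq> 0"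
  proof
    assume "nrm M ?\<phi> = 0"
    then have "AE p in M. ?\<phi> p = 0" by (rule nrm_eq_0[OF test_fun_sqi[OF T]])
    then have "AE p in lborel. p \<notin> box x y"
      unfolding AE_msr_iff
    proof eventually_elim
      case (elim p) then show ?case using pos[of p] sub box_subset_cbox[of x y] by blast
    qed
    then have "box x y \<in> null_sets lborel" by (subst (asm) AE_iff_null_sets[symmetric]) auto
    then have "negligible (box x y)" by (simp add: negligible_iff_null_sets null_sets_completionI)
    moreover have "box x y \<noteq> {}"
    proof -
      have "x + (d / 4) *\<^sub>R One \<in> box x y" using d(1) by (simp add: mem_box_pt y_def One_pt)
      then show ?thesis by blast
    qed
    ultimately show False using open_not_negligible[OF open_box] by blast
  qed
  moreover have "nrm M ?\<phi> \<le> normH \<Omega> 1 ?\<phi>"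
    using norm0_wd_le_normH[of 0 0 1 \<Omega> ?\<phi>] by (simp add: norm0_eq_nrm)
  ultimately have "normH \<Omega> 1 ?\<phi> \<noteq> 0" using nrm_nonneg[of M ?\<phi>] by linarith
  then show "{\<bar>\<integral>p. g p * v p \<partial>M\<bar> / normH \<Omega> 1 v |v. Hk0 \<Omega> 1 v \<and> normH \<Omega> 1 v \<noteq> 0} \<noteq> {}"
    using Hk0_test_fun[OF T, of 1] by blast
next
  fix y assume "y \<in> {\<bar>\<integral>p. g p * v p \<partial>M\<bar> / normH \<Omega> 1 v |v. Hk0 \<Omega> 1 v \<and> normH \<Omega> 1 v \<noteq> 0}"
  then obtain v where v: "y = \<bar>\<integral>p. g p * v p \<partial>M\<bar> / normH \<Omega> 1 v" "Hk0 \<Omega> 1 v" "normH \<Omega> 1 v \<noteq> 0" by blast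
  have "normH \<Omega> 1 v > 0" using v(3) normH_nonneg[of \<Omega> 1 v] by linarith
  then show "y \<le> K" using b[OF v(2)] by (simp add: v(1) divide_le_eq)
qed

text \<open>Each second derivative hands one derivative over to \<open>v\<close>, so the Laplacian
  of \<open>e\<close> has a negative norm controlled by \<open>semi\<close> of order one. The factor
  2 comes from estimating the two directions separately.\<close>

lemma lap_integral_bound:
  assumes e: "H20 \<Omega> e" and v: "Hk0 \<Omega> 1 v"
  shows "\<bar>\<integral>p. lap \<Omega> e p * v p \<partial>M\<bar> \<le> 2 * semi \<Omega> 1 e * normH \<Omega> 1 v"
proof -
  have sv: "sqi M v" "sqi M (wd \<Omega> 1 0 v)" "sqi M (wd \<Omega> 0 1 v)"
    using Hk0_Hk[OF v] by (auto intro: Hk_sqi wd_spec)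
  have se: "sqi M (wd \<Omega> i j e)" if "i + j \<le> 2" for i j by (rule H20_sqi(3)[OF e that])
  have "(\<integral>p. lap \<Omega> e p * v p \<partial>M) = (\<integral>p. wd \<Omega> 2 0 e p * v p \<partial>M) + (\<integral>p. wd \<Omega> 0 2 e p * v p \<partial>M)"
    unfolding lap_def using sqi_integrable_mult[OF se[of 2 0] sv(1)] sqi_integrable_mult[OF se[of 0 2] sv(1)]
    by (simp add: distrib_right)
  also have "\<dots> = - (\<integral>p. wd \<Omega> 1 0 e p * wd \<Omega> 1 0 v p \<partial>M) - (\<integral>p. wd \<Omega> 0 1 e p * wd \<Omega> 0 1 v p \<partial>M)"
    using wd_step(1)[OF Hk0_Hk[OF e] _ v, of 1 0] wd_step(2)[OF Hk0_Hk[OF e] _ v, of 0 1]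
    by (simp add: numeral_2_eq_2)
  finally have "\<bar>\<integral>p. lap \<Omega> e p * v p \<partial>M\<bar> \<le> \<bar>\<integral>p. wd \<Omega> 1 0 e p * wd \<Omega> 1 0 v p \<partial>M\<bar> + \<bar>\<integral>p. wd \<Omega> 0 1 e p * wd \<Omega> 0 1 v p \<partial>M\<bar>"
    by linarith
  also have "\<dots> \<le> nrm M (wd \<Omega> 1 0 e) * nrm M (wd \<Omega> 1 0 v) + nrm M (wd \<Omega> 0 1 e) * nrm M (wd \<Omega> 0 1 v)"
    by (intro add_mono Cauchy_Schwarz_integral se sv) simp_all
  also have "\<dots> \<le> semi \<Omega> 1 e * normH \<Omega> 1 v + semi \<Omega> 1 e * normH \<Omega> 1 v"
    using norm0_wd_le_semi[of \<Omega> 1 0 e] norm0_wd_le_semi[of \<Omega> 0 1 e]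
      norm0_wd_le_normH[of 1 0 1 \<Omega> v] norm0_wd_le_normH[of 0 1 1 \<Omega> v]
    unfolding norm0_eq_nrm by (intro add_mono mult_mono) simp_all
  finally show ?thesis by (simp add: mult_ac)
qed

text \<open>This is why the dual problem for the H1 estimate has the datum
  \<open>- lap \<Omega> e\<close>: tested with the error it returns the squared H1 seminorm.\<close>

lemma semi1_power2: assumes e: "H20 \<Omega> e" shows "(semi \<Omega> 1 e)\<^sup>2 = (\<integral>p. - lap \<Omega> e p * e p \<partial>M)"
proof -
  have e1: "Hk0 \<Omega> 1 e" using e by (rule Hk0_mono) simp
  have se: "sqi M (wd \<Omega> i j e)" if "i + j \<le> 2" for i j by (rule H20_sqi(3)[OF e that])
  have s0: "sqi M e" by (rule H20_sqi(1)[OF e])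
  have "(\<integral>p. - lap \<Omega> e p * e p \<partial>M) = - ((\<integral>p. wd \<Omega> 2 0 e p * e p \<partial>M) + (\<integral>p. wd \<Omega> 0 2 e p * e p \<partial>M))"
    unfolding lap_def using sqi_integrable_mult[OF se[of 2 0] s0] sqi_integrable_mult[OF se[of 0 2] s0]
    by (simp add: distrib_right left_diff_distrib)
  also have "\<dots> = (\<integral>p. wd \<Omega> 1 0 e p * wd \<Omega> 1 0 e p \<partial>M) + (\<integral>p. wd \<Omega> 0 1 e p * wd \<Omega> 0 1 e p \<partial>M)"
    using wd_step(1)[OF Hk0_Hk[OF e] _ e1, of 1 0] wd_step(2)[OF Hk0_Hk[OF e] _ e1, of 0 1]
    by (simp add: numeral_2_eq_2)
  also have "\<dots> = (semi \<Omega> 1 e)\<^sup>2"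
    by (simp add: semi_def norm0_eq_nrm nrm_power2 power2_eq_square[of "wd _ _ _ _ _"])
  finally show ?thesis by simp
qed

text \<open>The open triangles miss only the frontiers of finitely many convex sets, and these are
  null.\<close>

lemma triangulation_cover:
  assumes T: "triangulation \<Omega> T"
  defines "\<K> \<equiv> (\<lambda>K. interior (convex hull K)) ` T"
  shows "finite \<K>" "\<And>K. K \<in> \<K> \<Longrightarrow> open K \<and> convex K \<and> K \<subseteq> \<Omega>" "AE p in M. p \<in> \<Union>\<K>"
proof -
  have fin: "finite T" and Om: "\<Omega> = interior (\<Union>K\<in>T. convex hull K)" using T by (auto simp: triangulation_def)
  show "finite \<K>" using fin by (simp add: \<K>_def)
  show "open K \<and> convex K \<and> K \<subseteq> \<Omega>" if K: "K \<in> \<K>" for K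
  proof -
    obtain L where L: "L \<in> T" "K = interior (convex hull L)" using K unfolding \<K>_def by blast
    have "K \<subseteq> \<Omega>" unfolding L(2) Om using L(1) by (intro interior_mono) blast
    then show ?thesis unfolding L(2) by (simp add: convex_interior)
  qed
  have "AE p in lborel. \<forall>K\<in>T. p \<notin> frontier (convex hull K)"
  proof (rule AE_finite_allI[OF fin])
    fix K
    have "frontier (convex hull K) \<in> null_sets lebesgue"
      using negligible_convex_frontier[of "convex hull K"] by (simp add: negligible_iff_null_sets)
    then have "AE p in lebesgue. p \<notin> frontier (convex hull K)" by (rule AE_not_in)
    then show "AE p in lborel. p \<notin> frontier (convex hull K)" by (simp add: AE_completion_iff)
  qed
  then show "AE p in M. p \<in> \<Union>\<K>"
    unfolding AE_msr_iff
  proof (rule eventually_mono, intro impI)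
    fix p assume p: "\<forall>K\<in>T. p \<notin> frontier (convex hull K)" "p \<in> \<Omega>"
    then obtain K where K: "K \<in> T" "p \<in> convex hull K" using interior_subset unfolding Om by blast
    then have "p \<in> interior (convex hull K)"
      using p(1) closure_subset[of "convex hull K"] unfolding frontier_def by blast
    then show "p \<in> \<Union>\<K>" using K(1) by (auto simp: \<K>_def)
  qed
qed

lemma smooth2_poly2: "smooth2 (poly2 c)"
  unfolding poly2_def[abs_def] by (intro smooth2_sum smooth2_mult smooth2_const smooth2_power smooth2_fst smooth2_snd)

text \<open>On each open triangle the chosen weak derivatives agree almost everywhere with those of
  a polynomial, which is bounded on the bounded domain; the triangles cover almost
  everything.\<close>

lemma argyris_grad_bdd:
  assumes T: "triangulation \<Omega> T" and f: "f \<in> argyris \<Omega> T"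
  shows "grad_bdd f"
proof -
  have h: "H20 \<Omega> f" using f by (simp add: argyris_def)
  have "bdd_fun (wd \<Omega> i j f)" if ij: "i + j \<le> 2" for i j
  proof -
    have "\<exists>C. AE p in M. \<bar>wd \<Omega> i j f p\<bar> \<le> C"
    proof (rule AE_bounded_cover[OF triangulation_cover(1,3)[OF T]])
      fix K assume K: "K \<in> (\<lambda>K. interior (convex hull K)) ` T"
      then obtain L where L: "L \<in> T" "K = interior (convex hull L)" by blast
      have "\<exists>c. \<forall>K\<in>T. \<forall>p\<in>convex hull K. f p = poly2 (c K) p"
        using f unfolding argyris_def mem_Collect_eq 
        by (elim conjE exE) (rule exI, intro ballI, drule (1) bspec, elim conjE, drule (1) bspec, assumption)
      then obtain c where c: "\<And>p. p \<in> convex hull L \<Longrightarrow> f p = poly2 c p" using L(1) by blast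
      have Ko: "open K" "K \<subseteq> \<Omega>" using triangulation_cover(2)[OF T K] by auto
      have "AE p in M. p \<in> K \<longrightarrow> wd \<Omega> i j f p = cpd i j (poly2 c) p"
        by (rule wd_eq_on_subdomain[OF Ko Hk0_Hk[OF h] ij smooth2_poly2]) (use c interior_subset L(2) in blast)
      moreover obtain C where "AE p in M. \<bar>cpd i j (poly2 c) p\<bar> \<le> C"
        using smooth2_bounded[OF smooth2_cpd[OF smooth2_poly2]] by blast
      ultimately have "AE p in M. p \<in> K \<longrightarrow> \<bar>wd \<Omega> i j f p\<bar> \<le> C" by eventually_elim auto
      then show "\<exists>C. AE p in M. p \<in> K \<longrightarrow> \<bar>wd \<Omega> i j f p\<bar> \<le> C" by blast
    qed
    then show ?thesis using sqi_measurable[OF H20_sqi(3)[OF h ij]] by (simp add: bdd_fun_def)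
  qed
  then show ?thesis using h by (simp add: grad_bdd_def)
qed

text \<open>A non-collinear triangle is contained in the closure of its interior, which lies in the
  domain. The uniform upper bound is what later absorbs surplus powers of the mesh size.\<close>

lemma meshsize_bounds:
  assumes T: "triangulation \<Omega> T"
  shows "0 \<le> meshsize T" "meshsize T \<le> diameter (closure \<Omega>)"
proof -
  have fin: "finite T" "T \<noteq> {}" and tri: "\<And>K. K \<in> T \<Longrightarrow> card K = 3 \<and> \<not> collinear K" using T by (auto simp: triangulation_def)
  have d: "0 \<le> diameter (convex hull K) \<and> diameter (convex hull K) \<le> diameter (closure \<Omega>)" if K: "K \<in> T" for K
  proof
    have finK: "finite K" using tri[OF K] card.infinite by fastforce
    show "0 \<le> diameter (convex hull K)"
      using finite_imp_bounded_convex_hull[OF finK] by (rule diameter_ge_0)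
    obtain a b c where abc: "K = {a, b, c}" using tri[OF K] by (auto simp: card_3_iff)
    have "affine_dependent K \<longleftrightarrow> False"
      using tri[OF K] collinear_3_eq_affine_dependent[of a b c] unfolding abc by auto
    then have "interior (convex hull K) \<noteq> {}"
      using interior_convex_hull_eq_empty[of K] tri[OF K] by simp
    then have "closure (interior (convex hull K)) = closure (convex hull K)"
      by (intro convex_closure_interior) auto
    moreover have "interior (convex hull K) \<subseteq> \<Omega>" using triangulation_cover(2)[OF T] K by blast
    ultimately have "convex hull K \<subseteq> closure \<Omega>" using closure_mono closure_subset by blast
    then show "diameter (convex hull K) \<le> diameter (closure \<Omega>)" using bounded_dom by (intro diameter_subset) auto
  qed
  have fi: "finite ((\<lambda>K. diameter (convex hull K)) ` T)" "(\<lambda>K. diameter (convex hull K)) ` T \<noteq> {}" using fin by auto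
  show "meshsize T \<le> diameter (closure \<Omega>)" unfolding meshsize_def using d fi by (subst Max_le_iff) auto
  obtain K where "K \<in> T" using fin(2) by blast
  then show "0 \<le> meshsize T" unfolding meshsize_def using d[of K] fi by (subst Max_ge_iff) auto
qed

end

section \<open>The linearised form and its adjoint problem\<close>

locale linearized = bounded_open \<Omega> for \<Omega> +
  fixes Rey Ro G1 G2 :: real and \<psi> :: "pt \<Rightarrow> real"
  assumes Rey: "Rey > 0" and Ro: "Ro > 0" and G1: "G1 > 0" and G2: "G2 > 0"
    and a1_bd: "H20 \<Omega> u \<Longrightarrow> H20 \<Omega> v \<Longrightarrow> H20 \<Omega> w \<Longrightarrow> \<bar>a1 \<Omega> u v w\<bar> \<le> G1 * semi \<Omega> 2 u * semi \<Omega> 2 v * semi \<Omega> 2 w"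
    and a2_bd: "H20 \<Omega> u \<Longrightarrow> H20 \<Omega> v \<Longrightarrow> \<bar>a2 \<Omega> Ro u v\<bar> \<le> (1 / Ro) * G2 * semi \<Omega> 2 u * semi \<Omega> 2 v"
    and psi: "H20 \<Omega> \<psi>" and psi6: "Hk \<Omega> 6 \<psi>"
    and psi_bdd: "i + j \<le> 3 \<Longrightarrow> bdd_fun (wd \<Omega> i j \<psi>)"
    and coer: "G1 * semi \<Omega> 2 \<psi> < 1 / Rey"
begin

definition B :: "(pt \<Rightarrow> real) \<Rightarrow> (pt \<Rightarrow> real) \<Rightarrow> real" where
  "B v z = a0 \<Omega> Rey v z + a1 \<Omega> v \<psi> z + a1 \<Omega> \<psi> v z + a2 \<Omega> Ro v z"

text \<open>The coercivity constant of \<open>B\<close> with respect to \<open>semi\<close>;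
  \<open>\<kappa>\<close> is its continuity constant, with the 4 coming from two Laplacian norms,
  each at most twice \<open>semi\<close>.\<close>

definition \<alpha> :: real where "\<alpha> = 1 / Rey - G1 * semi \<Omega> 2 \<psi>"
definition \<kappa> :: real where "\<kappa> = 4 / Rey + 2 * (G1 * semi \<Omega> 2 \<psi>) + (1 / Ro) * G2"

lemma \<alpha>_pos: "\<alpha> > 0" using coer by (simp add: \<alpha>_def)
lemma \<kappa>_pos: "\<kappa> > 0"
proof -
  have "4 / Rey > 0" "G1 * semi \<Omega> 2 \<psi> \<ge> 0" "(1 / Ro) * G2 > 0" using Rey G1 Ro G2 by auto
  then show ?thesis unfolding \<kappa>_def by linarith
qed

lemma psi_grad: "grad_bdd \<psi>" using psi psi_bdd[of 1 0] psi_bdd[of 0 1] by (simp add: grad_bdd_def)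

lemma psi_a1_integrable:
  assumes "H20 \<Omega> u" "H20 \<Omega> v" shows "a1_integrable u \<psi> v" "a1_integrable \<psi> u v"
  using a1_integrable_grad[OF assms(1) psi_grad assms(2)] a1_integrable_lap[OF psi lap_bdd[OF psi_bdd] assms] by auto

lemma B_left:
  assumes "H20 \<Omega> u" "H20 \<Omega> v" "H20 \<Omega> z"
  shows "B (\<lambda>p. a * u p + b * v p) z = a * B u z + b * B v z"
proof -
  have uv: "H20 \<Omega> (\<lambda>p. a * u p + b * v p)" using assms(1,2) by (rule Hk0_lincomb)
  show ?thesis
    unfolding B_def a0_lincomb(1)[OF assms] a2_lincomb(1)[OF assms]
      a1_lincomb_1[OF psi_a1_integrable(1)[OF assms(1,3)] psi_a1_integrable(1)[OF assms(2,3)] psi_a1_integrable(1)[OF uv assms(3)]]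
      a1_lincomb_2[OF psi_a1_integrable(2)[OF assms(1,3)] psi_a1_integrable(2)[OF assms(2,3)] psi_a1_integrable(2)[OF uv assms(3)]]
    by (simp only: algebra_simps)
qed

lemma B_right:
  assumes "H20 \<Omega> u" "H20 \<Omega> v" "H20 \<Omega> z"
  shows "B z (\<lambda>p. a * u p + b * v p) = a * B z u + b * B z v"
proof -
  have uv: "H20 \<Omega> (\<lambda>p. a * u p + b * v p)" using assms(1,2) by (rule Hk0_lincomb)
  show ?thesis
    unfolding B_def a0_lincomb(2)[OF assms] a2_lincomb(2)[OF assms]
      a1_lincomb_3[OF psi_a1_integrable(1)[OF assms(3,1)] psi_a1_integrable(1)[OF assms(3,2)] psi_a1_integrable(1)[OF assms(3) uv]]
      a1_lincomb_3[OF psi_a1_integrable(2)[OF assms(3,1)] psi_a1_integrable(2)[OF assms(3,2)] psi_a1_integrable(2)[OF assms(3) uv]]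
    by (simp only: algebra_simps)
qed

lemma B_bound:
  assumes "H20 \<Omega> u" "H20 \<Omega> v" shows "\<bar>B u v\<bar> \<le> \<kappa> * semi \<Omega> 2 u * semi \<Omega> 2 v"
proof -
  have "\<bar>B u v\<bar> \<le> \<bar>a0 \<Omega> Rey u v\<bar> + \<bar>a1 \<Omega> u \<psi> v\<bar> + \<bar>a1 \<Omega> \<psi> u v\<bar> + \<bar>a2 \<Omega> Ro u v\<bar>"
    unfolding B_def by linarith
  also have "\<dots> \<le> 4 / Rey * semi \<Omega> 2 u * semi \<Omega> 2 v + G1 * semi \<Omega> 2 u * semi \<Omega> 2 \<psi> * semi \<Omega> 2 v
      + G1 * semi \<Omega> 2 \<psi> * semi \<Omega> 2 u * semi \<Omega> 2 v + (1 / Ro) * G2 * semi \<Omega> 2 u * semi \<Omega> 2 v"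
    by (intro add_mono a0_bound a1_bd a2_bd assms psi Rey)
  also have "\<dots> = \<kappa> * semi \<Omega> 2 u * semi \<Omega> 2 v" unfolding \<kappa>_def by (simp only: algebra_simps)
  finally show ?thesis .
qed

text \<open>On the diagonal \<open>a1 \<Omega> \<psi> v v\<close> and \<open>a2\<close> vanish, so
  only one trilinear term competes with \<open>1 / Rey\<close>.\<close>

lemma B_coercive:
  assumes "H20 \<Omega> v" shows "\<alpha> * (semi \<Omega> 2 v)\<^sup>2 \<le> B v v"
proof -
  have "- (G1 * semi \<Omega> 2 v * semi \<Omega> 2 \<psi> * semi \<Omega> 2 v) \<le> a1 \<Omega> v \<psi> v" using a1_bd[OF assms psi assms] by linarith
  moreover have "\<alpha> * (semi \<Omega> 2 v)\<^sup>2 = 1 / Rey * (semi \<Omega> 2 v)\<^sup>2 - G1 * semi \<Omega> 2 v * semi \<Omega> 2 \<psi> * semi \<Omega> 2 v"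
    unfolding \<alpha>_def left_diff_distrib by (simp only: power2_eq_square mult_ac)
  moreover have "B v v = a0 \<Omega> Rey v v + a1 \<Omega> v \<psi> v"
    using a1_self[of \<psi> v] a2_self[OF assms, of Ro] by (simp add: B_def)
  ultimately show ?thesis using a0_self_ge[OF assms Rey] by linarith
qed

text \<open>\<open>lax_milgram_H20\<close> solves for the second argument of \<open>B\<close>, which
  is precisely the adjoint problem. Testing with \<open>z\<close> itself gives the bound.\<close>

lemma adjoint_solution:
  assumes g: "sqi M g" and b: "\<And>v. H20 \<Omega> v \<Longrightarrow> \<bar>\<integral>p. g p * v p \<partial>M\<bar> \<le> L * semi \<Omega> 2 v"
    and L: "L \<ge> 0"
  shows "\<exists>z. H20 \<Omega> z \<and> (\<forall>v. H20 \<Omega> v \<longrightarrow> B v z = (\<integral>p. g p * v p \<partial>M)) \<and> semi \<Omega> 2 z \<le> L / \<alpha>"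
proof -
  have "\<exists>z. H20 \<Omega> z \<and> (\<forall>v. H20 \<Omega> v \<longrightarrow> B v z = (\<integral>p. g p * v p \<partial>M))"
  proof (rule lax_milgram_H20[OF B_left B_right B_bound B_coercive \<alpha>_pos _ b])
    fix u v a b assume u: "H20 \<Omega> u" and v: "H20 \<Omega> v"
    show "(\<integral>p. g p * (a * u p + b * v p) \<partial>M) = a * (\<integral>p. g p * u p \<partial>M) + b * (\<integral>p. g p * v p \<partial>M)"
    proof (rule integral_lincomb_AE)
      show "integrable M (\<lambda>p. g p * u p)" "integrable M (\<lambda>p. g p * v p)"
        by (intro sqi_integrable_mult g H20_sqi(1) u v)+
      show "(\<lambda>p. g p * (a * u p + b * v p)) \<in> borel_measurable M"
        by (intro borel_measurable_integrable sqi_integrable_mult g sqi_lincomb H20_sqi(1) u v)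
    qed (simp add: algebra_simps)
  qed
  then obtain z where z: "H20 \<Omega> z" "\<And>v. H20 \<Omega> v \<Longrightarrow> B v z = (\<integral>p. g p * v p \<partial>M)" by blast
  have "\<alpha> * (semi \<Omega> 2 z)\<^sup>2 \<le> L * semi \<Omega> 2 z"
    using B_coercive[OF z(1)] z(2)[OF z(1)] abs_le_D1[OF b[OF z(1)]] by linarith
  then have "semi \<Omega> 2 z * (\<alpha> * semi \<Omega> 2 z) \<le> semi \<Omega> 2 z * L" by (simp add: power2_eq_square mult_ac)
  then have "\<alpha> * semi \<Omega> 2 z \<le> L"
    using semi_nonneg[of \<Omega> 2 z] L by (cases "semi \<Omega> 2 z = 0") (simp_all add: mult_le_cancel_left)
  then have "semi \<Omega> 2 z \<le> L / \<alpha>" using \<alpha>_pos by (simp add: le_divide_eq mult.commute)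
  then show ?thesis using z by blast
qed

end

section \<open>Error estimates\<close>

context linearized
begin

text \<open>The right-hand side seen by the regularity hypothesis is \<open>g\<close> minus the
  correction, and the correction is controlled by \<open>semi\<close> of order two of
  \<open>z\<close>, hence by the datum. For \<open>g = - lap \<Omega> e\<close> the datum may be
  measured only by \<open>semi\<close> of order one, which is why its negative norm is used.\<close>

lemma dual_solution:
  assumes dual_reg: "\<And>g \<psi>s. L2 \<Omega> g \<Longrightarrow> H20 \<Omega> \<psi>s \<Longrightarrow> dual_eq \<Omega> Rey Ro \<psi> g \<psi>s \<Longrightarrow>
      Hk \<Omega> 4 \<psi>s \<and> normH \<Omega> 4 \<psi>s \<le> C * norm0 \<Omega> g \<and> normH \<Omega> 3 \<psi>s \<le> C * normm1 \<Omega> g"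
    and C: "C > 0" and ne: "\<Omega> \<noteq> {}"
  shows "\<exists>D>0. (\<forall>g. sqi M g \<longrightarrow> (\<exists>z. H20 \<Omega> z \<and> (\<forall>v. H20 \<Omega> v \<longrightarrow> B v z = (\<integral>p. g p * v p \<partial>M))
            \<and> Hk \<Omega> 4 z \<and> normH \<Omega> 4 z \<le> D * nrm M g))
      \<and> (\<forall>e. H20 \<Omega> e \<longrightarrow> (\<exists>z. H20 \<Omega> z \<and> (\<forall>v. H20 \<Omega> v \<longrightarrow> B v z = (\<integral>p. - lap \<Omega> e p * v p \<partial>M))
            \<and> Hk \<Omega> 4 z \<and> normH \<Omega> 3 z \<le> D * semi \<Omega> 1 e))"
proof -
  obtain P where P: "P > 0" "\<And>v. H20 \<Omega> v \<Longrightarrow> normH \<Omega> 2 v \<le> P * semi \<Omega> 2 v" using normH2_le_semi2 by blast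
  obtain K where K: "K \<ge> 0" "\<And>z. H20 \<Omega> z \<Longrightarrow> sqi M (dual_corr \<Omega> \<psi> z)"
    "\<And>z. H20 \<Omega> z \<Longrightarrow> nrm M (dual_corr \<Omega> \<psi> z) \<le> K * semi \<Omega> 2 z"
    using dual_corr_bound[OF psi_bdd] by blast
  have reg: "Hk \<Omega> 4 z \<and> normH \<Omega> 4 z \<le> C * norm0 \<Omega> (\<lambda>p. g p - dual_corr \<Omega> \<psi> z p)
      \<and> normH \<Omega> 3 z \<le> C * normm1 \<Omega> (\<lambda>p. g p - dual_corr \<Omega> \<psi> z p)"
    if z: "H20 \<Omega> z" and g: "sqi M g" and adj: "\<And>v. H20 \<Omega> v \<Longrightarrow> B v z = (\<integral>p. g p * v p \<partial>M)" for z g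
  proof (rule dual_reg[OF _ z])
    show "L2 \<Omega> (\<lambda>p. g p - dual_corr \<Omega> \<psi> z p)" using sqi_diff[OF g K(2)[OF z]] by (simp add: L2_iff_sqi)
    show "dual_eq \<Omega> Rey Ro \<psi> (\<lambda>p. g p - dual_corr \<Omega> \<psi> z p) z"
      by (rule adjoint_imp_dual_eq[OF psi6 _ psi_bdd z g _ K(2)[OF z]]) (use adj in \<open>simp_all add: B_def\<close>)
  qed
  \<comment> \<open>In each sum the first number accounts for the datum and the second term for the
    correction: \<open>K\<close> bounds \<open>dual_corr\<close>, \<open>P\<close> is the Poincare
    constant and \<open>1 / \<alpha>\<close> comes from \<open>adjoint_solution\<close>. The 2 in
    \<open>D1\<close> stems from \<open>lap_integral_bound\<close>.\<close>
  define D0 where "D0 = C * (1 + K * (P / \<alpha>))"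
  define D1 where "D1 = C * (2 + K * (2 * P / \<alpha>))"
  have D0: "D0 > 0" "D1 > 0" using C K(1) P(1) \<alpha>_pos by (auto simp: D0_def D1_def intro!: mult_pos_pos add_pos_nonneg)
  have part0: "\<exists>z. H20 \<Omega> z \<and> (\<forall>v. H20 \<Omega> v \<longrightarrow> B v z = (\<integral>p. g p * v p \<partial>M)) \<and> Hk \<Omega> 4 z \<and> normH \<Omega> 4 z \<le> D0 * nrm M g"
    if g: "sqi M g" for g
  proof -
    have "\<bar>\<integral>p. g p * v p \<partial>M\<bar> \<le> (nrm M g * P) * semi \<Omega> 2 v" if v: "H20 \<Omega> v" for v
    proof -
      have "\<bar>\<integral>p. g p * v p \<partial>M\<bar> \<le> nrm M g * nrm M v" by (intro Cauchy_Schwarz_integral g H20_sqi(1) v)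
      also have "\<dots> \<le> nrm M g * (P * semi \<Omega> 2 v)"
        using norm0_wd_le_normH[of 0 0 2 \<Omega> v] P(2)[OF v] by (intro mult_left_mono) (auto simp: norm0_eq_nrm)
      finally show ?thesis by (simp only: mult.assoc)
    qed
    from adjoint_solution[OF g this] obtain z where z: "H20 \<Omega> z"
      "\<And>v. H20 \<Omega> v \<Longrightarrow> B v z = (\<integral>p. g p * v p \<partial>M)" "semi \<Omega> 2 z \<le> nrm M g * P / \<alpha>"
      using P(1) by auto
    have "nrm M (\<lambda>p. g p - dual_corr \<Omega> \<psi> z p) \<le> nrm M g + nrm M (dual_corr \<Omega> \<psi> z)"
      by (rule nrm_triangle_diff[OF g K(2)[OF z(1)]])
    also have "nrm M (dual_corr \<Omega> \<psi> z) \<le> K * (nrm M g * P / \<alpha>)"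
      using K(3)[OF z(1)] mult_left_mono[OF z(3) K(1)] by linarith
    finally have "C * nrm M (\<lambda>p. g p - dual_corr \<Omega> \<psi> z p) \<le> C * (nrm M g + K * (nrm M g * P / \<alpha>))"
      using C by (intro mult_left_mono) auto
    also have "\<dots> = D0 * nrm M g" by (simp add: D0_def algebra_simps)
    finally show ?thesis using reg[OF z(1) g z(2)] z by (auto simp: norm0_eq_nrm)
  qed
  have part1: "\<exists>z. H20 \<Omega> z \<and> (\<forall>v. H20 \<Omega> v \<longrightarrow> B v z = (\<integral>p. - lap \<Omega> e p * v p \<partial>M)) \<and> Hk \<Omega> 4 z \<and> normH \<Omega> 3 z \<le> D1 * semi \<Omega> 1 e"
    if e: "H20 \<Omega> e" for e
  proof -
    have g: "sqi M (\<lambda>p. - lap \<Omega> e p)" by (intro sqi_uminus H20_sqi(2) e)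
    have lb: "\<bar>\<integral>p. - lap \<Omega> e p * v p \<partial>M\<bar> \<le> 2 * semi \<Omega> 1 e * normH \<Omega> 1 v" if "Hk0 \<Omega> 1 v" for v
      using lap_integral_bound[OF e that] by simp
    have "\<bar>\<integral>p. - lap \<Omega> e p * v p \<partial>M\<bar> \<le> (2 * semi \<Omega> 1 e * P) * semi \<Omega> 2 v" if v: "H20 \<Omega> v" for v
    proof -
      have "normH \<Omega> 1 v \<le> normH \<Omega> 2 v"
        unfolding normH_def by (intro real_sqrt_le_mono sum_mono2) auto
      then have "2 * semi \<Omega> 1 e * normH \<Omega> 1 v \<le> 2 * semi \<Omega> 1 e * (P * semi \<Omega> 2 v)"
        using P(2)[OF v] by (intro mult_left_mono) auto
      then show ?thesis using lb[OF Hk0_mono[OF v]] by (simp add: mult.assoc)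
    qed
    from adjoint_solution[OF g this] obtain z where z: "H20 \<Omega> z"
      "\<And>v. H20 \<Omega> v \<Longrightarrow> B v z = (\<integral>p. - lap \<Omega> e p * v p \<partial>M)" "semi \<Omega> 2 z \<le> 2 * semi \<Omega> 1 e * P / \<alpha>"
      using P(1) by auto
    let ?d = "dual_corr \<Omega> \<psi> z"
    have nd: "nrm M ?d \<le> K * (2 * semi \<Omega> 1 e * P / \<alpha>)"
      using K(3)[OF z(1)] mult_left_mono[OF z(3) K(1)] by linarith
    have "normm1 \<Omega> (\<lambda>p. - lap \<Omega> e p - ?d p) \<le> 2 * semi \<Omega> 1 e + nrm M ?d"
    proof (rule normm1_le[OF ne])
      fix v assume v: "Hk0 \<Omega> 1 v"
      have sv: "sqi M v" using v by (intro Hk_sqi Hk0_Hk)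
      have "(\<integral>p. (- lap \<Omega> e p - ?d p) * v p \<partial>M) = (\<integral>p. - lap \<Omega> e p * v p \<partial>M) - (\<integral>p. ?d p * v p \<partial>M)"
        using sqi_integrable_mult[OF g sv] sqi_integrable_mult[OF K(2)[OF z(1)] sv]
        by (simp add: left_diff_distrib)
      then have "\<bar>\<integral>p. (- lap \<Omega> e p - ?d p) * v p \<partial>M\<bar> \<le> \<bar>\<integral>p. - lap \<Omega> e p * v p \<partial>M\<bar> + \<bar>\<integral>p. ?d p * v p \<partial>M\<bar>"
        by linarith
      also have "\<dots> \<le> 2 * semi \<Omega> 1 e * normH \<Omega> 1 v + nrm M ?d * nrm M v"
        by (intro add_mono lb[OF v] Cauchy_Schwarz_integral K(2)[OF z(1)] sv)
      also have "nrm M ?d * nrm M v \<le> nrm M ?d * normH \<Omega> 1 v"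
        using norm0_wd_le_normH[of 0 0 1 \<Omega> v] by (intro mult_left_mono) (auto simp: norm0_eq_nrm)
      finally show "\<bar>\<integral>p. (- lap \<Omega> e p - ?d p) * v p \<partial>M\<bar> \<le> (2 * semi \<Omega> 1 e + nrm M ?d) * normH \<Omega> 1 v"
        by (simp add: distrib_right)
    qed
    then have "C * normm1 \<Omega> (\<lambda>p. - lap \<Omega> e p - ?d p) \<le> C * (2 * semi \<Omega> 1 e + K * (2 * semi \<Omega> 1 e * P / \<alpha>))"
      using C nd by (intro mult_left_mono) auto
    also have "\<dots> = D1 * semi \<Omega> 1 e" by (simp add: D1_def algebra_simps)
    finally show ?thesis using reg[OF z(1) g z(2)] z by auto
  qed
  have m0: "D0 * x \<le> max D0 D1 * x" "D1 * x \<le> max D0 D1 * x" if "x \<ge> 0" for x :: real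
    using that by (auto intro: mult_right_mono)
  show ?thesis
  proof (intro exI[of _ "max D0 D1"] conjI allI impI)
    show "0 < max D0 D1" using D0 by simp
    show "\<exists>z. H20 \<Omega> z \<and> (\<forall>v. H20 \<Omega> v \<longrightarrow> B v z = (\<integral>p. g p * v p \<partial>M)) \<and> Hk \<Omega> 4 z \<and> normH \<Omega> 4 z \<le> max D0 D1 * nrm M g"
      if "sqi M g" for g using part0[OF that] order_trans[OF _ m0(1)[OF nrm_nonneg[of M g]]] by blast
    show "\<exists>z. H20 \<Omega> z \<and> (\<forall>v. H20 \<Omega> v \<longrightarrow> B v z = (\<integral>p. - lap \<Omega> e p * v p \<partial>M)) \<and> Hk \<Omega> 4 z \<and> normH \<Omega> 3 z \<le> max D0 D1 * semi \<Omega> 1 e"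
      if "H20 \<Omega> e" for e using part1[OF that] order_trans[OF _ m0(2)[OF semi_nonneg[of \<Omega> 1 e]]] by blast
  qed
qed

text \<open>With \<open>e = \<psi> - w\<close>, expanding gives \<open>a1(\<psi>, \<psi>, v) - a1(w,
  w, v) = a1(e, \<psi>, v) + a1(\<psi>, e, v) - a1(e, e, v)\<close>. The first two terms belong to
  \<open>B\<close>, the last is the remainder.\<close>

lemma galerkin_orthogonality:
  assumes w: "grad_bdd w" and vh: "H20 \<Omega> vh"
    and eq: "a0 \<Omega> Rey w vh + a1 \<Omega> w w vh + a2 \<Omega> Ro w vh = a0 \<Omega> Rey \<psi> vh + a1 \<Omega> \<psi> \<psi> vh + a2 \<Omega> Ro \<psi> vh"
  shows "B (\<lambda>p. \<psi> p - w p) vh = a1 \<Omega> (\<lambda>p. \<psi> p - w p) (\<lambda>p. \<psi> p - w p) vh"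
proof -
  let ?e = "\<lambda>p. 1 * \<psi> p + (- 1) * w p"
  have hw: "H20 \<Omega> w" using w by (simp add: grad_bdd_def)
  have ge: "grad_bdd ?e" by (rule grad_bdd_lincomb[OF psi_grad w])
  have he: "H20 \<Omega> ?e" using ge by (simp add: grad_bdd_def)
  have i: "a1_integrable \<zeta> u vh" if "H20 \<Omega> \<zeta>" "grad_bdd u" for \<zeta> u using a1_integrable_grad[OF that vh] .
  have e1: "a1 \<Omega> ?e u vh = 1 * a1 \<Omega> \<psi> u vh + (- 1) * a1 \<Omega> w u vh" if "grad_bdd u" for u
    by (rule a1_lincomb_1[OF i[OF psi that] i[OF hw that] i[OF he that]])
  have e2: "a1 \<Omega> \<zeta> ?e vh = 1 * a1 \<Omega> \<zeta> \<psi> vh + (- 1) * a1 \<Omega> \<zeta> w vh" if "H20 \<Omega> \<zeta>" for \<zeta>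
    by (rule a1_lincomb_2[OF i[OF that psi_grad] i[OF that w] i[OF that ge]])
  have "B ?e vh = a1 \<Omega> ?e ?e vh"
    unfolding B_def a0_lincomb(1)[OF psi hw vh] a2_lincomb(1)[OF psi hw vh] e1[OF ge] e1[OF psi_grad]
      e2[OF psi] e2[OF hw]
    using eq by simp
  then show ?thesis by simp
qed

text \<open>Of the finite element spaces only bounded gradients and the interpolation property
  matter, so they appear as an abstract family \<open>X\<close> with a bounded mesh
  parameter.\<close>

lemma error_estimates:
  assumes ne: "\<Omega> \<noteq> {}"
    and gb: "\<And>T f. T \<in> Fam \<Longrightarrow> f \<in> X T \<Longrightarrow> grad_bdd f"
    and h: "\<And>T. T \<in> Fam \<Longrightarrow> 0 \<le> h T \<and> h T \<le> H"
    and F: "\<And>v. H20 \<Omega> v \<Longrightarrow> \<bar>l v\<bar> \<le> N * semi \<Omega> 2 v" "N \<ge> 0"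
    and psi_eq: "\<And>v. H20 \<Omega> v \<Longrightarrow> a0 \<Omega> Rey \<psi> v + a1 \<Omega> \<psi> \<psi> v + a2 \<Omega> Ro \<psi> v = l v"
    and dual_reg: "\<And>g \<psi>s. L2 \<Omega> g \<Longrightarrow> H20 \<Omega> \<psi>s \<Longrightarrow> dual_eq \<Omega> Rey Ro \<psi> g \<psi>s \<Longrightarrow>
      Hk \<Omega> 4 \<psi>s \<and> normH \<Omega> 4 \<psi>s \<le> C * norm0 \<Omega> g \<and> normH \<Omega> 3 \<psi>s \<le> C * normm1 \<Omega> g" and C: "C > 0"
    and interp: "\<And>T m v. T \<in> Fam \<Longrightarrow> m \<in> {3, 4, 6} \<Longrightarrow> Hk \<Omega> m v \<Longrightarrow> H20 \<Omega> v \<Longrightarrow>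
      \<exists>vh\<in>X T. normH \<Omega> 2 (\<lambda>p. v p - vh p) \<le> CI * h T ^ (m - 2) * semi \<Omega> m v" and CI: "CI > 0"
  shows "\<exists>C0>0. \<exists>C1>0. \<exists>C2>0. \<forall>T\<in>Fam. \<forall>\<psi>h\<in>X T.
     (\<forall>vh\<in>X T. a0 \<Omega> Rey \<psi>h vh + a1 \<Omega> \<psi>h \<psi>h vh + a2 \<Omega> Ro \<psi>h vh = l vh) \<longrightarrow>
       semi \<Omega> 2 (\<lambda>p. \<psi> p - \<psi>h p) \<le> C2 * h T ^ 4 \<and> semi \<Omega> 1 (\<lambda>p. \<psi> p - \<psi>h p) \<le> C1 * h T ^ 5
       \<and> norm0 \<Omega> (\<lambda>p. \<psi> p - \<psi>h p) \<le> C0 * h T ^ 6"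
proof -
  obtain D where D: "D > 0"
    "\<And>g. sqi M g \<Longrightarrow> \<exists>z. H20 \<Omega> z \<and> (\<forall>v. H20 \<Omega> v \<longrightarrow> B v z = (\<integral>p. g p * v p \<partial>M))
            \<and> Hk \<Omega> 4 z \<and> normH \<Omega> 4 z \<le> D * nrm M g"
    "\<And>e. H20 \<Omega> e \<Longrightarrow> \<exists>z. H20 \<Omega> z \<and> (\<forall>v. H20 \<Omega> v \<longrightarrow> B v z = (\<integral>p. - lap \<Omega> e p * v p \<partial>M))
            \<and> Hk \<Omega> 4 z \<and> normH \<Omega> 3 z \<le> D * semi \<Omega> 1 e"
    using dual_solution[OF dual_reg C ne] by blast
  \<comment> \<open>An a priori bound for the error in \<open>semi\<close> of order two, from the
    energy estimate of the discrete solution. It replaces one of the two error factors in the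
    quadratic term.\<close>
  define E where "E = semi \<Omega> 2 \<psi> + Rey * N"
  \<comment> \<open>The final \<open>+ 1\<close> keeps the constant positive even if the sixth-order
    seminorm of \<open>\<psi>\<close> vanishes.\<close>
  define c2 where "c2 = (\<kappa> + G1 * E) / \<alpha> * (CI * semi \<Omega> 6 \<psi>) + 1"
  have E: "E \<ge> 0" using Rey F(2) by (simp add: E_def)
  have c2: "c2 > 0" using \<kappa>_pos \<alpha>_pos G1 E CI by (auto simp: c2_def intro!: add_nonneg_pos mult_nonneg_nonneg divide_nonneg_pos)
  \<comment> \<open>The first term pairs \<open>h^4\<close> for the error with
    \<open>h^(m - 2)\<close> for interpolating the dual solution. In the second, \<open>h^8\<close>
    is split as \<open>h^(6 - m) h^(m + 2)\<close> and the first factor is bounded through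
    \<open>H\<close>; the bracket bounds the interpolant of the dual solution.\<close>
  define q where "q m = \<kappa> * c2 * CI + G1 * c2\<^sup>2 * H ^ (6 - m) * (1 + CI * H ^ (m - 2))" for m
  have est: "semi \<Omega> 2 (\<lambda>p. \<psi> p - \<psi>h p) \<le> c2 * h T ^ 4 \<and> semi \<Omega> 1 (\<lambda>p. \<psi> p - \<psi>h p) \<le> q 3 * D * h T ^ 5
       \<and> norm0 \<Omega> (\<lambda>p. \<psi> p - \<psi>h p) \<le> q 4 * D * h T ^ 6"
    if T: "T \<in> Fam" and ph: "\<psi>h \<in> X T"
      and eqh: "\<And>vh. vh \<in> X T \<Longrightarrow> a0 \<Omega> Rey \<psi>h vh + a1 \<Omega> \<psi>h \<psi>h vh + a2 \<Omega> Ro \<psi>h vh = l vh" for T \<psi>h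
  proof -
    let ?h = "h T" and ?e = "\<lambda>p. \<psi> p - \<psi>h p"
    have hT: "0 \<le> ?h" "?h \<le> H" using h[OF T] by auto
    have HX: "H20 \<Omega> f" if "f \<in> X T" for f using gb[OF T that] by (simp add: grad_bdd_def)
    have gh: "grad_bdd \<psi>h" by (rule gb[OF T ph])
    have ge: "grad_bdd ?e" using grad_bdd_lincomb[OF psi_grad gh, of 1 "-1"] by simp
    have e: "H20 \<Omega> ?e" using ge by (simp add: grad_bdd_def)
    have gal: "B ?e vh = a1 \<Omega> ?e ?e vh" if "vh \<in> X T" for vh
      using galerkin_orthogonality[OF gh HX[OF that]] eqh[OF that] psi_eq[OF HX[OF that]] by simp
    have Bdiff: "B ?e (\<lambda>p. u p - v p) = B ?e u - B ?e v" if "H20 \<Omega> u" "H20 \<Omega> v" for u v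
      using B_right[OF that e, of 1 "-1"] by simp
    have adiff: "a1 \<Omega> ?e ?e (\<lambda>p. u p - v p) = a1 \<Omega> ?e ?e u - a1 \<Omega> ?e ?e v" if "H20 \<Omega> u" "H20 \<Omega> v" for u v
      using a1_lincomb_3[OF a1_integrable_grad[OF e ge that(1)] a1_integrable_grad[OF e ge that(2)], of 1 "-1"]
        a1_integrable_grad[OF e ge Hk0_diff[OF that]] by simp
    \<comment> \<open>Testing the discrete equation with its own solution removes \<open>a1\<close>
      and \<open>a2\<close>.\<close>
    have energy: "semi \<Omega> 2 \<psi>h \<le> Rey * N"
    proof -
      have "1 / Rey * (semi \<Omega> 2 \<psi>h)\<^sup>2 \<le> l \<psi>h"
        using a0_self_ge[OF HX[OF ph] Rey] eqh[OF ph] a1_self[of \<psi>h \<psi>h] a2_self[OF HX[OF ph], of Ro] by simp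
      also have "\<dots> \<le> N * semi \<Omega> 2 \<psi>h" using F(1)[OF HX[OF ph]] by linarith
      finally have "semi \<Omega> 2 \<psi>h * semi \<Omega> 2 \<psi>h \<le> semi \<Omega> 2 \<psi>h * (Rey * N)"
        using Rey by (simp add: divide_le_eq power2_eq_square mult_ac)
      then show ?thesis using semi_nonneg[of \<Omega> 2 \<psi>h] Rey F(2)
        by (cases "semi \<Omega> 2 \<psi>h = 0") (simp_all add: mult_le_cancel_left)
    qed
    have eE: "semi \<Omega> 2 ?e \<le> E"
      using semi_diff_le[OF Hk0_Hk[OF psi] Hk0_Hk[OF HX[OF ph]]] energy by (simp add: E_def)
    have H2: "semi \<Omega> 2 ?e \<le> c2 * ?h ^ 4"
    proof -
      obtain ih where ih: "ih \<in> X T" "normH \<Omega> 2 (\<lambda>p. \<psi> p - ih p) \<le> CI * ?h ^ (6 - 2) * semi \<Omega> 6 \<psi>"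
        using interp[OF T _ psi6 psi] by blast
      let ?n = "\<lambda>p. \<psi> p - ih p"
      have n: "H20 \<Omega> ?n" by (intro Hk0_diff psi HX ih(1))
      have sn: "semi \<Omega> 2 ?n \<le> CI * ?h ^ 4 * semi \<Omega> 6 \<psi>" using semi_le_normH[of 2 2 \<Omega> ?n] ih(2) by simp
      \<comment> \<open>Orthogonality is applied to \<open>ih - \<psi>h = e - n\<close>, and
        \<open>a1(e, e, e) = 0\<close>, so the remainder also carries the interpolation error
        \<open>n\<close> as a factor.\<close>
      have "B ?e ?e = B ?e ?n + B ?e ih - B ?e \<psi>h"
        using Bdiff[OF psi HX[OF ih(1)]] Bdiff[OF psi HX[OF ph]] by simp
      also have "\<dots> = B ?e ?n - a1 \<Omega> ?e ?e ?n"
        using gal[OF ih(1)] gal[OF ph] adiff[OF psi HX[OF ih(1)]] adiff[OF psi HX[OF ph]] a1_self[of ?e ?e] by simp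
      finally have "\<alpha> * (semi \<Omega> 2 ?e)\<^sup>2 \<le> B ?e ?n - a1 \<Omega> ?e ?e ?n" using B_coercive[OF e] by linarith
      also have "\<dots> \<le> \<kappa> * semi \<Omega> 2 ?e * semi \<Omega> 2 ?n + G1 * semi \<Omega> 2 ?e * semi \<Omega> 2 ?e * semi \<Omega> 2 ?n"
        using B_bound[OF e n] a1_bd[OF e e n] by linarith
      also have "G1 * semi \<Omega> 2 ?e * semi \<Omega> 2 ?e * semi \<Omega> 2 ?n \<le> G1 * semi \<Omega> 2 ?e * E * semi \<Omega> 2 ?n"
        using eE G1 by (intro mult_right_mono mult_left_mono) auto
      finally have "semi \<Omega> 2 ?e * (\<alpha> * semi \<Omega> 2 ?e) \<le> semi \<Omega> 2 ?e * ((\<kappa> + G1 * E) * semi \<Omega> 2 ?n)"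
        by (simp add: power2_eq_square algebra_simps)
      then have "\<alpha> * semi \<Omega> 2 ?e \<le> (\<kappa> + G1 * E) * semi \<Omega> 2 ?n"
        using semi_nonneg[of \<Omega> 2 ?e] \<kappa>_pos G1 E
        by (cases "semi \<Omega> 2 ?e = 0") (simp_all add: mult_le_cancel_left)
      also have "\<dots> \<le> (\<kappa> + G1 * E) * (CI * ?h ^ 4 * semi \<Omega> 6 \<psi>)"
        using sn \<kappa>_pos G1 E by (intro mult_left_mono) auto
      finally have "semi \<Omega> 2 ?e \<le> (\<kappa> + G1 * E) * (CI * ?h ^ 4 * semi \<Omega> 6 \<psi>) / \<alpha>"
        using \<alpha>_pos by (simp add: le_divide_eq mult.commute)
      also have "\<dots> = (\<kappa> + G1 * E) / \<alpha> * (CI * semi \<Omega> 6 \<psi>) * ?h ^ 4" by simp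
      also have "\<dots> \<le> c2 * ?h ^ 4" unfolding c2_def by (intro mult_right_mono) (use hT in auto)
      finally show ?thesis .
    qed
    have Bz: "\<bar>B ?e z\<bar> \<le> q m * ?h ^ (m + 2) * normH \<Omega> m z"
      if z: "H20 \<Omega> z" "Hk \<Omega> m z" and m: "m = 3 \<or> m = 4" for z m
    proof -
      have "m \<in> {3, 4, 6}" using m by auto
      then obtain zh where zh: "zh \<in> X T" "normH \<Omega> 2 (\<lambda>p. z p - zh p) \<le> CI * ?h ^ (m - 2) * semi \<Omega> m z"
        using interp[OF T _ z(2,1)] by blast
      let ?n = "\<lambda>p. z p - zh p" and ?S = "normH \<Omega> m z"
      have n: "H20 \<Omega> ?n" by (intro Hk0_diff z HX zh(1))
      have S0: "0 \<le> CI * ?h ^ (m - 2)" using CI hT by simp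
      have sm: "semi \<Omega> m z \<le> ?S" "semi \<Omega> 2 z \<le> ?S" using m by (auto intro!: semi_le_normH)
      have sn: "semi \<Omega> 2 ?n \<le> CI * ?h ^ (m - 2) * ?S"
        using semi_le_normH[of 2 2 \<Omega> ?n] zh(2) mult_left_mono[OF sm(1) S0] by linarith
      have "semi \<Omega> 2 zh \<le> semi \<Omega> 2 z + semi \<Omega> 2 ?n"
        using semi_diff_le[OF Hk0_Hk[OF z(1)] Hk0_Hk[OF n]] by simp
      also have "\<dots> \<le> ?S + CI * H ^ (m - 2) * ?S"
      proof -
        have "CI * ?h ^ (m - 2) * ?S \<le> CI * H ^ (m - 2) * ?S"
          using CI hT by (intro mult_right_mono mult_left_mono power_mono) auto
        then show ?thesis using sm(2) sn by linarith
      qed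
      finally have szh: "semi \<Omega> 2 zh \<le> (1 + CI * H ^ (m - 2)) * ?S" by (simp add: distrib_right)
      have e8: "(semi \<Omega> 2 ?e)\<^sup>2 \<le> c2\<^sup>2 * H ^ (6 - m) * ?h ^ (m + 2)"
      proof -
        have "(semi \<Omega> 2 ?e)\<^sup>2 \<le> (c2 * ?h ^ 4)\<^sup>2" using H2 by (intro power_mono) auto
        also have "\<dots> = c2\<^sup>2 * (?h ^ (6 - m) * ?h ^ (m + 2))"
        proof -
          have "(6 - m) + (m + 2) = 8" using m by auto
          then have "?h ^ (6 - m) * ?h ^ (m + 2) = ?h ^ 8" by (simp only: power_add[symmetric])
          moreover have "(?h ^ 4)\<^sup>2 = ?h ^ 8" by (simp flip: power_mult)
          ultimately show ?thesis by (simp only: power_mult_distrib)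
        qed
        also have "\<dots> \<le> c2\<^sup>2 * (H ^ (6 - m) * ?h ^ (m + 2))"
          using hT by (intro mult_left_mono mult_right_mono power_mono) auto
        finally show ?thesis by (simp only: mult.assoc)
      qed
      \<comment> \<open>The dual solution is replaced by its interpolant. The interpolation error
        gains \<open>h^(m - 2)\<close>, and on the interpolant only the quadratic remainder
        survives.\<close>
      have "B ?e z = B ?e ?n + a1 \<Omega> ?e ?e zh" using Bdiff[OF z(1) HX[OF zh(1)]] gal[OF zh(1)] by simp
      then have "\<bar>B ?e z\<bar> \<le> \<bar>B ?e ?n\<bar> + \<bar>a1 \<Omega> ?e ?e zh\<bar>" by linarith
      also have "\<dots> \<le> \<kappa> * semi \<Omega> 2 ?e * semi \<Omega> 2 ?n + G1 * semi \<Omega> 2 ?e * semi \<Omega> 2 ?e * semi \<Omega> 2 zh"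
        by (intro add_mono B_bound a1_bd e n HX zh(1))
      also have "\<kappa> * semi \<Omega> 2 ?e * semi \<Omega> 2 ?n \<le> \<kappa> * (c2 * ?h ^ 4) * (CI * ?h ^ (m - 2) * ?S)"
        using H2 sn \<kappa>_pos c2 hT by (intro mult_mono mult_left_mono) auto
      also have "\<dots> = \<kappa> * c2 * CI * ?h ^ (m + 2) * ?S"
        using m by (auto simp: power_add eval_nat_numeral)
      also have "G1 * semi \<Omega> 2 ?e * semi \<Omega> 2 ?e * semi \<Omega> 2 zh = G1 * (semi \<Omega> 2 ?e)\<^sup>2 * semi \<Omega> 2 zh"
        by (simp add: power2_eq_square mult.assoc)
      also have "\<dots> \<le> G1 * (c2\<^sup>2 * H ^ (6 - m) * ?h ^ (m + 2)) * ((1 + CI * H ^ (m - 2)) * ?S)"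
        using e8 szh G1 hT by (intro mult_mono mult_left_mono) auto
      finally show ?thesis by (simp add: q_def algebra_simps)
    qed
    have cancel: "x \<le> k * D * y" if "x\<^sup>2 \<le> k * y * (D * x)" "x \<ge> 0" "0 \<le> k * D * y" for x k y :: real
    proof -
      have "x * x \<le> x * (k * D * y)" using that(1) by (simp add: power2_eq_square mult_ac)
      then show ?thesis using that(2,3) by (cases "x = 0") (simp_all add: mult_le_cancel_left)
    qed
    have H0: "H \<ge> 0" using hT by linarith
    have q0: "q m \<ge> 0" for m
      unfolding q_def using \<kappa>_pos c2 CI G1 H0 by (intro add_nonneg_nonneg mult_nonneg_nonneg) auto
    have H1: "semi \<Omega> 1 ?e \<le> q 3 * D * ?h ^ 5"
    proof (rule cancel)
      obtain z where z: "H20 \<Omega> z" "\<And>v. H20 \<Omega> v \<Longrightarrow> B v z = (\<integral>p. - lap \<Omega> ?e p * v p \<partial>M)" "Hk \<Omega> 4 z"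
        "normH \<Omega> 3 z \<le> D * semi \<Omega> 1 ?e" using D(3)[OF e] by blast
      have "(semi \<Omega> 1 ?e)\<^sup>2 = B ?e z" using semi1_power2[OF e] z(2)[OF e] by simp
      also have "\<dots> \<le> q 3 * ?h ^ (3 + 2) * normH \<Omega> 3 z"
        using Bz[OF z(1) Hk_mono[OF z(3)], of 3] by simp
      also have "\<dots> \<le> q 3 * ?h ^ (3 + 2) * (D * semi \<Omega> 1 ?e)"
        using z(4) q0[of 3] hT by (intro mult_left_mono) auto
      finally show "(semi \<Omega> 1 ?e)\<^sup>2 \<le> q 3 * ?h ^ 5 * (D * semi \<Omega> 1 ?e)" by simp
    qed (use q0[of 3] D(1) hT in auto)
    have "nrm M ?e \<le> q 4 * D * ?h ^ 6"
    proof (rule cancel)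
      obtain z where z: "H20 \<Omega> z" "\<And>v. H20 \<Omega> v \<Longrightarrow> B v z = (\<integral>p. ?e p * v p \<partial>M)" "Hk \<Omega> 4 z"
        "normH \<Omega> 4 z \<le> D * nrm M ?e" using D(2)[OF H20_sqi(1)[OF e]] by blast
      have "(nrm M ?e)\<^sup>2 = B ?e z" unfolding z(2)[OF e] nrm_power2 by (simp add: power2_eq_square)
      also have "\<dots> \<le> q 4 * ?h ^ (4 + 2) * normH \<Omega> 4 z"
        using Bz[OF z(1,3)] by simp
      also have "\<dots> \<le> q 4 * ?h ^ (4 + 2) * (D * nrm M ?e)"
        using z(4) q0[of 4] hT by (intro mult_left_mono) auto
      finally show "(nrm M ?e)\<^sup>2 \<le> q 4 * ?h ^ 6 * (D * nrm M ?e)" by simp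
    qed (use q0[of 4] D(1) hT in auto)
    then show ?thesis using H1 H2 by (simp add: norm0_eq_nrm)
  qed
  \<comment> \<open>The constants \<open>q m * D\<close> are only known to be nonnegative, whereas
    the claim asks for positive ones.\<close>
  have pos: "\<bar>q m * D\<bar> + 1 > 0" for m by linarith
  have weaken: "x \<le> (\<bar>q m * D\<bar> + 1) * y" if "x \<le> q m * D * y" "y \<ge> 0" for x y m
  proof -
    have "q m * D * y \<le> (\<bar>q m * D\<bar> + 1) * y" using that(2) by (intro mult_right_mono) auto
    then show ?thesis using that(1) by linarith
  qed
  show ?thesis
  proof (rule exI[of _ "\<bar>q 4 * D\<bar> + 1"], rule conjI[OF pos], rule exI[of _ "\<bar>q 3 * D\<bar> + 1"], rule conjI[OF pos],
      rule exI[of _ c2], rule conjI[OF c2], intro ballI impI)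
    fix T \<psi>h assume T: "T \<in> Fam" and ph: "\<psi>h \<in> X T"
      and eqh: "\<forall>vh\<in>X T. a0 \<Omega> Rey \<psi>h vh + a1 \<Omega> \<psi>h \<psi>h vh + a2 \<Omega> Ro \<psi>h vh = l vh"
    have hT: "0 \<le> h T" using h[OF T] by simp
    show "semi \<Omega> 2 (\<lambda>p. \<psi> p - \<psi>h p) \<le> c2 * h T ^ 4
       \<and> semi \<Omega> 1 (\<lambda>p. \<psi> p - \<psi>h p) \<le> (\<bar>q 3 * D\<bar> + 1) * h T ^ 5
       \<and> norm0 \<Omega> (\<lambda>p. \<psi> p - \<psi>h p) \<le> (\<bar>q 4 * D\<bar> + 1) * h T ^ 6"
      using est[OF T ph bspec[OF eqh]] weaken[of _ 3 "h T ^ 5"] weaken[of _ 4 "h T ^ 6"] hT by simp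
  qed
qed

end

text \<open>With equality in the small data condition coercivity still holds strictly: if \<open>\<psi>\<close> does not
  vanish then neither does its mixed derivative, and \<open>|\<psi>|\<^sub>2 < \<parallel>\<Delta>\<psi>\<parallel>\<close> improves the energy estimate.\<close>

lemma (in bounded_open) strict_coercivity:
  assumes Rey: "Rey > 0" and Ro: "Ro > 0" and F: "Hm2 \<Omega> F" and G1: "G1 > 0" and psi: "H20 \<Omega> \<psi>"
    and eq: "a0 \<Omega> Rey \<psi> \<psi> + a1 \<Omega> \<psi> \<psi> \<psi> + a2 \<Omega> Ro \<psi> \<psi> = ell Ro F \<psi>"
    and small: "Ro / Rey\<^sup>2 \<ge> G1 * normm2 \<Omega> F"
  shows "G1 * semi \<Omega> 2 \<psi> < 1 / Rey"
proof (cases "semi \<Omega> 2 \<psi> = 0")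
  case True
  then show ?thesis using Rey by simp
next
  case False
  let ?s = "semi \<Omega> 2 \<psi>"
  have s: "?s > 0" using False semi_nonneg[of \<Omega> 2 \<psi>] by linarith
  obtain K where K: "\<And>v. H20 \<Omega> v \<Longrightarrow> \<bar>F v\<bar> \<le> K * semi \<Omega> 2 v" using F by (auto simp: Hm2_def)
  \<comment> \<open>\<open>normm2\<close> is a real \<open>Sup\<close>; continuity of
    \<open>F\<close> bounds the set, so that the quotient for \<open>\<psi>\<close> lies below the
    supremum.\<close>
  have bdd: "bdd_above {\<bar>F v\<bar> / semi \<Omega> 2 v | v. H20 \<Omega> v \<and> semi \<Omega> 2 v \<noteq> 0}"
  proof (rule bdd_aboveI)
    fix y assume "y \<in> {\<bar>F v\<bar> / semi \<Omega> 2 v | v. H20 \<Omega> v \<and> semi \<Omega> 2 v \<noteq> 0}"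
    then obtain v where v: "y = \<bar>F v\<bar> / semi \<Omega> 2 v" "H20 \<Omega> v" "semi \<Omega> 2 v \<noteq> 0" by blast
    then have "semi \<Omega> 2 v > 0" using semi_nonneg[of \<Omega> 2 v] by linarith
    then show "y \<le> K" using K[OF v(2)] by (simp add: v(1) divide_le_eq)
  qed
  have "\<bar>F \<psi>\<bar> / ?s \<le> normm2 \<Omega> F" unfolding normm2_def using psi False by (intro cSup_upper[OF _ bdd]) blast
  then have FN: "F \<psi> \<le> normm2 \<Omega> F * ?s" using s by (simp add: divide_le_eq)
  have "nrm M (wd \<Omega> 1 1 \<psi>) \<noteq> 0" using mixed_derivative_zero[OF psi] False by blast
  then have "?s\<^sup>2 < (nrm M (lap \<Omega> \<psi>))\<^sup>2" using nrm_lap[OF psi] by simp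
  then have "1 / Rey * ?s\<^sup>2 < 1 / Rey * (nrm M (lap \<Omega> \<psi>))\<^sup>2" using Rey by (intro mult_strict_left_mono) auto
  also have "\<dots> = a0 \<Omega> Rey \<psi> \<psi>" by (simp only: a0_eq nrm_power2 power2_eq_square[symmetric])
  also have "\<dots> = 1 / Ro * F \<psi>" using eq a1_self[of \<psi> \<psi>] a2_self[OF psi, of Ro] by (simp add: ell_def)
  also have "\<dots> \<le> 1 / Ro * (normm2 \<Omega> F * ?s)" using FN Ro by (intro mult_left_mono) auto
  finally have "?s * (1 / Rey * ?s) < ?s * (1 / Ro * normm2 \<Omega> F)" by (simp add: power2_eq_square mult_ac)
  then have "1 / Rey * ?s < 1 / Ro * normm2 \<Omega> F" using s by (simp only: mult_less_cancel_left_pos)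
  then have "G1 * (1 / Rey * ?s) < G1 * (1 / Ro * normm2 \<Omega> F)" using G1 by (rule mult_strict_left_mono)
  also have "\<dots> = 1 / Ro * (G1 * normm2 \<Omega> F)" by simp
  also have "\<dots> \<le> 1 / Ro * (Ro / Rey\<^sup>2)" using small Ro by (intro mult_left_mono) auto
  also have "\<dots> = 1 / Rey * (1 / Rey)" using Ro by (simp add: power2_eq_square)
  finally have "1 / Rey * (G1 * ?s) < 1 / Rey * (1 / Rey)" by (simp only: mult.left_commute)
  then show ?thesis using Rey by (subst (asm) mult_less_cancel_left_pos) auto
qed

theorem theorem4p2:
  fixes \<Omega> :: "pt set" and Rey Ro \<Gamma>\<^sub>1 \<Gamma>\<^sub>2 :: real
    and F :: "(pt \<Rightarrow> real) \<Rightarrow> real" and \<psi> :: "pt \<Rightarrow> real"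
    and Fam :: "pt set set set"
  assumes dom: "polygonal_domain \<Omega>"
    and Rey: "Rey > 0" and Ro: "Ro > 0"
    and F: "Hm2 \<Omega> F"
    and G1: "\<Gamma>\<^sub>1 > 0" and G2: "\<Gamma>\<^sub>2 > 0"
    and a1_bd: "\<forall>\<zeta> \<phi> v. H20 \<Omega> \<zeta> \<longrightarrow> H20 \<Omega> \<phi> \<longrightarrow> H20 \<Omega> v \<longrightarrow>
                  \<bar>a1 \<Omega> \<zeta> \<phi> v\<bar> \<le> \<Gamma>\<^sub>1 * semi \<Omega> 2 \<zeta> * semi \<Omega> 2 \<phi> * semi \<Omega> 2 v"
    and a2_bd: "\<forall>\<phi> v. H20 \<Omega> \<phi> \<longrightarrow> H20 \<Omega> v \<longrightarrow>
                  \<bar>a2 \<Omega> Ro \<phi> v\<bar> \<le> (1 / Ro) * \<Gamma>\<^sub>2 * semi \<Omega> 2 \<phi> * semi \<Omega> 2 v"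
    and psi: "H20 \<Omega> \<psi>"
    and psi_eq: "\<forall>v. H20 \<Omega> v \<longrightarrow>
                  a0 \<Omega> Rey \<psi> v + a1 \<Omega> \<psi> \<psi> v + a2 \<Omega> Ro \<psi> v = ell Ro F v"
    and small: "Ro / Rey\<^sup>2 \<ge> \<Gamma>\<^sub>1 * normm2 \<Omega> F"
    and psi6: "Hk \<Omega> 6 \<psi>"
    and dual_reg: "\<exists>C>0. \<forall>g. L2 \<Omega> g \<longrightarrow>
                  (\<exists>\<psi>s. H20 \<Omega> \<psi>s \<and> dual_eq \<Omega> Rey Ro \<psi> g \<psi>s)
                \<and> (\<forall>\<psi>s. H20 \<Omega> \<psi>s \<and> dual_eq \<Omega> Rey Ro \<psi> g \<psi>s \<longrightarrow>
                      Hk \<Omega> 4 \<psi>s \<and> normH \<Omega> 4 \<psi>s \<le> C * norm0 \<Omega> g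
                      \<and> normH \<Omega> 3 \<psi>s \<le> C * normm1 \<Omega> g)"
    and fam: "\<forall>T\<in>Fam. triangulation \<Omega> T"
    and interp: "\<exists>CI>0. \<forall>T\<in>Fam. \<forall>m\<in>{3, 4, 6}. \<forall>v. Hk \<Omega> m v \<and> H20 \<Omega> v \<longrightarrow>
                  (\<exists>vh\<in>argyris \<Omega> T. normH \<Omega> 2 (\<lambda>p. v p - vh p)
                        \<le> CI * meshsize T ^ (m - 2) * semi \<Omega> m v)"
  shows "\<exists>C\<^sub>0>0. \<exists>C\<^sub>1>0. \<exists>C\<^sub>2>0. \<forall>T\<in>Fam. \<forall>\<psi>h\<in>argyris \<Omega> T.
           (\<forall>vh\<in>argyris \<Omega> T.
              a0 \<Omega> Rey \<psi>h vh + a1 \<Omega> \<psi>h \<psi>h vh + a2 \<Omega> Ro \<psi>h vh = ell Ro F vh) \<longrightarrow>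
           semi \<Omega> 2 (\<lambda>p. \<psi> p - \<psi>h p) \<le> C\<^sub>2 * meshsize T ^ 4
         \<and> semi \<Omega> 1 (\<lambda>p. \<psi> p - \<psi>h p) \<le> C\<^sub>1 * meshsize T ^ 5
         \<and> norm0 \<Omega> (\<lambda>p. \<psi> p - \<psi>h p) \<le> C\<^sub>0 * meshsize T ^ 6"
proof (cases "Fam = {}")
  case True
  moreover have "\<exists>x::real. x > 0" by (rule exI[of _ 1]) simp
  ultimately show ?thesis by simp
next
  case False
  \<comment> \<open>A single triangulation of the family supplies the convex pieces on which
    Sobolev's inequality is applied to \<open>\<psi>\<close>.\<close>
  then obtain T0 where T0: "T0 \<in> Fam" by blast
  interpret bounded_open \<Omega>
    using dom by unfold_locales (auto simp: polygonal_domain_def)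
  have ne: "\<Omega> \<noteq> {}" using dom by (simp add: polygonal_domain_def)
  have tri: "triangulation \<Omega> T" if "T \<in> Fam" for T using fam that by blast
  \<comment> \<open>Derivatives up to order 3 need two more for Sobolev's inequality, and
    \<open>3 + 2 \<le> 6\<close>.\<close>
  have bdd: "bdd_fun (wd \<Omega> i j \<psi>)" if ij: "i + j \<le> 3" for i j
  proof -
    have "\<exists>C. AE p in msr \<Omega>. \<bar>wd \<Omega> i j \<psi> p\<bar> \<le> C"
      by (rule sobolev_bound_cover[OF triangulation_cover(1,3)[OF tri[OF T0]] triangulation_cover(2)[OF tri[OF T0]] psi6])
         (use ij in auto)
    then show ?thesis using sqi_measurable[OF wd_spec(1)[OF psi6, of i j]] ij by (simp add: bdd_fun_def)
  qed
  interpret linearized \<Omega> Rey Ro \<Gamma>\<^sub>1 \<Gamma>\<^sub>2 \<psi>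
  proof unfold_locales
    show "\<Gamma>\<^sub>1 * semi \<Omega> 2 \<psi> < 1 / Rey"
      using strict_coercivity[OF Rey Ro F G1 psi _ small] psi_eq psi by blast
  qed (use Rey Ro G1 G2 a1_bd a2_bd psi psi6 bdd in auto)
  obtain C where C: "C > 0" "\<And>g \<psi>s. L2 \<Omega> g \<Longrightarrow> H20 \<Omega> \<psi>s \<Longrightarrow> dual_eq \<Omega> Rey Ro \<psi> g \<psi>s \<Longrightarrow>
      Hk \<Omega> 4 \<psi>s \<and> normH \<Omega> 4 \<psi>s \<le> C * norm0 \<Omega> g \<and> normH \<Omega> 3 \<psi>s \<le> C * normm1 \<Omega> g"
    using dual_reg by blast
  obtain CI where CI: "CI > 0" "\<And>T m v. T \<in> Fam \<Longrightarrow> m \<in> {3, 4, 6} \<Longrightarrow> Hk \<Omega> m v \<Longrightarrow> H20 \<Omega> v \<Longrightarrow>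
      \<exists>vh\<in>argyris \<Omega> T. normH \<Omega> 2 (\<lambda>p. v p - vh p) \<le> CI * meshsize T ^ (m - 2) * semi \<Omega> m v"
    using interp by blast
  obtain K where K: "\<And>v. H20 \<Omega> v \<Longrightarrow> \<bar>F v\<bar> \<le> K * semi \<Omega> 2 v" using F by (auto simp: Hm2_def)
  \<comment> \<open>The existential constant in \<open>Hm2\<close> may be negative, so its absolute
    value is used as the nonnegative bound of the load.\<close>
  have l: "\<bar>ell Ro F v\<bar> \<le> \<bar>K\<bar> / Ro * semi \<Omega> 2 v" if v: "H20 \<Omega> v" for v
  proof -
    have "\<bar>F v\<bar> \<le> \<bar>K\<bar> * semi \<Omega> 2 v"
      using K[OF v] mult_right_mono[OF abs_ge_self[of K] semi_nonneg[of \<Omega> 2 v]] by linarith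
    then have "1 / Ro * \<bar>F v\<bar> \<le> 1 / Ro * (\<bar>K\<bar> * semi \<Omega> 2 v)" using Ro by (intro mult_left_mono) auto
    then show ?thesis using Ro by (simp add: ell_def abs_mult)
  qed
  show ?thesis
    by (rule error_estimates[OF ne _ _ l _ _ C(2,1) CI(2,1), where H = "diameter (closure \<Omega>)"])
       (use argyris_grad_bdd[OF tri] meshsize_bounds[OF tri] Ro psi_eq in auto)
qed

end
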